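(* Let $\mathcal{C}$ be a finitely accessible category with products and suppose that $(\mathcal{C},\otimes, 1)$ is a closed symmetric monoidal category such that $\mathcal{C}^{\mathrm{fp}}$ is a symmetric rigid monoidal subcategory. Let $\mathsf{S}$ be a Serre subcategory of $\mathcal{C}^{\mathrm{fp}}\text{-}\mathrm{mod}$ and let $\mathcal{D}$ be the corresponding definable subcategory of $\mathcal{C}$. Then $\mathsf{S}$ is a Serre tensor-ideal of $\mathcal{C}^{\mathrm{fp}}\text{-}\mathrm{mod}$ with respect to the induced tensor product if and only if $\mathcal{D}$ is a definable tensor-ideal of $\mathcal{C}$.
   Context: All categories (including finitely accessible ones) are additive, and all functors, including $\otimes$ in each variable, are additive. $\mathcal{C}$ is finitely accessible if it has direct limits and a set of finitely presented objects such that every object is a direct limit of objects in this set; $\mathcal{C}^{\mathrm{fp}}$ is the full subcategory of finitely presented objects. A monoidal category is rigid if every object $C$ has a dual $C^{\vee}$, i.e. there are $\eta:1\to C^{\vee}\otimes C$ and $\epsilon:C\otimes C^{\vee}\to 1$ satisfying $(C^{\vee}\otimes\epsilon)(\eta\otimes C^{\vee})=\mathrm{Id}$ and $(\epsilon\otimes C)(C\otimes\eta)=\mathrm{Id}$. $\mathcal{C}^{\mathrm{fp}}\text{-}\mathrm{mod}$ is the abelian category of finitely presented additive functors $\mathcal{C}^{\mathrm{fp}}\to\mathbf{Ab}$; the induced tensor product is the restriction of Day convolution on $(\mathcal{C}^{\mathrm{fp}},\mathbf{Ab})$, i.e. right exact in each variable with $(A,-)\otimes(B,-)\cong(A\otimes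 B,-)$. For $F\in\mathcal{C}^{\mathrm{fp}}\text{-}\mathrm{mod}$, $\overrightarrow{F}:\mathcal{C}\to\mathbf{Ab}$ is the unique extension commuting with direct limits. The definable subcategory corresponding to $\mathsf{S}$ is $\mathcal{D}=\{X\in\mathcal{C}:\overrightarrow{F}(X)=0\ \forall F\in\mathsf{S}\}$ (definable: full, closed under products, direct limits and pure subobjects; this is a bijection between Serre subcategories of $\mathcal{C}^{\mathrm{fp}}\text{-}\mathrm{mod}$ and definable subcategories of $\mathcal{C}$). Here a monomorphism $m:X\to Y$ is pure if for every $f:A\to B$ in $\mathcal{C}^{\mathrm{fp}}$ and all $h:A\to X$, $h':B\to Y$ with $h'f=mh$ there is $k:B\to X$ with $kf=h$. $\mathsf{S}$ is a Serre tensor-ideal if $G\otimes F\in\mathsf{S}$ for all $F\in\mathsf{S}$, $G\in\mathcal{C}^{\mathrm{fp}}\text{-}\mathrm{mod}$. A definable tensor-ideal is a definable subcategory $\mathcal{D}$ with $X\otimes D\in\mathcal{D}$ for all $X\in\mathcal{C}$, $D\in\mathcal{D}$. *)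

theory Defs
  imports "HOL-Algebra.Group" "HOL-Library.FuncSet"
begin

unbundle cardinal_syntax

section \<open>Smallness\<close>

text \<open>
  The type \<open>'u\<close> plays the role of a Grothendieck universe: its cardinality is a strongly
  inaccessible cardinal, and the small sets are those of smaller cardinality.
  Every small set is in bijection with a subset of \<open>'u\<close>, so small hom-groups, small abelian
  groups and small index sets can all be taken to be carried by subsets of \<open>'u\<close>.
\<close>

definition universe :: "'u itself \<Rightarrow> bool" where
  "universe (_ :: 'u itself) \<longleftrightarrow>
     natLeq <o |UNIV :: 'u set| \<and> regularCard |UNIV :: 'u set| \<and>
     (\<forall>A :: 'u set. |A| <o |UNIV :: 'u set| \<longrightarrow> |Pow A| <o |UNIV :: 'u set| )"

definition small :: "'u itself \<Rightarrow> 'a set \<Rightarrow> bool" where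
  "small (_ :: 'u itself) A \<longleftrightarrow> |A| <o |UNIV :: 'u set|"


section \<open>Additive categories\<close>

text \<open>
  A (pre)additive category is given by its abelian groups of morphisms; these are written
  multiplicatively, as everywhere in HOL-Algebra, so that \<open>\<one>\<^bsub>Hom C X Y\<^esub>\<close> is the
  zero morphism.  Hom-groups need not be disjoint, hence
  composition carries its objects: \<open>Cmp C X Y Z g f\<close> is
  the composite of \<open>f : X \<rightarrow> Y\<close> followed by \<open>g : Y \<rightarrow> Z\<close>.
\<close>

record ('o, 'm) category =
  Obj :: "'o set"
  Hom :: "'o \<Rightarrow> 'o \<Rightarrow> 'm monoid"
  Idt :: "'o \<Rightarrow> 'm"
  Cmp :: "'o \<Rightarrow> 'o \<Rightarrow> 'o \<Rightarrow> 'm \<Rightarrow> 'm \<Rightarrow> 'm"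

abbreviation Mor :: "('o, 'm) category \<Rightarrow> 'o \<Rightarrow> 'o \<Rightarrow> 'm set" where
  "Mor C X Y \<equiv> carrier (Hom C X Y)"

abbreviation zero_mor :: "('o, 'm) category \<Rightarrow> 'o \<Rightarrow> 'o \<Rightarrow> 'm" where
  "zero_mor C X Y \<equiv> \<one>\<^bsub>Hom C X Y\<^esub>"

locale preadditive_category =
  fixes C :: "('o, 'm) category"
  assumes Hom_comm_group: "\<lbrakk>X \<in> Obj C; Y \<in> Obj C\<rbrakk> \<Longrightarrow> comm_group (Hom C X Y)"
    and Idt_Mor: "X \<in> Obj C \<Longrightarrow> Idt C X \<in> Mor C X X"
    and Cmp_Mor: "\<lbrakk>X \<in> Obj C; Y \<in> Obj C; Z \<in> Obj C; f \<in> Mor C X Y; g \<in> Mor C Y Z\<rbrakk>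
      \<Longrightarrow> Cmp C X Y Z g f \<in> Mor C X Z"
    and Cmp_Idt_left: "\<lbrakk>X \<in> Obj C; Y \<in> Obj C; f \<in> Mor C X Y\<rbrakk>
      \<Longrightarrow> Cmp C X Y Y (Idt C Y) f = f"
    and Cmp_Idt_right: "\<lbrakk>X \<in> Obj C; Y \<in> Obj C; f \<in> Mor C X Y\<rbrakk>
      \<Longrightarrow> Cmp C X X Y f (Idt C X) = f"
    and Cmp_assoc: "\<lbrakk>W \<in> Obj C; X \<in> Obj C; Y \<in> Obj C; Z \<in> Obj C;
        f \<in> Mor C W X; g \<in> Mor C X Y; h \<in> Mor C Y Z\<rbrakk>
      \<Longrightarrow> Cmp C W Y Z h (Cmp C W X Y g f) = Cmp C W X Z (Cmp C X Y Z h g) f"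
    and Cmp_add_left: "\<lbrakk>X \<in> Obj C; Y \<in> Obj C; Z \<in> Obj C;
        f \<in> Mor C X Y; g \<in> Mor C Y Z; g' \<in> Mor C Y Z\<rbrakk>
      \<Longrightarrow> Cmp C X Y Z (g \<otimes>\<^bsub>Hom C Y Z\<^esub> g') f
          = Cmp C X Y Z g f \<otimes>\<^bsub>Hom C X Z\<^esub> Cmp C X Y Z g' f"
    and Cmp_add_right: "\<lbrakk>X \<in> Obj C; Y \<in> Obj C; Z \<in> Obj C;
        f \<in> Mor C X Y; f' \<in> Mor C X Y; g \<in> Mor C Y Z\<rbrakk>
      \<Longrightarrow> Cmp C X Y Z g (f \<otimes>\<^bsub>Hom C X Y\<^esub> f')
          = Cmp C X Y Z g f \<otimes>\<^bsub>Hom C X Z\<^esub> Cmp C X Y Z g f'"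

definition zero_object :: "('o, 'm) category \<Rightarrow> 'o \<Rightarrow> bool" where
  "zero_object C Z \<longleftrightarrow> Z \<in> Obj C \<and>
     (\<forall>X \<in> Obj C. (\<exists>!f. f \<in> Mor C X Z) \<and> (\<exists>!f. f \<in> Mor C Z X))"

definition biproduct ::
  "('o, 'm) category \<Rightarrow> 'o \<Rightarrow> 'o \<Rightarrow> 'o \<Rightarrow> 'm \<Rightarrow> 'm \<Rightarrow> 'm \<Rightarrow> 'm \<Rightarrow> bool" where
  "biproduct C X Y P i j p q \<longleftrightarrow> P \<in> Obj C \<and>
     i \<in> Mor C X P \<and> j \<in> Mor C Y P \<and> p \<in> Mor C P X \<and> q \<in> Mor C P Y \<and>
     Cmp C X P X p i = Idt C X \<and> Cmp C Y P Y q j = Idt C Y \<and>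
     Cmp C X P Y q i = zero_mor C X Y \<and> Cmp C Y P X p j = zero_mor C Y X \<and>
     Cmp C P X P i p \<otimes>\<^bsub>Hom C P P\<^esub> Cmp C P Y P j q = Idt C P"

locale additive_category = preadditive_category C
  for C :: "('o, 'm) category" +
  assumes ex_zero_object: "\<exists>Z. zero_object C Z"
    and ex_biproduct: "\<lbrakk>X \<in> Obj C; Y \<in> Obj C\<rbrakk>
      \<Longrightarrow> \<exists>P i j p q. biproduct C X Y P i j p q"

definition full_subcategory :: "('o, 'm) category \<Rightarrow> 'o set \<Rightarrow> ('o, 'm) category" where
  "full_subcategory C P = C\<lparr>Obj := Obj C \<inter> P\<rparr>"

definition mono_mor :: "('o, 'm) category \<Rightarrow> 'o \<Rightarrow> 'o \<Rightarrow> 'm \<Rightarrow> bool" where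
  "mono_mor C X Y m \<longleftrightarrow> m \<in> Mor C X Y \<and>
     (\<forall>W \<in> Obj C. \<forall>f \<in> Mor C W X. \<forall>g \<in> Mor C W X.
        Cmp C W X Y m f = Cmp C W X Y m g \<longrightarrow> f = g)"

definition inverse_mors :: "('o, 'm) category \<Rightarrow> 'o \<Rightarrow> 'o \<Rightarrow> 'm \<Rightarrow> 'm \<Rightarrow> bool" where
  "inverse_mors C X Y f g \<longleftrightarrow> f \<in> Mor C X Y \<and> g \<in> Mor C Y X \<and>
     Cmp C X Y X g f = Idt C X \<and> Cmp C Y X Y f g = Idt C Y"

definition iso_mor :: "('o, 'm) category \<Rightarrow> 'o \<Rightarrow> 'o \<Rightarrow> 'm \<Rightarrow> bool" where
  "iso_mor C X Y f \<longleftrightarrow> (\<exists>g. inverse_mors C X Y f g)"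

definition inv_mor :: "('o, 'm) category \<Rightarrow> 'o \<Rightarrow> 'o \<Rightarrow> 'm \<Rightarrow> 'm" where
  "inv_mor C X Y f = (THE g. inverse_mors C X Y f g)"

definition isomorphic :: "('o, 'm) category \<Rightarrow> 'o \<Rightarrow> 'o \<Rightarrow> bool" where
  "isomorphic C X Y \<longleftrightarrow> (\<exists>f. iso_mor C X Y f)"

definition is_kernel ::
  "('o, 'm) category \<Rightarrow> 'o \<Rightarrow> 'o \<Rightarrow> 'o \<Rightarrow> 'm \<Rightarrow> 'm \<Rightarrow> bool" where
  \<comment> \<open>\<open>k : K \<rightarrow> X\<close> is a kernel of \<open>f : X \<rightarrow> Y\<close>\<close>
  "is_kernel C K X Y k f \<longleftrightarrow> K \<in> Obj C \<and> k \<in> Mor C K X \<and>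
     Cmp C K X Y f k = zero_mor C K Y \<and>
     (\<forall>W \<in> Obj C. \<forall>h \<in> Mor C W X. Cmp C W X Y f h = zero_mor C W Y \<longrightarrow>
        (\<exists>!l. l \<in> Mor C W K \<and> Cmp C W K X k l = h))"

definition is_cokernel ::
  "('o, 'm) category \<Rightarrow> 'o \<Rightarrow> 'o \<Rightarrow> 'o \<Rightarrow> 'm \<Rightarrow> 'm \<Rightarrow> bool" where
  \<comment> \<open>\<open>q : Y \<rightarrow> Q\<close> is a cokernel of \<open>f : X \<rightarrow> Y\<close>\<close>
  "is_cokernel C X Y Q f q \<longleftrightarrow> Q \<in> Obj C \<and> q \<in> Mor C Y Q \<and>
     Cmp C X Y Q q f = zero_mor C X Q \<and>
     (\<forall>W \<in> Obj C. \<forall>h \<in> Mor C Y W. Cmp C X Y W h f = zero_mor C X W \<longrightarrow>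
        (\<exists>!l. l \<in> Mor C Q W \<and> Cmp C Y Q W l q = h))"

definition short_exact ::
  "('o, 'm) category \<Rightarrow> 'o \<Rightarrow> 'o \<Rightarrow> 'o \<Rightarrow> 'm \<Rightarrow> 'm \<Rightarrow> bool" where
  "short_exact C X Y Z f g \<longleftrightarrow> X \<in> Obj C \<and> Y \<in> Obj C \<and> Z \<in> Obj C \<and>
     is_kernel C X Y Z f g \<and> is_cokernel C X Y Z f g"

text \<open>A Serre subcategory is a full subcategory, so it is given by its class of objects.\<close>

definition serre_subcategory :: "('o, 'm) category \<Rightarrow> 'o set \<Rightarrow> bool" where
  "serre_subcategory C S \<longleftrightarrow> S \<subseteq> Obj C \<and> S \<noteq> {} \<and>
     (\<forall>X Y Z f g. short_exact C X Y Z f g \<longrightarrow> (Y \<in> S \<longleftrightarrow> X \<in> S \<and> Z \<in> S))"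


section \<open>Functors and functor categories\<close>

record ('o, 'm, 'p, 'n) cfunctor =
  FOb :: "'o \<Rightarrow> 'p"
  FMor :: "'o \<Rightarrow> 'o \<Rightarrow> 'm \<Rightarrow> 'n"

definition additive_functor ::
  "('o, 'm) category \<Rightarrow> ('p, 'n) category \<Rightarrow> ('o, 'm, 'p, 'n) cfunctor \<Rightarrow> bool" where
  "additive_functor C K F \<longleftrightarrow>
     (\<forall>X \<in> Obj C. FOb F X \<in> Obj K \<and> FMor F X X (Idt C X) = Idt K (FOb F X)) \<and>
     (\<forall>X \<in> Obj C. \<forall>Y \<in> Obj C. FMor F X Y \<in> hom (Hom C X Y) (Hom K (FOb F X) (FOb F Y))) \<and>
     (\<forall>X \<in> Obj C. \<forall>Y \<in> Obj C. \<forall>Z \<in> Obj C. \<forall>f \<in> Mor C X Y. \<forall>g \<in> Mor C Y Z.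
        FMor F X Z (Cmp C X Y Z g f)
        = Cmp K (FOb F X) (FOb F Y) (FOb F Z) (FMor F Y Z g) (FMor F X Y f))"

definition nat_trans ::
  "('o, 'm) category \<Rightarrow> ('p, 'n) category \<Rightarrow> ('o, 'm, 'p, 'n) cfunctor
    \<Rightarrow> ('o, 'm, 'p, 'n) cfunctor \<Rightarrow> ('o \<Rightarrow> 'n) set" where
  "nat_trans C K F G = {t \<in> (\<Pi>\<^sub>E X \<in> Obj C. Mor K (FOb F X) (FOb G X)).
     \<forall>X \<in> Obj C. \<forall>Y \<in> Obj C. \<forall>f \<in> Mor C X Y.
       Cmp K (FOb F X) (FOb F Y) (FOb G Y) (t Y) (FMor F X Y f)
       = Cmp K (FOb F X) (FOb G X) (FOb G Y) (FMor G X Y f) (t X)}"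

definition functor_category ::
  "('o, 'm) category \<Rightarrow> ('p, 'n) category
    \<Rightarrow> (('o, 'm, 'p, 'n) cfunctor, 'o \<Rightarrow> 'n) category" where
  "functor_category C K = \<lparr>
     Obj = {F. additive_functor C K F},
     Hom = (\<lambda>F G. \<lparr>carrier = nat_trans C K F G,
        monoid.mult = (\<lambda>s t. \<lambda>X \<in> Obj C. s X \<otimes>\<^bsub>Hom K (FOb F X) (FOb G X)\<^esub> t X),
        one = (\<lambda>X \<in> Obj C. zero_mor K (FOb F X) (FOb G X))\<rparr>),
     Idt = (\<lambda>F. \<lambda>X \<in> Obj C. Idt K (FOb F X)),
     Cmp = (\<lambda>F G H t s. \<lambda>X \<in> Obj C. Cmp K (FOb F X) (FOb G X) (FOb H X) (t X) (s X))\<rparr>"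

definition Ab :: "('u monoid, 'u \<Rightarrow> 'u) category" where
  "Ab = \<lparr>
     Obj = {G. comm_group G \<and> small TYPE('u) (carrier G)},
     Hom = (\<lambda>G H. \<lparr>carrier = hom G H \<inter> extensional (carrier G),
        monoid.mult = (\<lambda>f g. \<lambda>x \<in> carrier G. f x \<otimes>\<^bsub>H\<^esub> g x),
        one = (\<lambda>x \<in> carrier G. \<one>\<^bsub>H\<^esub>)\<rparr>),
     Idt = (\<lambda>G. \<lambda>x \<in> carrier G. x),
     Cmp = (\<lambda>G H K g f. compose (carrier G) g f)\<rparr>"

type_synonym ('o, 'u) abfunctor = "('o, 'u, 'u monoid, 'u \<Rightarrow> 'u) cfunctor"

definition representable :: "('o, 'u) category \<Rightarrow> 'o \<Rightarrow> ('o, 'u) abfunctor" where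
  \<comment> \<open>the functor \<open>(A,-)\<close>\<close>
  "representable C A = \<lparr>
     FOb = Hom C A,
     FMor = (\<lambda>X Y f. \<lambda>h \<in> Mor C A X. Cmp C A X Y f h)\<rparr>"


section \<open>Direct limits, products, finite accessibility\<close>

definition directed_poset :: "'i set \<Rightarrow> 'i rel \<Rightarrow> bool" where
  "directed_poset I r \<longleftrightarrow> I \<noteq> {} \<and> partial_order_on I r \<and>
     (\<forall>i \<in> I. \<forall>j \<in> I. \<exists>k \<in> I. (i, k) \<in> r \<and> (j, k) \<in> r)"

definition directed_system ::
  "('o, 'm) category \<Rightarrow> 'i set \<Rightarrow> 'i rel \<Rightarrow> ('i \<Rightarrow> 'o) \<Rightarrow> ('i \<Rightarrow> 'i \<Rightarrow> 'm) \<Rightarrow> bool" where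
  "directed_system C I r D d \<longleftrightarrow> directed_poset I r \<and> (\<forall>i \<in> I. D i \<in> Obj C) \<and>
     (\<forall>(i, j) \<in> r. d i j \<in> Mor C (D i) (D j)) \<and>
     (\<forall>i \<in> I. d i i = Idt C (D i)) \<and>
     (\<forall>i j k. (i, j) \<in> r \<and> (j, k) \<in> r \<longrightarrow> d i k = Cmp C (D i) (D j) (D k) (d j k) (d i j))"

definition is_cocone ::
  "('o, 'm) category \<Rightarrow> 'i set \<Rightarrow> 'i rel \<Rightarrow> ('i \<Rightarrow> 'o) \<Rightarrow> ('i \<Rightarrow> 'i \<Rightarrow> 'm)
    \<Rightarrow> 'o \<Rightarrow> ('i \<Rightarrow> 'm) \<Rightarrow> bool" where
  "is_cocone C I r D d X c \<longleftrightarrow> X \<in> Obj C \<and> (\<forall>i \<in> I. c i \<in> Mor C (D i) X) \<and>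
     (\<forall>(i, j) \<in> r. Cmp C (D i) (D j) X (c j) (d i j) = c i)"

definition is_direct_limit ::
  "('o, 'm) category \<Rightarrow> 'i set \<Rightarrow> 'i rel \<Rightarrow> ('i \<Rightarrow> 'o) \<Rightarrow> ('i \<Rightarrow> 'i \<Rightarrow> 'm)
    \<Rightarrow> 'o \<Rightarrow> ('i \<Rightarrow> 'm) \<Rightarrow> bool" where
  "is_direct_limit C I r D d X c \<longleftrightarrow> directed_system C I r D d \<and> is_cocone C I r D d X c \<and>
     (\<forall>Y b. is_cocone C I r D d Y b \<longrightarrow>
        (\<exists>!f. f \<in> Mor C X Y \<and> (\<forall>i \<in> I. Cmp C (D i) X Y f (c i) = b i)))"

text \<open>Small index sets are taken inside the type \<open>'u\<close> that also carries the hom-groups.\<close>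

definition has_direct_limits :: "('o, 'u) category \<Rightarrow> bool" where
  "has_direct_limits C \<longleftrightarrow>
     (\<forall>(I :: 'u set) r D d. small TYPE('u) I \<and> directed_system C I r D d \<longrightarrow>
        (\<exists>X c. is_direct_limit C I r D d X c))"

definition preserves_direct_limits ::
  "('o, 'u) category \<Rightarrow> ('p, 'n) category \<Rightarrow> ('o, 'u, 'p, 'n) cfunctor \<Rightarrow> bool" where
  "preserves_direct_limits C K F \<longleftrightarrow>
     (\<forall>(I :: 'u set) r D d X c. small TYPE('u) I \<and> is_direct_limit C I r D d X c \<longrightarrow>
        is_direct_limit K I r (\<lambda>i. FOb F (D i)) (\<lambda>i j. FMor F (D i) (D j) (d i j))
          (FOb F X) (\<lambda>i. FMor F (D i) X (c i)))"

definition is_product ::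
  "('o, 'm) category \<Rightarrow> 'i set \<Rightarrow> ('i \<Rightarrow> 'o) \<Rightarrow> 'o \<Rightarrow> ('i \<Rightarrow> 'm) \<Rightarrow> bool" where
  "is_product C I D X p \<longleftrightarrow> X \<in> Obj C \<and> (\<forall>i \<in> I. D i \<in> Obj C \<and> p i \<in> Mor C X (D i)) \<and>
     (\<forall>Y \<in> Obj C. \<forall>q. (\<forall>i \<in> I. q i \<in> Mor C Y (D i)) \<longrightarrow>
        (\<exists>!f. f \<in> Mor C Y X \<and> (\<forall>i \<in> I. Cmp C Y X (D i) (p i) f = q i)))"

definition has_products :: "('o, 'u) category \<Rightarrow> bool" where
  "has_products C \<longleftrightarrow>
     (\<forall>(I :: 'u set) D. small TYPE('u) I \<and> (\<forall>i \<in> I. D i \<in> Obj C) \<longrightarrow>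
        (\<exists>X p. is_product C I D X p))"

definition fp_objects :: "('o, 'u) category \<Rightarrow> 'o set" where
  "fp_objects C = {A \<in> Obj C. preserves_direct_limits C Ab (representable C A)}"

definition fp_category :: "('o, 'u) category \<Rightarrow> ('o, 'u) category" where
  "fp_category C = full_subcategory C (fp_objects C)"

locale finitely_accessible = additive_category C
  for C :: "('o, 'u) category" +
  assumes locally_small: "\<lbrakk>X \<in> Obj C; Y \<in> Obj C\<rbrakk> \<Longrightarrow> small TYPE('u) (Mor C X Y)"
    and direct_limits: "has_direct_limits C"
    and fp_generators: "\<exists>P \<subseteq> fp_objects C. small TYPE('u) P \<and>
      (\<forall>X \<in> Obj C. \<exists>(I :: 'u set) r D d c. small TYPE('u) I \<and> D ` I \<subseteq> P \<and>
         is_direct_limit C I r D d X c)"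


section \<open>Monoidal structures\<close>

text \<open>
  Tensor product of morphisms: for \<open>f : X \<rightarrow> X'\<close> and \<open>g : Y \<rightarrow> Y'\<close>,
  \<open>TMor M X X' Y Y' f g : X \<boxtimes> Y \<rightarrow> X' \<boxtimes> Y'\<close>.
  Coherence maps: \<open>Asc M X Y Z : (X \<boxtimes> Y) \<boxtimes> Z \<rightarrow> X \<boxtimes> (Y \<boxtimes> Z)\<close>,
  \<open>Lun M X : \<II> \<boxtimes> X \<rightarrow> X\<close>, \<open>Run M X : X \<boxtimes> \<II> \<rightarrow> X\<close>,
  \<open>Brd M X Y : X \<boxtimes> Y \<rightarrow> Y \<boxtimes> X\<close>.
\<close>

record ('o, 'm) monoidal_structure =
  TOb :: "'o \<Rightarrow> 'o \<Rightarrow> 'o" (infixr \<open>\<boxtimes>\<index>\<close> 70)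
  TMor :: "'o \<Rightarrow> 'o \<Rightarrow> 'o \<Rightarrow> 'o \<Rightarrow> 'm \<Rightarrow> 'm \<Rightarrow> 'm"
  Unt :: "'o" (\<open>\<II>\<index>\<close>)
  Asc :: "'o \<Rightarrow> 'o \<Rightarrow> 'o \<Rightarrow> 'm"
  Lun :: "'o \<Rightarrow> 'm"
  Run :: "'o \<Rightarrow> 'm"
  Brd :: "'o \<Rightarrow> 'o \<Rightarrow> 'm"

locale symmetric_monoidal = additive_category C
  for C :: "('o, 'm) category" +
  fixes M :: "('o, 'm) monoidal_structure" (structure)
  assumes TOb_Obj: "\<lbrakk>X \<in> Obj C; Y \<in> Obj C\<rbrakk> \<Longrightarrow> X \<boxtimes> Y \<in> Obj C"
    and Unt_Obj: "\<II> \<in> Obj C"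
    and TMor_Mor: "\<lbrakk>X \<in> Obj C; X' \<in> Obj C; Y \<in> Obj C; Y' \<in> Obj C;
        f \<in> Mor C X X'; g \<in> Mor C Y Y'\<rbrakk>
      \<Longrightarrow> TMor M X X' Y Y' f g \<in> Mor C (X \<boxtimes> Y) (X' \<boxtimes> Y')"
    and TMor_Idt: "\<lbrakk>X \<in> Obj C; Y \<in> Obj C\<rbrakk>
      \<Longrightarrow> TMor M X X Y Y (Idt C X) (Idt C Y) = Idt C (X \<boxtimes> Y)"
    and TMor_Cmp: "\<lbrakk>X \<in> Obj C; X' \<in> Obj C; X'' \<in> Obj C; Y \<in> Obj C; Y' \<in> Obj C; Y'' \<in> Obj C;
        f \<in> Mor C X X'; f' \<in> Mor C X' X''; g \<in> Mor C Y Y'; g' \<in> Mor C Y' Y''\<rbrakk>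
      \<Longrightarrow> TMor M X X'' Y Y'' (Cmp C X X' X'' f' f) (Cmp C Y Y' Y'' g' g)
        = Cmp C (X \<boxtimes> Y) (X' \<boxtimes> Y') (X'' \<boxtimes> Y'')
            (TMor M X' X'' Y' Y'' f' g') (TMor M X X' Y Y' f g)"
    and TMor_add_left: "\<lbrakk>X \<in> Obj C; X' \<in> Obj C; Y \<in> Obj C; Y' \<in> Obj C;
        f \<in> Mor C X X'; f' \<in> Mor C X X'; g \<in> Mor C Y Y'\<rbrakk>
      \<Longrightarrow> TMor M X X' Y Y' (f \<otimes>\<^bsub>Hom C X X'\<^esub> f') g
        = TMor M X X' Y Y' f g \<otimes>\<^bsub>Hom C (X \<boxtimes> Y) (X' \<boxtimes> Y')\<^esub> TMor M X X' Y Y' f' g"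
    and TMor_add_right: "\<lbrakk>X \<in> Obj C; X' \<in> Obj C; Y \<in> Obj C; Y' \<in> Obj C;
        f \<in> Mor C X X'; g \<in> Mor C Y Y'; g' \<in> Mor C Y Y'\<rbrakk>
      \<Longrightarrow> TMor M X X' Y Y' f (g \<otimes>\<^bsub>Hom C Y Y'\<^esub> g')
        = TMor M X X' Y Y' f g \<otimes>\<^bsub>Hom C (X \<boxtimes> Y) (X' \<boxtimes> Y')\<^esub> TMor M X X' Y Y' f g'"
    and Asc_iso: "\<lbrakk>X \<in> Obj C; Y \<in> Obj C; Z \<in> Obj C\<rbrakk>
      \<Longrightarrow> iso_mor C ((X \<boxtimes> Y) \<boxtimes> Z) (X \<boxtimes> (Y \<boxtimes> Z)) (Asc M X Y Z)"
    and Lun_iso: "X \<in> Obj C \<Longrightarrow> iso_mor C (\<II> \<boxtimes> X) X (Lun M X)"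
    and Run_iso: "X \<in> Obj C \<Longrightarrow> iso_mor C (X \<boxtimes> \<II>) X (Run M X)"
    and Brd_iso: "\<lbrakk>X \<in> Obj C; Y \<in> Obj C\<rbrakk> \<Longrightarrow> iso_mor C (X \<boxtimes> Y) (Y \<boxtimes> X) (Brd M X Y)"
    and Asc_natural: "\<lbrakk>X \<in> Obj C; X' \<in> Obj C; Y \<in> Obj C; Y' \<in> Obj C; Z \<in> Obj C; Z' \<in> Obj C;
        f \<in> Mor C X X'; g \<in> Mor C Y Y'; h \<in> Mor C Z Z'\<rbrakk>
      \<Longrightarrow> Cmp C ((X \<boxtimes> Y) \<boxtimes> Z) ((X' \<boxtimes> Y') \<boxtimes> Z') (X' \<boxtimes> (Y' \<boxtimes> Z'))
            (Asc M X' Y' Z') (TMor M (X \<boxtimes> Y) (X' \<boxtimes> Y') Z Z' (TMor M X X' Y Y' f g) h)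
        = Cmp C ((X \<boxtimes> Y) \<boxtimes> Z) (X \<boxtimes> (Y \<boxtimes> Z)) (X' \<boxtimes> (Y' \<boxtimes> Z'))
            (TMor M X X' (Y \<boxtimes> Z) (Y' \<boxtimes> Z') f (TMor M Y Y' Z Z' g h)) (Asc M X Y Z)"
    and Lun_natural: "\<lbrakk>X \<in> Obj C; Y \<in> Obj C; f \<in> Mor C X Y\<rbrakk>
      \<Longrightarrow> Cmp C (\<II> \<boxtimes> X) (\<II> \<boxtimes> Y) Y (Lun M Y) (TMor M \<II> \<II> X Y (Idt C \<II>) f)
        = Cmp C (\<II> \<boxtimes> X) X Y f (Lun M X)"
    and Run_natural: "\<lbrakk>X \<in> Obj C; Y \<in> Obj C; f \<in> Mor C X Y\<rbrakk>
      \<Longrightarrow> Cmp C (X \<boxtimes> \<II>) (Y \<boxtimes> \<II>) Y (Run M Y) (TMor M X Y \<II> \<II> f (Idt C \<II>))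
        = Cmp C (X \<boxtimes> \<II>) X Y f (Run M X)"
    and Brd_natural: "\<lbrakk>X \<in> Obj C; X' \<in> Obj C; Y \<in> Obj C; Y' \<in> Obj C;
        f \<in> Mor C X X'; g \<in> Mor C Y Y'\<rbrakk>
      \<Longrightarrow> Cmp C (X \<boxtimes> Y) (X' \<boxtimes> Y') (Y' \<boxtimes> X') (Brd M X' Y') (TMor M X X' Y Y' f g)
        = Cmp C (X \<boxtimes> Y) (Y \<boxtimes> X) (Y' \<boxtimes> X') (TMor M Y Y' X X' g f) (Brd M X Y)"
    and pentagon: "\<lbrakk>W \<in> Obj C; X \<in> Obj C; Y \<in> Obj C; Z \<in> Obj C\<rbrakk>
      \<Longrightarrow> Cmp C (((W \<boxtimes> X) \<boxtimes> Y) \<boxtimes> Z) ((W \<boxtimes> X) \<boxtimes> (Y \<boxtimes> Z)) (W \<boxtimes> (X \<boxtimes> (Y \<boxtimes> Z)))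
            (Asc M W X (Y \<boxtimes> Z)) (Asc M (W \<boxtimes> X) Y Z)
        = Cmp C (((W \<boxtimes> X) \<boxtimes> Y) \<boxtimes> Z) (W \<boxtimes> ((X \<boxtimes> Y) \<boxtimes> Z)) (W \<boxtimes> (X \<boxtimes> (Y \<boxtimes> Z)))
            (TMor M W W ((X \<boxtimes> Y) \<boxtimes> Z) (X \<boxtimes> (Y \<boxtimes> Z)) (Idt C W) (Asc M X Y Z))
            (Cmp C (((W \<boxtimes> X) \<boxtimes> Y) \<boxtimes> Z) ((W \<boxtimes> (X \<boxtimes> Y)) \<boxtimes> Z) (W \<boxtimes> ((X \<boxtimes> Y) \<boxtimes> Z))
              (Asc M W (X \<boxtimes> Y) Z)
              (TMor M ((W \<boxtimes> X) \<boxtimes> Y) (W \<boxtimes> (X \<boxtimes> Y)) Z Z (Asc M W X Y) (Idt C Z)))"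
    and triangle: "\<lbrakk>X \<in> Obj C; Y \<in> Obj C\<rbrakk>
      \<Longrightarrow> Cmp C ((X \<boxtimes> \<II>) \<boxtimes> Y) (X \<boxtimes> (\<II> \<boxtimes> Y)) (X \<boxtimes> Y)
            (TMor M X X (\<II> \<boxtimes> Y) Y (Idt C X) (Lun M Y)) (Asc M X \<II> Y)
        = TMor M (X \<boxtimes> \<II>) X Y Y (Run M X) (Idt C Y)"
    and hexagon: "\<lbrakk>X \<in> Obj C; Y \<in> Obj C; Z \<in> Obj C\<rbrakk>
      \<Longrightarrow> Cmp C ((X \<boxtimes> Y) \<boxtimes> Z) ((Y \<boxtimes> Z) \<boxtimes> X) (Y \<boxtimes> (Z \<boxtimes> X))
            (Asc M Y Z X)
            (Cmp C ((X \<boxtimes> Y) \<boxtimes> Z) (X \<boxtimes> (Y \<boxtimes> Z)) ((Y \<boxtimes> Z) \<boxtimes> X)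
              (Brd M X (Y \<boxtimes> Z)) (Asc M X Y Z))
        = Cmp C ((X \<boxtimes> Y) \<boxtimes> Z) (Y \<boxtimes> (X \<boxtimes> Z)) (Y \<boxtimes> (Z \<boxtimes> X))
            (TMor M Y Y (X \<boxtimes> Z) (Z \<boxtimes> X) (Idt C Y) (Brd M X Z))
            (Cmp C ((X \<boxtimes> Y) \<boxtimes> Z) ((Y \<boxtimes> X) \<boxtimes> Z) (Y \<boxtimes> (X \<boxtimes> Z))
              (Asc M Y X Z)
              (TMor M (X \<boxtimes> Y) (Y \<boxtimes> X) Z Z (Brd M X Y) (Idt C Z)))"
    and symmetry: "\<lbrakk>X \<in> Obj C; Y \<in> Obj C\<rbrakk>
      \<Longrightarrow> Cmp C (X \<boxtimes> Y) (Y \<boxtimes> X) (X \<boxtimes> Y) (Brd M Y X) (Brd M X Y) = Idt C (X \<boxtimes> Y)"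

text \<open>Closedness: every functor \<open>- \<boxtimes> Y\<close> has a right adjoint, given by universal
  evaluation maps \<open>e : H \<boxtimes> Y \<rightarrow> Z\<close>.\<close>

locale closed_symmetric_monoidal = symmetric_monoidal C M
  for C :: "('o, 'm) category" and M :: "('o, 'm) monoidal_structure" (structure) +
  assumes closed: "\<lbrakk>Y \<in> Obj C; Z \<in> Obj C\<rbrakk>
    \<Longrightarrow> \<exists>H \<in> Obj C. \<exists>e \<in> Mor C (H \<boxtimes> Y) Z. \<forall>X \<in> Obj C. \<forall>f \<in> Mor C (X \<boxtimes> Y) Z.
          \<exists>!g. g \<in> Mor C X H \<and>
            Cmp C (X \<boxtimes> Y) (H \<boxtimes> Y) Z e (TMor M X H Y Y g (Idt C Y)) = f"

text \<open>
  \<open>is_dual C M A A' \<eta> \<epsilon>\<close>: the two triangle identities, with the coherence isomorphisms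
  (suppressed in the informal notation) made explicit.
\<close>

definition is_dual ::
  "('o, 'm) category \<Rightarrow> ('o, 'm) monoidal_structure \<Rightarrow> 'o \<Rightarrow> 'o \<Rightarrow> 'm \<Rightarrow> 'm \<Rightarrow> bool" where
  "is_dual C M A A' \<eta> \<epsilon> \<longleftrightarrow> A' \<in> Obj C \<and>
     \<eta> \<in> Mor C \<II>\<^bsub>M\<^esub> (A' \<boxtimes>\<^bsub>M\<^esub> A) \<and> \<epsilon> \<in> Mor C (A \<boxtimes>\<^bsub>M\<^esub> A') \<II>\<^bsub>M\<^esub> \<and>
     Cmp C (\<II>\<^bsub>M\<^esub> \<boxtimes>\<^bsub>M\<^esub> A') (A' \<boxtimes>\<^bsub>M\<^esub> \<II>\<^bsub>M\<^esub>) A'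
       (Run M A')
       (Cmp C (\<II>\<^bsub>M\<^esub> \<boxtimes>\<^bsub>M\<^esub> A') (A' \<boxtimes>\<^bsub>M\<^esub> (A \<boxtimes>\<^bsub>M\<^esub> A')) (A' \<boxtimes>\<^bsub>M\<^esub> \<II>\<^bsub>M\<^esub>)
         (TMor M A' A' (A \<boxtimes>\<^bsub>M\<^esub> A') \<II>\<^bsub>M\<^esub> (Idt C A') \<epsilon>)
         (Cmp C (\<II>\<^bsub>M\<^esub> \<boxtimes>\<^bsub>M\<^esub> A') ((A' \<boxtimes>\<^bsub>M\<^esub> A) \<boxtimes>\<^bsub>M\<^esub> A') (A' \<boxtimes>\<^bsub>M\<^esub> (A \<boxtimes>\<^bsub>M\<^esub> A'))
           (Asc M A' A A')
           (TMor M \<II>\<^bsub>M\<^esub> (A' \<boxtimes>\<^bsub>M\<^esub> A) A' A' \<eta> (Idt C A'))))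
     = Lun M A' \<and>
     Cmp C (A \<boxtimes>\<^bsub>M\<^esub> \<II>\<^bsub>M\<^esub>) (\<II>\<^bsub>M\<^esub> \<boxtimes>\<^bsub>M\<^esub> A) A
       (Lun M A)
       (Cmp C (A \<boxtimes>\<^bsub>M\<^esub> \<II>\<^bsub>M\<^esub>) ((A \<boxtimes>\<^bsub>M\<^esub> A') \<boxtimes>\<^bsub>M\<^esub> A) (\<II>\<^bsub>M\<^esub> \<boxtimes>\<^bsub>M\<^esub> A)
         (TMor M (A \<boxtimes>\<^bsub>M\<^esub> A') \<II>\<^bsub>M\<^esub> A A \<epsilon> (Idt C A))
         (Cmp C (A \<boxtimes>\<^bsub>M\<^esub> \<II>\<^bsub>M\<^esub>) (A \<boxtimes>\<^bsub>M\<^esub> (A' \<boxtimes>\<^bsub>M\<^esub> A)) ((A \<boxtimes>\<^bsub>M\<^esub> A') \<boxtimes>\<^bsub>M\<^esub> A)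
           (inv_mor C ((A \<boxtimes>\<^bsub>M\<^esub> A') \<boxtimes>\<^bsub>M\<^esub> A) (A \<boxtimes>\<^bsub>M\<^esub> (A' \<boxtimes>\<^bsub>M\<^esub> A)) (Asc M A A' A))
           (TMor M A A \<II>\<^bsub>M\<^esub> (A' \<boxtimes>\<^bsub>M\<^esub> A) (Idt C A) \<eta>)))
     = Run M A"

locale rigid_symmetric_monoidal = symmetric_monoidal C M
  for C :: "('o, 'm) category" and M :: "('o, 'm) monoidal_structure" (structure) +
  assumes rigid: "A \<in> Obj C \<Longrightarrow> \<exists>A' \<eta> \<epsilon>. is_dual C M A A' \<eta> \<epsilon>"


section \<open>Finitely presented functors and the induced tensor product\<close>

text \<open>
  \<open>fp_mod C\<close> is \<open>C\<^sup>f\<^sup>p\<close>-mod: a functor \<open>F : C\<^sup>f\<^sup>p \<rightarrow> Ab\<close> is finitely presented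
  if there is an exact sequence \<open>(B,-) \<rightarrow> (A,-) \<rightarrow> F \<rightarrow> 0\<close> with \<open>A\<close>, \<open>B\<close> in \<open>C\<^sup>f\<^sup>p\<close>.
\<close>

definition fp_functors :: "('o, 'u) category \<Rightarrow> ('o, 'u) abfunctor set" where
  "fp_functors C = {F. \<exists>A \<in> fp_objects C. \<exists>B \<in> fp_objects C.
     \<exists>s \<in> nat_trans (fp_category C) Ab
            (representable (fp_category C) B) (representable (fp_category C) A). \<exists>q.
       is_cokernel (functor_category (fp_category C) Ab)
         (representable (fp_category C) B) (representable (fp_category C) A) F s q}"

definition fp_mod :: "('o, 'u) category \<Rightarrow> (('o, 'u) abfunctor, 'o \<Rightarrow> 'u \<Rightarrow> 'u) category" where
  "fp_mod C = full_subcategory (functor_category (fp_category C) Ab) (fp_functors C)"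

text \<open>
  Day convolution: \<open>P = F \<otimes> G\<close> is the left Kan extension of \<open>(A, B) \<mapsto> F A \<otimes>\<^sub>\<int> G B\<close> along
  \<open>\<boxtimes>\<close>.  Maps out of the external product are unfolded to families of biadditive maps
  \<open>F A \<times> G B \<rightarrow> H (A \<boxtimes> B)\<close>, natural in \<open>A\<close> and \<open>B\<close>.
\<close>

definition biadditive_family ::
  "('o, 'u) category \<Rightarrow> ('o, 'u) monoidal_structure \<Rightarrow> ('o, 'u) abfunctor
    \<Rightarrow> ('o, 'u) abfunctor \<Rightarrow> ('o, 'u) abfunctor \<Rightarrow> ('o \<Rightarrow> 'o \<Rightarrow> 'u \<Rightarrow> 'u \<Rightarrow> 'u) \<Rightarrow> bool" where
  "biadditive_family C M F G H b \<longleftrightarrow>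
     (\<forall>A \<in> Obj C. \<forall>B \<in> Obj C.
        (\<forall>x \<in> carrier (FOb F A). b A B x \<in> hom (FOb G B) (FOb H (A \<boxtimes>\<^bsub>M\<^esub> B))) \<and>
        (\<forall>y \<in> carrier (FOb G B). (\<lambda>x. b A B x y) \<in> hom (FOb F A) (FOb H (A \<boxtimes>\<^bsub>M\<^esub> B)))) \<and>
     (\<forall>A \<in> Obj C. \<forall>A' \<in> Obj C. \<forall>B \<in> Obj C. \<forall>B' \<in> Obj C.
        \<forall>f \<in> Mor C A A'. \<forall>g \<in> Mor C B B'. \<forall>x \<in> carrier (FOb F A). \<forall>y \<in> carrier (FOb G B).
          FMor H (A \<boxtimes>\<^bsub>M\<^esub> B) (A' \<boxtimes>\<^bsub>M\<^esub> B') (TMor M A A' B B' f g) (b A B x y)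
          = b A' B' (FMor F A A' f x) (FMor G B B' g y))"

definition is_day_convolution ::
  "('o, 'u) category \<Rightarrow> ('o, 'u) monoidal_structure \<Rightarrow> ('o, 'u) abfunctor
    \<Rightarrow> ('o, 'u) abfunctor \<Rightarrow> ('o, 'u) abfunctor \<Rightarrow> bool" where
  "is_day_convolution C M F G P \<longleftrightarrow> additive_functor C Ab P \<and>
     (\<exists>u. biadditive_family C M F G P u \<and>
        (\<forall>H b. additive_functor C Ab H \<and> biadditive_family C M F G H b \<longrightarrow>
           (\<exists>!t. t \<in> nat_trans C Ab P H \<and>
             (\<forall>A \<in> Obj C. \<forall>B \<in> Obj C. \<forall>x \<in> carrier (FOb F A). \<forall>y \<in> carrier (FOb G B).
                t (A \<boxtimes>\<^bsub>M\<^esub> B) (u A B x y) = b A B x y))))"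

definition day_tensor ::
  "('o, 'u) category \<Rightarrow> ('o, 'u) monoidal_structure \<Rightarrow> ('o, 'u) abfunctor
    \<Rightarrow> ('o, 'u) abfunctor \<Rightarrow> ('o, 'u) abfunctor" where
  "day_tensor C M F G = (SOME P. is_day_convolution C M F G P)"

definition serre_tensor_ideal ::
  "('o, 'u) category \<Rightarrow> ('o, 'u) monoidal_structure \<Rightarrow> ('o, 'u) abfunctor set \<Rightarrow> bool" where
  "serre_tensor_ideal C M S \<longleftrightarrow> serre_subcategory (fp_mod C) S \<and>
     (\<forall>F \<in> S. \<forall>G \<in> Obj (fp_mod C). day_tensor (fp_category C) M G F \<in> S)"


section \<open>Definable subcategories\<close>

definition is_direct_limit_extension ::
  "('o, 'u) category \<Rightarrow> ('o, 'u) abfunctor \<Rightarrow> ('o, 'u) abfunctor \<Rightarrow> bool" where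
  "is_direct_limit_extension C F E \<longleftrightarrow>
     additive_functor C Ab E \<and> preserves_direct_limits C Ab E \<and>
     isomorphic (functor_category (fp_category C) Ab) E F"

definition direct_limit_extension ::
  "('o, 'u) category \<Rightarrow> ('o, 'u) abfunctor \<Rightarrow> ('o, 'u) abfunctor" where
  \<comment> \<open>the functor \<open>F\<close> with an arrow on top; unique up to natural isomorphism\<close>
  "direct_limit_extension C F = (SOME E. is_direct_limit_extension C F E)"

definition definable_of :: "('o, 'u) category \<Rightarrow> ('o, 'u) abfunctor set \<Rightarrow> 'o set" where
  "definable_of C S = {X \<in> Obj C. \<forall>F \<in> S.
     carrier (FOb (direct_limit_extension C F) X) = {\<one>\<^bsub>FOb (direct_limit_extension C F) X\<^esub>}}"

definition pure_mono :: "('o, 'u) category \<Rightarrow> 'o \<Rightarrow> 'o \<Rightarrow> 'u \<Rightarrow> bool" where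
  "pure_mono C X Y m \<longleftrightarrow> mono_mor C X Y m \<and>
     (\<forall>A \<in> fp_objects C. \<forall>B \<in> fp_objects C. \<forall>f \<in> Mor C A B. \<forall>h \<in> Mor C A X. \<forall>h' \<in> Mor C B Y.
        Cmp C A B Y h' f = Cmp C A X Y m h \<longrightarrow> (\<exists>k \<in> Mor C B X. Cmp C A B X k f = h))"

definition definable_subcategory :: "('o, 'u) category \<Rightarrow> 'o set \<Rightarrow> bool" where
  "definable_subcategory C \<D> \<longleftrightarrow> \<D> \<subseteq> Obj C \<and>
     (\<forall>(I :: 'u set) D X p. small TYPE('u) I \<and> D ` I \<subseteq> \<D> \<and> is_product C I D X p
        \<longrightarrow> X \<in> \<D>) \<and>
     (\<forall>(I :: 'u set) r D d X c. small TYPE('u) I \<and> D ` I \<subseteq> \<D> \<and> is_direct_limit C I r D d X c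
        \<longrightarrow> X \<in> \<D>) \<and>
     (\<forall>X \<in> Obj C. \<forall>Y \<in> \<D>. \<forall>m. pure_mono C X Y m \<longrightarrow> X \<in> \<D>)"

definition definable_tensor_ideal ::
  "('o, 'u) category \<Rightarrow> ('o, 'u) monoidal_structure \<Rightarrow> 'o set \<Rightarrow> bool" where
  "definable_tensor_ideal C M \<D> \<longleftrightarrow> definable_subcategory C \<D> \<and>
     (\<forall>X \<in> Obj C. \<forall>Y \<in> \<D>. X \<boxtimes>\<^bsub>M\<^esub> Y \<in> \<D>)"

end

theory Submission
  imports Defs "HOL-Algebra.Product_Groups"
begin

text \<open>
  A finitely presented functor \<open>F = coker (f,-)\<close>, with \<open>f : A \<rightarrow> B\<close>, satisfies \<open>F X = 0\<close> (for the extension of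
  \<open>F\<close> commuting with direct limits) iff every morphism \<open>A \<rightarrow> X\<close> factors through \<open>f\<close>.  So \<open>\<D>\<close> is determined
  by the class of those \<open>f\<close> with \<open>coker (f,-)\<close> in \<open>S\<close>, and \<open>(P,-) \<otimes> F\<close> is the cokernel of \<open>(P \<boxtimes> f,-)\<close>.
  By duality, every \<open>P \<boxtimes> A \<rightarrow> X\<close> factors through \<open>P \<boxtimes> f\<close> once every \<open>A \<rightarrow> P\<^sup>\<or> \<boxtimes> X\<close> factors through
  \<open>f\<close>, and similarly on the other side.  This moves the ideal property between
  \<open>S\<close> and \<open>\<D>\<close>; a general object of \<open>C\<close> is a direct limit of finitely presented ones, and tensoring preserves
  direct limits.

  Passing from \<open>\<D>\<close> back to \<open>S\<close> needs that \<open>S\<close> contains every \<open>coker (f,-)\<close> vanishing on \<open>\<D>\<close>.  If \<open>coker (f,-)\<close>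
  is not in \<open>S\<close>, an object of \<open>\<D>\<close> and a morphism from \<open>A\<close> to it that does not factor through \<open>f\<close> arise from \<open>A\<close>
  in \<open>\<omega>\<close> steps.  Each step solves all factorization problems posed by \<open>S\<close>: finitely many of them are
  solved by weak pushouts of finitely presented objects, and a reduced product combines the solutions.
\<close>

section \<open>Small sets\<close>

text \<open>Neither \<open>C\<close> nor its finitely presented part need have pushouts. Weak
  pushouts exist, but they are not functorial: the solution of a larger finite set of factorization
  problems receives no compatible map from that of a smaller one, so the solutions form no directed
  system. A reduced product needs no maps between its factors, and an equality of morphisms from a
  finitely presented object into it holds at a single coordinate; this carries the obstruction to
  factoring through \<open>f\<close> across a step. Each step creates new morphisms from generators,
  hence new problems, which forces the iteration.

  The finitely presented objects need not form a small set. A retraction argument reduces the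
  problems to morphisms between generators, so that all index sets become small.

  Tensor products and extensions are arbitrary choices within an isomorphism class, while closure of
  \<open>S\<close> under isomorphism has to be derived from exact sequences with a zero term. Hence
  explicit cokernels are built, their universal properties proved, and the chosen functors compared
  with them.\<close>

lemma small_image: "small TYPE('u) A \<Longrightarrow> small TYPE('u) (f ` A)"
  unfolding small_def using card_of_image ordLeq_ordLess_trans by blast

lemma small_subset: "small TYPE('u) A \<Longrightarrow> B \<subseteq> A \<Longrightarrow> small TYPE('u) B"
  unfolding small_def using card_of_mono1 ordLeq_ordLess_trans by blast

text \<open>Direct limits, products and the groups of \<open>Ab\<close> are available only with
  index sets and elements in \<open>'u\<close>. Anything small of another type is moved there along
  such an injection.\<close>

lemma small_code:
  assumes "small TYPE('u) A"
  obtains \<phi> :: "'a \<Rightarrow> 'u" where "inj_on \<phi> A"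
  using assms ordLess_imp_ordLeq card_of_ordLeq[of A "UNIV :: 'u set"]
  unfolding small_def by blast

lemma small_nat:
  assumes "universe TYPE('u)"
  shows "small TYPE('u) (A :: nat set)"
  using assms ordLeq_ordLess_trans[OF card_of_mono1[OF subset_UNIV] ordIso_ordLess_trans[OF card_of_nat]]
  unfolding small_def universe_def by blast

text \<open>Regularity bounds unions of few small sets; for an infinite cardinal it yields
  stability, the corresponding bound for disjoint sums.\<close>

lemma universe_stable:
  assumes "universe TYPE('u)"
  shows "stable |UNIV :: 'u set|"
proof -
  have "infinite (UNIV :: 'u set)"
    using assms unfolding universe_def
    by (metis infinite_iff_natLeq_ordLeq ordLess_imp_ordLeq)
  then show ?thesis
    using assms regularCard_stable[of "|UNIV :: 'u set|"] card_of_Card_order Field_card_of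
    unfolding universe_def by metis
qed

lemma small_Sigma:
  assumes "universe TYPE('u)" "small TYPE('u) I" "\<And>i. i \<in> I \<Longrightarrow> small TYPE('u) (A i)"
  shows "small TYPE('u) (Sigma I A)"
  using stable_elim[OF universe_stable[OF assms(1)]] assms(2,3) unfolding small_def by blast

text \<open>\<open>universe\<close> bounds the power sets of subsets of \<open>'u\<close> only; a
  code carries the bound over to any small set.\<close>

lemma small_Pow:
  assumes "universe TYPE('u)" "small TYPE('u) A"
  shows "small TYPE('u) (Pow A)"
proof -
  obtain \<phi> :: "'a \<Rightarrow> 'u" where \<phi>: "inj_on \<phi> A"
    using small_code[OF assms(2)] by blast
  have "small TYPE('u) (\<phi> ` A)"
    using assms(2) by (rule small_image)
  then have "small TYPE('u) (Pow (\<phi> ` A))"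
    using assms(1) unfolding universe_def small_def by blast
  then have "small TYPE('u) ((\<lambda>B. inv_into A \<phi> ` B) ` Pow (\<phi> ` A))"
    by (rule small_image)
  moreover have "Pow A \<subseteq> (\<lambda>B. inv_into A \<phi> ` B) ` Pow (\<phi> ` A)"
  proof
    fix B assume B: "B \<in> Pow A"
    then have "inv_into A \<phi> ` \<phi> ` B = B"
      by (intro inv_into_image_cancel[OF \<phi>]) auto
    moreover have "\<phi> ` B \<in> Pow (\<phi> ` A)" using B by blast
    ultimately show "B \<in> (\<lambda>B. inv_into A \<phi> ` B) ` Pow (\<phi> ` A)"
      using image_eqI by metis
  qed
  ultimately show ?thesis
    by (rule small_subset)
qed

text \<open>A function on \<open>I\<close> is determined by its graph, and the graphs lie in the
  power set of the small set \<open>Sigma I A\<close>; \<open>?h\<close> reads the function off its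
  graph.\<close>

lemma small_PiE:
  assumes U: "universe TYPE('u)" and I: "small TYPE('u) I" and A: "\<And>i. i \<in> I \<Longrightarrow> small TYPE('u) (A i)"
  shows "small TYPE('u) (Pi\<^sub>E I A)"
proof -
  let ?g = "\<lambda>f. (\<lambda>i. (i, f i)) ` I" and ?h = "\<lambda>R. \<lambda>i\<in>I. THE y. (i, y) \<in> R"
  have "small TYPE('u) (?h ` Pow (Sigma I A))"
    by (intro small_image small_Pow small_Sigma U I A)
  moreover have "Pi\<^sub>E I A \<subseteq> ?h ` Pow (Sigma I A)"
  proof
    fix f assume f: "f \<in> Pi\<^sub>E I A"
    then have "f = ?h (?g f)" "?g f \<in> Pow (Sigma I A)"
      by (auto simp: fun_eq_iff PiE_def extensional_def image_iff)
    then show "f \<in> ?h ` Pow (Sigma I A)" by blast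
  qed
  ultimately show ?thesis by (rule small_subset)
qed

section \<open>Groups with elements in another type\<close>

text \<open>The quotient of \<open>G\<close> by the kernel of \<open>\<rho>\<close>, with
  \<open>\<rho> x\<close> as the name of the class of \<open>x\<close>. The product picks preimages,
  so it is meaningful only once \<open>\<rho>\<close> is known to identify exactly the elements of
  each coset of a subgroup.\<close>

definition recode_group :: "('a, 'b) monoid_scheme \<Rightarrow> ('a \<Rightarrow> 'c) \<Rightarrow> 'c monoid" where
  "recode_group G \<rho> = \<lparr>carrier = \<rho> ` carrier G,
     monoid.mult = (\<lambda>a b. \<rho> (inv_into (carrier G) \<rho> a \<otimes>\<^bsub>G\<^esub> inv_into (carrier G) \<rho> b)),
     one = \<rho> \<one>\<^bsub>G\<^esub>\<rparr>"

lemma carrier_recode_group [simp]: "carrier (recode_group G \<rho>) = \<rho> ` carrier G"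
  and one_recode_group [simp]: "\<one>\<^bsub>recode_group G \<rho>\<^esub> = \<rho> \<one>\<^bsub>G\<^esub>"
  by (simp_all add: recode_group_def)

text \<open>Commutativity makes the product independent of the preimages: the quotient of
  \<open>x\<close> by \<open>x'\<close> and that of \<open>y\<close> by \<open>y'\<close>, both in
  \<open>N\<close>, multiply to the quotient of the product of \<open>x\<close> and \<open>y\<close>
  by that of \<open>x'\<close> and \<open>y'\<close>.\<close>

lemma recode_group_hom:
  assumes G: "group G"
    and N: "\<And>x y. \<lbrakk>x \<in> carrier G; y \<in> carrier G\<rbrakk> \<Longrightarrow> \<rho> x = \<rho> y \<longleftrightarrow> x \<otimes>\<^bsub>G\<^esub> inv\<^bsub>G\<^esub> y \<in> N"
    and sub: "subgroup N G" and comm: "comm_group G"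
  shows "\<rho> \<in> hom G (recode_group G \<rho>)" and "comm_group (recode_group G \<rho>)"
proof -
  interpret comm_group G by fact
  have cong: "\<rho> (x \<otimes>\<^bsub>G\<^esub> y) = \<rho> (x' \<otimes>\<^bsub>G\<^esub> y')"
    if "x \<in> carrier G" "y \<in> carrier G" "x' \<in> carrier G" "y' \<in> carrier G"
      "\<rho> x = \<rho> x'" "\<rho> y = \<rho> y'" for x y x' y'
  proof -
    have "(x \<otimes>\<^bsub>G\<^esub> inv\<^bsub>G\<^esub> x') \<otimes>\<^bsub>G\<^esub> (y \<otimes>\<^bsub>G\<^esub> inv\<^bsub>G\<^esub> y') \<in> N"
      using that N by (blast intro: subgroup.m_closed[OF sub])
    moreover have "(x \<otimes>\<^bsub>G\<^esub> inv\<^bsub>G\<^esub> x') \<otimes>\<^bsub>G\<^esub> (y \<otimes>\<^bsub>G\<^esub> inv\<^bsub>G\<^esub> y')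
      = (x \<otimes>\<^bsub>G\<^esub> y) \<otimes>\<^bsub>G\<^esub> inv\<^bsub>G\<^esub> (x' \<otimes>\<^bsub>G\<^esub> y')"
      using that by (simp add: inv_mult m_ac)
    ultimately show ?thesis using that N by simp
  qed
  show hom: "\<rho> \<in> hom G (recode_group G \<rho>)"
  proof (rule homI)
    fix x y assume xy: "x \<in> carrier G" "y \<in> carrier G"
    have "inv_into (carrier G) \<rho> (\<rho> z) \<in> carrier G \<and> \<rho> (inv_into (carrier G) \<rho> (\<rho> z)) = \<rho> z"
      if "z \<in> carrier G" for z
      using that by (meson f_inv_into_f imageI inv_into_into)
    then have "\<rho> (x \<otimes>\<^bsub>G\<^esub> y) = \<rho> (inv_into (carrier G) \<rho> (\<rho> x) \<otimes>\<^bsub>G\<^esub> inv_into (carrier G) \<rho> (\<rho> y))"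
      using xy by (intro cong) auto
    then show "\<rho> (x \<otimes>\<^bsub>G\<^esub> y) = \<rho> x \<otimes>\<^bsub>recode_group G \<rho>\<^esub> \<rho> y"
      by (simp add: recode_group_def)
  qed simp
  show "comm_group (recode_group G \<rho>)"
    using hom_imp_img_comm_group[OF hom] by (simp add: recode_group_def)
qed

text \<open>A coset is named by one of its elements instead of by a set, so that a quotient of a
  group with elements in \<open>'u\<close> again has its elements in \<open>'u\<close>.\<close>

definition coset_rep :: "('a, 'b) monoid_scheme \<Rightarrow> 'a set \<Rightarrow> 'a \<Rightarrow> 'a" where
  "coset_rep G N x = (SOME y. y \<in> carrier G \<and> x \<otimes>\<^bsub>G\<^esub> inv\<^bsub>G\<^esub> y \<in> N)"

lemma (in group) coset_rep:
  assumes N: "subgroup N G" and x: "x \<in> carrier G"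
  shows "coset_rep G N x \<in> carrier G" and "x \<otimes> inv (coset_rep G N x) \<in> N"
    and "y \<in> carrier G \<Longrightarrow> coset_rep G N x = coset_rep G N y \<longleftrightarrow> x \<otimes> inv y \<in> N"
    and "coset_rep G N (coset_rep G N x) = coset_rep G N x"
proof -
  have *: "coset_rep G N x \<in> carrier G \<and> x \<otimes> inv (coset_rep G N x) \<in> N" if "x \<in> carrier G" for x
    unfolding coset_rep_def by (rule someI[of _ x]) (use that N subgroup.one_closed in auto)
  show 1: "coset_rep G N x \<in> carrier G" and 2: "x \<otimes> inv (coset_rep G N x) \<in> N"
    using *[OF x] by auto
  have 3: "coset_rep G N x = coset_rep G N y \<longleftrightarrow> x \<otimes> inv y \<in> N" if x: "x \<in> carrier G" and y: "y \<in> carrier G" for x y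
  proof
    assume eq: "coset_rep G N x = coset_rep G N y"
    let ?r = "coset_rep G N y"
    have "x \<otimes> inv ?r \<in> N" "?r \<in> carrier G"
      using *[OF x] eq by simp_all
    moreover have "inv (y \<otimes> inv ?r) \<in> N"
      using *[OF y] by (intro subgroup.m_inv_closed[OF N]) simp
    ultimately have "(x \<otimes> inv ?r) \<otimes> inv (y \<otimes> inv ?r) \<in> N"
      by (blast intro: subgroup.m_closed[OF N])
    moreover have "(x \<otimes> inv ?r) \<otimes> inv (y \<otimes> inv ?r) = x \<otimes> inv y"
    proof -
      have "(x \<otimes> inv ?r) \<otimes> inv (y \<otimes> inv ?r) = x \<otimes> (inv ?r \<otimes> (?r \<otimes> inv y))"
        using x y \<open>?r \<in> carrier G\<close> by (simp add: inv_mult_group m_assoc)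
      also have "inv ?r \<otimes> (?r \<otimes> inv y) = inv y"
        using y \<open>?r \<in> carrier G\<close> by (simp flip: m_assoc)
      finally show ?thesis .
    qed
    ultimately show "x \<otimes> inv y \<in> N" by simp
  next
    assume xy: "x \<otimes> inv y \<in> N"
    \<comment> \<open>The choice in \<open>coset_rep\<close> depends only on the predicate chosen
      from, so it is enough that \<open>x\<close> and \<open>y\<close> are congruent to the same
      elements.\<close>
    have "x \<otimes> inv z \<in> N \<longleftrightarrow> y \<otimes> inv z \<in> N" if z: "z \<in> carrier G" for z
    proof
      assume "y \<otimes> inv z \<in> N"
      then have "(x \<otimes> inv y) \<otimes> (y \<otimes> inv z) \<in> N" by (rule subgroup.m_closed[OF N xy])
      then show "x \<otimes> inv z \<in> N"
        using x y z by (metis inv_closed m_assoc l_inv l_one m_closed)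
    next
      assume "x \<otimes> inv z \<in> N"
      then have "inv (x \<otimes> inv y) \<otimes> (x \<otimes> inv z) \<in> N"
        by (rule subgroup.m_closed[OF N subgroup.m_inv_closed[OF N xy]])
      then show "y \<otimes> inv z \<in> N"
        using x y z by (metis inv_closed inv_inv inv_mult_group m_assoc l_inv l_one m_closed)
    qed
    then show "coset_rep G N x = coset_rep G N y"
      unfolding coset_rep_def by metis
  qed
  then show "coset_rep G N x = coset_rep G N y \<longleftrightarrow> x \<otimes> inv y \<in> N" if "y \<in> carrier G"
    using x that by blast
  show "coset_rep G N (coset_rep G N x) = coset_rep G N x"
    using 1 2 3 x by metis
qed

lemma (in group) mult_inv_eq_one_iff:
  "\<lbrakk>x \<in> carrier G; y \<in> carrier G\<rbrakk> \<Longrightarrow> x \<otimes> inv y = \<one> \<longleftrightarrow> x = y"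
  by (metis inv_equality inv_inv inv_closed r_inv)

section \<open>Preadditive categories\<close>

context preadditive_category
begin

lemma Hom_group: "\<lbrakk>X \<in> Obj C; Y \<in> Obj C\<rbrakk> \<Longrightarrow> group (Hom C X Y)"
  using Hom_comm_group comm_group.axioms(2) by blast

lemma zero_Mor [simp]: "\<lbrakk>X \<in> Obj C; Y \<in> Obj C\<rbrakk> \<Longrightarrow> zero_mor C X Y \<in> Mor C X Y"
  using Hom_group group.is_monoid monoid.one_closed by blast

lemma mult_Mor: "\<lbrakk>X \<in> Obj C; Y \<in> Obj C; f \<in> Mor C X Y; g \<in> Mor C X Y\<rbrakk> \<Longrightarrow> f \<otimes>\<^bsub>Hom C X Y\<^esub> g \<in> Mor C X Y"
  using Hom_group group.is_monoid monoid.m_closed by metis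

lemma inv_Mor: "\<lbrakk>X \<in> Obj C; Y \<in> Obj C; f \<in> Mor C X Y\<rbrakk> \<Longrightarrow> inv\<^bsub>Hom C X Y\<^esub> f \<in> Mor C X Y"
  using Hom_group group.inv_closed by metis

lemma Cmp_hom_left:
  "\<lbrakk>X \<in> Obj C; Y \<in> Obj C; Z \<in> Obj C; f \<in> Mor C X Y\<rbrakk>
    \<Longrightarrow> (\<lambda>g. Cmp C X Y Z g f) \<in> hom (Hom C Y Z) (Hom C X Z)"
  by (rule homI) (auto intro: Cmp_Mor simp: Cmp_add_left)

lemma Cmp_hom_right:
  "\<lbrakk>X \<in> Obj C; Y \<in> Obj C; Z \<in> Obj C; g \<in> Mor C Y Z\<rbrakk>
    \<Longrightarrow> Cmp C X Y Z g \<in> hom (Hom C X Y) (Hom C X Z)"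
  by (rule homI) (auto intro: Cmp_Mor simp: Cmp_add_right)

lemma Cmp_zero_left [simp]:
  "\<lbrakk>X \<in> Obj C; Y \<in> Obj C; Z \<in> Obj C; f \<in> Mor C X Y\<rbrakk> \<Longrightarrow> Cmp C X Y Z (zero_mor C Y Z) f = zero_mor C X Z"
  using hom_one[OF Cmp_hom_left] Hom_group by metis

lemma Cmp_zero_right [simp]:
  "\<lbrakk>X \<in> Obj C; Y \<in> Obj C; Z \<in> Obj C; g \<in> Mor C Y Z\<rbrakk> \<Longrightarrow> Cmp C X Y Z g (zero_mor C X Y) = zero_mor C X Z"
  using hom_one[OF Cmp_hom_right] Hom_group by metis

lemma Cmp_inv_left:
  assumes "X \<in> Obj C" "Y \<in> Obj C" "Z \<in> Obj C" "f \<in> Mor C X Y" "g \<in> Mor C Y Z"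
  shows "Cmp C X Y Z (inv\<^bsub>Hom C Y Z\<^esub> g) f = inv\<^bsub>Hom C X Z\<^esub> (Cmp C X Y Z g f)"
  using group_hom.hom_inv[OF group_hom.intro[OF Hom_group Hom_group group_hom_axioms.intro[OF Cmp_hom_left]]]
    assms by blast

lemma Cmp_inv_right:
  assumes "X \<in> Obj C" "Y \<in> Obj C" "Z \<in> Obj C" "f \<in> Mor C X Y" "g \<in> Mor C Y Z"
  shows "Cmp C X Y Z g (inv\<^bsub>Hom C X Y\<^esub> f) = inv\<^bsub>Hom C X Z\<^esub> (Cmp C X Y Z g f)"
  using group_hom.hom_inv[OF group_hom.intro[OF Hom_group Hom_group group_hom_axioms.intro[OF Cmp_hom_right]]]
    assms by blast

end

section \<open>Factorization through a fixed morphism\<close>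

definition factors :: "('o, 'm) category \<Rightarrow> 'o \<Rightarrow> 'o \<Rightarrow> 'o \<Rightarrow> 'm \<Rightarrow> 'm \<Rightarrow> bool" where
  "factors C A B W f x \<longleftrightarrow> (\<exists>y \<in> Mor C B W. x = Cmp C A B W y f)"

text \<open>These morphisms are the image of the homomorphism given by precomposition with
  \<open>f\<close>. The quotient of \<open>Hom C A W\<close> by them is the value at
  \<open>W\<close> of the cokernel of \<open>(f,-)\<close>.\<close>

lemma (in preadditive_category) factors_subgroup:
  assumes "A \<in> Obj C" "B \<in> Obj C" "W \<in> Obj C" "f \<in> Mor C A B"
  shows "subgroup {x. factors C A B W f x} (Hom C A W)"
proof -
  interpret group_hom "Hom C B W" "Hom C A W" "\<lambda>y. Cmp C A B W y f"
    using assms Hom_group Cmp_hom_left by (intro group_hom.intro group_hom_axioms.intro) auto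
  have "{x. factors C A B W f x} = (\<lambda>y. Cmp C A B W y f) ` Mor C B W"
    by (auto simp: factors_def)
  then show ?thesis using img_is_subgroup by simp
qed

lemma (in preadditive_category) factors_Cmp:
  assumes "A \<in> Obj C" "B \<in> Obj C" "W \<in> Obj C" "V \<in> Obj C" "f \<in> Mor C A B" "w \<in> Mor C W V"
    "factors C A B W f x"
  shows "factors C A B V f (Cmp C A W V w x)"
  using assms unfolding factors_def by (metis Cmp_Mor Cmp_assoc)

lemma (in preadditive_category) biproduct_copair:
  assumes b: "biproduct C B B' R i j p q"
    and o: "B \<in> Obj C" "B' \<in> Obj C" "W \<in> Obj C" and y: "y \<in> Mor C B W" "y' \<in> Mor C B' W"
  obtains z where "z \<in> Mor C R W" "Cmp C B R W z i = y" "Cmp C B' R W z j = y'"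
proof -
  from b have R: "R \<in> Obj C" and m: "i \<in> Mor C B R" "j \<in> Mor C B' R" "p \<in> Mor C R B" "q \<in> Mor C R B'"
    and e: "Cmp C B R B p i = Idt C B" "Cmp C B' R B' q j = Idt C B'"
      "Cmp C B R B' q i = zero_mor C B B'" "Cmp C B' R B p j = zero_mor C B' B"
    unfolding biproduct_def by auto
  interpret GB: comm_group "Hom C B W" using o Hom_comm_group by blast
  interpret GB': comm_group "Hom C B' W" using o Hom_comm_group by blast
  define z where "z = Cmp C R B W y p \<otimes>\<^bsub>Hom C R W\<^esub> Cmp C R B' W y' q"
  have z: "z \<in> Mor C R W" unfolding z_def using o R m y by (intro mult_Mor Cmp_Mor) auto
  have "Cmp C B R W z i = Cmp C B R W (Cmp C R B W y p) i \<otimes>\<^bsub>Hom C B W\<^esub> Cmp C B R W (Cmp C R B' W y' q) i"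
    unfolding z_def using o R m y by (intro Cmp_add_left Cmp_Mor) auto
  also have "\<dots> = Cmp C B B W y (Idt C B) \<otimes>\<^bsub>Hom C B W\<^esub> Cmp C B B' W y' (zero_mor C B B')"
    using o R m y by (simp add: e flip: Cmp_assoc)
  also have "\<dots> = y" using o R m y by (simp add: Cmp_Idt_right)
  finally have zi: "Cmp C B R W z i = y" .
  have "Cmp C B' R W z j = Cmp C B' R W (Cmp C R B W y p) j \<otimes>\<^bsub>Hom C B' W\<^esub> Cmp C B' R W (Cmp C R B' W y' q) j"
    unfolding z_def using o R m y by (intro Cmp_add_left Cmp_Mor) auto
  also have "\<dots> = Cmp C B' B W y (zero_mor C B' B) \<otimes>\<^bsub>Hom C B' W\<^esub> Cmp C B' B' W y' (Idt C B')"
    using o R m y by (simp add: e flip: Cmp_assoc)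
  also have "\<dots> = y'" using o R m y by (simp add: Cmp_Idt_right)
  finally have zj: "Cmp C B' R W z j = y'" .
  show thesis using z zi zj by (rule that)
qed

text \<open>\<open>h\<close> is the morphism with components \<open>f\<close> and \<open>f'\<close>.
  The image of \<open>(h,-)\<close> in \<open>(A,-)\<close> is the sum of the images of
  \<open>(f,-)\<close> and \<open>(f',-)\<close>; so two families of relations on one generator can
  be imposed by a single morphism.\<close>

lemma (in preadditive_category) biproduct_pair:
  assumes b: "biproduct C B B' R i j p q"
    and o: "A \<in> Obj C" "B \<in> Obj C" "B' \<in> Obj C" "f \<in> Mor C A B" "f' \<in> Mor C A B'"
  defines "h \<equiv> Cmp C A B R i f \<otimes>\<^bsub>Hom C A R\<^esub> Cmp C A B' R j f'"
  shows "h \<in> Mor C A R"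
    and "\<lbrakk>W \<in> Obj C; y \<in> Mor C R W\<rbrakk> \<Longrightarrow> Cmp C A R W y h
      = Cmp C A B W (Cmp C B R W y i) f \<otimes>\<^bsub>Hom C A W\<^esub> Cmp C A B' W (Cmp C B' R W y j) f'"
    and "W \<in> Obj C \<Longrightarrow> factors C A R W h x \<longleftrightarrow>
      (\<exists>y \<in> Mor C B W. \<exists>y' \<in> Mor C B' W. x = Cmp C A B W y f \<otimes>\<^bsub>Hom C A W\<^esub> Cmp C A B' W y' f')"
proof -
  from b have R: "R \<in> Obj C" and m: "i \<in> Mor C B R" "j \<in> Mor C B' R"
    unfolding biproduct_def by auto
  show h: "h \<in> Mor C A R"
    unfolding h_def using o R m by (intro mult_Mor Cmp_Mor) auto
  have yh: "Cmp C A R W y h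
      = Cmp C A B W (Cmp C B R W y i) f \<otimes>\<^bsub>Hom C A W\<^esub> Cmp C A B' W (Cmp C B' R W y j) f'"
    if W: "W \<in> Obj C" and y: "y \<in> Mor C R W" for W y
  proof -
    have "Cmp C A R W y h = Cmp C A R W y (Cmp C A B R i f) \<otimes>\<^bsub>Hom C A W\<^esub> Cmp C A R W y (Cmp C A B' R j f')"
      unfolding h_def using o R m y W by (intro Cmp_add_right Cmp_Mor) auto
    then show ?thesis using o R m y W by (simp add: Cmp_assoc)
  qed
  then show "\<lbrakk>W \<in> Obj C; y \<in> Mor C R W\<rbrakk> \<Longrightarrow> Cmp C A R W y h
      = Cmp C A B W (Cmp C B R W y i) f \<otimes>\<^bsub>Hom C A W\<^esub> Cmp C A B' W (Cmp C B' R W y j) f'" .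
  show "factors C A R W h x \<longleftrightarrow>
      (\<exists>y \<in> Mor C B W. \<exists>y' \<in> Mor C B' W. x = Cmp C A B W y f \<otimes>\<^bsub>Hom C A W\<^esub> Cmp C A B' W y' f')" (is "?l \<longleftrightarrow> ?r")
    if W: "W \<in> Obj C"
  proof
    assume ?l
    then obtain y where y: "y \<in> Mor C R W" "x = Cmp C A R W y h" unfolding factors_def by blast
    then show ?r using yh[OF W y(1)] o R m W by (blast intro: Cmp_Mor)
  next
    assume ?r
    then obtain y y' where y: "y \<in> Mor C B W" "y' \<in> Mor C B' W"
      "x = Cmp C A B W y f \<otimes>\<^bsub>Hom C A W\<^esub> Cmp C A B' W y' f'" by blast
    obtain z where "z \<in> Mor C R W" "Cmp C B R W z i = y" "Cmp C B' R W z j = y'"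
      using biproduct_copair[OF b o(2,3) W y(1,2)] by blast
    then show ?l using yh[OF W] y(3) unfolding factors_def by metis
  qed
qed

section \<open>Functors to abelian groups\<close>

lemma restrict_in_hom: "\<lbrakk>group G; h \<in> hom G H\<rbrakk> \<Longrightarrow> restrict h (carrier G) \<in> hom G H"
  by (rule group.hom_restrict) auto

lemma Obj_Ab: "(G :: 'u monoid) \<in> Obj Ab \<longleftrightarrow> comm_group G \<and> small TYPE('u) (carrier G)"
  and Mor_Ab: "Mor Ab G H = hom G H \<inter> extensional (carrier G)"
  and Idt_Ab: "Idt Ab G = (\<lambda>x \<in> carrier G. x)"
  and Cmp_Ab: "Cmp Ab G H K g f = compose (carrier G) g f"
  and zero_Ab: "zero_mor Ab G H = (\<lambda>x \<in> carrier G. \<one>\<^bsub>H\<^esub>)"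
  and mult_Ab: "f \<otimes>\<^bsub>Hom Ab G H\<^esub> g = (\<lambda>x \<in> carrier G. f x \<otimes>\<^bsub>H\<^esub> g x)"
  by (simp_all add: Ab_def)

lemma Mor_Ab_eqI:
  "\<lbrakk>f \<in> Mor Ab G H; g \<in> Mor Ab G H'; \<And>x. x \<in> carrier G \<Longrightarrow> f x = g x\<rbrakk> \<Longrightarrow> f = g"
  unfolding Mor_Ab by (blast intro: extensionalityI)

lemma functor_comm_group:
  "\<lbrakk>additive_functor C Ab F; X \<in> Obj C\<rbrakk> \<Longrightarrow> comm_group (FOb F X)"
  and functor_small:
  "\<lbrakk>additive_functor C Ab (F :: ('o, 'm, 'u monoid, 'u \<Rightarrow> 'u) cfunctor); X \<in> Obj C\<rbrakk>
    \<Longrightarrow> small TYPE('u) (carrier (FOb F X))"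
  by (simp_all add: additive_functor_def Obj_Ab)

lemma functor_group:
  "\<lbrakk>additive_functor C Ab F; X \<in> Obj C\<rbrakk> \<Longrightarrow> group (FOb F X)"
  by (rule comm_group.axioms(2)[OF functor_comm_group])

lemma functor_Mor:
  "\<lbrakk>additive_functor C Ab F; X \<in> Obj C; Y \<in> Obj C; f \<in> Mor C X Y\<rbrakk>
    \<Longrightarrow> FMor F X Y f \<in> Mor Ab (FOb F X) (FOb F Y)"
  by (rule hom_in_carrier[of "FMor F X Y" "Hom C X Y"]) (simp_all add: additive_functor_def)

lemma functor_hom:
  "\<lbrakk>additive_functor C Ab F; X \<in> Obj C; Y \<in> Obj C; f \<in> Mor C X Y\<rbrakk>
    \<Longrightarrow> FMor F X Y f \<in> hom (FOb F X) (FOb F Y)"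
  using functor_Mor[of C F X Y f] by (simp add: Mor_Ab)

lemma functor_closed:
  "\<lbrakk>additive_functor C Ab F; X \<in> Obj C; Y \<in> Obj C; f \<in> Mor C X Y; x \<in> carrier (FOb F X)\<rbrakk>
    \<Longrightarrow> FMor F X Y f x \<in> carrier (FOb F Y)"
  by (rule hom_in_carrier[OF functor_hom])

lemma functor_one:
  "\<lbrakk>additive_functor C Ab F; X \<in> Obj C; Y \<in> Obj C; f \<in> Mor C X Y\<rbrakk>
    \<Longrightarrow> FMor F X Y f \<one>\<^bsub>FOb F X\<^esub> = \<one>\<^bsub>FOb F Y\<^esub>"
  by (rule hom_one[OF functor_hom functor_group functor_group])

lemma functor_Idt:
  "\<lbrakk>additive_functor C Ab F; X \<in> Obj C; x \<in> carrier (FOb F X)\<rbrakk> \<Longrightarrow> FMor F X X (Idt C X) x = x"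
  unfolding additive_functor_def by (simp add: Idt_Ab)

lemma functor_Cmp:
  "\<lbrakk>additive_functor C Ab F; X \<in> Obj C; Y \<in> Obj C; Z \<in> Obj C; f \<in> Mor C X Y; g \<in> Mor C Y Z;
    x \<in> carrier (FOb F X)\<rbrakk>
    \<Longrightarrow> FMor F X Z (Cmp C X Y Z g f) x = FMor F Y Z g (FMor F X Y f x)"
  unfolding additive_functor_def by (simp add: Cmp_Ab compose_eq)

lemma functor_add:
  "\<lbrakk>additive_functor C Ab F; X \<in> Obj C; Y \<in> Obj C; f \<in> Mor C X Y; g \<in> Mor C X Y; x \<in> carrier (FOb F X)\<rbrakk>
    \<Longrightarrow> FMor F X Y (f \<otimes>\<^bsub>Hom C X Y\<^esub> g) x = FMor F X Y f x \<otimes>\<^bsub>FOb F Y\<^esub> FMor F X Y g x"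
  using hom_mult[of "FMor F X Y" "Hom C X Y" "Hom Ab (FOb F X) (FOb F Y)" f g]
  by (simp add: additive_functor_def mult_Ab)

lemma functor_eval_hom:
  "\<lbrakk>additive_functor C Ab F; X \<in> Obj C; Y \<in> Obj C; x \<in> carrier (FOb F X)\<rbrakk>
    \<Longrightarrow> (\<lambda>f. FMor F X Y f x) \<in> hom (Hom C X Y) (FOb F Y)"
  by (rule homI) (simp_all add: functor_closed functor_add)

text \<open>Morphisms of \<open>Ab\<close> are extensional, so each functor law has to be checked
  only on elements of the carriers.\<close>

lemma additive_functor_AbI:
  fixes F :: "('o, 'm, 'u monoid, 'u \<Rightarrow> 'u) cfunctor"
  assumes "\<And>X. X \<in> Obj C \<Longrightarrow> comm_group (FOb F X)"
    and "\<And>X. X \<in> Obj C \<Longrightarrow> small TYPE('u) (carrier (FOb F X))"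
    and M: "\<And>X Y f. \<lbrakk>X \<in> Obj C; Y \<in> Obj C; f \<in> Mor C X Y\<rbrakk> \<Longrightarrow> FMor F X Y f \<in> Mor Ab (FOb F X) (FOb F Y)"
    and I: "\<And>X x. \<lbrakk>X \<in> Obj C; x \<in> carrier (FOb F X)\<rbrakk> \<Longrightarrow> FMor F X X (Idt C X) x = x"
    and c: "\<And>X Y Z f g x. \<lbrakk>X \<in> Obj C; Y \<in> Obj C; Z \<in> Obj C; f \<in> Mor C X Y; g \<in> Mor C Y Z; x \<in> carrier (FOb F X)\<rbrakk>
      \<Longrightarrow> FMor F X Z (Cmp C X Y Z g f) x = FMor F Y Z g (FMor F X Y f x)"
    and a: "\<And>X Y f g x. \<lbrakk>X \<in> Obj C; Y \<in> Obj C; f \<in> Mor C X Y; g \<in> Mor C X Y; x \<in> carrier (FOb F X)\<rbrakk>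
      \<Longrightarrow> FMor F X Y (f \<otimes>\<^bsub>Hom C X Y\<^esub> g) x = FMor F X Y f x \<otimes>\<^bsub>FOb F Y\<^esub> FMor F X Y g x"
    and cat: "preadditive_category C"
  shows "additive_functor C Ab F"
proof -
  interpret preadditive_category C by fact
  have I': "FMor F X X (Idt C X) = Idt Ab (FOb F X)" if "X \<in> Obj C" for X
    using M[OF that that Idt_Mor[OF that]] I[OF that]
    unfolding Idt_Ab Mor_Ab by (intro extensionalityI[of _ "carrier (FOb F X)"]) auto
  have a': "FMor F X Y (f \<otimes>\<^bsub>Hom C X Y\<^esub> g) = FMor F X Y f \<otimes>\<^bsub>Hom Ab (FOb F X) (FOb F Y)\<^esub> FMor F X Y g"
    if "X \<in> Obj C" "Y \<in> Obj C" "f \<in> Mor C X Y" "g \<in> Mor C X Y" for X Y f g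
    using M[OF that(1,2) mult_Mor[OF that]] a[OF that]
    unfolding mult_Ab Mor_Ab by (intro extensionalityI[of _ "carrier (FOb F X)"]) auto
  have c': "FMor F X Z (Cmp C X Y Z g f)
        = Cmp Ab (FOb F X) (FOb F Y) (FOb F Z) (FMor F Y Z g) (FMor F X Y f)"
    if "X \<in> Obj C" "Y \<in> Obj C" "Z \<in> Obj C" "f \<in> Mor C X Y" "g \<in> Mor C Y Z" for X Y Z f g
    using M[OF that(1,3) Cmp_Mor[OF that]] c[OF that]
    unfolding Cmp_Ab Mor_Ab by (intro extensionalityI[of _ "carrier (FOb F X)"]) (auto simp: compose_eq)
  show ?thesis
    unfolding additive_functor_def hom_def[of "Hom C _ _"] Obj_Ab
    using assms(1,2) M I' a' c' by auto
qed

text \<open>Natural transformations are extensional in the object and their components are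
  extensional in the element, so a family given by a formula is cut down twice.\<close>

definition ab_nat :: "('o, 'm) category \<Rightarrow> ('o, 'm, 'u monoid, 'u \<Rightarrow> 'u) cfunctor
    \<Rightarrow> ('o \<Rightarrow> 'u \<Rightarrow> 'u) \<Rightarrow> 'o \<Rightarrow> 'u \<Rightarrow> 'u" where
  "ab_nat C F \<tau> = (\<lambda>X \<in> Obj C. \<lambda>x \<in> carrier (FOb F X). \<tau> X x)"

lemma ab_nat_apply [simp]: "\<lbrakk>X \<in> Obj C; x \<in> carrier (FOb F X)\<rbrakk> \<Longrightarrow> ab_nat C F \<tau> X x = \<tau> X x"
  by (simp add: ab_nat_def)

lemma nat_trans_Mor: "\<lbrakk>t \<in> nat_trans C Ab F G; X \<in> Obj C\<rbrakk> \<Longrightarrow> t X \<in> Mor Ab (FOb F X) (FOb G X)"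
  by (auto simp: nat_trans_def)

lemma nat_trans_hom: "\<lbrakk>t \<in> nat_trans C Ab F G; X \<in> Obj C\<rbrakk> \<Longrightarrow> t X \<in> hom (FOb F X) (FOb G X)"
  using nat_trans_Mor[of t C F G X] by (simp add: Mor_Ab)

lemma nat_trans_closed:
  "\<lbrakk>t \<in> nat_trans C Ab F G; X \<in> Obj C; x \<in> carrier (FOb F X)\<rbrakk> \<Longrightarrow> t X x \<in> carrier (FOb G X)"
  by (rule hom_in_carrier[OF nat_trans_hom])

lemma nat_trans_mult:
  "\<lbrakk>t \<in> nat_trans C Ab F G; X \<in> Obj C; x \<in> carrier (FOb F X); y \<in> carrier (FOb F X)\<rbrakk>
    \<Longrightarrow> t X (x \<otimes>\<^bsub>FOb F X\<^esub> y) = t X x \<otimes>\<^bsub>FOb G X\<^esub> t X y"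
  by (rule hom_mult[OF nat_trans_hom])

lemma nat_trans_one:
  "\<lbrakk>t \<in> nat_trans C Ab F G; additive_functor C Ab F; additive_functor C Ab G; X \<in> Obj C\<rbrakk>
    \<Longrightarrow> t X \<one>\<^bsub>FOb F X\<^esub> = \<one>\<^bsub>FOb G X\<^esub>"
  by (rule hom_one[OF nat_trans_hom functor_group functor_group])

lemma nat_trans_natural:
  "\<lbrakk>t \<in> nat_trans C Ab F G; X \<in> Obj C; Y \<in> Obj C; f \<in> Mor C X Y; x \<in> carrier (FOb F X)\<rbrakk>
    \<Longrightarrow> t Y (FMor F X Y f x) = FMor G X Y f (t X x)"
  unfolding nat_trans_def Cmp_Ab by (auto dest!: bspec simp: compose_def fun_eq_iff split: if_splits)

lemma nat_trans_eqI:
  assumes "s \<in> nat_trans C Ab F G" "t \<in> nat_trans C Ab F H"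
    "\<And>X x. \<lbrakk>X \<in> Obj C; x \<in> carrier (FOb F X)\<rbrakk> \<Longrightarrow> s X x = t X x"
  shows "s = t"
proof (rule extensionalityI[of s "Obj C"])
  show "s \<in> extensional (Obj C)" "t \<in> extensional (Obj C)"
    using assms(1,2) unfolding nat_trans_def by (auto simp: PiE_def)
  show "s X = t X" if "X \<in> Obj C" for X
    using Mor_Ab_eqI[OF nat_trans_Mor[OF assms(1) that] nat_trans_Mor[OF assms(2) that]] assms(3) that by blast
qed

lemma ab_nat_in:
  assumes h: "\<And>X. X \<in> Obj C \<Longrightarrow> \<tau> X \<in> hom (FOb F X) (FOb G X)"
    and n: "\<And>X Y f x. \<lbrakk>X \<in> Obj C; Y \<in> Obj C; f \<in> Mor C X Y; x \<in> carrier (FOb F X)\<rbrakk>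
      \<Longrightarrow> \<tau> Y (FMor F X Y f x) = FMor G X Y f (\<tau> X x)"
    and F: "additive_functor C Ab F" and G: "additive_functor C Ab G"
  shows "ab_nat C F \<tau> \<in> nat_trans C Ab F G"
proof -
  have 1: "ab_nat C F \<tau> X \<in> Mor Ab (FOb F X) (FOb G X)" if X: "X \<in> Obj C" for X
    using h[OF X] functor_group[OF F X]
    unfolding Mor_Ab ab_nat_def by (simp add: X restrict_in_hom)
  moreover have "Cmp Ab (FOb F X) (FOb F Y) (FOb G Y) (ab_nat C F \<tau> Y) (FMor F X Y f)
       = Cmp Ab (FOb F X) (FOb G X) (FOb G Y) (FMor G X Y f) (ab_nat C F \<tau> X)"
    if X: "X \<in> Obj C" "Y \<in> Obj C" "f \<in> Mor C X Y" for X Y f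
    unfolding Cmp_Ab compose_def
    using n[OF X] functor_closed[OF F X] by (auto simp: fun_eq_iff X)
  ultimately show ?thesis
    unfolding nat_trans_def by (auto simp: ab_nat_def)
qed

section \<open>Categories of group-valued functors, elementwise\<close>

lemma Obj_functor_category [simp]: "F \<in> Obj (functor_category C K) \<longleftrightarrow> additive_functor C K F"
  and Mor_functor_category [simp]: "Mor (functor_category C K) F G = nat_trans C K F G"
  by (simp_all add: functor_category_def)

lemma Idt_functor_category [simp]:
  "\<lbrakk>X \<in> Obj C; x \<in> carrier (FOb F X)\<rbrakk> \<Longrightarrow> Idt (functor_category C Ab) F X x = x"
  by (simp add: functor_category_def Idt_Ab)

lemma Cmp_functor_category [simp]:
  "\<lbrakk>X \<in> Obj C; x \<in> carrier (FOb F X)\<rbrakk> \<Longrightarrow> Cmp (functor_category C Ab) F G H t s X x = t X (s X x)"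
  by (simp add: functor_category_def Cmp_Ab compose_eq)

lemma zero_functor_category [simp]:
  "\<lbrakk>X \<in> Obj C; x \<in> carrier (FOb F X)\<rbrakk> \<Longrightarrow> zero_mor (functor_category C Ab) F G X x = \<one>\<^bsub>FOb G X\<^esub>"
  by (simp add: functor_category_def zero_Ab)

lemma Idt_nat_trans:
  assumes F: "additive_functor C Ab F"
  shows "Idt (functor_category C Ab) F \<in> nat_trans C Ab F F"
proof -
  have "Idt (functor_category C Ab) F = ab_nat C F (\<lambda>X x. x)"
    by (simp add: functor_category_def Idt_Ab ab_nat_def)
  moreover have "ab_nat C F (\<lambda>X x. x) \<in> nat_trans C Ab F F"
    by (rule ab_nat_in) (auto simp: F hom_def)
  ultimately show ?thesis by simp
qed

lemma Cmp_nat_trans: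
  assumes F: "additive_functor C Ab F" and G: "additive_functor C Ab G" and H: "additive_functor C Ab H"
    and s: "s \<in> nat_trans C Ab F G" and t: "t \<in> nat_trans C Ab G H"
  shows "Cmp (functor_category C Ab) F G H t s \<in> nat_trans C Ab F H"
proof -
  have "Cmp (functor_category C Ab) F G H t s = ab_nat C F (\<lambda>X x. t X (s X x))"
    by (simp add: functor_category_def Cmp_Ab ab_nat_def compose_def)
  moreover have "ab_nat C F (\<lambda>X x. t X (s X x)) \<in> nat_trans C Ab F H"
    by (rule ab_nat_in[OF _ _ F H], rule homI)
      (simp_all add: nat_trans_closed[OF s] nat_trans_closed[OF t] nat_trans_mult[OF s]
        nat_trans_mult[OF t] nat_trans_natural[OF s] nat_trans_natural[OF t])
  ultimately show ?thesis by simp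
qed

lemma zero_nat_trans:
  assumes F: "additive_functor C Ab F" and G: "additive_functor C Ab G"
  shows "zero_mor (functor_category C Ab) F G \<in> nat_trans C Ab F G"
proof -
  have "zero_mor (functor_category C Ab) F G = ab_nat C F (\<lambda>X x. \<one>\<^bsub>FOb G X\<^esub>)"
    by (simp add: functor_category_def zero_Ab ab_nat_def)
  moreover have "ab_nat C F (\<lambda>X x. \<one>\<^bsub>FOb G X\<^esub>) \<in> nat_trans C Ab F G"
    by (rule ab_nat_in[OF _ _ F G], rule homI)
      (simp_all add: functor_one[OF G] functor_group[OF G] group.is_monoid)
  ultimately show ?thesis by simp
qed

lemma inverse_nat_trans_iff:
  assumes F: "additive_functor C Ab F" and G: "additive_functor C Ab G"
  shows "inverse_mors (functor_category C Ab) F G s t \<longleftrightarrow>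
    s \<in> nat_trans C Ab F G \<and> t \<in> nat_trans C Ab G F \<and>
    (\<forall>X \<in> Obj C. (\<forall>x \<in> carrier (FOb F X). t X (s X x) = x) \<and> (\<forall>y \<in> carrier (FOb G X). s X (t X y) = y))"
    (is "?l \<longleftrightarrow> ?r")
proof
  assume l: ?l
  have "t X (s X x) = x" if "X \<in> Obj C" "x \<in> carrier (FOb F X)" for X x
    using l that unfolding inverse_mors_def
    by (metis Cmp_functor_category Idt_functor_category)
  moreover have "s X (t X x) = x" if "X \<in> Obj C" "x \<in> carrier (FOb G X)" for X x
    using l that unfolding inverse_mors_def
    by (metis Cmp_functor_category Idt_functor_category)
  ultimately show ?r using l unfolding inverse_mors_def by simp
next
  assume r: ?r
  then have s: "s \<in> nat_trans C Ab F G" and t: "t \<in> nat_trans C Ab G F" by blast+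
  have "Cmp (functor_category C Ab) F G F t s = Idt (functor_category C Ab) F"
    using r by (intro nat_trans_eqI[OF Cmp_nat_trans[OF F G F s t] Idt_nat_trans[OF F]]) simp
  moreover have "Cmp (functor_category C Ab) G F G s t = Idt (functor_category C Ab) G"
    using r by (intro nat_trans_eqI[OF Cmp_nat_trans[OF G F G t s] Idt_nat_trans[OF G]]) simp
  ultimately show ?l using s t unfolding inverse_mors_def by simp
qed

section \<open>Functors with a presentation\<close>

text \<open>By the Yoneda lemma, a natural epimorphism \<open>(A,-) \<rightarrow> F\<close> amounts to an element of \<open>F A\<close>; here its
  kernel is the image of \<open>(f,-)\<close>.\<close>

definition presents ::
  "('o, 'm) category \<Rightarrow> 'o \<Rightarrow> 'o \<Rightarrow> 'm \<Rightarrow> ('o, 'm, 'u monoid, 'u \<Rightarrow> 'u) cfunctor \<Rightarrow> 'u \<Rightarrow> bool" where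
  "presents C A B f F e \<longleftrightarrow> additive_functor C Ab F \<and>
     A \<in> Obj C \<and> B \<in> Obj C \<and> f \<in> Mor C A B \<and> e \<in> carrier (FOb F A) \<and>
     (\<forall>W \<in> Obj C. \<forall>z \<in> carrier (FOb F W). \<exists>x \<in> Mor C A W. z = FMor F A W x e) \<and>
     (\<forall>W \<in> Obj C. \<forall>x \<in> Mor C A W. FMor F A W x e = \<one>\<^bsub>FOb F W\<^esub> \<longleftrightarrow> factors C A B W f x)"

lemma presents_functor: "presents C A B f F e \<Longrightarrow> additive_functor C Ab F"
  and presents_Mor: "presents C A B f F e \<Longrightarrow> A \<in> Obj C" "presents C A B f F e \<Longrightarrow> B \<in> Obj C"
    "presents C A B f F e \<Longrightarrow> f \<in> Mor C A B"
  and presents_gen: "presents C A B f F e \<Longrightarrow> e \<in> carrier (FOb F A)"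
  and presents_surj: "\<lbrakk>presents C A B f F e; W \<in> Obj C; z \<in> carrier (FOb F W)\<rbrakk>
    \<Longrightarrow> \<exists>x \<in> Mor C A W. z = FMor F A W x e"
  and presents_kernel: "\<lbrakk>presents C A B f F e; W \<in> Obj C; x \<in> Mor C A W\<rbrakk>
    \<Longrightarrow> FMor F A W x e = \<one>\<^bsub>FOb F W\<^esub> \<longleftrightarrow> factors C A B W f x"
  by (simp_all add: presents_def)

context preadditive_category
begin

text \<open>The universal property of the cokernel of \<open>(f,-)\<close>, in terms of elements:
  the class of \<open>x\<close> goes to \<open>FMor H A W x e'\<close>. If two morphisms name the
  same element of \<open>F W\<close>, their difference factors through \<open>f\<close>, and
  \<open>f\<close> kills \<open>e'\<close>.\<close>

lemma presents_universal:
  assumes p: "presents C A B f F e" and H: "additive_functor C Ab H"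
    and e': "e' \<in> carrier (FOb H A)" and f: "FMor H A B f e' = \<one>\<^bsub>FOb H B\<^esub>"
  obtains t where "t \<in> nat_trans C Ab F H" "t A e = e'"
proof -
  note F = presents_functor[OF p] and m [simp] = presents_Mor[OF p] and e = presents_gen[OF p]
  define \<tau> where "\<tau> W z = FMor H A W (SOME x. x \<in> Mor C A W \<and> z = FMor F A W x e) e'" for W z
  have wd: "FMor H A W x e' = FMor H A W x' e'"
    if W: "W \<in> Obj C" and x: "x \<in> Mor C A W" "x' \<in> Mor C A W" and eq: "FMor F A W x e = FMor F A W x' e" for W x x'
  proof -
    interpret G: group "Hom C A W" using W Hom_group by simp
    interpret FW: group "FOb F W" by (rule functor_group[OF F W])
    interpret HW: group "FOb H W" by (rule functor_group[OF H W])
    interpret ef: group_hom "Hom C A W" "FOb F W" "\<lambda>f. FMor F A W f e"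
      by unfold_locales (rule functor_eval_hom[OF F _ W e], simp)
    interpret eh: group_hom "Hom C A W" "FOb H W" "\<lambda>f. FMor H A W f e'"
      by unfold_locales (rule functor_eval_hom[OF H _ W e'], simp)
    have "FMor F A W (x \<otimes>\<^bsub>Hom C A W\<^esub> inv\<^bsub>Hom C A W\<^esub> x') e = \<one>\<^bsub>FOb F W\<^esub>"
      using x eq ef.hom_closed[OF x(2)] by simp
    then obtain y where y: "y \<in> Mor C B W" "x \<otimes>\<^bsub>Hom C A W\<^esub> inv\<^bsub>Hom C A W\<^esub> x' = Cmp C A B W y f"
      using presents_kernel[OF p W] x G.m_closed G.inv_closed unfolding factors_def by metis
    then have "FMor H A W (x \<otimes>\<^bsub>Hom C A W\<^esub> inv\<^bsub>Hom C A W\<^esub> x') e' = \<one>\<^bsub>FOb H W\<^esub>"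
      using W f e' H by (simp add: functor_Cmp functor_one)
    then have "FMor H A W x e' \<otimes>\<^bsub>FOb H W\<^esub> inv\<^bsub>FOb H W\<^esub> FMor H A W x' e' = \<one>\<^bsub>FOb H W\<^esub>"
      using x by simp
    then show ?thesis using x eh.hom_closed HW.mult_inv_eq_one_iff by metis
  qed
  have \<tau>: "\<tau> W (FMor F A W x e) = FMor H A W x e'" if W: "W \<in> Obj C" and x: "x \<in> Mor C A W" for W x
  proof -
    have "\<exists>x'. x' \<in> Mor C A W \<and> FMor F A W x e = FMor F A W x' e" using x by blast
    note x' = someI_ex[OF this]
    show ?thesis unfolding \<tau>_def
      by (rule wd[OF W x conjunct1[OF x'] conjunct2[OF x'], symmetric])
  qed
  have "ab_nat C F \<tau> \<in> nat_trans C Ab F H"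
  proof (rule ab_nat_in[OF _ _ F H])
    fix X assume X: "X \<in> Obj C"
    show "\<tau> X \<in> hom (FOb F X) (FOb H X)"
    proof (rule homI)
      fix z assume "z \<in> carrier (FOb F X)"
      then obtain x where "x \<in> Mor C A X" "z = FMor F A X x e" using presents_surj[OF p X] by blast
      then show "\<tau> X z \<in> carrier (FOb H X)" using \<tau>[OF X] functor_closed[OF H _ X _ e'] by simp
    next
      fix z z' assume "z \<in> carrier (FOb F X)" "z' \<in> carrier (FOb F X)"
      then obtain x x' where x: "x \<in> Mor C A X" "z = FMor F A X x e" "x' \<in> Mor C A X" "z' = FMor F A X x' e"
        using presents_surj[OF p X] by metis
      have "z \<otimes>\<^bsub>FOb F X\<^esub> z' = FMor F A X (x \<otimes>\<^bsub>Hom C A X\<^esub> x') e"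
        using functor_add[OF F _ X] x e by simp
      then show "\<tau> X (z \<otimes>\<^bsub>FOb F X\<^esub> z') = \<tau> X z \<otimes>\<^bsub>FOb H X\<^esub> \<tau> X z'"
        using functor_add[OF H _ X] x e' \<tau>[OF X] mult_Mor[OF _ X] by simp
    qed
  next
    fix X Y g z assume X: "X \<in> Obj C" and Y: "Y \<in> Obj C" and g: "g \<in> Mor C X Y" and "z \<in> carrier (FOb F X)"
    then obtain x where x: "x \<in> Mor C A X" "z = FMor F A X x e" using presents_surj[OF p X] by blast
    then have "FMor F X Y g z = FMor F A Y (Cmp C A X Y g x) e"
      using functor_Cmp[OF F _ X Y _ g e] by simp
    then show "\<tau> Y (FMor F X Y g z) = FMor H X Y g (\<tau> X z)"
      using functor_Cmp[OF H _ X Y _ g e'] x \<tau>[OF X] \<tau>[OF Y] Cmp_Mor[OF _ X Y _ g] by simp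
  qed
  moreover have "ab_nat C F \<tau> A e = e'"
    using \<tau>[of A "Idt C A"] e e' functor_Idt[OF F] functor_Idt[OF H] Idt_Mor by simp
  ultimately show thesis using that by blast
qed

lemma presents_nat_trans_apply:
  assumes p: "presents C A B f F e" and t: "t \<in> nat_trans C Ab F H" and "W \<in> Obj C" "x \<in> Mor C A W"
  shows "t W (FMor F A W x e) = FMor H A W x (t A e)"
  using nat_trans_natural[OF t] presents_Mor[OF p] presents_gen[OF p] assms by blast

lemma presents_nat_trans_eqI:
  assumes p: "presents C A B f F e"
    and s: "s \<in> nat_trans C Ab F H" and t: "t \<in> nat_trans C Ab F H" and eq: "s A e = t A e"
  shows "s = t"
  by (rule nat_trans_eqI[OF s t])
    (metis presents_surj[OF p] presents_nat_trans_apply[OF p s] presents_nat_trans_apply[OF p t] eq)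

text \<open>\<open>f\<close> factors through itself and so kills either generator; hence there are
  transformations exchanging the two generators. Their composites fix the generators and therefore
  every element.\<close>

lemma presents_unique:
  assumes p: "presents C A B f F e" and q: "presents C A B f G e'"
  shows "isomorphic (functor_category C Ab) F G"
proof -
  note F = presents_functor[OF p] and G = presents_functor[OF q] and m = presents_Mor[OF p]
  have k: "factors C A B B f f"
    using m unfolding factors_def by (metis Cmp_Idt_left Idt_Mor)
  obtain s where s: "s \<in> nat_trans C Ab F G" "s A e = e'"
    using presents_universal[OF p G presents_gen[OF q]] presents_kernel[OF q] k m by metis
  obtain t where t: "t \<in> nat_trans C Ab G F" "t A e' = e"
    using presents_universal[OF q F presents_gen[OF p]] presents_kernel[OF p] k m by metis
  have "t X (s X x) = x" if "X \<in> Obj C" "x \<in> carrier (FOb F X)" for X x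
    using presents_surj[OF p that] presents_nat_trans_apply[OF p s(1)] presents_nat_trans_apply[OF q t(1)]
      s(2) t(2) that by metis
  moreover have "s X (t X x) = x" if "X \<in> Obj C" "x \<in> carrier (FOb G X)" for X x
    using presents_surj[OF q that] presents_nat_trans_apply[OF p s(1)] presents_nat_trans_apply[OF q t(1)]
      s(2) t(2) that by metis
  ultimately have "inverse_mors (functor_category C Ab) F G s t"
    using s t by (simp add: inverse_nat_trans_iff[OF F G])
  then show ?thesis unfolding isomorphic_def iso_mor_def by blast
qed

text \<open>Serves functors that are fixed only up to isomorphism by a choice, such as
  \<open>day_tensor\<close>.\<close>

lemma presents_isomorphic:
  assumes p: "presents C A B f F e" and iso: "isomorphic (functor_category C Ab) F G"
    and G: "additive_functor C Ab G"
  obtains e' where "presents C A B f G e'"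
proof -
  note F = presents_functor[OF p] and m = presents_Mor[OF p] and e = presents_gen[OF p]
  obtain s t where "inverse_mors (functor_category C Ab) F G s t"
    using iso unfolding isomorphic_def iso_mor_def by blast
  then have s: "s \<in> nat_trans C Ab F G" and t: "t \<in> nat_trans C Ab G F"
    and ts: "\<And>X x. X \<in> Obj C \<Longrightarrow> x \<in> carrier (FOb F X) \<Longrightarrow> t X (s X x) = x"
    and st: "\<And>X x. X \<in> Obj C \<Longrightarrow> x \<in> carrier (FOb G X) \<Longrightarrow> s X (t X x) = x"
    unfolding inverse_nat_trans_iff[OF F G] by auto
  have "presents C A B f G (s A e)"
    unfolding presents_def
  proof (intro conjI ballI)
    fix W z assume W: "W \<in> Obj C" and z: "z \<in> carrier (FOb G W)"
    obtain x where x: "x \<in> Mor C A W" "t W z = FMor F A W x e"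
      using presents_surj[OF p W nat_trans_closed[OF t W z]] by blast
    then show "\<exists>x\<in>Mor C A W. z = FMor G A W x (s A e)"
      using st[OF W z] presents_nat_trans_apply[OF p s W] by metis
  next
    fix W x assume W: "W \<in> Obj C" and x: "x \<in> Mor C A W"
    have "FMor G A W x (s A e) = \<one>\<^bsub>FOb G W\<^esub> \<longleftrightarrow> s W (FMor F A W x e) = s W \<one>\<^bsub>FOb F W\<^esub>"
      using presents_nat_trans_apply[OF p s W x] nat_trans_one[OF s F G W] by simp
    also have "\<dots> \<longleftrightarrow> FMor F A W x e = \<one>\<^bsub>FOb F W\<^esub>"
      using ts[OF W] functor_closed[OF F m(1) W x e] functor_group[OF F W] group.is_monoid monoid.one_closed by metis
    finally show "FMor G A W x (s A e) = \<one>\<^bsub>FOb G W\<^esub> \<longleftrightarrow> factors C A B W f x"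
      using presents_kernel[OF p W x] by simp
  qed (use G m nat_trans_closed[OF s m(1) e] in auto)
  then show thesis by (rule that)
qed

end

text \<open>The cokernel of \<open>(f,-)\<close>, formed pointwise. Its elements at \<open>W\<close>
  are chosen representatives, again morphisms from \<open>A\<close> to \<open>W\<close>, which keeps
  them in \<open>'u\<close>. Objects enter only through homs and composition, so the same functor
  serves \<open>C\<close> and \<open>fp_category C\<close>.\<close>

definition Cok :: "('o, 'u) category \<Rightarrow> 'o \<Rightarrow> 'o \<Rightarrow> 'u \<Rightarrow> ('o, 'u) abfunctor" where
  "Cok C A B f = \<lparr>
     FOb = (\<lambda>W. recode_group (Hom C A W) (coset_rep (Hom C A W) {x. factors C A B W f x})),
     FMor = (\<lambda>W V w. \<lambda>z \<in> coset_rep (Hom C A W) {x. factors C A B W f x} ` Mor C A W.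
       coset_rep (Hom C A V) {x. factors C A B V f x} (Cmp C A W V w z))\<rparr>"

locale small_preadditive_category = preadditive_category C
  for C :: "('o, 'u) category" +
  assumes small_Mor: "\<lbrakk>X \<in> Obj C; Y \<in> Obj C\<rbrakk> \<Longrightarrow> small TYPE('u) (Mor C X Y)"
begin

lemma Cok_presents:
  assumes m: "A \<in> Obj C" "B \<in> Obj C" "f \<in> Mor C A B"
  obtains e where "presents C A B f (Cok C A B f) e"
proof -
  define \<rho> where "\<rho> W = coset_rep (Hom C A W) {x. factors C A B W f x}" for W
  let ?F = "Cok C A B f"
  have FOb: "FOb ?F W = recode_group (Hom C A W) (\<rho> W)" for W by (simp add: Cok_def \<rho>_def)
  have FMor: "FMor ?F W V w = (\<lambda>z \<in> \<rho> W ` Mor C A W. \<rho> V (Cmp C A W V w z))" for W V w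
    by (simp add: Cok_def \<rho>_def)
  have \<rho>_Mor: "\<rho> W x \<in> Mor C A W" and \<rho>_class: "factors C A B W f (x \<otimes>\<^bsub>Hom C A W\<^esub> inv\<^bsub>Hom C A W\<^esub> \<rho> W x)"
    and \<rho>_eq: "y \<in> Mor C A W \<Longrightarrow> \<rho> W x = \<rho> W y \<longleftrightarrow> factors C A B W f (x \<otimes>\<^bsub>Hom C A W\<^esub> inv\<^bsub>Hom C A W\<^esub> y)"
    if "W \<in> Obj C" "x \<in> Mor C A W" for W x y
    using group.coset_rep[OF Hom_group[OF m(1) that(1)] factors_subgroup[OF m(1,2) that(1) m(3)] that(2)]
    unfolding \<rho>_def by auto
  have hom: "\<rho> W \<in> hom (Hom C A W) (FOb ?F W)" and cg: "comm_group (FOb ?F W)" if W: "W \<in> Obj C" for W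
    using recode_group_hom[OF Hom_group[OF m(1) W] _ factors_subgroup[OF m(1,2) W m(3)] Hom_comm_group[OF m(1) W],
        of "\<rho> W"] \<rho>_eq[OF W] unfolding FOb by auto
  \<comment> \<open>A morphism and its representative differ by one that factors through
    \<open>f\<close>, and composition with \<open>w\<close> preserves this; so the action on
    representatives is well defined.\<close>
  have \<rho>_Cmp: "\<rho> V (Cmp C A W V w (\<rho> W x)) = \<rho> V (Cmp C A W V w x)"
    if W: "W \<in> Obj C" "V \<in> Obj C" "w \<in> Mor C W V" "x \<in> Mor C A W" for W V w x
  proof -
    have "factors C A B V f (Cmp C A W V w (x \<otimes>\<^bsub>Hom C A W\<^esub> inv\<^bsub>Hom C A W\<^esub> \<rho> W x))"
      using factors_Cmp[OF m(1,2) W(1,2) m(3) W(3) \<rho>_class[OF W(1,4)]] .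
    also have "Cmp C A W V w (x \<otimes>\<^bsub>Hom C A W\<^esub> inv\<^bsub>Hom C A W\<^esub> \<rho> W x)
      = Cmp C A W V w x \<otimes>\<^bsub>Hom C A V\<^esub> inv\<^bsub>Hom C A V\<^esub> Cmp C A W V w (\<rho> W x)"
      using m W \<rho>_Mor[OF W(1,4)] inv_Mor by (simp add: Cmp_add_right Cmp_inv_right)
    finally show ?thesis
      using \<rho>_eq[OF W(2)] Cmp_Mor m W \<rho>_Mor by metis
  qed
  have FMor_\<rho>: "FMor ?F W V w (\<rho> W x) = \<rho> V (Cmp C A W V w x)"
    if "W \<in> Obj C" "V \<in> Obj C" "w \<in> Mor C W V" "x \<in> Mor C A W" for W V w x
    using \<rho>_Cmp[OF that] that by (simp add: FMor)
  have carr: "carrier (FOb ?F W) = \<rho> W ` Mor C A W" for W by (simp add: FOb)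
  have mult: "\<rho> W x \<otimes>\<^bsub>FOb ?F W\<^esub> \<rho> W y = \<rho> W (x \<otimes>\<^bsub>Hom C A W\<^esub> y)"
    if "W \<in> Obj C" "x \<in> Mor C A W" "y \<in> Mor C A W" for W x y
    using hom_mult[OF hom] that by simp
  have func: "additive_functor C Ab ?F"
  proof (rule additive_functor_AbI[OF cg])
    show "small TYPE('u) (carrier (FOb ?F X))" if "X \<in> Obj C" for X
      unfolding carr by (intro small_image small_Mor m that)
    show "FMor ?F X Y g \<in> Mor Ab (FOb ?F X) (FOb ?F Y)"
      if X: "X \<in> Obj C" "Y \<in> Obj C" "g \<in> Mor C X Y" for X Y g
      unfolding Mor_Ab
    proof (intro IntI homI)
      show "FMor ?F X Y g \<in> extensional (carrier (FOb ?F X))" by (simp add: FMor carr)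
      show "FMor ?F X Y g z \<in> carrier (FOb ?F Y)" if "z \<in> carrier (FOb ?F X)" for z
        using that X m unfolding carr by (auto simp: FMor_\<rho> intro: Cmp_Mor)
      show "FMor ?F X Y g (z \<otimes>\<^bsub>FOb ?F X\<^esub> z') = FMor ?F X Y g z \<otimes>\<^bsub>FOb ?F Y\<^esub> FMor ?F X Y g z'"
        if "z \<in> carrier (FOb ?F X)" "z' \<in> carrier (FOb ?F X)" for z z'
        using that X m unfolding carr
        by (auto simp: FMor_\<rho> mult Cmp_Mor mult_Mor Cmp_add_right)
    qed
    show "FMor ?F X X (Idt C X) x = x" if "X \<in> Obj C" "x \<in> carrier (FOb ?F X)" for X x
      using that m unfolding carr by (auto simp: FMor_\<rho> Idt_Mor Cmp_Idt_left)
    show "FMor ?F X Z (Cmp C X Y Z h g) x = FMor ?F Y Z h (FMor ?F X Y g x)"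
      if "X \<in> Obj C" "Y \<in> Obj C" "Z \<in> Obj C" "g \<in> Mor C X Y" "h \<in> Mor C Y Z" "x \<in> carrier (FOb ?F X)"
      for X Y Z g h x
      using that m unfolding carr by (auto simp: FMor_\<rho> Cmp_Mor Cmp_assoc)
    show "FMor ?F X Y (g \<otimes>\<^bsub>Hom C X Y\<^esub> h) x = FMor ?F X Y g x \<otimes>\<^bsub>FOb ?F Y\<^esub> FMor ?F X Y h x"
      if "X \<in> Obj C" "Y \<in> Obj C" "g \<in> Mor C X Y" "h \<in> Mor C X Y" "x \<in> carrier (FOb ?F X)" for X Y g h x
      using that m unfolding carr by (auto simp: FMor_\<rho> Cmp_Mor mult_Mor mult Cmp_add_left)
  qed (simp_all add: preadditive_category_axioms)
  have ker: "\<rho> W x = \<one>\<^bsub>FOb ?F W\<^esub> \<longleftrightarrow> factors C A B W f x" if "W \<in> Obj C" "x \<in> Mor C A W" for W x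
  proof -
    have "\<one>\<^bsub>FOb ?F W\<^esub> = \<rho> W (zero_mor C A W)" by (simp add: FOb)
    moreover have "x \<otimes>\<^bsub>Hom C A W\<^esub> inv\<^bsub>Hom C A W\<^esub> zero_mor C A W = x"
      using Hom_group[OF m(1) that(1)] that(2) by (simp add: group.is_monoid monoid.inv_one monoid.r_one)
    ultimately show ?thesis using \<rho>_eq[OF that] m that zero_Mor by simp
  qed
  \<comment> \<open>As for a representable functor, the class of the identity generates.\<close>
  have "presents C A B f ?F (\<rho> A (Idt C A))"
    unfolding presents_def
    using m func ker Idt_Mor[OF m(1)] by (auto simp: carr FMor_\<rho> Cmp_Idt_right)
  then show thesis by (rule that)
qed

lemma representable_functor:
  assumes A: "A \<in> Obj C"
  shows "additive_functor C Ab (representable C A)"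
proof (rule additive_functor_AbI)
  show "FMor (representable C A) X Y f \<in> Mor Ab (FOb (representable C A) X) (FOb (representable C A) Y)"
    if "X \<in> Obj C" "Y \<in> Obj C" "f \<in> Mor C X Y" for X Y f
    using Cmp_hom_right[OF A that] Hom_group[OF A that(1)]
    by (simp add: representable_def Mor_Ab restrict_in_hom)
qed (use A in \<open>auto simp: representable_def Hom_comm_group small_Mor Cmp_Idt_left Cmp_Mor Cmp_assoc Cmp_add_left
      intro: preadditive_category_axioms\<close>)

lemma FOb_representable [simp]: "FOb (representable C A) X = Hom C A X"
  and FMor_representable [simp]: "h \<in> Mor C A X \<Longrightarrow> FMor (representable C A) X Y f h = Cmp C A X Y f h"
  by (simp_all add: representable_def)

lemma presents_nat_trans_Yoneda:
  assumes F: "additive_functor C Ab F" and A: "A \<in> Obj C" and e: "e \<in> carrier (FOb F A)"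
  shows "ab_nat C (representable C A) (\<lambda>W x. FMor F A W x e) \<in> nat_trans C Ab (representable C A) F"
  by (rule ab_nat_in[OF _ _ representable_functor[OF A] F])
    (use functor_eval_hom[OF F A _ e] functor_Cmp[OF F A _ _ _ _ e] in auto)

text \<open>Leads from a presentation back to the form in which \<open>fp_functors\<close> is
  defined. By the Yoneda lemma a transformation out of \<open>(A,-)\<close> is an element, so
  \<open>presents_universal\<close> supplies the factorization.\<close>

lemma presents_is_cokernel:
  assumes p: "presents C A B f F e"
  defines "s \<equiv> ab_nat C (representable C B) (\<lambda>W y. Cmp C A B W y f)"
    and "q \<equiv> ab_nat C (representable C A) (\<lambda>W x. FMor F A W x e)"
  shows "s \<in> nat_trans C Ab (representable C B) (representable C A)"
    and "is_cokernel (functor_category C Ab) (representable C B) (representable C A) F s q"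
proof -
  note F = presents_functor[OF p] and m = presents_Mor[OF p] and e = presents_gen[OF p]
  note rA = representable_functor[OF m(1)] and rB = representable_functor[OF m(2)]
  show s: "s \<in> nat_trans C Ab (representable C B) (representable C A)"
    unfolding s_def
    by (rule ab_nat_in[OF _ _ rB rA])
      (use m Cmp_hom_left in \<open>auto simp: Cmp_Mor Cmp_assoc\<close>)
  have q: "q \<in> nat_trans C Ab (representable C A) F"
    unfolding q_def using presents_nat_trans_Yoneda[OF F m(1) e] .
  show "is_cokernel (functor_category C Ab) (representable C B) (representable C A) F s q"
    unfolding is_cokernel_def
  proof (intro conjI ballI impI)
    show "Cmp (functor_category C Ab) (representable C B) (representable C A) F q s
      = zero_mor (functor_category C Ab) (representable C B) F"
    proof (rule nat_trans_eqI[OF Cmp_nat_trans[OF rB rA F s q] zero_nat_trans[OF rB F]])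
      fix X x assume "X \<in> Obj C" "x \<in> carrier (FOb (representable C B) X)"
      then show "Cmp (functor_category C Ab) (representable C B) (representable C A) F q s X x
        = zero_mor (functor_category C Ab) (representable C B) F X x"
        using m presents_kernel[OF p] by (auto simp: q_def s_def Cmp_Mor factors_def)
    qed
  next
    fix H h assume H: "H \<in> Obj (functor_category C Ab)"
      and h: "h \<in> Mor (functor_category C Ab) (representable C A) H"
      and hs: "Cmp (functor_category C Ab) (representable C B) (representable C A) H h s
        = zero_mor (functor_category C Ab) (representable C B) H"
    from H h have H: "additive_functor C Ab H" and h: "h \<in> nat_trans C Ab (representable C A) H" by auto
    let ?e' = "h A (Idt C A)"
    have e': "?e' \<in> carrier (FOb H A)" using nat_trans_closed[OF h m(1)] m Idt_Mor by simp
    have h_eq: "h W x = FMor H A W x ?e'" if "W \<in> Obj C" "x \<in> Mor C A W" for W x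
      using nat_trans_natural[OF h m(1) that, of "Idt C A"] m that Idt_Mor by (simp add: Cmp_Idt_right)
    have "h B f = Cmp (functor_category C Ab) (representable C B) (representable C A) H h s B (Idt C B)"
      using m Idt_Mor by (simp add: s_def Cmp_Idt_left)
    then have "FMor H A B f ?e' = \<one>\<^bsub>FOb H B\<^esub>"
      unfolding hs h_eq[OF m(2,3), symmetric] using m Idt_Mor by simp
    then obtain t where t: "t \<in> nat_trans C Ab F H" "t A e = ?e'"
      using presents_universal[OF p H e'] by blast
    have tq: "Cmp (functor_category C Ab) (representable C A) F H t q = h"
    proof (rule nat_trans_eqI[OF Cmp_nat_trans[OF rA F H q t(1)] h])
      fix X x assume "X \<in> Obj C" "x \<in> carrier (FOb (representable C A) X)"
      then show "Cmp (functor_category C Ab) (representable C A) F H t q X x = h X x"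
        using presents_nat_trans_apply[OF p t(1)] t(2) h_eq[of X x] by (simp add: q_def)
    qed
    show "\<exists>!l. l \<in> Mor (functor_category C Ab) F H \<and>
      Cmp (functor_category C Ab) (representable C A) F H l q = h"
    proof (rule ex1I[of _ t])
      show "t \<in> Mor (functor_category C Ab) F H \<and> Cmp (functor_category C Ab) (representable C A) F H t q = h"
        using t tq by simp
    next
      fix l assume l: "l \<in> Mor (functor_category C Ab) F H \<and>
        Cmp (functor_category C Ab) (representable C A) F H l q = h"
      have "Cmp (functor_category C Ab) (representable C A) F H l q A (Idt C A) = l A e" for l
        using m Idt_Mor functor_Idt[OF F m(1) e] by (simp add: q_def)
      then show "l = t"
        using presents_nat_trans_eqI[OF p] l t tq by (metis Mor_functor_category)
    qed
  qed (use F q in simp_all)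
qed

text \<open>A universal property says nothing about values, so \<open>F\<close> is compared with the
  pointwise cokernel. The transformation \<open>t\<close> from \<open>Cok C A B f\<close> to
  \<open>F\<close> and the transformation \<open>l\<close> back match the two generators, and
  \<open>t\<close> after \<open>l\<close> is the identity because \<open>q\<close> is an
  epimorphism. Surjectivity and kernel are then read off from \<open>Cok\<close>.\<close>

lemma cokernel_presents:
  assumes m: "A \<in> Obj C" "B \<in> Obj C"
    and s: "s \<in> nat_trans C Ab (representable C B) (representable C A)"
    and cok: "is_cokernel (functor_category C Ab) (representable C B) (representable C A) F s q"
  shows "presents C A B (s B (Idt C B)) F (q A (Idt C A))"
proof -
  let ?K = "functor_category C Ab"
  note rA = representable_functor[OF m(1)] and rB = representable_functor[OF m(2)]
  from cok have F: "additive_functor C Ab F" and q: "q \<in> nat_trans C Ab (representable C A) F"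
    and qs: "Cmp ?K (representable C B) (representable C A) F q s = zero_mor ?K (representable C B) F"
    and univ: "\<And>H h. additive_functor C Ab H \<Longrightarrow> h \<in> nat_trans C Ab (representable C A) H \<Longrightarrow>
      Cmp ?K (representable C B) (representable C A) H h s = zero_mor ?K (representable C B) H \<Longrightarrow>
      \<exists>!l. l \<in> nat_trans C Ab F H \<and> Cmp ?K (representable C A) F H l q = h"
    unfolding is_cokernel_def by auto
  define f where "f = s B (Idt C B)"
  define e where "e = q A (Idt C A)"
  have f: "f \<in> Mor C A B" unfolding f_def using nat_trans_closed[OF s m(2)] m Idt_Mor by simp
  have e: "e \<in> carrier (FOb F A)" unfolding e_def using nat_trans_closed[OF q m(1)] m Idt_Mor by simp
  have s_eq: "s W y = Cmp C A B W y f" if "W \<in> Obj C" "y \<in> Mor C B W" for W y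
    using nat_trans_natural[OF s m(2) that, of "Idt C B"] m that Idt_Mor f
    by (simp add: Cmp_Idt_right f_def)
  have q_eq: "q W x = FMor F A W x e" if "W \<in> Obj C" "x \<in> Mor C A W" for W x
    using nat_trans_natural[OF q m(1) that, of "Idt C A"] m that Idt_Mor by (simp add: Cmp_Idt_right e_def)
  have "FMor F A B f e = Cmp ?K (representable C B) (representable C A) F q s B (Idt C B)"
    using m Idt_Mor f q_eq s_eq by (simp add: Cmp_Idt_left)
  then have fe: "FMor F A B f e = \<one>\<^bsub>FOb F B\<^esub>" using qs m Idt_Mor by simp
  obtain e0 where p: "presents C A B f (Cok C A B f) e0"
    using Cok_presents[OF m f] by blast
  let ?Q = "Cok C A B f"
  note Q = presents_functor[OF p] and e0 = presents_gen[OF p]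
  obtain t where t: "t \<in> nat_trans C Ab ?Q F" "t A e0 = e"
    using presents_universal[OF p F e fe] by blast
  define q' where "q' = ab_nat C (representable C A) (\<lambda>W x. FMor ?Q A W x e0)"
  have q': "q' \<in> nat_trans C Ab (representable C A) ?Q"
    unfolding q'_def using presents_nat_trans_Yoneda[OF Q m(1) e0] .
  have "Cmp ?K (representable C B) (representable C A) ?Q q' s = zero_mor ?K (representable C B) ?Q"
  proof (rule nat_trans_eqI[OF Cmp_nat_trans[OF rB rA Q s q'] zero_nat_trans[OF rB Q]])
    fix X x assume "X \<in> Obj C" "x \<in> carrier (FOb (representable C B) X)"
    then show "Cmp ?K (representable C B) (representable C A) ?Q q' s X x = zero_mor ?K (representable C B) ?Q X x"
      using m f presents_kernel[OF p] s_eq by (auto simp: q'_def Cmp_Mor factors_def)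
  qed
  from univ[OF Q q' this] obtain l where l: "l \<in> nat_trans C Ab F ?Q"
    and lq: "Cmp ?K (representable C A) F ?Q l q = q'" by blast
  have le: "l A e = e0"
  proof -
    have "l A e = Cmp ?K (representable C A) F ?Q l q A (Idt C A)"
      using m Idt_Mor by (simp add: e_def)
    then show ?thesis using lq m Idt_Mor functor_Idt[OF Q m(1) e0] by (simp add: q'_def)
  qed
  have tl: "t W (l W z) = z" if W: "W \<in> Obj C" and z: "z \<in> carrier (FOb F W)" for W z
  proof -
    have "Cmp ?K (representable C A) F F (Cmp ?K F ?Q F t l) q = q"
    proof (rule nat_trans_eqI[OF Cmp_nat_trans[OF rA F F q Cmp_nat_trans[OF F Q F l t(1)]] q])
      fix X x assume X: "X \<in> Obj C" "x \<in> carrier (FOb (representable C A) X)"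
      then have "t X (l X (FMor F A X x e)) = FMor F A X x e"
        using nat_trans_natural[OF l m(1) X(1) _ e] nat_trans_natural[OF t(1) m(1) X(1) _ e0] le t(2) by simp
      then show "Cmp ?K (representable C A) F F (Cmp ?K F ?Q F t l) q X x = q X x"
        using X q_eq nat_trans_closed[OF q] by simp
    qed
    moreover have "Cmp ?K (representable C A) F F (Idt ?K F) q = q"
    proof (rule nat_trans_eqI[OF Cmp_nat_trans[OF rA F F q Idt_nat_trans[OF F]] q])
      fix X x assume X: "X \<in> Obj C" "x \<in> carrier (FOb (representable C A) X)"
      then show "Cmp ?K (representable C A) F F (Idt ?K F) q X x = q X x"
        using nat_trans_closed[OF q] by simp
    qed
    moreover have "Cmp ?K (representable C B) (representable C A) F q s = zero_mor ?K (representable C B) F"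
      by (rule qs)
    ultimately have "Cmp ?K F ?Q F t l = Idt ?K F"
      using univ[OF F q qs] Cmp_nat_trans[OF F Q F l t(1)] Idt_nat_trans[OF F] by blast
    then have "Cmp ?K F ?Q F t l W z = z" using W z by simp
    then show ?thesis using W z by simp
  qed
  have "presents C A B f F e"
    unfolding presents_def
  proof (intro conjI ballI)
    fix W z assume W: "W \<in> Obj C" and z: "z \<in> carrier (FOb F W)"
    obtain x where x: "x \<in> Mor C A W" "l W z = FMor ?Q A W x e0"
      using presents_surj[OF p W nat_trans_closed[OF l W z]] by blast
    then show "\<exists>x\<in>Mor C A W. z = FMor F A W x e"
      using tl[OF W z] presents_nat_trans_apply[OF p t(1) W] t(2) by metis
  next
    fix W x assume W: "W \<in> Obj C" and x: "x \<in> Mor C A W"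
    have "FMor ?Q A W x e0 = l W (FMor F A W x e)"
      using nat_trans_natural[OF l m(1) W x e] le by simp
    moreover have "FMor F A W x e = t W (FMor ?Q A W x e0)"
      using presents_nat_trans_apply[OF p t(1) W x] t(2) by simp
    ultimately have "FMor F A W x e = \<one>\<^bsub>FOb F W\<^esub> \<longleftrightarrow> FMor ?Q A W x e0 = \<one>\<^bsub>FOb ?Q W\<^esub>"
      using nat_trans_one[OF l F Q W] nat_trans_one[OF t(1) Q F W] by metis
    then show "FMor F A W x e = \<one>\<^bsub>FOb F W\<^esub> \<longleftrightarrow> factors C A B W f x"
      using presents_kernel[OF p W x] by simp
  qed (use F m f e in auto)
  then show ?thesis unfolding f_def e_def .
qed

end

section \<open>Direct limits of abelian groups\<close>

lemma directed_posetD: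
  assumes "directed_poset I r"
  shows "I \<noteq> {}" "\<And>i. i \<in> I \<Longrightarrow> (i, i) \<in> r" "\<And>i j k. \<lbrakk>(i, j) \<in> r; (j, k) \<in> r\<rbrakk> \<Longrightarrow> (i, k) \<in> r"
    "\<And>i j. (i, j) \<in> r \<Longrightarrow> i \<in> I \<and> j \<in> I"
    "\<And>i j. \<lbrakk>i \<in> I; j \<in> I\<rbrakk> \<Longrightarrow> \<exists>k\<in>I. (i, k) \<in> r \<and> (j, k) \<in> r"
  using assms partial_order_onD[of I r] unfolding directed_poset_def refl_on_def trans_def by blast+

lemma directed_systemD:
  assumes "directed_system C I r D d"
  shows "directed_poset I r" "\<And>i. i \<in> I \<Longrightarrow> D i \<in> Obj C"
    "\<And>i j. (i, j) \<in> r \<Longrightarrow> d i j \<in> Mor C (D i) (D j)"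
    "\<And>i. i \<in> I \<Longrightarrow> d i i = Idt C (D i)"
    "\<And>i j k. \<lbrakk>(i, j) \<in> r; (j, k) \<in> r\<rbrakk> \<Longrightarrow> d i k = Cmp C (D i) (D j) (D k) (d j k) (d i j)"
  using assms unfolding directed_system_def by auto

lemma is_direct_limitD:
  assumes "is_direct_limit C I r D d X c"
  shows "directed_system C I r D d" "X \<in> Obj C" "\<And>i. i \<in> I \<Longrightarrow> c i \<in> Mor C (D i) X"
    "\<And>i j. (i, j) \<in> r \<Longrightarrow> Cmp C (D i) (D j) X (c j) (d i j) = c i"
    "is_cocone C I r D d X c"
  using assms unfolding is_direct_limit_def is_cocone_def by auto

lemma direct_limit_universal:
  assumes "is_direct_limit C I r D d X c" "is_cocone C I r D d Y b"
  obtains f where "f \<in> Mor C X Y" "\<And>i. i \<in> I \<Longrightarrow> Cmp C (D i) X Y f (c i) = b i"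
  using assms unfolding is_direct_limit_def by blast

lemma direct_limit_unique:
  assumes "is_direct_limit C I r D d X c" "is_cocone C I r D d Y b"
    and "f \<in> Mor C X Y" "\<And>i. i \<in> I \<Longrightarrow> Cmp C (D i) X Y f (c i) = b i"
    and "g \<in> Mor C X Y" "\<And>i. i \<in> I \<Longrightarrow> Cmp C (D i) X Y g (c i) = b i"
  shows "f = g"
  using assms unfolding is_direct_limit_def by blast

text \<open>By directedness the elements coming from some stage form a subgroup. The limit cocone
  lands in it, and the induced map from \<open>L\<close> into this subgroup must be the identity by
  uniqueness, so the subgroup is everything.\<close>

lemma Ab_direct_limit_surj:
  fixes L :: "'u monoid"
  assumes lim: "is_direct_limit Ab I r G g L c" and x: "x \<in> carrier L"
  obtains i y where "i \<in> I" "y \<in> carrier (G i)" "x = c i y"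
proof -
  note sys = is_direct_limitD(1)[OF lim] and cocone = is_direct_limitD(5)[OF lim]
  note dir = directed_posetD[OF directed_systemD(1)[OF sys]]
  have L: "comm_group L" "small TYPE('u) (carrier L)" using is_direct_limitD(2)[OF lim] by (auto simp: Obj_Ab)
  interpret L: comm_group L by (rule L(1))
  have G: "comm_group (G i)" if "i \<in> I" for i using directed_systemD(2)[OF sys that] by (simp add: Obj_Ab)
  have c: "c i \<in> hom (G i) L" "c i \<in> extensional (carrier (G i))" if "i \<in> I" for i
    using is_direct_limitD(3)[OF lim that] by (auto simp: Mor_Ab)
  have g: "g i j \<in> hom (G i) (G j)" if "(i, j) \<in> r" for i j
    using directed_systemD(3)[OF sys that] by (simp add: Mor_Ab)
  have cg: "c j (g i j y) = c i y" if "(i, j) \<in> r" "y \<in> carrier (G i)" for i j y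
    using is_direct_limitD(4)[OF lim that(1)] that(2) by (auto simp: Cmp_Ab compose_def fun_eq_iff split: if_splits)
  define U where "U = (\<Union>i\<in>I. c i ` carrier (G i))"
  have sub: "subgroup U L"
  proof (rule L.subgroupI)
    show "U \<subseteq> carrier L" unfolding U_def using c hom_in_carrier by fastforce
    obtain i where "i \<in> I" using dir(1) by blast
    have "\<one>\<^bsub>G i\<^esub> \<in> carrier (G i)"
      using G[OF \<open>i \<in> I\<close>] by (simp add: comm_group_def comm_monoid_def monoid.one_closed)
    then show "U \<noteq> {}" unfolding U_def using \<open>i \<in> I\<close> by blast
    fix a assume "a \<in> U"
    then obtain i y where i: "i \<in> I" "y \<in> carrier (G i)" "a = c i y" unfolding U_def by blast
    interpret Gi: comm_group "G i" using G[OF i(1)] .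
    interpret ci: group_hom "G i" L "c i" by unfold_locales (rule c(1)[OF i(1)])
    show "inv\<^bsub>L\<^esub> a \<in> U" unfolding U_def using i ci.hom_inv[OF i(2)] Gi.inv_closed by (metis UN_iff imageI)
    fix a' assume "a' \<in> U"
    then obtain j y' where j: "j \<in> I" "y' \<in> carrier (G j)" "a' = c j y'" unfolding U_def by blast
    obtain k where k: "k \<in> I" "(i, k) \<in> r" "(j, k) \<in> r" using dir(5)[OF i(1) j(1)] by blast
    interpret Gk: comm_group "G k" using G[OF k(1)] .
    have "a \<otimes>\<^bsub>L\<^esub> a' = c k (g i k y \<otimes>\<^bsub>G k\<^esub> g j k y')"
      using i j k hom_mult[OF c(1)[OF k(1)]] hom_in_carrier[OF g] by (simp add: cg)
    moreover have "g i k y \<otimes>\<^bsub>G k\<^esub> g j k y' \<in> carrier (G k)"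
      using i j k by (simp add: hom_in_carrier[OF g])
    ultimately show "a \<otimes>\<^bsub>L\<^esub> a' \<in> U" unfolding U_def using k(1) by blast
  qed
  let ?L' = "L\<lparr>carrier := U\<rparr>"
  have "U \<subseteq> carrier L" using sub subgroup.subset by blast
  have "comm_group ?L'"
    by (rule group.group_comm_groupI[OF L.subgroup_imp_group[OF sub]])
      (use \<open>U \<subseteq> carrier L\<close> in \<open>auto intro: L.m_comm\<close>)
  then have L': "?L' \<in> Obj Ab"
    using L(2) \<open>U \<subseteq> carrier L\<close> small_subset by (auto simp: Obj_Ab)
  have "is_cocone Ab I r G g ?L' c"
    unfolding is_cocone_def
  proof (intro conjI ballI)
    show "c i \<in> Mor Ab (G i) ?L'" if "i \<in> I" for i
      using c[OF that] that unfolding Mor_Ab hom_def U_def by auto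
    show "case p of (i, j) \<Rightarrow> Cmp Ab (G i) (G j) ?L' (c j) (g i j) = c i" if "p \<in> r" for p
      using that is_direct_limitD(4)[OF lim] by (auto simp: Cmp_Ab)
  qed (rule L')
  then obtain f where f: "f \<in> Mor Ab L ?L'" "\<And>i. i \<in> I \<Longrightarrow> Cmp Ab (G i) L ?L' f (c i) = c i"
    using direct_limit_universal[OF lim] by blast
  have f': "f \<in> Mor Ab L L"
    using f(1) \<open>U \<subseteq> carrier L\<close> unfolding Mor_Ab hom_def by auto
  \<comment> \<open>Both \<open>f\<close>, followed by the inclusion, and the identity mediate the
    limit cocone to itself.\<close>
  have "f = Idt Ab L"
  proof (rule direct_limit_unique[OF lim cocone f'])
    show "Cmp Ab (G i) L L f (c i) = c i" if "i \<in> I" for i using f(2)[OF that] by (simp add: Cmp_Ab)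
    show "Idt Ab L \<in> Mor Ab L L" by (simp add: Idt_Ab Mor_Ab hom_def)
    show "Cmp Ab (G i) L L (Idt Ab L) (c i) = c i" if "i \<in> I" for i
      using c[OF that] hom_in_carrier[OF c(1)[OF that]]
      by (auto simp: Cmp_Ab Idt_Ab compose_def fun_eq_iff extensional_def)
  qed
  then have "x \<in> U" using f(1) x funcset_mem[of f "carrier L" U x] unfolding Mor_Ab hom_def by (auto simp: Idt_Ab)
  then show thesis using that unfolding U_def by blast
qed

text \<open>Families modulo eventual equality receive a cocone that kills only what is killed at some stage.\<close>

lemma Ab_direct_limit_zero:
  fixes L :: "'u monoid"
  assumes U: "universe TYPE('u)" and I: "small TYPE('u) I"
    and lim: "is_direct_limit Ab I r G g L c" and i: "i \<in> I" and x: "x \<in> carrier (G i)"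
    and cx: "c i x = \<one>\<^bsub>L\<^esub>"
  obtains j where "(i, j) \<in> r" "g i j x = \<one>\<^bsub>G j\<^esub>"
proof -
  note sys = is_direct_limitD(1)[OF lim]
  note dir = directed_posetD[OF directed_systemD(1)[OF sys]]
  have L: "comm_group L" using is_direct_limitD(2)[OF lim] by (auto simp: Obj_Ab)
  have G: "comm_group (G i)" and G_small: "small TYPE('u) (carrier (G i))" if "i \<in> I" for i
    using directed_systemD(2)[OF sys that] by (simp_all add: Obj_Ab)
  have Gg: "group (G i)" if "i \<in> I" for i using G[OF that] by (rule comm_group.axioms(2))
  have g: "g i j \<in> hom (G i) (G j)" if "(i, j) \<in> r" for i j
    using directed_systemD(3)[OF sys that] by (simp add: Mor_Ab)
  have gg: "g i k y = g j k (g i j y)" if "(i, j) \<in> r" "(j, k) \<in> r" "y \<in> carrier (G i)" for i j k y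
    using directed_systemD(5)[OF sys that(1,2)] that(3) by (simp add: Cmp_Ab compose_eq)
  define P where "P = product_group I G"
  have carrP: "carrier P = (\<Pi>\<^sub>E i\<in>I. carrier (G i))" by (simp add: P_def)
  have gP: "group P" unfolding P_def using Gg by simp
  interpret P: comm_group P
  proof (rule group.group_comm_groupI[OF gP])
    fix p q assume "p \<in> carrier P" "q \<in> carrier P"
    then show "p \<otimes>\<^bsub>P\<^esub> q = q \<otimes>\<^bsub>P\<^esub> p"
      unfolding P_def by (auto simp: fun_eq_iff dest: PiE_mem intro!: comm_monoid.m_comm[OF comm_group.axioms(1)[OF G]])
  qed
  have invP: "(inv\<^bsub>P\<^esub> p) j = inv\<^bsub>G j\<^esub> (p j)" if "p \<in> carrier P" "j \<in> I" for p j
    using that Gg unfolding P_def by simp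
  have multP: "(p \<otimes>\<^bsub>P\<^esub> q) j = p j \<otimes>\<^bsub>G j\<^esub> q j" if "j \<in> I" for p q j
    using that unfolding P_def by simp
  \<comment> \<open>Families that vanish from some index on.\<close>
  define N where "N = {p \<in> carrier P. \<exists>k\<in>I. \<forall>j. (k, j) \<in> r \<longrightarrow> p j = \<one>\<^bsub>G j\<^esub>}"
  have N: "subgroup N P"
  proof (rule P.subgroupI)
    show "N \<subseteq> carrier P" unfolding N_def by blast
    have "\<one>\<^bsub>P\<^esub> \<in> N" unfolding N_def using dir by (auto simp: P_def intro: Gg group.is_monoid)
    then show "N \<noteq> {}" by blast
    fix p assume p: "p \<in> N"
    then obtain k where k: "k \<in> I" "p \<in> carrier P" "\<And>j. (k, j) \<in> r \<Longrightarrow> p j = \<one>\<^bsub>G j\<^esub>"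
      unfolding N_def by blast
    have "(inv\<^bsub>P\<^esub> p) j = \<one>\<^bsub>G j\<^esub>" if "(k, j) \<in> r" for j
      using invP[OF k(2)] k(3) dir(4)[OF that] Gg[of j] that by (simp add: group.is_monoid monoid.inv_one)
    then show "inv\<^bsub>P\<^esub> p \<in> N" unfolding N_def using k by auto
    fix q assume q: "q \<in> N"
    obtain k k' where k: "k \<in> I" "\<And>j. (k, j) \<in> r \<Longrightarrow> p j = \<one>\<^bsub>G j\<^esub>" "k' \<in> I" "\<And>j. (k', j) \<in> r \<Longrightarrow> q j = \<one>\<^bsub>G j\<^esub>"
      using p q unfolding N_def by blast
    obtain l where l: "l \<in> I" "(k, l) \<in> r" "(k', l) \<in> r" using dir(5) k by blast
    have "(p \<otimes>\<^bsub>P\<^esub> q) j = \<one>\<^bsub>G j\<^esub>" if "(l, j) \<in> r" for j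
      using k l dir(3)[OF _ that] dir(4)[OF that] Gg[of j] by (simp add: multP group.is_monoid)
    then show "p \<otimes>\<^bsub>P\<^esub> q \<in> N" using p q l unfolding N_def by auto
  qed
  have "small TYPE('u) (carrier P)" unfolding carrP by (intro small_PiE U I G_small)
  then obtain \<phi> :: "('a \<Rightarrow> 'u) \<Rightarrow> 'u" where \<phi>: "inj_on \<phi> (carrier P)" by (rule small_code)
  \<comment> \<open>The elements of the product are functions; coding the coset representatives
    brings the quotient into \<open>Ab\<close>.\<close>
  define \<rho> where "\<rho> p = \<phi> (coset_rep P N p)" for p
  have \<rho>_eq: "\<rho> p = \<rho> q \<longleftrightarrow> p \<otimes>\<^bsub>P\<^esub> inv\<^bsub>P\<^esub> q \<in> N" if "p \<in> carrier P" "q \<in> carrier P" for p q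
    unfolding \<rho>_def using P.coset_rep[OF N] that inj_onD[OF \<phi>] by metis
  define Q where "Q = recode_group P \<rho>"
  have \<rho>: "\<rho> \<in> hom P Q" and "comm_group Q"
    unfolding Q_def using recode_group_hom[OF gP \<rho>_eq N P.comm_group_axioms] by auto
  moreover have "small TYPE('u) (carrier Q)"
    unfolding Q_def by (simp add: small_image \<open>small TYPE('u) (carrier P)\<close>)
  ultimately have Q: "Q \<in> Obj Ab" by (simp add: Obj_Ab)
  have \<rho>_ev: "\<rho> p = \<rho> q \<longleftrightarrow> (\<exists>k\<in>I. \<forall>j. (k, j) \<in> r \<longrightarrow> p j = q j)"
    if p: "p \<in> carrier P" and q: "q \<in> carrier P" for p q
  proof -
    have "(p \<otimes>\<^bsub>P\<^esub> inv\<^bsub>P\<^esub> q) j = \<one>\<^bsub>G j\<^esub> \<longleftrightarrow> p j = q j" if "j \<in> I" for j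
      using p q that group.mult_inv_eq_one_iff[OF Gg[OF that], of "p j" "q j"] invP multP
      by (auto simp: carrP PiE_mem)
    then have "(p \<otimes>\<^bsub>P\<^esub> inv\<^bsub>P\<^esub> q) j = \<one>\<^bsub>G j\<^esub> \<longleftrightarrow> p j = q j" if "(k, j) \<in> r" for k j
      using dir(4)[OF that] by blast
    then have "p \<otimes>\<^bsub>P\<^esub> inv\<^bsub>P\<^esub> q \<in> N \<longleftrightarrow> (\<exists>k\<in>I. \<forall>j. (k, j) \<in> r \<longrightarrow> p j = q j)"
      unfolding N_def mem_Collect_eq using P.m_closed[OF p P.inv_closed[OF q]] by blast
    then show ?thesis using \<rho>_eq[OF p q] by simp
  qed
  \<comment> \<open>The orbit of \<open>x\<close> along the system, with the unit as default at
    indices not above \<open>i\<close>; the default is invisible in the quotient.\<close>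
  define h where "h i x = (\<lambda>j\<in>I. if (i, j) \<in> r then g i j x else \<one>\<^bsub>G j\<^esub>)" for i x
  have h_P: "h i x \<in> carrier P" if "x \<in> carrier (G i)" for i x
    using that hom_in_carrier[OF g] Gg unfolding h_def carrP by (auto simp: group.is_monoid monoid.one_closed)
  have h_mult: "h i (x \<otimes>\<^bsub>G i\<^esub> y) = h i x \<otimes>\<^bsub>P\<^esub> h i y"
    if "x \<in> carrier (G i)" "y \<in> carrier (G i)" for i x y
    using that hom_mult[OF g] Gg unfolding h_def P_def by (auto simp: fun_eq_iff group.is_monoid monoid.l_one)
  define b where "b i = (\<lambda>x \<in> carrier (G i). \<rho> (h i x))" for i
  have "is_cocone Ab I r G g Q b"
    unfolding is_cocone_def
  proof (intro conjI ballI)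
    show "Q \<in> Obj Ab" by (rule Q)
    show "b i \<in> Mor Ab (G i) Q" if i: "i \<in> I" for i
    proof -
      have "(\<lambda>x. \<rho> (h i x)) \<in> hom (G i) Q"
        by (rule homI) (auto simp: hom_in_carrier[OF \<rho>] h_P h_mult hom_mult[OF \<rho>])
      then show ?thesis unfolding Mor_Ab b_def using restrict_in_hom Gg[OF i] by auto
    qed
    fix ij assume "ij \<in> r"
    then obtain i j where ij: "ij = (i, j)" "(i, j) \<in> r" by (cases ij) auto
    have "b j (g i j x) = b i x" if x: "x \<in> carrier (G i)" for x
    proof -
      have "\<rho> (h j (g i j x)) = \<rho> (h i x)"
        unfolding \<rho>_ev[OF h_P[OF hom_in_carrier[OF g[OF ij(2)] x]] h_P[OF x]]
      proof (rule bexI[of _ j], intro allI impI)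
        fix l assume l: "(j, l) \<in> r"
        then show "h j (g i j x) l = h i x l"
          using gg[OF ij(2) l x] dir(3)[OF ij(2) l] dir(4)[OF l] by (simp add: h_def)
      qed (use dir(4) ij in blast)
      then show ?thesis using x hom_in_carrier[OF g[OF ij(2)] x] by (simp add: b_def)
    qed
    then show "case ij of (i, j) \<Rightarrow> Cmp Ab (G i) (G j) Q (b j) (g i j) = b i"
      by (auto simp: ij Cmp_Ab compose_def fun_eq_iff b_def)
  qed
  then obtain f where f: "f \<in> Mor Ab L Q" "\<And>i. i \<in> I \<Longrightarrow> Cmp Ab (G i) L Q f (c i) = b i"
    using direct_limit_universal[OF lim] by blast
  have "f (c i x) = b i x" using f(2)[OF i] x by (metis Cmp_Ab compose_eq)
  moreover have "f (c i x) = \<one>\<^bsub>Q\<^esub>"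
    unfolding cx using f(1) hom_one[of f L Q] comm_group.axioms(2)[OF L] comm_group.axioms(2)[OF \<open>comm_group Q\<close>]
    by (simp add: Mor_Ab)
  ultimately have "\<rho> (h i x) = \<rho> \<one>\<^bsub>P\<^esub>" using x by (simp add: b_def Q_def)
  then obtain k where k: "k \<in> I" "\<And>j. (k, j) \<in> r \<Longrightarrow> h i x j = \<one>\<^bsub>P\<^esub> j"
    using \<rho>_ev[OF h_P[OF x] P.one_closed] by blast
  obtain j where j: "j \<in> I" "(i, j) \<in> r" "(k, j) \<in> r" using dir(5)[OF i k(1)] by blast
  then have "g i j x = \<one>\<^bsub>G j\<^esub>" using k(2)[OF j(3)] by (simp add: h_def P_def)
  with j show thesis using that by blast
qed

section \<open>Finitely presented objects\<close>

lemma fp_category_simps [simp]: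
  "Obj (fp_category C) = fp_objects C" "Hom (fp_category C) = Hom C"
  "Idt (fp_category C) = Idt C" "Cmp (fp_category C) = Cmp C"
  by (auto simp: fp_category_def full_subcategory_def fp_objects_def)

lemma fp_objects_Obj: "A \<in> fp_objects C \<Longrightarrow> A \<in> Obj C"
  by (simp add: fp_objects_def)

lemma factors_fp_category [simp]: "factors (fp_category C) = factors C"
  by (simp add: factors_def fun_eq_iff)

lemma Cok_fp_category [simp]: "Cok (fp_category C) = Cok C"
  by (simp add: Cok_def fun_eq_iff)

lemma representable_fp_category [simp]: "representable (fp_category C) = representable C"
  by (simp add: representable_def fun_eq_iff)

locale finitely_accessible_universe = finitely_accessible C
  for C :: "('o, 'u) category" +
  assumes universe: "universe TYPE('u)"

sublocale finitely_accessible_universe \<subseteq> small_preadditive_category C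
  by unfold_locales (rule locally_small)

text \<open>Presentations are used over both categories: over \<open>C\<close> for the extended
  functors, over \<open>fp_category C\<close> for the objects of \<open>fp_mod C\<close>.\<close>

sublocale finitely_accessible_universe \<subseteq> fp: small_preadditive_category "fp_category C"
  by (intro small_preadditive_category.intro preadditive_category.intro small_preadditive_category_axioms.intro)
    (simp_all add: fp_objects_Obj Hom_comm_group Idt_Mor Cmp_Mor Cmp_Idt_left Cmp_Idt_right
      Cmp_assoc Cmp_add_left Cmp_add_right locally_small)

context finitely_accessible_universe
begin

lemma fp_direct_limit:
  fixes I :: "'u set"
  assumes A: "A \<in> fp_objects C" and "small TYPE('u) I" "is_direct_limit C I r D d X c"
  shows "is_direct_limit Ab I r (\<lambda>i. Hom C A (D i)) (\<lambda>i j. FMor (representable C A) (D i) (D j) (d i j))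
    (Hom C A X) (\<lambda>i. FMor (representable C A) (D i) X (c i))"
  using assms unfolding fp_objects_def preserves_direct_limits_def by auto

text \<open>\<open>(A,-)\<close> preserves the direct limit, and a direct limit of groups is covered
  by its stages.\<close>

lemma fp_lift:
  fixes I :: "'u set"
  assumes A: "A \<in> fp_objects C" and I: "small TYPE('u) I" and lim: "is_direct_limit C I r D d X c"
    and h: "h \<in> Mor C A X"
  obtains i h' where "i \<in> I" "h' \<in> Mor C A (D i)" "h = Cmp C A (D i) X (c i) h'"
proof -
  obtain i y where "i \<in> I" "y \<in> Mor C A (D i)" "h = FMor (representable C A) (D i) X (c i) y"
    using Ab_direct_limit_surj[OF fp_direct_limit[OF A I lim] h] by blast
  then show thesis using that by simp
qed

lemma fp_zero:
  fixes I :: "'u set"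
  assumes A: "A \<in> fp_objects C" and I: "small TYPE('u) I" and lim: "is_direct_limit C I r D d X c"
    and i: "i \<in> I" and h: "h \<in> Mor C A (D i)" and 0: "Cmp C A (D i) X (c i) h = zero_mor C A X"
  obtains j where "(i, j) \<in> r" "Cmp C A (D i) (D j) (d i j) h = zero_mor C A (D j)"
  using Ab_direct_limit_zero[OF universe I fp_direct_limit[OF A I lim] i h] 0 h that by auto

text \<open>The difference of the two morphisms vanishes in the limit, hence already at a later
  stage.\<close>

lemma fp_eq:
  fixes I :: "'u set"
  assumes A: "A \<in> fp_objects C" and I: "small TYPE('u) I" and lim: "is_direct_limit C I r D d X c"
    and i: "i \<in> I" and h: "h \<in> Mor C A (D i)" "h' \<in> Mor C A (D i)"
    and eq: "Cmp C A (D i) X (c i) h = Cmp C A (D i) X (c i) h'"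
  obtains j where "(i, j) \<in> r" "Cmp C A (D i) (D j) (d i j) h = Cmp C A (D i) (D j) (d i j) h'"
proof -
  note sys = directed_systemD[OF is_direct_limitD(1)[OF lim]]
  have A': "A \<in> Obj C" using A by (rule fp_objects_Obj)
  note X = is_direct_limitD(2)[OF lim] and Di = sys(2)[OF i] and ci = is_direct_limitD(3)[OF lim i]
  let ?k = "h \<otimes>\<^bsub>Hom C A (D i)\<^esub> inv\<^bsub>Hom C A (D i)\<^esub> h'"
  have k: "?k \<in> Mor C A (D i)" using h A' Di by (intro mult_Mor inv_Mor)
  have diff: "Cmp C A (D i) Y f ?k = Cmp C A (D i) Y f h \<otimes>\<^bsub>Hom C A Y\<^esub> inv\<^bsub>Hom C A Y\<^esub> Cmp C A (D i) Y f h'"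
    if "Y \<in> Obj C" "f \<in> Mor C (D i) Y" for Y f
    using h A' Di that by (simp add: Cmp_add_right Cmp_inv_right inv_Mor)
  have "Cmp C A (D i) X (c i) ?k = zero_mor C A X"
    unfolding diff[OF X ci] eq
    using group.r_inv[OF Hom_group[OF A' X]] Cmp_Mor[OF A' Di X h(2) ci] by simp
  then obtain j where j: "(i, j) \<in> r" "Cmp C A (D i) (D j) (d i j) ?k = zero_mor C A (D j)"
    using fp_zero[OF A I lim i k] by blast
  then have Dj: "D j \<in> Obj C" and dij: "d i j \<in> Mor C (D i) (D j)"
    using directed_posetD(4)[OF sys(1)] sys by blast+
  have "Cmp C A (D i) (D j) (d i j) h = Cmp C A (D i) (D j) (d i j) h'"
    using j(2) group.mult_inv_eq_one_iff[OF Hom_group[OF A' Dj]] Cmp_Mor[OF A' Di Dj _ dij] h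
    unfolding diff[OF Dj dij] by blast
  with j(1) show thesis using that by blast
qed

text \<open>A fixed small set from which test maps and factorization problems are taken; the class
  of all finitely presented objects need not be small.\<close>

definition generators :: "'o set" where
  "generators = (SOME P. P \<subseteq> fp_objects C \<and> small TYPE('u) P \<and>
      (\<forall>X \<in> Obj C. \<exists>(I :: 'u set) r D d c. small TYPE('u) I \<and> D ` I \<subseteq> P \<and>
         is_direct_limit C I r D d X c))"

lemma generators_fp: "generators \<subseteq> fp_objects C"
  and generators_small: "small TYPE('u) generators"
  and generators_direct_limit: "X \<in> Obj C \<Longrightarrow> \<exists>(I :: 'u set) r D d c. small TYPE('u) I \<and>
    D ` I \<subseteq> generators \<and> is_direct_limit C I r D d X c"
  using someI_ex[OF fp_generators] unfolding generators_def by blast+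

lemma direct_limit_of_fp:
  assumes "X \<in> Obj C"
  obtains I :: "'u set" and r D d c where "small TYPE('u) I" "D ` I \<subseteq> fp_objects C" "is_direct_limit C I r D d X c"
  using generators_direct_limit[OF assms] generators_fp by (metis subset_trans)

text \<open>\<open>A\<close> is a direct limit of generators, and as \<open>A\<close> is finitely
  presented its identity lifts to one of the stages.\<close>

lemma fp_retract:
  assumes A: "A \<in> fp_objects C"
  obtains P i p where "P \<in> generators" "i \<in> Mor C A P" "p \<in> Mor C P A" "Cmp C A P A p i = Idt C A"
proof -
  have A': "A \<in> Obj C" using A by (rule fp_objects_Obj)
  obtain I :: "'u set" and r D d c where I: "small TYPE('u) I" "D ` I \<subseteq> generators" and lim: "is_direct_limit C I r D d A c"
    using generators_direct_limit[OF A'] by blast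
  obtain i h where "i \<in> I" "h \<in> Mor C A (D i)" "Idt C A = Cmp C A (D i) A (c i) h"
    using fp_lift[OF A I(1) lim Idt_Mor[OF A']] by blast
  then show thesis using that I is_direct_limitD(3)[OF lim] by (metis image_subset_iff)
qed

end

section \<open>Products over small index sets of any type\<close>

lemma product_exists:
  fixes C :: "('o, 'u) category" and J :: "'j set"
  assumes prod: "has_products C" and J: "small TYPE('u) J" and D: "\<And>j. j \<in> J \<Longrightarrow> D j \<in> Obj C"
  obtains X p where "is_product C J D X p"
proof -
  obtain \<phi> :: "'j \<Rightarrow> 'u" where \<phi>: "inj_on \<phi> J" using small_code[OF J] by blast
  let ?D = "\<lambda>i. D (inv_into J \<phi> i)"
  have "small TYPE('u) (\<phi> ` J)" "\<forall>i\<in>\<phi> ` J. ?D i \<in> Obj C"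
    using J D \<phi> by (auto simp: small_image)
  then obtain X p where P: "is_product C (\<phi> ` J) ?D X p"
    using prod[unfolded has_products_def, rule_format, of "\<phi> ` J" ?D] by blast
  have "is_product C J D X (\<lambda>j. p (\<phi> j))"
    unfolding is_product_def
  proof (intro conjI ballI allI impI)
    show "X \<in> Obj C" using P unfolding is_product_def by blast
    show "D j \<in> Obj C" "p (\<phi> j) \<in> Mor C X (D j)" if "j \<in> J" for j
      using P D that \<phi> unfolding is_product_def by auto
    fix Y q assume Y: "Y \<in> Obj C" and q: "\<forall>j\<in>J. q j \<in> Mor C Y (D j)"
    then have "\<forall>i\<in>\<phi> ` J. q (inv_into J \<phi> i) \<in> Mor C Y (?D i)" using \<phi> by auto
    moreover have "\<forall>q. (\<forall>i\<in>\<phi> ` J. q i \<in> Mor C Y (?D i)) \<longrightarrow>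
        (\<exists>!f. f \<in> Mor C Y X \<and> (\<forall>i\<in>\<phi> ` J. Cmp C Y X (?D i) (p i) f = q i))"
      using P Y unfolding is_product_def by (elim conjE) (drule (1) bspec)
    ultimately have "\<exists>!f. f \<in> Mor C Y X \<and> (\<forall>i\<in>\<phi> ` J. Cmp C Y X (?D i) (p i) f = q (inv_into J \<phi> i))"
      by (elim allE[of _ "\<lambda>i. q (inv_into J \<phi> i)"] impE)
    then show "\<exists>!f. f \<in> Mor C Y X \<and> (\<forall>j\<in>J. Cmp C Y X (D j) (p (\<phi> j)) f = q j)"
      using \<phi> by simp
  qed
  then show thesis by (rule that)
qed

lemma productD:
  assumes "is_product C J D X p"
  shows "X \<in> Obj C" "\<And>j. j \<in> J \<Longrightarrow> D j \<in> Obj C" "\<And>j. j \<in> J \<Longrightarrow> p j \<in> Mor C X (D j)"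
  using assms unfolding is_product_def by blast+

lemma product_universal:
  assumes "is_product C J D X p" "Y \<in> Obj C" "\<And>j. j \<in> J \<Longrightarrow> q j \<in> Mor C Y (D j)"
  obtains f where "f \<in> Mor C Y X" "\<And>j. j \<in> J \<Longrightarrow> Cmp C Y X (D j) (p j) f = q j"
  using assms unfolding is_product_def by blast

lemma product_eqI:
  assumes P: "is_product C J D X p" and Y: "Y \<in> Obj C" and f: "f \<in> Mor C Y X" "g \<in> Mor C Y X"
    and eq: "\<And>j. j \<in> J \<Longrightarrow> Cmp C Y X (D j) (p j) f = Cmp C Y X (D j) (p j) g"
    and cat: "preadditive_category C"
  shows "f = g"
proof -
  have g: "Cmp C Y X (D j) (p j) g \<in> Mor C Y (D j)" if "j \<in> J" for j
    using preadditive_category.Cmp_Mor[OF cat Y productD(1)[OF P]] productD[OF P] f that by blast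
  have "\<forall>q. (\<forall>j\<in>J. q j \<in> Mor C Y (D j)) \<longrightarrow>
      (\<exists>!f. f \<in> Mor C Y X \<and> (\<forall>j\<in>J. Cmp C Y X (D j) (p j) f = q j))"
    using P Y unfolding is_product_def by (elim conjE) (drule (1) bspec)
  from this[rule_format, of "\<lambda>j. Cmp C Y X (D j) (p j) g", OF g]
  have "\<exists>!f. f \<in> Mor C Y X \<and> (\<forall>j\<in>J. Cmp C Y X (D j) (p j) f = Cmp C Y X (D j) (p j) g)" by blast
  then show ?thesis using f eq by blast
qed

text \<open>Exactness of \<open>(D,-) \<rightarrow> (B,-) \<rightarrow> (A,-)\<close> in the middle:
  the kernel of \<open>(f,-)\<close> is generated by one element. The factorization through
  \<open>c\<close> need not be unique.\<close>

definition weak_cokernel :: "('o, 'm) category \<Rightarrow> 'o \<Rightarrow> 'o \<Rightarrow> 'o \<Rightarrow> 'm \<Rightarrow> 'm \<Rightarrow> bool" where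
  "weak_cokernel C A B D f c \<longleftrightarrow> D \<in> Obj C \<and> c \<in> Mor C B D \<and>
     (\<forall>W \<in> Obj C. \<forall>y \<in> Mor C B W. Cmp C A B W y f = zero_mor C A W \<longleftrightarrow> factors C B D W c y)"

context finitely_accessible_universe
begin

text \<open>The product of all test maps killing \<open>f\<close> kills \<open>f\<close>; as \<open>B\<close> and \<open>A\<close> are finitely presented, so does
  the lift of that map to a suitable stage of a direct limit of finitely presented objects.\<close>

lemma weak_cokernel_exists:
  assumes prod: "has_products C" and A: "A \<in> fp_objects C" and B: "B \<in> fp_objects C" and f: "f \<in> Mor C A B"
  obtains D c where "weak_cokernel (fp_category C) A B D f c"
proof -
  have o: "A \<in> Obj C" "B \<in> Obj C" using A B by (simp_all add: fp_objects_Obj)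
  \<comment> \<open>All morphisms from \<open>B\<close> to generators that kill \<open>f\<close>;
    restricting the targets to generators keeps the product small.\<close>
  define J where "J = (SIGMA Z:generators. {h \<in> Mor C B Z. Cmp C A B Z h f = zero_mor C A Z})"
  have gen: "Z \<in> Obj C" "Z \<in> fp_objects C" if "Z \<in> generators" for Z using that generators_fp fp_objects_Obj[of Z C] by blast+
  have J: "small TYPE('u) J"
    unfolding J_def
    by (intro small_Sigma universe generators_small small_subset[OF small_Mor[OF o(2) gen(1)]]) auto
  have fstJ: "fst j \<in> Obj C" if "j \<in> J" for j using that gen unfolding J_def by auto
  have sndJ: "snd j \<in> Mor C B (fst j)" if "j \<in> J" for j using that unfolding J_def by auto
  obtain X p where P: "is_product C J fst X p"
    using product_exists[OF prod J, of fst] fstJ by blast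
  obtain h where h: "h \<in> Mor C B X" "\<And>j. j \<in> J \<Longrightarrow> Cmp C B X (fst j) (p j) h = snd j"
    using product_universal[OF P o(2), of snd] sndJ by blast
  note X = productD(1)[OF P]
  have hf: "Cmp C A B X h f = zero_mor C A X"
  proof (rule product_eqI[OF P o(1)])
    fix j assume j: "j \<in> J"
    have "Cmp C A X (fst j) (p j) (Cmp C A B X h f) = Cmp C A B (fst j) (snd j) f"
      using h j o f X productD[OF P] by (simp add: Cmp_assoc)
    also have "\<dots> = Cmp C A X (fst j) (p j) (zero_mor C A X)"
      using j o X productD[OF P] by (auto simp: J_def)
    finally show "Cmp C A X (fst j) (p j) (Cmp C A B X h f) = Cmp C A X (fst j) (p j) (zero_mor C A X)" .
  qed (use h f o X in \<open>auto intro: Cmp_Mor preadditive_category_axioms\<close>)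
  obtain I :: "'u set" and r D d c where I: "small TYPE('u) I" "D ` I \<subseteq> fp_objects C" and lim: "is_direct_limit C I r D d X c"
    by (rule direct_limit_of_fp[OF X])
  note sys = directed_systemD[OF is_direct_limitD(1)[OF lim]] and c = is_direct_limitD(3)[OF lim]
  obtain i h' where i: "i \<in> I" "h' \<in> Mor C B (D i)" "h = Cmp C B (D i) X (c i) h'"
    using fp_lift[OF B I(1) lim h(1)] by blast
  have "Cmp C A (D i) X (c i) (Cmp C A B (D i) h' f) = zero_mor C A X"
    using hf i o f sys(2) X c by (simp add: Cmp_assoc)
  then obtain j where j: "(i, j) \<in> r" "Cmp C A (D i) (D j) (d i j) (Cmp C A B (D i) h' f) = zero_mor C A (D j)"
    using fp_zero[OF A I(1) lim i(1)] i o f sys(2) Cmp_Mor by blast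
  have jI: "j \<in> I" using j directed_posetD(4)[OF sys(1)] by blast
  define k where "k = Cmp C B (D i) (D j) (d i j) h'"
  have k: "k \<in> Mor C B (D j)" unfolding k_def using i j jI o sys by (blast intro: Cmp_Mor)
  have kf: "Cmp C A B (D j) k f = zero_mor C A (D j)"
    unfolding k_def j(2)[symmetric] using i j jI o sys f by (simp add: Cmp_assoc)
  have ck: "Cmp C B (D j) X (c j) k = h"
    unfolding k_def i(3) is_direct_limitD(4)[OF lim j(1), symmetric] using i j jI o sys c X by (simp add: Cmp_assoc)
  have "weak_cokernel (fp_category C) A B (D j) f k"
    unfolding weak_cokernel_def fp_category_simps factors_fp_category
  proof (intro conjI ballI iffI)
    show "D j \<in> fp_objects C" using I jI by blast
    show "k \<in> Mor C B (D j)" by (rule k)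
    fix W y assume W: "W \<in> fp_objects C" and y: "y \<in> Mor C B W"
    have oW: "W \<in> Obj C" using W by (rule fp_objects_Obj)
    show "Cmp C A B W y f = zero_mor C A W" if fac: "factors C B (D j) W k y"
    proof -
      obtain v where "v \<in> Mor C (D j) W" "y = Cmp C B (D j) W v k" using fac unfolding factors_def by blast
      then have "Cmp C A B W y f = Cmp C A (D j) W v (Cmp C A B (D j) k f)"
        using o oW f k sys(2)[OF jI] by (simp add: Cmp_assoc)
      then show ?thesis using kf o oW sys(2)[OF jI] \<open>v \<in> _\<close> by simp
    qed
    show "factors C B (D j) W k y" if yf: "Cmp C A B W y f = zero_mor C A W"
    proof -
      \<comment> \<open>\<open>W\<close> is a retract of a generator, so \<open>y\<close> followed
        by the section gives a member of \<open>J\<close>, and the retraction recovers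
        \<open>y\<close>.\<close>
      obtain Z s q where Z: "Z \<in> generators" "s \<in> Mor C W Z" "q \<in> Mor C Z W" "Cmp C W Z W q s = Idt C W"
        using fp_retract[OF W] by blast
      let ?l = "(Z, Cmp C B W Z s y)"
      have oZ: "Z \<in> Obj C" using Z gen by blast
      have "Cmp C A B Z (Cmp C B W Z s y) f = zero_mor C A Z"
        using Z oZ o oW y f yf by (simp flip: Cmp_assoc)
      then have l: "?l \<in> J" using Z oZ o oW y unfolding J_def by (auto intro: Cmp_Mor)
      have pl: "p ?l \<in> Mor C X Z" using productD(3)[OF P l] by simp
      have "y = Cmp C B Z W q (Cmp C B W Z s y)" using Z oZ o oW y by (simp add: Cmp_assoc Cmp_Idt_left)
      also have "Cmp C B W Z s y = Cmp C B X Z (p ?l) (Cmp C B (D j) X (c j) k)"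
        using h(2)[OF l] ck by simp
      also have "Cmp C B Z W q \<dots> = Cmp C B (D j) W (Cmp C (D j) Z W q (Cmp C (D j) X Z (p ?l) (c j))) k"
        using Z oZ o oW X k pl c[OF jI] sys(2)[OF jI] by (simp add: Cmp_assoc Cmp_Mor)
      finally show ?thesis unfolding factors_def
        using Z oZ o oW X k pl c[OF jI] sys(2)[OF jI] by (blast intro: Cmp_Mor)
    qed
  qed
  then show thesis by (rule that)
qed

section \<open>Extensions commuting with direct limits\<close>

text \<open>A cocone on the groups \<open>E (D i)\<close> pulls back along the generator to one on
  \<open>(A, D i)\<close>, and these groups have limit \<open>(A, X)\<close> because
  \<open>A\<close> is finitely presented. The resulting map descends to \<open>E X\<close>: a
  relation at \<open>X\<close> is given by a morphism from \<open>B\<close>, which lifts to a stage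
  because \<open>B\<close> is finitely presented, and at that stage the relation already
  holds.\<close>

lemma presents_preserves_direct_limits:
  fixes E :: "('o, 'u) abfunctor"
  assumes p: "presents C A B f E e" and A: "A \<in> fp_objects C" and B: "B \<in> fp_objects C"
  shows "preserves_direct_limits C Ab E"
  unfolding preserves_direct_limits_def
proof (intro allI impI, elim conjE)
  fix I :: "'u set" and r D d X c
  assume I: "small TYPE('u) I" and lim: "is_direct_limit C I r D d X c"
  note E = presents_functor[OF p] and m = presents_Mor[OF p] and e = presents_gen[OF p]
  note sys = directed_systemD[OF is_direct_limitD(1)[OF lim]] and c = is_direct_limitD(3)[OF lim]
  note X = is_direct_limitD(2)[OF lim]
  note dir = directed_posetD[OF sys(1)]
  have Ob: "FOb E W \<in> Obj Ab" if "W \<in> Obj C" for W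
    using functor_comm_group[OF E that] functor_small[OF E that] by (simp add: Obj_Ab)
  have FC: "Cmp Ab (FOb E W) (FOb E V) (FOb E Z) (FMor E V Z h) (FMor E W V g) = FMor E W Z (Cmp C W V Z h g)"
    if "W \<in> Obj C" "V \<in> Obj C" "Z \<in> Obj C" "g \<in> Mor C W V" "h \<in> Mor C V Z" for W V Z g h
    using E that unfolding additive_functor_def by simp
  let ?D = "\<lambda>i. FOb E (D i)" and ?d = "\<lambda>i j. FMor E (D i) (D j) (d i j)" and ?c = "\<lambda>i. FMor E (D i) X (c i)"
  have sysE: "directed_system Ab I r ?D ?d"
    unfolding directed_system_def
  proof (intro conjI ballI allI impI)
    show "directed_poset I r" by (rule sys(1))
    show "?D i \<in> Obj Ab" if "i \<in> I" for i using Ob sys(2) that by blast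
    show "case ij of (i, j) \<Rightarrow> ?d i j \<in> Mor Ab (?D i) (?D j)" if "ij \<in> r" for ij
      using that functor_Mor[OF E] sys(2,3) dir(4) by auto
    show "?d i i = Idt Ab (?D i)" if "i \<in> I" for i
      using E sys(2,4) that unfolding additive_functor_def by simp
    show "?d i k = Cmp Ab (?D i) (?D j) (?D k) (?d j k) (?d i j)" if "(i, j) \<in> r \<and> (j, k) \<in> r" for i j k
    proof -
      have "i \<in> I" "j \<in> I" "k \<in> I" using that dir(4) by blast+
      moreover have "d i k = Cmp C (D i) (D j) (D k) (d j k) (d i j)" using sys(5) that by blast
      ultimately show ?thesis using sys(3) that by (simp add: FC sys(2))
    qed
  qed
  have coneE: "is_cocone Ab I r ?D ?d (FOb E X) ?c"
    unfolding is_cocone_def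
  proof (intro conjI ballI)
    show "?c i \<in> Mor Ab (?D i) (FOb E X)" if "i \<in> I" for i using functor_Mor[OF E] sys(2) c X that by blast
    show "case ij of (i, j) \<Rightarrow> Cmp Ab (?D i) (?D j) (FOb E X) (?c j) (?d i j) = ?c i" if "ij \<in> r" for ij
      using that dir(4) is_direct_limitD(4)[OF lim] sys X c by (auto simp: FC)
  qed (rule Ob[OF X])
  show "is_direct_limit Ab I r ?D ?d (FOb E X) ?c"
    unfolding is_direct_limit_def
  proof (intro conjI allI impI sysE coneE)
    fix Y :: "'u monoid" and b assume b: "is_cocone Ab I r ?D ?d Y b"
    then have Y: "Y \<in> Obj Ab" and bM: "\<And>i. i \<in> I \<Longrightarrow> b i \<in> hom (?D i) Y"
      and bC: "\<And>i j z. \<lbrakk>(i, j) \<in> r; z \<in> carrier (?D i)\<rbrakk> \<Longrightarrow> b j (?d i j z) = b i z"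
      unfolding is_cocone_def Mor_Ab Cmp_Ab by (auto simp: compose_def fun_eq_iff split: if_splits)
    have bE: "b i \<in> extensional (carrier (?D i))" if "i \<in> I" for i
      using b that unfolding is_cocone_def Mor_Ab by blast
    have gY: "group Y" using Y comm_group.axioms(2) by (auto simp: Obj_Ab)
    let ?R = "\<lambda>i. Hom C A (D i)" and ?r = "\<lambda>i j. FMor (representable C A) (D i) (D j) (d i j)"
      and ?rc = "\<lambda>i. FMor (representable C A) (D i) X (c i)"
    note limR = fp_direct_limit[OF A I lim]
    define b' where "b' i = (\<lambda>x \<in> Mor C A (D i). b i (FMor E A (D i) x e))" for i
    have "is_cocone Ab I r ?R ?r Y b'"
      unfolding is_cocone_def
    proof (intro conjI ballI Y)
      fix i assume i: "i \<in> I"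
      have "(\<lambda>x. b i (FMor E A (D i) x e)) \<in> hom (Hom C A (D i)) Y"
        using hom_compose[OF functor_eval_hom[OF E m(1) sys(2)[OF i] e] bM[OF i]] by (simp add: comp_def)
      then show "b' i \<in> Mor Ab (Hom C A (D i)) Y"
        unfolding Mor_Ab b'_def using restrict_in_hom Hom_group[OF m(1) sys(2)[OF i]] by auto
    next
      fix ij assume "ij \<in> r"
      then obtain i j where ij: "ij = (i, j)" "(i, j) \<in> r" by (cases ij) auto
      then have I2: "i \<in> I" "j \<in> I" using dir(4) by blast+
      have cl: "Cmp C A (D i) (D j) (d i j) x \<in> Mor C A (D j)" if "x \<in> Mor C A (D i)" for x
        using Cmp_Mor[OF m(1) sys(2)[OF I2(1)] sys(2)[OF I2(2)] that sys(3)[OF ij(2)]] .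
      have "b' j (Cmp C A (D i) (D j) (d i j) x) = b' i x" if x: "x \<in> Mor C A (D i)" for x
        using cl[OF x] x functor_Cmp[OF E m(1) sys(2)[OF I2(1)] sys(2)[OF I2(2)] x sys(3)[OF ij(2)] e]
          bC[OF ij(2) functor_closed[OF E m(1) sys(2)[OF I2(1)] x e]]
        by (simp add: b'_def)
      then show "case ij of (i, j) \<Rightarrow> Cmp Ab (?R i) (?R j) Y (b' j) (?r i j) = b' i"
        by (auto simp: ij Cmp_Ab compose_def fun_eq_iff b'_def cl)
    qed
    then obtain t where t: "t \<in> Mor Ab (Hom C A X) Y" "\<And>i. i \<in> I \<Longrightarrow> Cmp Ab (?R i) (Hom C A X) Y t (?rc i) = b' i"
      using direct_limit_universal[OF limR] by blast
    have th: "t \<in> hom (Hom C A X) Y" using t(1) by (simp add: Mor_Ab)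
    have tc: "t (Cmp C A (D i) X (c i) x) = b i (FMor E A (D i) x e)" if "i \<in> I" "x \<in> Mor C A (D i)" for i x
      using fun_cong[OF t(2)[OF that(1)], of x] that by (simp add: Cmp_Ab compose_eq b'_def)
    interpret th: group_hom "Hom C A X" Y t
      using th gY Hom_group[OF m(1) X] by (intro group_hom.intro group_hom_axioms.intro)
    interpret eh: group_hom "Hom C A X" "FOb E X" "\<lambda>x. FMor E A X x e"
      using functor_eval_hom[OF E m(1) X e] functor_group[OF E X] Hom_group[OF m(1) X]
      by (intro group_hom.intro group_hom_axioms.intro)
    have tker: "t x = \<one>\<^bsub>Y\<^esub>" if x: "x \<in> Mor C A X" and 0: "FMor E A X x e = \<one>\<^bsub>FOb E X\<^esub>" for x
    proof -
      obtain y where y: "y \<in> Mor C B X" "x = Cmp C A B X y f"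
        using presents_kernel[OF p X x] 0 unfolding factors_def by blast
      obtain i y' where i: "i \<in> I" "y' \<in> Mor C B (D i)" "y = Cmp C B (D i) X (c i) y'"
        using fp_lift[OF B I lim y(1)] by blast
      have y'f: "Cmp C A B (D i) y' f \<in> Mor C A (D i)" using i m sys(2) by (blast intro: Cmp_Mor)
      have "x = Cmp C A (D i) X (c i) (Cmp C A B (D i) y' f)"
        using y(2) i m sys(2) X c by (simp add: Cmp_assoc)
      then have "t x = b i (FMor E A (D i) (Cmp C A B (D i) y' f) e)" using tc[OF i(1) y'f] by simp
      also have "FMor E A (D i) (Cmp C A B (D i) y' f) e = \<one>\<^bsub>?D i\<^esub>"
        using presents_kernel[OF p sys(2)[OF i(1)] y'f] i(2) unfolding factors_def by blast
      finally show ?thesis using hom_one[OF bM[OF i(1)] functor_group[OF E sys(2)[OF i(1)]] gY] by simp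
    qed
    have twd: "t x = t x'" if x: "x \<in> Mor C A X" "x' \<in> Mor C A X" and eq: "FMor E A X x e = FMor E A X x' e" for x x'
    proof -
      have "FMor E A X (x \<otimes>\<^bsub>Hom C A X\<^esub> inv\<^bsub>Hom C A X\<^esub> x') e = \<one>\<^bsub>FOb E X\<^esub>"
        using x eq eh.hom_closed[OF x(2)] by simp
      then have "t (x \<otimes>\<^bsub>Hom C A X\<^esub> inv\<^bsub>Hom C A X\<^esub> x') = \<one>\<^bsub>Y\<^esub>" using tker x by simp
      then show ?thesis using x th.H.mult_inv_eq_one_iff[of "t x" "t x'"] by simp
    qed
    define u where "u = (\<lambda>z \<in> carrier (FOb E X). t (SOME x. x \<in> Mor C A X \<and> z = FMor E A X x e))"
    have u: "u (FMor E A X x e) = t x" if x: "x \<in> Mor C A X" for x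
    proof -
      have "\<exists>x'. x' \<in> Mor C A X \<and> FMor E A X x e = FMor E A X x' e" using x by blast
      note x' = someI_ex[OF this]
      then show ?thesis using twd[OF x conjunct1[OF x'] conjunct2[OF x']] functor_closed[OF E m(1) X x e]
        by (simp add: u_def)
    qed
    have uM: "u \<in> Mor Ab (FOb E X) Y"
      unfolding Mor_Ab
    proof (intro IntI homI)
      fix z assume "z \<in> carrier (FOb E X)"
      then obtain x where x: "x \<in> Mor C A X" "z = FMor E A X x e" using presents_surj[OF p X] by blast
      then show "u z \<in> carrier Y" using u by simp
    next
      fix z z' assume "z \<in> carrier (FOb E X)" "z' \<in> carrier (FOb E X)"
      then obtain x x' where x: "x \<in> Mor C A X" "z = FMor E A X x e" "x' \<in> Mor C A X" "z' = FMor E A X x' e"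
        using presents_surj[OF p X] by metis
      then have zz': "z \<otimes>\<^bsub>FOb E X\<^esub> z' = FMor E A X (x \<otimes>\<^bsub>Hom C A X\<^esub> x') e" by simp
      show "u (z \<otimes>\<^bsub>FOb E X\<^esub> z') = u z \<otimes>\<^bsub>Y\<^esub> u z'"
        unfolding zz' using x u[OF mult_Mor[OF m(1) X x(1,3)]] u by simp
    qed (simp add: u_def)
    have uc: "Cmp Ab (?D i) (FOb E X) Y u (?c i) = b i" if i: "i \<in> I" for i
    proof (rule extensionalityI[of _ "carrier (?D i)"])
      fix z assume "z \<in> carrier (?D i)"
      then obtain x where x: "x \<in> Mor C A (D i)" "z = FMor E A (D i) x e" using presents_surj[OF p sys(2)[OF i]] by blast
      then have "?c i z = FMor E A X (Cmp C A (D i) X (c i) x) e"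
        using functor_Cmp[OF E m(1) sys(2)[OF i] X _ c[OF i] e] by simp
      then show "Cmp Ab (?D i) (FOb E X) Y u (?c i) z = b i z"
        using x tc[OF i x(1)] u Cmp_Mor[OF m(1) sys(2)[OF i] X x(1) c[OF i]] \<open>z \<in> _\<close> by (simp add: Cmp_Ab compose_eq)
    qed (use bE i in \<open>simp_all add: Cmp_Ab compose_def\<close>)
    show "\<exists>!u. u \<in> Mor Ab (FOb E X) Y \<and> (\<forall>i\<in>I. Cmp Ab (?D i) (FOb E X) Y u (?c i) = b i)"
    proof (rule ex1I[of _ u])
      fix v assume v: "v \<in> Mor Ab (FOb E X) Y \<and> (\<forall>i\<in>I. Cmp Ab (?D i) (FOb E X) Y v (?c i) = b i)"
      have vc: "v (?c i z) = u (?c i z)" if "i \<in> I" "z \<in> carrier (?D i)" for i z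
        using v uc[OF that(1)] that by (metis Cmp_Ab compose_eq)
      show "v = u"
      proof (rule Mor_Ab_eqI[OF _ uM])
        show "v \<in> Mor Ab (FOb E X) Y" using v by blast
        fix z assume "z \<in> carrier (FOb E X)"
        then obtain x where x: "x \<in> Mor C A X" "z = FMor E A X x e" using presents_surj[OF p X] by blast
        obtain i x' where i: "i \<in> I" "x' \<in> Mor C A (D i)" "x = Cmp C A (D i) X (c i) x'"
          using fp_lift[OF A I lim x(1)] by blast
        then have "z = ?c i (FMor E A (D i) x' e)"
          using x functor_Cmp[OF E m(1) sys(2)[OF i(1)] X i(2) c[OF i(1)] e] by simp
        then show "v z = u z" using vc[OF i(1)] functor_closed[OF E m(1) sys(2)[OF i(1)] i(2) e] by simp
      qed
    qed (use uM uc in simp)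
  qed
qed

lemma additive_functor_restrict:
  "additive_functor C Ab E \<Longrightarrow> additive_functor (fp_category C) Ab E"
  unfolding additive_functor_def using fp_objects_Obj by (simp add: fp_objects_Obj)

text \<open>To carry triviality from one extension to another, a surjection from \<open>E X\<close>
  to \<open>E' X\<close> is enough. It is induced by an isomorphism on finitely presented objects,
  where both functors are isomorphic to \<open>F\<close>.\<close>

lemma extension_trivial:
  assumes E: "is_direct_limit_extension C F E" and E': "is_direct_limit_extension C F E'"
    and F: "additive_functor (fp_category C) Ab F"
    and X: "X \<in> Obj C" and triv: "carrier (FOb E X) = {\<one>\<^bsub>FOb E X\<^esub>}"
  shows "carrier (FOb E' X) = {\<one>\<^bsub>FOb E' X\<^esub>}"
proof -
  let ?K = "functor_category (fp_category C) Ab"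
  from E E' have f: "additive_functor C Ab E" "additive_functor C Ab E'"
    and pr: "preserves_direct_limits C Ab E" "preserves_direct_limits C Ab E'"
    and i: "isomorphic ?K E F" "isomorphic ?K E' F"
    unfolding is_direct_limit_extension_def by auto
  note rE = additive_functor_restrict[OF f(1)] and rE' = additive_functor_restrict[OF f(2)]
  obtain s s' where "inverse_mors ?K E F s s'" using i unfolding isomorphic_def iso_mor_def by blast
  then have s: "s \<in> nat_trans (fp_category C) Ab E F" "s' \<in> nat_trans (fp_category C) Ab F E"
    "\<And>X x. \<lbrakk>X \<in> fp_objects C; x \<in> carrier (FOb F X)\<rbrakk> \<Longrightarrow> s X (s' X x) = x"
    unfolding inverse_nat_trans_iff[OF rE F] by auto
  obtain u u' where "inverse_mors ?K E' F u u'" using i unfolding isomorphic_def iso_mor_def by blast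
  then have u: "u \<in> nat_trans (fp_category C) Ab E' F" "u' \<in> nat_trans (fp_category C) Ab F E'"
    "\<And>X x. \<lbrakk>X \<in> fp_objects C; x \<in> carrier (FOb E' X)\<rbrakk> \<Longrightarrow> u' X (u X x) = x"
    unfolding inverse_nat_trans_iff[OF rE' F] by auto
  \<comment> \<open>The comparison over finitely presented objects, through \<open>F\<close>; the
    cocone \<open>b\<close> below extends it to \<open>X\<close>.\<close>
  define w where "w = Cmp ?K E F E' u' s"
  have w: "w \<in> nat_trans (fp_category C) Ab E E'" unfolding w_def by (rule Cmp_nat_trans[OF rE F rE' s(1) u(2)])
  obtain I :: "'u set" and r D d c where I: "small TYPE('u) I" "D ` I \<subseteq> fp_objects C" and lim: "is_direct_limit C I r D d X c"
    by (rule direct_limit_of_fp[OF X])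
  note sys = directed_systemD[OF is_direct_limitD(1)[OF lim]] and c = is_direct_limitD(3)[OF lim]
  note dir = directed_posetD[OF sys(1)]
  have fp: "D i \<in> fp_objects C" if "i \<in> I" for i using I that by blast
  let ?D = "\<lambda>i. FOb E (D i)" and ?d = "\<lambda>i j. FMor E (D i) (D j) (d i j)" and ?c = "\<lambda>i. FMor E (D i) X (c i)"
  let ?D' = "\<lambda>i. FOb E' (D i)" and ?d' = "\<lambda>i j. FMor E' (D i) (D j) (d i j)" and ?c' = "\<lambda>i. FMor E' (D i) X (c i)"
  have limE: "is_direct_limit Ab I r ?D ?d (FOb E X) ?c" and limE': "is_direct_limit Ab I r ?D' ?d' (FOb E' X) ?c'"
    using pr I(1) lim unfolding preserves_direct_limits_def by blast+
  define b where "b i = (\<lambda>z \<in> carrier (?D i). ?c' i (w (D i) z))" for i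
  have "is_cocone Ab I r ?D ?d (FOb E' X) b"
    unfolding is_cocone_def
  proof (intro conjI ballI)
    show "FOb E' X \<in> Obj Ab" using is_direct_limitD(2)[OF limE'] .
    fix i assume i: "i \<in> I"
    have "(\<lambda>z. ?c' i (w (D i) z)) \<in> hom (?D i) (FOb E' X)"
      using hom_compose[OF nat_trans_hom[OF w] functor_hom[OF f(2) sys(2)[OF i] X c[OF i]]] fp[OF i] by (simp add: comp_def)
    then show "b i \<in> Mor Ab (?D i) (FOb E' X)"
      unfolding Mor_Ab b_def using restrict_in_hom functor_group[OF f(1) sys(2)[OF i]] by auto
  next
    fix ij assume "ij \<in> r"
    then obtain i j where ij: "ij = (i, j)" "(i, j) \<in> r" by (cases ij) auto
    then have I2: "i \<in> I" "j \<in> I" using dir(4) by blast+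
    have "b j (?d i j z) = b i z" if z: "z \<in> carrier (?D i)" for z
    proof -
      have "?c' j (w (D j) (?d i j z)) = ?c' j (?d' i j (w (D i) z))"
        using nat_trans_natural[OF w _ _ _ z] fp I2 sys ij by simp
      also have "\<dots> = ?c' i (w (D i) z)"
        using functor_Cmp[OF f(2) sys(2)[OF I2(1)] sys(2)[OF I2(2)] X sys(3)[OF ij(2)] c[OF I2(2)]
            nat_trans_closed[OF w _ z]] is_direct_limitD(4)[OF lim ij(2)] fp[OF I2(1)]
        by simp
      finally show ?thesis using z functor_closed[OF f(1) _ _ _ z] sys I2 ij by (simp add: b_def)
    qed
    then show "case ij of (i, j) \<Rightarrow> Cmp Ab (?D i) (?D j) (FOb E' X) (b j) (?d i j) = b i"
      by (auto simp: ij Cmp_Ab compose_def fun_eq_iff b_def)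
  qed
  then obtain t where t: "t \<in> Mor Ab (FOb E X) (FOb E' X)" "\<And>i. i \<in> I \<Longrightarrow> Cmp Ab (?D i) (FOb E X) (FOb E' X) t (?c i) = b i"
    using direct_limit_universal[OF limE] by blast
  have "x = \<one>\<^bsub>FOb E' X\<^esub>" if x: "x \<in> carrier (FOb E' X)" for x
  proof -
    obtain i y where y: "i \<in> I" "y \<in> carrier (?D' i)" "x = ?c' i y"
      using Ab_direct_limit_surj[OF limE' x] by blast
    let ?z = "s' (D i) (u (D i) y)"
    have uy: "u (D i) y \<in> carrier (FOb F (D i))" using nat_trans_closed[OF u(1)] y fp by simp
    have z: "?z \<in> carrier (?D i)" using nat_trans_closed[OF s(2)] uy y fp by simp
    have "w (D i) ?z = y"
      unfolding w_def using z y fp s(3) u(3) uy by simp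
    then have "x = b i ?z" using y z by (simp add: b_def)
    also have "\<dots> = t (?c i ?z)"
      using t(2)[OF y(1)] z by (metis Cmp_Ab compose_eq)
    also have "?c i ?z = \<one>\<^bsub>FOb E X\<^esub>"
      using functor_closed[OF f(1) sys(2)[OF y(1)] X c[OF y(1)] z] triv by blast
    finally show ?thesis
      using t(1) hom_one[of t "FOb E X" "FOb E' X"] functor_group[OF f(1) X] functor_group[OF f(2) X] by (simp add: Mor_Ab)
  qed
  then show ?thesis using functor_group[OF f(2) X] group.is_monoid monoid.one_closed by blast
qed

text \<open>The cokernel of \<open>(f,-)\<close> formed over all of \<open>C\<close> commutes with
  direct limits and is isomorphic to \<open>F\<close> on finitely presented objects, so it is one
  possible extension. Its value at \<open>X\<close> consists of the translates of its
  generator.\<close>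

lemma direct_limit_extension_trivial_iff:
  assumes p: "presents (fp_category C) A B f F e" and X: "X \<in> Obj C"
  shows "carrier (FOb (direct_limit_extension C F) X) = {\<one>\<^bsub>FOb (direct_limit_extension C F) X\<^esub>} \<longleftrightarrow>
    (\<forall>x \<in> Mor C A X. factors C A B X f x)"
proof -
  note m = presents_Mor[OF p, simplified] and F = presents_functor[OF p]
  have o: "A \<in> Obj C" "B \<in> Obj C" using m by (simp_all add: fp_objects_Obj)
  obtain e0 where q: "presents C A B f (Cok C A B f) e0"
    using Cok_presents[OF o m(3)] by blast
  let ?E = "Cok C A B f"
  note E = presents_functor[OF q]
  obtain e1 where q': "presents (fp_category C) A B f ?E e1"
    using fp.Cok_presents[of A B f] m by auto
  have ext: "is_direct_limit_extension C F ?E"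
    unfolding is_direct_limit_extension_def
    using E presents_preserves_direct_limits[OF q m(1,2)] fp.presents_unique[OF q' p] by blast
  then have ext': "is_direct_limit_extension C F (direct_limit_extension C F)"
    unfolding direct_limit_extension_def by (rule someI)
  have "carrier (FOb (direct_limit_extension C F) X) = {\<one>\<^bsub>FOb (direct_limit_extension C F) X\<^esub>} \<longleftrightarrow>
    carrier (FOb ?E X) = {\<one>\<^bsub>FOb ?E X\<^esub>}"
    using extension_trivial[OF ext ext' F X] extension_trivial[OF ext' ext F X] by blast
  also have "\<dots> \<longleftrightarrow> (\<forall>x \<in> Mor C A X. FMor ?E A X x e0 = \<one>\<^bsub>FOb ?E X\<^esub>)" (is "?l \<longleftrightarrow> ?r")
  proof
    assume ?l
    then show ?r using functor_closed[OF E o(1) X _ presents_gen[OF q]] by blast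
  next
    assume ?r
    then have "z = \<one>\<^bsub>FOb ?E X\<^esub>" if "z \<in> carrier (FOb ?E X)" for z
      using presents_surj[OF q X that] by metis
    then show ?l using functor_group[OF E X] group.is_monoid monoid.one_closed by blast
  qed
  also have "\<dots> \<longleftrightarrow> (\<forall>x \<in> Mor C A X. factors C A B X f x)"
    using presents_kernel[OF q X] by blast
  finally show ?thesis .
qed

end

section \<open>Exact sequences of presented functors\<close>

text \<open>Pointwise exactness suffices: a transformation killed by \<open>t\<close> lifts
  elementwise through the injective \<open>s\<close>, and one that kills \<open>s\<close> descends
  elementwise along the surjective \<open>t\<close>. Injectivity in the first case and exactness in
  the second make the chosen elements form a natural transformation.\<close>

lemma short_exact_functorI:
  assumes F: "additive_functor C Ab F" and G: "additive_functor C Ab G" and H: "additive_functor C Ab H"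
    and s: "s \<in> nat_trans C Ab F G" and t: "t \<in> nat_trans C Ab G H"
    and inj: "\<And>X x. \<lbrakk>X \<in> Obj C; x \<in> carrier (FOb F X); s X x = \<one>\<^bsub>FOb G X\<^esub>\<rbrakk> \<Longrightarrow> x = \<one>\<^bsub>FOb F X\<^esub>"
    and exact: "\<And>X y. \<lbrakk>X \<in> Obj C; y \<in> carrier (FOb G X)\<rbrakk>
      \<Longrightarrow> t X y = \<one>\<^bsub>FOb H X\<^esub> \<longleftrightarrow> (\<exists>x \<in> carrier (FOb F X). y = s X x)"
    and surj: "\<And>X z. \<lbrakk>X \<in> Obj C; z \<in> carrier (FOb H X)\<rbrakk> \<Longrightarrow> \<exists>y \<in> carrier (FOb G X). z = t X y"
  shows "short_exact (functor_category C Ab) F G H s t"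
proof -
  let ?K = "functor_category C Ab"
  have sh: "group_hom (FOb F X) (FOb G X) (s X)" and th: "group_hom (FOb G X) (FOb H X) (t X)" if "X \<in> Obj C" for X
    using that functor_group F G H nat_trans_hom s t by (auto intro!: group_hom.intro group_hom_axioms.intro)
  have s_inj: "x = x'" if X: "X \<in> Obj C" and x: "x \<in> carrier (FOb F X)" "x' \<in> carrier (FOb F X)" "s X x = s X x'" for X x x'
  proof -
    interpret group_hom "FOb F X" "FOb G X" "s X" using sh[OF X] .
    have s1: "s X (x \<otimes>\<^bsub>FOb F X\<^esub> inv\<^bsub>FOb F X\<^esub> x') = \<one>\<^bsub>FOb G X\<^esub>" using x by simp
    have "x \<otimes>\<^bsub>FOb F X\<^esub> inv\<^bsub>FOb F X\<^esub> x' = \<one>\<^bsub>FOb F X\<^esub>" by (rule inj[OF X _ s1]) (use x in simp)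
    then show ?thesis using x G.mult_inv_eq_one_iff by simp
  qed
  have ts: "Cmp ?K F G H t s = zero_mor ?K F H"
    by (rule nat_trans_eqI[OF Cmp_nat_trans[OF F G H s t] zero_nat_trans[OF F H]])
      (use exact nat_trans_closed[OF s] in auto)
  have "is_kernel ?K F G H s t"
    unfolding is_kernel_def Obj_functor_category Mor_functor_category
  proof (intro conjI ballI impI F s ts)
    fix T h assume T: "T \<in> Obj ?K" and h: "h \<in> nat_trans C Ab T G" and th0: "Cmp ?K T G H t h = zero_mor ?K T H"
    from T have T: "additive_functor C Ab T" by simp
    have im: "\<exists>x \<in> carrier (FOb F X). h X w = s X x" if "X \<in> Obj C" "w \<in> carrier (FOb T X)" for X w
    proof -
      have "Cmp ?K T G H t h X w = zero_mor ?K T H X w" using th0 by simp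
      then show ?thesis using that exact[OF that(1)] nat_trans_closed[OF h that] by simp
    qed
    define l where "l X w = (SOME x. x \<in> carrier (FOb F X) \<and> h X w = s X x)" for X w
    have l: "l X w \<in> carrier (FOb F X)" "s X (l X w) = h X w" if "X \<in> Obj C" "w \<in> carrier (FOb T X)" for X w
    proof -
      have "\<exists>x. x \<in> carrier (FOb F X) \<and> h X w = s X x" using im[OF that] by blast
      from someI_ex[OF this] show "l X w \<in> carrier (FOb F X)" "s X (l X w) = h X w" unfolding l_def by auto
    qed
    have lN: "ab_nat C T l \<in> nat_trans C Ab T F"
    proof (rule ab_nat_in[OF _ _ T F])
      fix X assume X: "X \<in> Obj C"
      interpret F: group "FOb F X" using functor_group[OF F X] .
      interpret T: group "FOb T X" using functor_group[OF T X] .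
      show "l X \<in> hom (FOb T X) (FOb F X)"
      proof (rule homI)
        fix w w' assume w: "w \<in> carrier (FOb T X)" "w' \<in> carrier (FOb T X)"
        show "l X (w \<otimes>\<^bsub>FOb T X\<^esub> w') = l X w \<otimes>\<^bsub>FOb F X\<^esub> l X w'"
          by (rule s_inj[OF X])
            (use w l[OF X] nat_trans_mult[OF s X] nat_trans_mult[OF h X] in simp_all)
      qed (use l X in blast)
    next
      fix X Y f w assume X: "X \<in> Obj C" "Y \<in> Obj C" "f \<in> Mor C X Y" and w: "w \<in> carrier (FOb T X)"
      show "l Y (FMor T X Y f w) = FMor F X Y f (l X w)"
        by (rule s_inj[OF X(2)])
          (use w l X functor_closed[OF T X w] functor_closed[OF F X] nat_trans_natural[OF s X] nat_trans_natural[OF h X w] in simp_all)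
    qed
    show "\<exists>!l. l \<in> nat_trans C Ab T F \<and> Cmp ?K T F G s l = h"
    proof (rule ex1I[of _ "ab_nat C T l"])
      show "ab_nat C T l \<in> nat_trans C Ab T F \<and> Cmp ?K T F G s (ab_nat C T l) = h"
        using lN l by (auto intro!: nat_trans_eqI[OF Cmp_nat_trans[OF T F G lN s] h])
      fix l' assume l': "l' \<in> nat_trans C Ab T F \<and> Cmp ?K T F G s l' = h"
      show "l' = ab_nat C T l"
      proof (rule nat_trans_eqI[OF conjunct1[OF l'] lN])
        fix X x assume X: "X \<in> Obj C" and x: "x \<in> carrier (FOb T X)"
        have "s X (l' X x) = Cmp ?K T F G s l' X x" using X x by simp
        then have "s X (l' X x) = h X x" using l' by simp
        then show "l' X x = ab_nat C T l X x"
          using s_inj[OF X] l[OF X x] nat_trans_closed[OF conjunct1[OF l'] X x] X x by simp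
      qed
    qed
  qed
  moreover have "is_cokernel ?K F G H s t"
    unfolding is_cokernel_def Obj_functor_category Mor_functor_category
  proof (intro conjI ballI impI H t ts)
    fix T h assume T: "T \<in> Obj ?K" and h: "h \<in> nat_trans C Ab G T" and hs: "Cmp ?K F G T h s = zero_mor ?K F T"
    from T have T: "additive_functor C Ab T" by simp
    have hs0: "h X (s X x) = \<one>\<^bsub>FOb T X\<^esub>" if "X \<in> Obj C" "x \<in> carrier (FOb F X)" for X x
    proof -
      have "Cmp ?K F G T h s X x = zero_mor ?K F T X x" using hs by simp
      then show ?thesis using that by simp
    qed
    have wd: "h X y = h X y'" if X: "X \<in> Obj C" and y: "y \<in> carrier (FOb G X)" "y' \<in> carrier (FOb G X)" "t X y = t X y'" for X y y'
    proof -
      interpret tX: group_hom "FOb G X" "FOb H X" "t X" using th[OF X] .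
      interpret hX: group_hom "FOb G X" "FOb T X" "h X"
        using functor_group[OF G X] functor_group[OF T X] nat_trans_hom[OF h X] by (intro group_hom.intro group_hom_axioms.intro)
      have "t X (y \<otimes>\<^bsub>FOb G X\<^esub> inv\<^bsub>FOb G X\<^esub> y') = \<one>\<^bsub>FOb H X\<^esub>" using y by simp
      then obtain x where "x \<in> carrier (FOb F X)" "y \<otimes>\<^bsub>FOb G X\<^esub> inv\<^bsub>FOb G X\<^esub> y' = s X x"
        using exact[OF X, of "y \<otimes>\<^bsub>FOb G X\<^esub> inv\<^bsub>FOb G X\<^esub> y'"] y by auto
      then have "h X (y \<otimes>\<^bsub>FOb G X\<^esub> inv\<^bsub>FOb G X\<^esub> y') = \<one>\<^bsub>FOb T X\<^esub>" using hs0[OF X] by simp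
      then show ?thesis using y hX.H.mult_inv_eq_one_iff[of "h X y" "h X y'"] by simp
    qed
    define l where "l X z = h X (SOME y. y \<in> carrier (FOb G X) \<and> z = t X y)" for X z
    have l: "l X (t X y) = h X y" if X: "X \<in> Obj C" and y: "y \<in> carrier (FOb G X)" for X y
    proof -
      have "\<exists>y'. y' \<in> carrier (FOb G X) \<and> t X y = t X y'" using y by blast
      note y' = someI_ex[OF this]
      show ?thesis unfolding l_def by (rule wd[OF X conjunct1[OF y'] y conjunct2[OF y', symmetric]])
    qed
    have lN: "ab_nat C H l \<in> nat_trans C Ab H T"
    proof (rule ab_nat_in[OF _ _ H T])
      fix X assume X: "X \<in> Obj C"
      interpret G: group "FOb G X" using functor_group[OF G X] .
      show "l X \<in> hom (FOb H X) (FOb T X)"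
      proof (rule homI)
        fix z assume "z \<in> carrier (FOb H X)"
        then obtain y where "y \<in> carrier (FOb G X)" "z = t X y" using surj[OF X] by blast
        then show "l X z \<in> carrier (FOb T X)" using l[OF X] nat_trans_closed[OF h X] by simp
      next
        fix z z' assume "z \<in> carrier (FOb H X)" "z' \<in> carrier (FOb H X)"
        then obtain y y' where y: "y \<in> carrier (FOb G X)" "z = t X y" "y' \<in> carrier (FOb G X)" "z' = t X y'"
          using surj[OF X] by metis
        have zz': "z \<otimes>\<^bsub>FOb H X\<^esub> z' = t X (y \<otimes>\<^bsub>FOb G X\<^esub> y')" using y nat_trans_mult[OF t X] by simp
        show "l X (z \<otimes>\<^bsub>FOb H X\<^esub> z') = l X z \<otimes>\<^bsub>FOb T X\<^esub> l X z'"
          unfolding zz' using l[OF X G.m_closed[OF y(1,3)]] l[OF X] y nat_trans_mult[OF h X] by simp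
      qed
    next
      fix X Y f z assume X: "X \<in> Obj C" "Y \<in> Obj C" "f \<in> Mor C X Y" and "z \<in> carrier (FOb H X)"
      then obtain y where y: "y \<in> carrier (FOb G X)" "z = t X y" using surj by blast
      then show "l Y (FMor H X Y f z) = FMor T X Y f (l X z)"
        using l[OF X(1)] l[OF X(2) functor_closed[OF G X y(1)]] nat_trans_natural[OF t X y(1)] nat_trans_natural[OF h X y(1)] by simp
    qed
    show "\<exists>!l. l \<in> nat_trans C Ab H T \<and> Cmp ?K G H T l t = h"
    proof (rule ex1I[of _ "ab_nat C H l"])
      show "ab_nat C H l \<in> nat_trans C Ab H T \<and> Cmp ?K G H T (ab_nat C H l) t = h"
        using lN l nat_trans_closed[OF t] by (auto intro!: nat_trans_eqI[OF Cmp_nat_trans[OF G H T t lN] h])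
      fix l' assume l': "l' \<in> nat_trans C Ab H T \<and> Cmp ?K G H T l' t = h"
      show "l' = ab_nat C H l"
      proof (rule nat_trans_eqI[OF conjunct1[OF l'] lN])
        fix X z assume X: "X \<in> Obj C" and z: "z \<in> carrier (FOb H X)"
        then obtain y where y: "y \<in> carrier (FOb G X)" "z = t X y" using surj by blast
        have "l' X z = Cmp ?K G H T l' t X y" using X y by simp
        then show "l' X z = ab_nat C H l X z"
          using l' l[OF X y(1)] X y z by simp
      qed
    qed
  qed
  ultimately show ?thesis using F G H unfolding short_exact_def by simp
qed

text \<open>In a full subcategory the universal properties are tested against fewer objects.\<close>

lemma short_exact_full_subcategory:
  assumes "short_exact K X Y Z f g" "X \<in> P" "Y \<in> P" "Z \<in> P"
  shows "short_exact (full_subcategory K P) X Y Z f g"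
  using assms unfolding short_exact_def is_kernel_def is_cokernel_def full_subcategory_def by simp

text \<open>\<open>F2\<close> and \<open>F3\<close> are quotients of the same \<open>(A,-)\<close>,
  and the map from \<open>F1\<close> sends the generator \<open>e1\<close> to the translate of
  \<open>e2\<close> along \<open>k\<close>. Condition \<open>a\<close> says that this map is well
  defined and injective, condition \<open>b\<close> that the relations of \<open>F3\<close> are
  those of \<open>F2\<close> together with the image of \<open>F1\<close>.\<close>

lemma (in preadditive_category) presents_short_exact:
  assumes p1: "presents C A1 B1 f1 F1 e1" and p2: "presents C A B2 f2 F2 e2" and p3: "presents C A B3 f3 F3 e3"
    and k: "k \<in> Mor C A A1"
    and a: "\<And>W x. \<lbrakk>W \<in> Obj C; x \<in> Mor C A1 W\<rbrakk> \<Longrightarrow> factors C A B2 W f2 (Cmp C A A1 W x k) \<longleftrightarrow> factors C A1 B1 W f1 x"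
    and b: "\<And>W y. \<lbrakk>W \<in> Obj C; y \<in> Mor C A W\<rbrakk> \<Longrightarrow> factors C A B3 W f3 y \<longleftrightarrow>
      (\<exists>x \<in> Mor C A1 W. \<exists>v \<in> Mor C B2 W. y = Cmp C A A1 W x k \<otimes>\<^bsub>Hom C A W\<^esub> Cmp C A B2 W v f2)"
  obtains s t where "short_exact (functor_category C Ab) F1 F2 F3 s t"
proof -
  note F1 = presents_functor[OF p1] and F2 = presents_functor[OF p2] and F3 = presents_functor[OF p3]
  note m1 = presents_Mor[OF p1] and m2 = presents_Mor[OF p2] and m3 = presents_Mor[OF p3]
  note e1 = presents_gen[OF p1] and e2 = presents_gen[OF p2] and e3 = presents_gen[OF p3]
  let ?e = "FMor F2 A A1 k e2"
  have e: "?e \<in> carrier (FOb F2 A1)" using functor_closed[OF F2 m1(1) m1(1)] functor_closed[OF F2 m2(1) m1(1) k e2] by simp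
  have self: "factors C X Y Y f f" if "X \<in> Obj C" "Y \<in> Obj C" "f \<in> Mor C X Y" for X Y f
    unfolding factors_def using that Cmp_Idt_left Idt_Mor by metis
  have xk: "FMor F2 A1 W x ?e = FMor F2 A W (Cmp C A A1 W x k) e2" if "W \<in> Obj C" "x \<in> Mor C A1 W" for W x
    using functor_Cmp[OF F2 m2(1) m1(1) that(1) k that(2) e2] by simp
  have "FMor F2 A1 B1 f1 ?e = \<one>\<^bsub>FOb F2 B1\<^esub>"
    using xk[OF m1(2,3)] a[OF m1(2,3)] self[OF m1] presents_kernel[OF p2 m1(2)] Cmp_Mor[OF m2(1) m1(1,2) k m1(3)] by simp
  then obtain s where s: "s \<in> nat_trans C Ab F1 F2" "s A1 e1 = ?e"
    using presents_universal[OF p1 F2 e] by blast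
  have "factors C A B3 B2 f3 f2"
  proof -
    interpret G: group "Hom C A B2" using Hom_group m2 by blast
    have "f2 = Cmp C A A1 B2 (zero_mor C A1 B2) k \<otimes>\<^bsub>Hom C A B2\<^esub> Cmp C A B2 B2 (Idt C B2) f2"
      using m1 m2 k by (simp add: Cmp_Idt_left)
    then show ?thesis using b[OF m2(2,3)] m1 m2 Idt_Mor zero_Mor by blast
  qed
  then have "FMor F3 A B2 f2 e3 = \<one>\<^bsub>FOb F3 B2\<^esub>"
    using presents_kernel[OF p3 m2(2,3)] by simp
  then obtain t where t: "t \<in> nat_trans C Ab F2 F3" "t A e2 = e3"
    using presents_universal[OF p2 F3 e3] by blast
  have s_eq: "s W (FMor F1 A1 W x e1) = FMor F2 A W (Cmp C A A1 W x k) e2" if "W \<in> Obj C" "x \<in> Mor C A1 W" for W x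
    using presents_nat_trans_apply[OF p1 s(1) that] s(2) xk[OF that] by simp
  have t_eq: "t W (FMor F2 A W y e2) = FMor F3 A W y e3" if "W \<in> Obj C" "y \<in> Mor C A W" for W y
    using presents_nat_trans_apply[OF p2 t(1) that] t(2) by simp
  have "short_exact (functor_category C Ab) F1 F2 F3 s t"
  proof (rule short_exact_functorI[OF F1 F2 F3 s(1) t(1)])
    fix W z assume W: "W \<in> Obj C" and z: "z \<in> carrier (FOb F1 W)" and sz: "s W z = \<one>\<^bsub>FOb F2 W\<^esub>"
    obtain x where x: "x \<in> Mor C A1 W" "z = FMor F1 A1 W x e1" using presents_surj[OF p1 W z] by blast
    have "factors C A B2 W f2 (Cmp C A A1 W x k)"
      using sz s_eq[OF W x(1)] x presents_kernel[OF p2 W Cmp_Mor[OF m2(1) m1(1) W k x(1)]] by simp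
    then show "z = \<one>\<^bsub>FOb F1 W\<^esub>" using a[OF W x(1)] presents_kernel[OF p1 W x(1)] x(2) by simp
  next
    fix W z assume W: "W \<in> Obj C" and z: "z \<in> carrier (FOb F3 W)"
    obtain y where y: "y \<in> Mor C A W" "z = FMor F3 A W y e3" using presents_surj[OF p3 W z] by blast
    then show "\<exists>y\<in>carrier (FOb F2 W). z = t W y"
      using t_eq[OF W y(1)] functor_closed[OF F2 m2(1) W y(1) e2] by metis
  next
    fix W z assume W: "W \<in> Obj C" and z: "z \<in> carrier (FOb F2 W)"
    obtain y where y: "y \<in> Mor C A W" "z = FMor F2 A W y e2" using presents_surj[OF p2 W z] by blast
    interpret G: group "FOb F2 W" using functor_group[OF F2 W] .
    have "t W z = \<one>\<^bsub>FOb F3 W\<^esub> \<longleftrightarrow> factors C A B3 W f3 y"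
      using t_eq[OF W y(1)] y presents_kernel[OF p3 W y(1)] by simp
    also have "\<dots> \<longleftrightarrow> (\<exists>x \<in> Mor C A1 W. \<exists>v \<in> Mor C B2 W. y = Cmp C A A1 W x k \<otimes>\<^bsub>Hom C A W\<^esub> Cmp C A B2 W v f2)"
      by (rule b[OF W y(1)])
    also have "\<dots> \<longleftrightarrow> (\<exists>x \<in> Mor C A1 W. z = s W (FMor F1 A1 W x e1))" (is "?l \<longleftrightarrow> ?r")
    proof
      assume ?l
      then obtain x v where x: "x \<in> Mor C A1 W" "v \<in> Mor C B2 W" "y = Cmp C A A1 W x k \<otimes>\<^bsub>Hom C A W\<^esub> Cmp C A B2 W v f2" by blast
      have vM: "Cmp C A B2 W v f2 \<in> Mor C A W" and xM: "Cmp C A A1 W x k \<in> Mor C A W"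
        using Cmp_Mor m1 m2 W x k by blast+
      have "FMor F2 A W (Cmp C A B2 W v f2) e2 = \<one>\<^bsub>FOb F2 W\<^esub>"
        using presents_kernel[OF p2 W vM] x(2) unfolding factors_def by blast
      then have "z = s W (FMor F1 A1 W x e1)"
        using s_eq[OF W x(1)] y(2) x(3) functor_add[OF F2 m2(1) W xM vM e2] functor_closed[OF F2 m2(1) W xM e2] by simp
      then show ?r using x by blast
    next
      assume ?r
      then obtain x where x: "x \<in> Mor C A1 W" "z = s W (FMor F1 A1 W x e1)" by blast
      interpret A: comm_group "Hom C A W" using Hom_comm_group m2 W by blast
      let ?x = "Cmp C A A1 W x k"
      have xM: "?x \<in> Mor C A W" using Cmp_Mor m1 m2 W x k by blast
      interpret eh: group_hom "Hom C A W" "FOb F2 W" "\<lambda>y. FMor F2 A W y e2"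
        using functor_eval_hom[OF F2 m2(1) W e2] functor_group[OF F2 W] A.is_group by (intro group_hom.intro group_hom_axioms.intro)
      have "FMor F2 A W (y \<otimes>\<^bsub>Hom C A W\<^esub> inv\<^bsub>Hom C A W\<^esub> ?x) e2 = \<one>\<^bsub>FOb F2 W\<^esub>"
        using s_eq[OF W x(1)] x(2) y xM z by simp
      then obtain v where v: "v \<in> Mor C B2 W" "y \<otimes>\<^bsub>Hom C A W\<^esub> inv\<^bsub>Hom C A W\<^esub> ?x = Cmp C A B2 W v f2"
        using presents_kernel[OF p2 W] y xM unfolding factors_def by (metis A.inv_closed A.m_closed)
      have "y = ?x \<otimes>\<^bsub>Hom C A W\<^esub> (y \<otimes>\<^bsub>Hom C A W\<^esub> inv\<^bsub>Hom C A W\<^esub> ?x)"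
        using y xM A.m_lcomm[of ?x y "inv\<^bsub>Hom C A W\<^esub> ?x"] by simp
      then show ?l using x v by metis
    qed
    also have "\<dots> \<longleftrightarrow> (\<exists>x\<in>carrier (FOb F1 W). z = s W x)"
      using presents_surj[OF p1 W] functor_closed[OF F1 m1(1) W _ e1] by metis
    finally show "t W z = \<one>\<^bsub>FOb F3 W\<^esub> \<longleftrightarrow> (\<exists>x\<in>carrier (FOb F1 W). z = s W x)" .
  qed
  then show thesis by (rule that)
qed

section \<open>The morphisms annihilated by a Serre subcategory\<close>

text \<open>\<open>fp_biproduct\<close> will come from the additivity of
  \<open>fp_category C\<close>, which is part of its monoidal structure.\<close>

locale finitely_accessible_products = finitely_accessible_universe C
  for C :: "('o, 'u) category" +
  assumes products: "has_products C"
    and fp_biproduct: "\<lbrakk>B \<in> fp_objects C; B' \<in> fp_objects C\<rbrakk> \<Longrightarrow> \<exists>R i j p q. biproduct (fp_category C) B B' R i j p q"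
begin

lemma fp_functors_iff: "F \<in> fp_functors C \<longleftrightarrow> (\<exists>A B f e. presents (fp_category C) A B f F e)"
proof
  assume "F \<in> fp_functors C"
  then obtain A B s q where "A \<in> fp_objects C" "B \<in> fp_objects C"
    "s \<in> nat_trans (fp_category C) Ab (representable C B) (representable C A)"
    "is_cokernel (functor_category (fp_category C) Ab) (representable C B) (representable C A) F s q"
    unfolding fp_functors_def by auto
  then show "\<exists>A B f e. presents (fp_category C) A B f F e"
    using fp.cokernel_presents[of A B s F q] by auto
next
  assume "\<exists>A B f e. presents (fp_category C) A B f F e"
  then obtain A B f e where p: "presents (fp_category C) A B f F e" by blast
  show "F \<in> fp_functors C"
    using fp.presents_is_cokernel[OF p] presents_Mor[OF p] unfolding fp_functors_def by auto
qed

lemma Obj_fp_mod: "F \<in> Obj (fp_mod C) \<longleftrightarrow> (\<exists>A B f e. presents (fp_category C) A B f F e)"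
  unfolding fp_mod_def full_subcategory_def using fp_functors_iff presents_functor by auto

lemma fp_biproduct':
  assumes "B \<in> fp_objects C" "B' \<in> fp_objects C"
  obtains R i j p q where "R \<in> fp_objects C" "biproduct C B B' R i j p q"
  using fp_biproduct[OF assms] that by (force simp: biproduct_def fp_objects_Obj)

end

locale serre_setting = finitely_accessible_products C
  for C :: "('o, 'u) category" +
  fixes S :: "('o, 'u) abfunctor set"
  assumes serre: "serre_subcategory (fp_mod C) S"
begin

text \<open>Membership in \<open>S\<close> is handled through presenting morphisms: \<open>f\<close>
  is annihilated when \<open>(f,-)\<close> becomes an epimorphism modulo \<open>S\<close>. That the
  particular cokernel \<open>Cok\<close> does not matter is shown in
  \<open>presents_annihilated\<close>.\<close>

definition annihilated :: "'o \<Rightarrow> 'o \<Rightarrow> 'u \<Rightarrow> bool" where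
  "annihilated A B f \<longleftrightarrow> A \<in> fp_objects C \<and> B \<in> fp_objects C \<and> f \<in> Mor C A B \<and> Cok C A B f \<in> S"

lemma annihilatedD:
  assumes "annihilated A B f"
  shows "A \<in> fp_objects C" "B \<in> fp_objects C" "f \<in> Mor C A B" "A \<in> Obj C" "B \<in> Obj C"
  using assms by (simp_all add: annihilated_def fp_objects_Obj)

lemma presents_serre_iff:
  assumes p1: "presents (fp_category C) A1 B1 f1 F1 e1" and p2: "presents (fp_category C) A B2 f2 F2 e2"
    and p3: "presents (fp_category C) A B3 f3 F3 e3" and k: "k \<in> Mor C A A1"
    and a: "\<And>W x. \<lbrakk>W \<in> fp_objects C; x \<in> Mor C A1 W\<rbrakk> \<Longrightarrow> factors C A B2 W f2 (Cmp C A A1 W x k) \<longleftrightarrow> factors C A1 B1 W f1 x"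
    and b: "\<And>W y. \<lbrakk>W \<in> fp_objects C; y \<in> Mor C A W\<rbrakk> \<Longrightarrow> factors C A B3 W f3 y \<longleftrightarrow>
      (\<exists>x \<in> Mor C A1 W. \<exists>v \<in> Mor C B2 W. y = Cmp C A A1 W x k \<otimes>\<^bsub>Hom C A W\<^esub> Cmp C A B2 W v f2)"
  shows "F2 \<in> S \<longleftrightarrow> F1 \<in> S \<and> F3 \<in> S"
proof -
  obtain s t where "short_exact (functor_category (fp_category C) Ab) F1 F2 F3 s t"
    using fp.presents_short_exact[OF p1 p2 p3, of k] k a b by auto
  then have "short_exact (fp_mod C) F1 F2 F3 s t"
    unfolding fp_mod_def using fp_functors_iff p1 p2 p3 by (intro short_exact_full_subcategory) blast+
  then show ?thesis using serre unfolding serre_subcategory_def by blast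
qed

lemma fp_Cok_presents:
  assumes "A \<in> fp_objects C" "B \<in> fp_objects C" "f \<in> Mor C A B"
  obtains e where "presents (fp_category C) A B f (Cok C A B f) e"
  using fp.Cok_presents[of A B f] assms by auto

lemma factors_Idt: "\<lbrakk>A \<in> Obj C; W \<in> Obj C; x \<in> Mor C A W\<rbrakk> \<Longrightarrow> factors C A A W (Idt C A) x"
  unfolding factors_def by (metis Cmp_Idt_right)

text \<open>The functor presented by an identity is zero. Some \<open>F\<close> lies in
  \<open>S\<close>; the exact sequence from \<open>F\<close> identically to \<open>F\<close> with
  zero quotient puts one zero functor into \<open>S\<close>, and an exact sequence of zero functors
  then puts in those presented by the other identities.\<close>

lemma Cok_Idt_serre:
  assumes A: "A \<in> fp_objects C"
  shows "Cok C A A (Idt C A) \<in> S"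
proof -
  obtain F where "F \<in> S" "F \<in> Obj (fp_mod C)" using serre unfolding serre_subcategory_def by blast
  then obtain A0 B0 f0 e0 where p: "presents (fp_category C) A0 B0 f0 F e0" using Obj_fp_mod by blast
  note m = presents_Mor[OF p, simplified]
  have o: "A0 \<in> Obj C" "B0 \<in> Obj C" "A \<in> Obj C" using m A by (simp_all add: fp_objects_Obj)
  obtain e1 where p1: "presents (fp_category C) A0 A0 (Idt C A0) (Cok C A0 A0 (Idt C A0)) e1"
    using fp_Cok_presents[OF m(1) m(1) Idt_Mor[OF o(1)]] by blast
  obtain e2 where p2: "presents (fp_category C) A A (Idt C A) (Cok C A A (Idt C A)) e2"
    using fp_Cok_presents[OF A A Idt_Mor[OF o(3)]] by blast
  have "F \<in> S \<longleftrightarrow> F \<in> S \<and> Cok C A0 A0 (Idt C A0) \<in> S"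
  proof (rule presents_serre_iff[OF p p p1 Idt_Mor[OF o(1)]])
    fix W x assume W: "W \<in> fp_objects C" and x: "x \<in> Mor C A0 W"
    have oW: "W \<in> Obj C" using W by (rule fp_objects_Obj)
    show "factors C A0 B0 W f0 (Cmp C A0 A0 W x (Idt C A0)) = factors C A0 B0 W f0 x"
      using x o oW by (simp add: Cmp_Idt_right)
    interpret G: comm_group "Hom C A0 W" using Hom_comm_group o oW by blast
    have "x = Cmp C A0 A0 W x (Idt C A0) \<otimes>\<^bsub>Hom C A0 W\<^esub> Cmp C A0 B0 W (zero_mor C B0 W) f0"
      using x o oW m by (simp add: Cmp_Idt_right)
    then show "factors C A0 A0 W (Idt C A0) x \<longleftrightarrow>
      (\<exists>y \<in> Mor C A0 W. \<exists>v \<in> Mor C B0 W. x = Cmp C A0 A0 W y (Idt C A0) \<otimes>\<^bsub>Hom C A0 W\<^esub> Cmp C A0 B0 W v f0)"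
      using x factors_Idt[OF o(1) oW x] zero_Mor[OF o(2) oW] by blast
  qed
  moreover have "Cok C A0 A0 (Idt C A0) \<in> S \<longleftrightarrow> Cok C A A (Idt C A) \<in> S \<and> Cok C A0 A0 (Idt C A0) \<in> S"
  proof (rule presents_serre_iff[OF p2 p1 p1 zero_Mor[OF o(1,3)]])
    fix W x assume W: "W \<in> fp_objects C" and x: "x \<in> Mor C A W"
    have oW: "W \<in> Obj C" using W by (rule fp_objects_Obj)
    show "factors C A0 A0 W (Idt C A0) (Cmp C A0 A W x (zero_mor C A0 A)) = factors C A A W (Idt C A) x"
      using factors_Idt o oW x Cmp_Mor zero_Mor by simp
  next
    fix W y assume W: "W \<in> fp_objects C" and y: "y \<in> Mor C A0 W"
    have oW: "W \<in> Obj C" using W by (rule fp_objects_Obj)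
    interpret G: comm_group "Hom C A0 W" using Hom_comm_group o oW by blast
    have "y = Cmp C A0 A W (zero_mor C A W) (zero_mor C A0 A) \<otimes>\<^bsub>Hom C A0 W\<^esub> Cmp C A0 A0 W y (Idt C A0)"
      using y o oW m by (simp add: Cmp_Idt_right)
    then show "factors C A0 A0 W (Idt C A0) y \<longleftrightarrow>
      (\<exists>x \<in> Mor C A W. \<exists>v \<in> Mor C A0 W. y = Cmp C A0 A W x (zero_mor C A0 A) \<otimes>\<^bsub>Hom C A0 W\<^esub> Cmp C A0 A0 W v (Idt C A0))"
      using y factors_Idt[OF o(1) oW y] zero_Mor[OF o(3) oW] by blast
  qed
  ultimately show ?thesis using \<open>F \<in> S\<close> by blast
qed

lemma annihilated_Idt: "A \<in> fp_objects C \<Longrightarrow> annihilated A A (Idt C A)"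
  by (simp add: annihilated_def Cok_Idt_serre Idt_Mor fp_objects_Obj)

text \<open>Short exact sequences of cokernels, with \<open>k\<close> inducing the monomorphism.\<close>

lemma presents_annihilated_short_exact:
  assumes p: "presents (fp_category C) A B2 f2 F e"
    and m: "A1 \<in> fp_objects C" "B1 \<in> fp_objects C" "f1 \<in> Mor C A1 B1" "B3 \<in> fp_objects C" "f3 \<in> Mor C A B3" "k \<in> Mor C A A1"
    and a: "\<And>W x. \<lbrakk>W \<in> fp_objects C; x \<in> Mor C A1 W\<rbrakk> \<Longrightarrow> factors C A B2 W f2 (Cmp C A A1 W x k) \<longleftrightarrow> factors C A1 B1 W f1 x"
    and b: "\<And>W y. \<lbrakk>W \<in> fp_objects C; y \<in> Mor C A W\<rbrakk> \<Longrightarrow> factors C A B3 W f3 y \<longleftrightarrow>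
      (\<exists>x \<in> Mor C A1 W. \<exists>v \<in> Mor C B2 W. y = Cmp C A A1 W x k \<otimes>\<^bsub>Hom C A W\<^esub> Cmp C A B2 W v f2)"
  shows "F \<in> S \<longleftrightarrow> annihilated A1 B1 f1 \<and> annihilated A B3 f3"
proof -
  note n = presents_Mor[OF p, simplified]
  obtain e1 where p1: "presents (fp_category C) A1 B1 f1 (Cok C A1 B1 f1) e1"
    using fp_Cok_presents[OF m(1-3)] by blast
  obtain e3 where p3: "presents (fp_category C) A B3 f3 (Cok C A B3 f3) e3"
    using fp_Cok_presents[OF n(1) m(4,5)] by blast
  show ?thesis
    using presents_serre_iff[OF p1 p p3 m(6) a b] m n unfolding annihilated_def by blast
qed

lemma annihilated_short_exact:
  assumes m: "A \<in> fp_objects C" "B2 \<in> fp_objects C" "f2 \<in> Mor C A B2"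
    "A1 \<in> fp_objects C" "B1 \<in> fp_objects C" "f1 \<in> Mor C A1 B1" "B3 \<in> fp_objects C" "f3 \<in> Mor C A B3" "k \<in> Mor C A A1"
    and a: "\<And>W x. \<lbrakk>W \<in> fp_objects C; x \<in> Mor C A1 W\<rbrakk> \<Longrightarrow> factors C A B2 W f2 (Cmp C A A1 W x k) \<longleftrightarrow> factors C A1 B1 W f1 x"
    and b: "\<And>W y. \<lbrakk>W \<in> fp_objects C; y \<in> Mor C A W\<rbrakk> \<Longrightarrow> factors C A B3 W f3 y \<longleftrightarrow>
      (\<exists>x \<in> Mor C A1 W. \<exists>v \<in> Mor C B2 W. y = Cmp C A A1 W x k \<otimes>\<^bsub>Hom C A W\<^esub> Cmp C A B2 W v f2)"
  shows "annihilated A B2 f2 \<longleftrightarrow> annihilated A1 B1 f1 \<and> annihilated A B3 f3"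
proof -
  obtain e where p: "presents (fp_category C) A B2 f2 (Cok C A B2 f2) e"
    using fp_Cok_presents[OF m(1-3)] by blast
  show ?thesis
    using presents_annihilated_short_exact[OF p m(4-9) a b] m(1-3) unfolding annihilated_def by blast
qed

text \<open>An isomorphism is a short exact sequence with zero third term. Condition
  \<open>l\<close> makes the map induced by \<open>k\<close> surjective, so its cokernel is
  presented by the identity of \<open>A\<close>.\<close>

lemma presents_annihilated_iso:
  assumes p: "presents (fp_category C) A B f F e"
    and m: "A1 \<in> fp_objects C" "B1 \<in> fp_objects C" "f1 \<in> Mor C A1 B1" "k \<in> Mor C A A1"
    and l: "\<And>W y. \<lbrakk>W \<in> fp_objects C; y \<in> Mor C A W\<rbrakk> \<Longrightarrow> \<exists>x \<in> Mor C A1 W. y = Cmp C A A1 W x k"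
    and a: "\<And>W x. \<lbrakk>W \<in> fp_objects C; x \<in> Mor C A1 W\<rbrakk> \<Longrightarrow> factors C A B W f (Cmp C A A1 W x k) \<longleftrightarrow> factors C A1 B1 W f1 x"
  shows "F \<in> S \<longleftrightarrow> annihilated A1 B1 f1"
proof -
  note n = presents_Mor[OF p, simplified]
  have o: "A \<in> Obj C" "B \<in> Obj C" "A1 \<in> Obj C" using m n by (simp_all add: fp_objects_Obj)
  have "F \<in> S \<longleftrightarrow> annihilated A1 B1 f1 \<and> annihilated A A (Idt C A)"
  proof (rule presents_annihilated_short_exact[OF p m(1-3) n(1) Idt_Mor[OF o(1)] m(4) a])
    fix W y assume W: "W \<in> fp_objects C" and y: "y \<in> Mor C A W"
    have oW: "W \<in> Obj C" using W by (rule fp_objects_Obj)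
    interpret G: comm_group "Hom C A W" using Hom_comm_group o oW by blast
    obtain x where x: "x \<in> Mor C A1 W" "y = Cmp C A A1 W x k" using l[OF W y] by blast
    then have "y = Cmp C A A1 W x k \<otimes>\<^bsub>Hom C A W\<^esub> Cmp C A B W (zero_mor C B W) f"
      using o oW n y by simp
    then show "factors C A A W (Idt C A) y \<longleftrightarrow>
      (\<exists>x \<in> Mor C A1 W. \<exists>v \<in> Mor C B W. y = Cmp C A A1 W x k \<otimes>\<^bsub>Hom C A W\<^esub> Cmp C A B W v f)"
      using x factors_Idt[OF o(1) oW y] zero_Mor[OF o(2) oW] by blast
  qed
  then show ?thesis using annihilated_Idt[OF n(1)] by blast
qed

lemma presents_annihilated:
  assumes p: "presents (fp_category C) A B f F e"
  shows "F \<in> S \<longleftrightarrow> annihilated A B f"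
proof -
  note n = presents_Mor[OF p, simplified]
  have o: "A \<in> Obj C" using n by (simp add: fp_objects_Obj)
  have eq: "Cmp C A A W x (Idt C A) = x" if "W \<in> fp_objects C" "x \<in> Mor C A W" for W x
    using that o by (simp add: Cmp_Idt_right fp_objects_Obj)
  show ?thesis
  proof (rule presents_annihilated_iso[OF p n Idt_Mor[OF o]])
    show "\<exists>x\<in>Mor C A W. y = Cmp C A A W x (Idt C A)" if "W \<in> fp_objects C" "y \<in> Mor C A W" for W y
      using eq[OF that] that(2) by metis
  qed (simp add: eq)
qed

text \<open>The extension of a functor vanishes at \<open>X\<close> exactly when all morphisms from
  \<open>A\<close> to \<open>X\<close> factor through the presenting morphism, so \<open>S\<close>
  may be replaced by its annihilated morphisms.\<close>

lemma definable_of_iff: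
  "X \<in> definable_of C S \<longleftrightarrow> X \<in> Obj C \<and>
    (\<forall>A B f. annihilated A B f \<longrightarrow> (\<forall>x \<in> Mor C A X. factors C A B X f x))"
proof -
  have "(\<forall>F \<in> S. carrier (FOb (direct_limit_extension C F) X) = {\<one>\<^bsub>FOb (direct_limit_extension C F) X\<^esub>})
    \<longleftrightarrow> (\<forall>A B f. annihilated A B f \<longrightarrow> (\<forall>x \<in> Mor C A X. factors C A B X f x))" (is "?l \<longleftrightarrow> ?r")
    if X: "X \<in> Obj C"
  proof
    assume l: ?l
    show ?r
    proof (intro allI impI)
      fix A B f assume f: "annihilated A B f"
      obtain e where p: "presents (fp_category C) A B f (Cok C A B f) e"
        using fp_Cok_presents[OF annihilatedD(1-3)[OF f]] by blast
      then show "\<forall>x \<in> Mor C A X. factors C A B X f x"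
        using direct_limit_extension_trivial_iff[OF p X] l f unfolding annihilated_def by blast
    qed
  next
    assume r: ?r
    show ?l
    proof
      fix F assume F: "F \<in> S"
      then have "F \<in> Obj (fp_mod C)" using serre unfolding serre_subcategory_def by blast
      then obtain A B f e where p: "presents (fp_category C) A B f F e"
        using Obj_fp_mod by blast
      then have "annihilated A B f" using presents_annihilated F by blast
      then show "carrier (FOb (direct_limit_extension C F) X) = {\<one>\<^bsub>FOb (direct_limit_extension C F) X\<^esub>}"
        using direct_limit_extension_trivial_iff[OF p X] r by blast
    qed
  qed
  then show ?thesis unfolding definable_of_def by blast
qed

text \<open>With \<open>c\<close> a weak cokernel of \<open>f\<close> there is an exact sequence of cokernels of
  \<open>([h, c], -)\<close>, \<open>(h f, -)\<close> and \<open>(f, -)\<close>.\<close>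

lemma annihilated_Cmp_iff:
  assumes A: "A \<in> fp_objects C" and B: "B \<in> fp_objects C" and Z: "Z \<in> fp_objects C"
    and f: "f \<in> Mor C A B" and h: "h \<in> Mor C B Z"
  obtains R r where "annihilated A Z (Cmp C A B Z h f) \<longleftrightarrow> annihilated B R r \<and> annihilated A B f"
    "R \<in> fp_objects C" "r \<in> Mor C B R" "factors C B R Z r h"
proof -
  have o: "A \<in> Obj C" "B \<in> Obj C" "Z \<in> Obj C" using A B Z by (simp_all add: fp_objects_Obj)
  obtain D c where "weak_cokernel (fp_category C) A B D f c"
    using weak_cokernel_exists[OF products A B f] by blast
  then have D: "D \<in> fp_objects C" and c: "c \<in> Mor C B D"
    and wc: "\<And>W y. \<lbrakk>W \<in> fp_objects C; y \<in> Mor C B W\<rbrakk> \<Longrightarrow> Cmp C A B W y f = zero_mor C A W \<longleftrightarrow> factors C B D W c y"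
    unfolding weak_cokernel_def by auto
  have oD: "D \<in> Obj C" using D by (rule fp_objects_Obj)
  obtain R i j p q where R: "R \<in> fp_objects C" and bp: "biproduct C Z D R i j p q"
    using fp_biproduct'[OF Z D] by blast
  define r where "r = Cmp C B Z R i h \<otimes>\<^bsub>Hom C B R\<^esub> Cmp C B D R j c"
  note rp = biproduct_pair[OF bp o(2,3) oD h c, folded r_def]
  have hf: "Cmp C A B Z h f \<in> Mor C A Z" using o f h by (blast intro: Cmp_Mor)
  have "annihilated A Z (Cmp C A B Z h f) \<longleftrightarrow> annihilated B R r \<and> annihilated A B f"
  proof (rule annihilated_short_exact[OF A Z hf B R rp(1) B f f])
    fix W x assume W: "W \<in> fp_objects C" and x: "x \<in> Mor C B W"
    have oW: "W \<in> Obj C" using W by (rule fp_objects_Obj)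
    interpret BW: comm_group "Hom C B W" using Hom_comm_group o oW by blast
    interpret AW: comm_group "Hom C A W" using Hom_comm_group o oW by blast
    show "factors C A Z W (Cmp C A B Z h f) (Cmp C A B W x f) = factors C B R W r x" (is "?l \<longleftrightarrow> ?r")
    proof
      assume ?l
      then obtain y where y: "y \<in> Mor C Z W" "Cmp C A B W x f = Cmp C A Z W y (Cmp C A B Z h f)"
        unfolding factors_def by blast
      have yh: "Cmp C B Z W y h \<in> Mor C B W" using o oW h y by (blast intro: Cmp_Mor)
      have xf: "Cmp C A B W x f \<in> Mor C A W" using o oW x f by (blast intro: Cmp_Mor)
      \<comment> \<open>The difference of \<open>x\<close> and \<open>y h\<close> becomes zero when
        composed with \<open>f\<close>, so it factors through the weak cokernel.\<close>
      let ?d = "x \<otimes>\<^bsub>Hom C B W\<^esub> inv\<^bsub>Hom C B W\<^esub> Cmp C B Z W y h"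
      have "Cmp C A B W ?d f = Cmp C A B W x f \<otimes>\<^bsub>Hom C A W\<^esub> inv\<^bsub>Hom C A W\<^esub> Cmp C A B W (Cmp C B Z W y h) f"
        using o oW x yh f by (simp add: Cmp_add_left Cmp_inv_left)
      also have "Cmp C A B W (Cmp C B Z W y h) f = Cmp C A B W x f"
        using y o oW f h by (simp add: Cmp_assoc)
      finally have "factors C B D W c ?d" using wc[OF W] x yh xf by simp
      then obtain y' where y': "y' \<in> Mor C D W" "?d = Cmp C B D W y' c" unfolding factors_def by blast
      have "x = Cmp C B Z W y h \<otimes>\<^bsub>Hom C B W\<^esub> ?d"
        using x yh BW.m_lcomm[of "Cmp C B Z W y h" x "inv\<^bsub>Hom C B W\<^esub> Cmp C B Z W y h"] by simp
      then show ?r unfolding rp(3)[OF oW] using y(1) y' by metis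
    next
      assume ?r
      then obtain y y' where y: "y \<in> Mor C Z W" "y' \<in> Mor C D W"
        "x = Cmp C B Z W y h \<otimes>\<^bsub>Hom C B W\<^esub> Cmp C B D W y' c" unfolding rp(3)[OF oW] by blast
      have M: "Cmp C B Z W y h \<in> Mor C B W" "Cmp C B D W y' c \<in> Mor C B W"
        using o oD oW h c y by (blast intro: Cmp_Mor)+
      have "factors C B D W c (Cmp C B D W y' c)" using y unfolding factors_def by blast
      then have "Cmp C A B W (Cmp C B D W y' c) f = zero_mor C A W" using wc[OF W M(2)] by blast
      then have "Cmp C A B W x f = Cmp C A B W (Cmp C B Z W y h) f"
        unfolding y(3) using o oW f M Cmp_Mor[OF o(1,2) oW f M(1)] by (simp add: Cmp_add_left)
      also have "\<dots> = Cmp C A Z W y (Cmp C A B Z h f)" using o oW f h y by (simp add: Cmp_assoc)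
      finally show ?l using y unfolding factors_def by blast
    qed
  next
    fix W y assume W: "W \<in> fp_objects C" and y: "y \<in> Mor C A W"
    have oW: "W \<in> Obj C" using W by (rule fp_objects_Obj)
    interpret AW: comm_group "Hom C A W" using Hom_comm_group o oW by blast
    show "factors C A B W f y \<longleftrightarrow> (\<exists>x\<in>Mor C B W. \<exists>v\<in>Mor C Z W.
      y = Cmp C A B W x f \<otimes>\<^bsub>Hom C A W\<^esub> Cmp C A Z W v (Cmp C A B Z h f))" (is "?l \<longleftrightarrow> ?r")
    proof
      assume ?l
      then obtain x where x: "x \<in> Mor C B W" "y = Cmp C A B W x f" unfolding factors_def by blast
      then have "y = Cmp C A B W x f \<otimes>\<^bsub>Hom C A W\<^esub> Cmp C A Z W (zero_mor C Z W) (Cmp C A B Z h f)"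
        using o oW hf y by simp
      then show ?r using x o oW zero_Mor by blast
    next
      assume ?r
      then obtain x v where x: "x \<in> Mor C B W" "v \<in> Mor C Z W"
        "y = Cmp C A B W x f \<otimes>\<^bsub>Hom C A W\<^esub> Cmp C A Z W v (Cmp C A B Z h f)" by blast
      have "y = Cmp C A B W (x \<otimes>\<^bsub>Hom C B W\<^esub> Cmp C B Z W v h) f"
        using x o oW f h by (simp add: Cmp_add_left Cmp_assoc Cmp_Mor)
      then show ?l unfolding factors_def using x o oW h by (blast intro: mult_Mor Cmp_Mor)
    qed
  qed
  \<comment> \<open>\<open>h\<close> is the first component of \<open>r\<close>: take the identity
    on it and zero on the other component.\<close>
  moreover have "factors C B R Z r h"
  proof -
    interpret BZ: comm_group "Hom C B Z" using Hom_comm_group o by blast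
    have "h = Cmp C B Z Z (Idt C Z) h \<otimes>\<^bsub>Hom C B Z\<^esub> Cmp C B D Z (zero_mor C D Z) c"
      using o oD h c by (simp add: Cmp_Idt_left)
    then show ?thesis unfolding rp(3)[OF o(3)] using Idt_Mor[OF o(3)] zero_Mor[OF oD o(3)] by blast
  qed
  ultimately show thesis using that R rp(1) by blast
qed

text \<open>The cokernel of \<open>(f,-)\<close> is a quotient of that of
  \<open>(h f,-)\<close>.\<close>

lemma annihilated_right:
  assumes "A \<in> fp_objects C" "B \<in> fp_objects C" "Z \<in> fp_objects C" "f \<in> Mor C A B" "h \<in> Mor C B Z"
    and "annihilated A Z (Cmp C A B Z h f)"
  shows "annihilated A B f"
  using annihilated_Cmp_iff[OF assms(1-5)] assms(6) by metis

lemma annihilated_factors: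
  assumes "annihilated A Z a" "B \<in> fp_objects C" "f \<in> Mor C A B" "factors C A B Z f a"
  shows "annihilated A B f"
  using assms annihilated_right[OF annihilatedD(1)[OF assms(1)] assms(2) annihilatedD(2)[OF assms(1)] assms(3)]
  unfolding factors_def by blast

text \<open>The kernel of the map from the cokernel of \<open>(h f,-)\<close> onto that of
  \<open>(f,-)\<close> is presented by \<open>r\<close>. As \<open>h\<close> factors through
  \<open>r\<close>, it is a quotient of the cokernel of \<open>(h,-)\<close>, and closure of
  \<open>S\<close> under extensions applies.\<close>

lemma annihilated_Cmp:
  assumes f: "annihilated A B f" and h: "annihilated B Z h"
  shows "annihilated A Z (Cmp C A B Z h f)"
proof -
  note mf = annihilatedD[OF f] and mh = annihilatedD[OF h]
  obtain R r where "annihilated A Z (Cmp C A B Z h f) \<longleftrightarrow> annihilated B R r \<and> annihilated A B f"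
    and "R \<in> fp_objects C" "r \<in> Mor C B R" "factors C B R Z r h"
    using annihilated_Cmp_iff[OF mf(1,2) mh(2) mf(3) mh(3)] by blast
  then show ?thesis using annihilated_factors[OF h] f by blast
qed

text \<open>\<open>Z'\<close> is a weak pushout of \<open>g\<close> and \<open>u\<close>, formed as
  a weak cokernel of the morphism \<open>q\<close> into the biproduct with components
  \<open>g\<close> and \<open>u\<close>. Precomposition with \<open>u\<close> embeds the cokernel of
  \<open>(z,-)\<close> into that of \<open>(g,-)\<close>, so the former lies in \<open>S\<close>
  with the latter.\<close>

lemma annihilated_pushout:
  assumes g: "annihilated A D g" and Z: "Z \<in> fp_objects C" and u: "u \<in> Mor C A Z"
  obtains Z' z where "annihilated Z Z' z" "factors C A D Z' g (Cmp C A Z Z' z u)"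
proof -
  note A = annihilatedD(1)[OF g] and D = annihilatedD(2)[OF g] and gM = annihilatedD(3)[OF g]
  have o: "A \<in> Obj C" "D \<in> Obj C" "Z \<in> Obj C" using A D Z by (simp_all add: fp_objects_Obj)
  obtain R i j p' q' where R: "R \<in> fp_objects C" and bp: "biproduct C D Z R i j p' q'"
    using fp_biproduct'[OF D Z] by blast
  define q where "q = Cmp C A D R i g \<otimes>\<^bsub>Hom C A R\<^esub> Cmp C A Z R j u"
  note qp = biproduct_pair[OF bp o gM u, folded q_def]
  obtain Z' c where "weak_cokernel (fp_category C) A R Z' q c"
    using weak_cokernel_exists[OF products A R qp(1)] by blast
  then have Z': "Z' \<in> fp_objects C" and c: "c \<in> Mor C R Z'"
    and wc: "\<And>W y. \<lbrakk>W \<in> fp_objects C; y \<in> Mor C R W\<rbrakk> \<Longrightarrow> Cmp C A R W y q = zero_mor C A W \<longleftrightarrow> factors C R Z' W c y"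
    unfolding weak_cokernel_def by auto
  have oR: "R \<in> Obj C" "Z' \<in> Obj C" using R Z' by (simp_all add: fp_objects_Obj)
  have ij: "i \<in> Mor C D R" "j \<in> Mor C Z R" using bp unfolding biproduct_def by auto
  define z where "z = Cmp C Z R Z' c j"
  have z: "z \<in> Mor C Z Z'" unfolding z_def using o oR ij c by (blast intro: Cmp_Mor)
  \<comment> \<open>The square commutes up to sign, since \<open>c q\<close> is the sum of its two
    composites; hence the inverse.\<close>
  have zu: "Cmp C A Z Z' z u = Cmp C A D Z' (inv\<^bsub>Hom C D Z'\<^esub> Cmp C D R Z' c i) g"
  proof -
    have ci: "Cmp C D R Z' c i \<in> Mor C D Z'" using o oR ij c by (blast intro: Cmp_Mor)
    interpret G: comm_group "Hom C A Z'" using Hom_comm_group o oR by blast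
    have M: "Cmp C A D Z' (Cmp C D R Z' c i) g \<in> Mor C A Z'" "Cmp C A Z Z' z u \<in> Mor C A Z'"
      using o oR ci gM z u by (blast intro: Cmp_Mor)+
    \<comment> \<open>\<open>c\<close> factors through itself, so by the weak cokernel property it
      kills \<open>q\<close>.\<close>
    have "Cmp C A R Z' c q = zero_mor C A Z'"
      using wc[OF Z' c] factors_Cmp c oR unfolding factors_def by (metis Cmp_Idt_left Idt_Mor)
    then have "Cmp C A D Z' (Cmp C D R Z' c i) g \<otimes>\<^bsub>Hom C A Z'\<^esub> Cmp C A Z Z' z u = zero_mor C A Z'"
      using qp(2)[OF oR(2) c] by (simp add: z_def)
    then have "Cmp C A Z Z' z u = inv\<^bsub>Hom C A Z'\<^esub> Cmp C A D Z' (Cmp C D R Z' c i) g"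
      using M G.inv_equality G.m_comm by metis
    then show ?thesis using o oR ci gM by (simp add: Cmp_inv_left)
  qed
  have gz: "factors C A D Z' g (Cmp C A Z Z' z u)"
    unfolding zu factors_def using o oR ij c by (blast intro: inv_Mor Cmp_Mor)
  have "annihilated A D g \<longleftrightarrow> annihilated Z Z' z \<and> annihilated A R q"
  proof (rule annihilated_short_exact[OF A D gM Z Z' z R qp(1) u])
    fix W x assume W: "W \<in> fp_objects C" and x: "x \<in> Mor C Z W"
    have oW: "W \<in> Obj C" using W by (rule fp_objects_Obj)
    interpret AW: comm_group "Hom C A W" using Hom_comm_group o oW by blast
    show "factors C A D W g (Cmp C A Z W x u) = factors C Z Z' W z x" (is "?l \<longleftrightarrow> ?r")
    proof
      assume ?l
      then obtain y where y: "y \<in> Mor C D W" "Cmp C A Z W x u = Cmp C A D W y g" unfolding factors_def by blast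
      \<comment> \<open>The copairing of minus \<open>y\<close> and \<open>x\<close>, made so that
        its composite with \<open>q\<close> vanishes.\<close>
      obtain t where t: "t \<in> Mor C R W" "Cmp C D R W t i = inv\<^bsub>Hom C D W\<^esub> y" "Cmp C Z R W t j = x"
        using biproduct_copair[OF bp o(2,3) oW inv_Mor[OF o(2) oW y(1)] x] by blast
      have yg: "Cmp C A D W y g \<in> Mor C A W" using o oW y gM by (blast intro: Cmp_Mor)
      have "Cmp C A R W t q = inv\<^bsub>Hom C A W\<^esub> Cmp C A D W y g \<otimes>\<^bsub>Hom C A W\<^esub> Cmp C A D W y g"
        unfolding qp(2)[OF oW t(1)] t(2,3) y(2) using o oW y gM by (simp add: Cmp_inv_left)
      then have "factors C R Z' W c t" using wc[OF W t(1)] yg by simp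
      then obtain w where w: "w \<in> Mor C Z' W" "t = Cmp C R Z' W w c" unfolding factors_def by blast
      have "x = Cmp C Z Z' W w z"
        unfolding t(3)[symmetric] w(2) z_def using o oR oW ij c w by (simp add: Cmp_assoc)
      then show ?r using w unfolding factors_def by blast
    next
      assume ?r
      then obtain w where w: "w \<in> Mor C Z' W" "x = Cmp C Z Z' W w z" unfolding factors_def by blast
      have "Cmp C A Z W x u = Cmp C A Z' W w (Cmp C A Z Z' z u)"
        unfolding w(2) using o oR oW z u w by (simp add: Cmp_assoc)
      then show ?l using factors_Cmp[OF o(1,2) oR(2) oW gM w(1) gz] by simp
    qed
  next
    fix W y assume W: "W \<in> fp_objects C" and y: "y \<in> Mor C A W"
    have oW: "W \<in> Obj C" using W by (rule fp_objects_Obj)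
    interpret AW: comm_group "Hom C A W" using Hom_comm_group o oW by blast
    have "Cmp C A D W v g \<otimes>\<^bsub>Hom C A W\<^esub> Cmp C A Z W x u = Cmp C A Z W x u \<otimes>\<^bsub>Hom C A W\<^esub> Cmp C A D W v g"
      if "v \<in> Mor C D W" "x \<in> Mor C Z W" for v x
      using that o oW gM u by (intro AW.m_comm Cmp_Mor)
    then show "factors C A R W q y \<longleftrightarrow> (\<exists>x\<in>Mor C Z W. \<exists>v\<in>Mor C D W.
      y = Cmp C A Z W x u \<otimes>\<^bsub>Hom C A W\<^esub> Cmp C A D W v g)"
      unfolding qp(3)[OF oW] by metis
  qed
  then show thesis using that g gz by blast
qed

text \<open>Problems are solved one after the other: factorizations already obtained survive
  composition with the next morphism, and annihilated morphisms compose.\<close>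

lemma annihilated_finite_pushout:
  assumes "finite s" and Z: "Z \<in> fp_objects C"
    and "\<And>A D g u. (A, D, g, u) \<in> s \<Longrightarrow> annihilated A D g \<and> u \<in> Mor C A Z"
  shows "\<exists>Z' z. annihilated Z Z' z \<and> (\<forall>(A, D, g, u) \<in> s. factors C A D Z' g (Cmp C A Z Z' z u))"
  using assms(1,3)
proof (induction s)
  case empty
  then show ?case using annihilated_Idt[OF Z] by blast
next
  case (insert l s)
  obtain A D g u where l: "l = (A, D, g, u)" by (cases l) auto
  have g: "annihilated A D g" and u: "u \<in> Mor C A Z" using insert.prems l by blast+
  obtain Z1 z1 where z1: "annihilated Z Z1 z1"
    "\<And>A D g u. (A, D, g, u) \<in> s \<Longrightarrow> factors C A D Z1 g (Cmp C A Z Z1 z1 u)"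
    using insert.IH insert.prems by fast
  note o = annihilatedD(4,5)[OF z1(1)] and z1M = annihilatedD(3)[OF z1(1)]
  have z1u: "Cmp C A Z Z1 z1 u \<in> Mor C A Z1" using Cmp_Mor[OF annihilatedD(4)[OF g] o u z1M] .
  obtain Z2 z2 where z2: "annihilated Z1 Z2 z2" "factors C A D Z2 g (Cmp C A Z1 Z2 z2 (Cmp C A Z Z1 z1 u))"
    using annihilated_pushout[OF g annihilatedD(2)[OF z1(1)] z1u] by blast
  note o2 = annihilatedD(5)[OF z2(1)] and z2M = annihilatedD(3)[OF z2(1)]
  have as: "Cmp C A Z Z2 (Cmp C Z Z1 Z2 z2 z1) u = Cmp C A Z1 Z2 z2 (Cmp C A Z Z1 z1 u)"
    if "A \<in> Obj C" "u \<in> Mor C A Z" for A u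
    using that o o2 z1M z2M by (simp add: Cmp_assoc)
  note z2' = z2(2)[folded as[OF annihilatedD(4)[OF g] u]]
  have "factors C A D Z2 g (Cmp C A Z Z2 (Cmp C Z Z1 Z2 z2 z1) u)" if "(A, D, g, u) \<in> insert l s" for A D g u
  proof (cases "(A, D, g, u) = l")
    case True
    then show ?thesis using z2' l by simp
  next
    case False
    then have s: "(A, D, g, u) \<in> s" using that by blast
    have g: "annihilated A D g" and u: "u \<in> Mor C A Z" using insert.prems that by blast+
    show ?thesis
      using factors_Cmp[OF annihilatedD(4,5)[OF g] o(2) o2 annihilatedD(3)[OF g] z2M z1(2)[OF s]]
      unfolding as[OF annihilatedD(4)[OF g] u] .
  qed
  then show ?case using annihilated_Cmp[OF z1(1) z2(1)] by blast
qed

text \<open>The source, and then the target, is replaced by a generator of which it is a retract.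
  The part of \<open>A0\<close> cut out by the idempotent \<open>1 - i p\<close> has to be added to
  the relations, which enlarges the target to the biproduct \<open>R\<close>. Membership in the
  definable subcategory can thus be tested against a small set of morphisms.\<close>

lemma annihilated_generators:
  assumes f: "annihilated A B f"
  obtains A0 B0 f0 where "A0 \<in> generators" "B0 \<in> generators" "annihilated A0 B0 f0"
    "\<And>X. \<lbrakk>X \<in> Obj C; \<And>x. x \<in> Mor C A0 X \<Longrightarrow> factors C A0 B0 X f0 x\<rbrakk>
      \<Longrightarrow> \<forall>x \<in> Mor C A X. factors C A B X f x"
proof -
  note A = annihilatedD(1)[OF f] and B = annihilatedD(2)[OF f] and fM = annihilatedD(3)[OF f]
  obtain A0 i p where A0: "A0 \<in> generators" and ip: "i \<in> Mor C A A0" "p \<in> Mor C A0 A" "Cmp C A A0 A p i = Idt C A"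
    using fp_retract[OF A] by blast
  have A0fp: "A0 \<in> fp_objects C" using A0 generators_fp by blast
  have o: "A \<in> Obj C" "B \<in> Obj C" "A0 \<in> Obj C" using A B A0fp by (simp_all add: fp_objects_Obj)
  obtain R i1 i2 p1 p2 where R: "R \<in> fp_objects C" and bp: "biproduct C B A0 R i1 i2 p1 p2"
    using fp_biproduct'[OF B A0fp] by blast
  have oR: "R \<in> Obj C" using R by (rule fp_objects_Obj)
  let ?d = "Idt C A0 \<otimes>\<^bsub>Hom C A0 A0\<^esub> inv\<^bsub>Hom C A0 A0\<^esub> Cmp C A0 A A0 i p"
  have ipM: "Cmp C A0 A A0 i p \<in> Mor C A0 A0" using o ip by (blast intro: Cmp_Mor)
  have d: "?d \<in> Mor C A0 A0" using o ipM by (intro mult_Mor inv_Mor Idt_Mor)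
  have fp: "Cmp C A0 A B f p \<in> Mor C A0 B" using o ip fM by (blast intro: Cmp_Mor)
  define h where "h = Cmp C A0 B R i1 (Cmp C A0 A B f p) \<otimes>\<^bsub>Hom C A0 R\<^esub> Cmp C A0 A0 R i2 ?d"
  note hp = biproduct_pair[OF bp o(3,2,3) fp d, folded h_def]
  obtain B0 s q where B0: "B0 \<in> generators" and sq: "s \<in> Mor C R B0" "q \<in> Mor C B0 R" "Cmp C R B0 R q s = Idt C R"
    using fp_retract[OF R] by blast
  have B0fp: "B0 \<in> fp_objects C" using B0 generators_fp by blast
  have oB0: "B0 \<in> Obj C" using B0fp by (rule fp_objects_Obj)
  define f0 where "f0 = Cmp C A0 R B0 s h"
  have f0: "f0 \<in> Mor C A0 B0" unfolding f0_def using o oR oB0 sq hp(1) by (blast intro: Cmp_Mor)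
  have xd: "Cmp C A0 A0 W x ?d = x \<otimes>\<^bsub>Hom C A0 W\<^esub> inv\<^bsub>Hom C A0 W\<^esub> Cmp C A0 A W (Cmp C A A0 W x i) p"
    if "W \<in> Obj C" "x \<in> Mor C A0 W" for W x
    using that o ip ipM Idt_Mor by (simp add: Cmp_add_right Cmp_inv_right Cmp_Idt_right Cmp_assoc inv_Mor)
  \<comment> \<open>Holds at every \<open>W\<close> in \<open>C\<close>: finitely presented
    \<open>W\<close> identify the two cokernels, arbitrary \<open>W\<close> transfer the
    factorization condition of \<open>definable_of_iff\<close>.\<close>
  have f0_iff: "factors C A B W f (Cmp C A A0 W x i) \<longleftrightarrow> factors C A0 B0 W f0 x"
    if W: "W \<in> Obj C" and x: "x \<in> Mor C A0 W" for W x
  proof -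
    interpret G: comm_group "Hom C A0 W" using Hom_comm_group o W by blast
    interpret GA: comm_group "Hom C A W" using Hom_comm_group o W by blast
    have xi: "Cmp C A A0 W x i \<in> Mor C A W" using o W x ip by (blast intro: Cmp_Mor)
    have "factors C A0 B0 W f0 x \<longleftrightarrow> factors C A0 R W h x"
    proof
      assume "factors C A0 B0 W f0 x"
      then obtain y where y: "y \<in> Mor C B0 W" "x = Cmp C A0 B0 W y f0" unfolding factors_def by blast
      then have "x = Cmp C A0 R W (Cmp C R B0 W y s) h"
        unfolding f0_def using o oR oB0 W sq hp(1) by (simp add: Cmp_assoc)
      then show "factors C A0 R W h x" unfolding factors_def using y oR oB0 W sq by (blast intro: Cmp_Mor)
    next
      assume "factors C A0 R W h x"
      then obtain y where y: "y \<in> Mor C R W" "x = Cmp C A0 R W y h" unfolding factors_def by blast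
      have "Cmp C A0 B0 W (Cmp C B0 R W y q) f0 = Cmp C A0 R W (Cmp C R R W y (Cmp C R B0 R q s)) h"
        unfolding f0_def using y o oR oB0 W sq(1,2) hp(1) by (simp add: Cmp_assoc Cmp_Mor)
      then have "x = Cmp C A0 B0 W (Cmp C B0 R W y q) f0"
        using y oR W sq by (simp add: Cmp_Idt_right)
      then show "factors C A0 B0 W f0 x" unfolding factors_def using y oR oB0 W sq by (blast intro: Cmp_Mor)
    qed
    also have "\<dots> \<longleftrightarrow> factors C A B W f (Cmp C A A0 W x i)"
    proof
      assume "factors C A0 R W h x"
      then obtain y y' where y: "y \<in> Mor C B W" "y' \<in> Mor C A0 W"
        "x = Cmp C A0 B W y (Cmp C A0 A B f p) \<otimes>\<^bsub>Hom C A0 W\<^esub> Cmp C A0 A0 W y' ?d" unfolding hp(3)[OF W] by blast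
      have y'd: "Cmp C A0 A0 W y' ?d \<in> Mor C A0 W" and yfp: "Cmp C A0 B W y (Cmp C A0 A B f p) \<in> Mor C A0 W"
        using o W y d fp by (blast intro: Cmp_Mor)+
      have y'i: "Cmp C A A0 W y' i \<in> Mor C A W" using o W y ip by (blast intro: Cmp_Mor)
      \<comment> \<open>\<open>?d\<close> vanishes on \<open>i\<close>, so only the component
        through \<open>f\<close> will contribute.\<close>
      have "Cmp C A A0 W (Cmp C A0 A0 W y' ?d) i = Cmp C A A0 W y' i \<otimes>\<^bsub>Hom C A W\<^esub> inv\<^bsub>Hom C A W\<^esub> Cmp C A A0 W (Cmp C A0 A W (Cmp C A A0 W y' i) p) i"
        unfolding xd[OF W y(2)] using o W y ip y'i by (simp add: Cmp_add_left Cmp_inv_left Cmp_Mor inv_Mor)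
      also have "Cmp C A A0 W (Cmp C A0 A W (Cmp C A A0 W y' i) p) i = Cmp C A A0 W y' i"
        using o W y'i ip by (simp add: Cmp_Idt_right flip: Cmp_assoc)
      finally have 0: "Cmp C A A0 W (Cmp C A0 A0 W y' ?d) i = zero_mor C A W" using y'i by simp
      have "Cmp C A A0 W (Cmp C A0 B W y (Cmp C A0 A B f p)) i = Cmp C A B W y (Cmp C A A B f (Cmp C A A0 A p i))"
        using o W y ip(1,2) fM fp by (simp add: Cmp_assoc Cmp_Mor)
      then have "Cmp C A A0 W x i = Cmp C A B W y f"
        unfolding y(3) using 0 o W y ip fM y'd yfp by (simp add: Cmp_add_left Cmp_Idt_right Cmp_Mor)
      then show "factors C A B W f (Cmp C A A0 W x i)" using y unfolding factors_def by blast
    next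
      assume "factors C A B W f (Cmp C A A0 W x i)"
      then obtain y where y: "y \<in> Mor C B W" "Cmp C A A0 W x i = Cmp C A B W y f" unfolding factors_def by blast
      have xip: "Cmp C A0 A W (Cmp C A A0 W x i) p \<in> Mor C A0 W" using o W xi ip by (blast intro: Cmp_Mor)
      \<comment> \<open>The identity of \<open>A0\<close> decomposed into \<open>i p\<close> and
        \<open>?d\<close>.\<close>
      have "x = Cmp C A0 A W (Cmp C A A0 W x i) p \<otimes>\<^bsub>Hom C A0 W\<^esub> Cmp C A0 A0 W x ?d"
        unfolding xd[OF W x] using x xip G.m_lcomm[of "Cmp C A0 A W (Cmp C A A0 W x i) p" x] by simp
      also have "Cmp C A0 A W (Cmp C A A0 W x i) p = Cmp C A0 B W y (Cmp C A0 A B f p)"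
        unfolding y(2) using o W y fM ip by (simp add: Cmp_assoc)
      finally show "factors C A0 R W h x" unfolding hp(3)[OF W] using y(1) x by blast
    qed
    finally show ?thesis by blast
  qed
  have l: "y = Cmp C A A0 W (Cmp C A0 A W y p) i" if "W \<in> Obj C" "y \<in> Mor C A W" for W y
    using that o ip by (simp add: Cmp_Idt_right flip: Cmp_assoc)
  obtain e where pr: "presents (fp_category C) A B f (Cok C A B f) e"
    using fp_Cok_presents[OF A B fM] by blast
  have "Cok C A B f \<in> S \<longleftrightarrow> annihilated A0 B0 f0"
  proof (rule presents_annihilated_iso[OF pr A0fp B0fp f0 ip(1)])
    fix W y assume "W \<in> fp_objects C" "y \<in> Mor C A W"
    then show "\<exists>x\<in>Mor C A0 W. y = Cmp C A A0 W x i"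
      using l[of W y] o ip fp_objects_Obj[of W C] by (blast intro: Cmp_Mor)
  next
    fix W x assume "W \<in> fp_objects C" "x \<in> Mor C A0 W"
    then show "factors C A B W f (Cmp C A A0 W x i) = factors C A0 B0 W f0 x"
      by (intro f0_iff) (simp_all add: fp_objects_Obj)
  qed
  then have "annihilated A0 B0 f0" using f unfolding annihilated_def by blast
  moreover have "\<forall>x \<in> Mor C A X. factors C A B X f x"
    if X: "X \<in> Obj C" and r: "\<And>x. x \<in> Mor C A0 X \<Longrightarrow> factors C A0 B0 X f0 x" for X
    using f0_iff[OF X] r l[OF X] Cmp_Mor[OF o(3,1) X ip(2)] by metis
  ultimately show thesis using that A0 B0 by blast
qed

end

section \<open>Reduced products\<close>

text \<open>What the direct limit looks like from finitely presented objects; the index type is arbitrary.\<close>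

definition fp_limit_cocone ::
  "('o, 'u) category \<Rightarrow> 'l set \<Rightarrow> 'l rel \<Rightarrow> ('l \<Rightarrow> 'o) \<Rightarrow> ('l \<Rightarrow> 'l \<Rightarrow> 'u) \<Rightarrow> 'o \<Rightarrow> ('l \<Rightarrow> 'u) \<Rightarrow> bool" where
  "fp_limit_cocone C L r D d X c \<longleftrightarrow> is_cocone C L r D d X c \<and>
     (\<forall>A \<in> fp_objects C. \<forall>h \<in> Mor C A X. \<exists>l\<in>L. \<exists>h'\<in>Mor C A (D l). h = Cmp C A (D l) X (c l) h') \<and>
     (\<forall>A \<in> fp_objects C. \<forall>l \<in> L. \<forall>h \<in> Mor C A (D l). \<forall>h' \<in> Mor C A (D l).
        Cmp C A (D l) X (c l) h = Cmp C A (D l) X (c l) h' \<longrightarrow>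
        (\<exists>m. (l, m) \<in> r \<and> Cmp C A (D l) (D m) (d l m) h = Cmp C A (D l) (D m) (d l m) h'))"

lemma fp_limit_coconeD:
  assumes "fp_limit_cocone C L r D d X c"
  shows "is_cocone C L r D d X c"
    "\<And>A h. \<lbrakk>A \<in> fp_objects C; h \<in> Mor C A X\<rbrakk> \<Longrightarrow> \<exists>l\<in>L. \<exists>h'\<in>Mor C A (D l). h = Cmp C A (D l) X (c l) h'"
    "\<And>A l h h'. \<lbrakk>A \<in> fp_objects C; l \<in> L; h \<in> Mor C A (D l); h' \<in> Mor C A (D l);
      Cmp C A (D l) X (c l) h = Cmp C A (D l) X (c l) h'\<rbrakk>
      \<Longrightarrow> \<exists>m. (l, m) \<in> r \<and> Cmp C A (D l) (D m) (d l m) h = Cmp C A (D l) (D m) (d l m) h'"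
proof -
  note * = assms[unfolded fp_limit_cocone_def]
  show "is_cocone C L r D d X c" by (rule *[THEN conjunct1])
qed (fact assms[unfolded fp_limit_cocone_def, THEN conjunct2, THEN conjunct1, rule_format]
    assms[unfolded fp_limit_cocone_def, THEN conjunct2, THEN conjunct2, rule_format])+

text \<open>A reduced product \<open>X\<close> of the \<open>Z l\<close> over the directed set \<open>L\<close>: the direct limit over \<open>l\<close> of
  \<open>T l\<close>, the product of the \<open>Z m\<close> with \<open>m\<close> above \<open>l\<close>.\<close>

definition is_reduced_product ::
  "('o, 'u) category \<Rightarrow> 'l set \<Rightarrow> 'l rel \<Rightarrow> ('l \<Rightarrow> 'o) \<Rightarrow> 'o \<Rightarrow> ('l \<Rightarrow> 'o) \<Rightarrow> ('l \<Rightarrow> 'u) \<Rightarrow> ('l \<Rightarrow> 'l \<Rightarrow> 'u) \<Rightarrow> bool" where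
  "is_reduced_product C L r Z X T c \<pi> \<longleftrightarrow> X \<in> Obj C \<and> (\<forall>l \<in> L. T l \<in> Obj C \<and> c l \<in> Mor C (T l) X) \<and>
     (\<forall>l m. (l, m) \<in> r \<longrightarrow> \<pi> l m \<in> Mor C (T l) (Z m)) \<and>
     (\<forall>A \<in> fp_objects C. \<forall>h \<in> Mor C A X. \<exists>l\<in>L. \<exists>h'\<in>Mor C A (T l). h = Cmp C A (T l) X (c l) h') \<and>
     (\<forall>A \<in> fp_objects C. \<forall>l \<in> L. \<forall>l' \<in> L. \<forall>h \<in> Mor C A (T l). \<forall>h' \<in> Mor C A (T l').
        Cmp C A (T l) X (c l) h = Cmp C A (T l') X (c l') h' \<longrightarrow>
        (\<exists>m. (l, m) \<in> r \<and> (l', m) \<in> r \<and> Cmp C A (T l) (Z m) (\<pi> l m) h = Cmp C A (T l') (Z m) (\<pi> l' m) h')) \<and>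
     (\<forall>Y \<in> Obj C. \<forall>l \<in> L. \<forall>l' \<in> L. \<forall>h \<in> Mor C Y (T l). \<forall>h' \<in> Mor C Y (T l').
        (\<forall>m. (l, m) \<in> r \<and> (l', m) \<in> r \<longrightarrow> Cmp C Y (T l) (Z m) (\<pi> l m) h = Cmp C Y (T l') (Z m) (\<pi> l' m) h') \<longrightarrow>
        Cmp C Y (T l) X (c l) h = Cmp C Y (T l') X (c l') h') \<and>
     (\<forall>Y \<in> Obj C. \<forall>l \<in> L. \<forall>y. (\<forall>m. (l, m) \<in> r \<longrightarrow> y m \<in> Mor C Y (Z m)) \<longrightarrow>
        (\<exists>h\<in>Mor C Y (T l). \<forall>m. (l, m) \<in> r \<longrightarrow> Cmp C Y (T l) (Z m) (\<pi> l m) h = y m))"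

lemma is_reduced_productD:
  assumes "is_reduced_product C L r Z X T c \<pi>"
  shows "X \<in> Obj C" "\<And>l. l \<in> L \<Longrightarrow> T l \<in> Obj C" "\<And>l. l \<in> L \<Longrightarrow> c l \<in> Mor C (T l) X"
    "\<And>l m. (l, m) \<in> r \<Longrightarrow> \<pi> l m \<in> Mor C (T l) (Z m)"
    "\<And>A h. \<lbrakk>A \<in> fp_objects C; h \<in> Mor C A X\<rbrakk> \<Longrightarrow> \<exists>l\<in>L. \<exists>h'\<in>Mor C A (T l). h = Cmp C A (T l) X (c l) h'"
    "\<And>A l l' h h'. \<lbrakk>A \<in> fp_objects C; l \<in> L; l' \<in> L; h \<in> Mor C A (T l); h' \<in> Mor C A (T l');
      Cmp C A (T l) X (c l) h = Cmp C A (T l') X (c l') h'\<rbrakk>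
      \<Longrightarrow> \<exists>m. (l, m) \<in> r \<and> (l', m) \<in> r \<and> Cmp C A (T l) (Z m) (\<pi> l m) h = Cmp C A (T l') (Z m) (\<pi> l' m) h'"
    "\<And>Y l l' h h'. \<lbrakk>Y \<in> Obj C; l \<in> L; l' \<in> L; h \<in> Mor C Y (T l); h' \<in> Mor C Y (T l');
      \<And>m. (l, m) \<in> r \<and> (l', m) \<in> r \<Longrightarrow> Cmp C Y (T l) (Z m) (\<pi> l m) h = Cmp C Y (T l') (Z m) (\<pi> l' m) h'\<rbrakk>
      \<Longrightarrow> Cmp C Y (T l) X (c l) h = Cmp C Y (T l') X (c l') h'"
    "\<And>Y l y. \<lbrakk>Y \<in> Obj C; l \<in> L; \<And>m. (l, m) \<in> r \<Longrightarrow> y m \<in> Mor C Y (Z m)\<rbrakk>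
      \<Longrightarrow> \<exists>h\<in>Mor C Y (T l). \<forall>m. (l, m) \<in> r \<longrightarrow> Cmp C Y (T l) (Z m) (\<pi> l m) h = y m"
proof -
  note * = assms[unfolded is_reduced_product_def]
  show "X \<in> Obj C" by (rule *[THEN conjunct1])
  show "T l \<in> Obj C" "c l \<in> Mor C (T l) X" if "l \<in> L" for l
    using *[THEN conjunct2, THEN conjunct1] that by blast+
  note ** = *[THEN conjunct2, THEN conjunct2]
  show "\<pi> l m \<in> Mor C (T l) (Z m)" if "(l, m) \<in> r" for l m
    using **[THEN conjunct1] that by blast
  note *** = **[THEN conjunct2]
  show "\<exists>l\<in>L. \<exists>h'\<in>Mor C A (T l). h = Cmp C A (T l) X (c l) h'" if "A \<in> fp_objects C" "h \<in> Mor C A X" for A h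
    by (rule ***[THEN conjunct1, rule_format, OF that])
  show "\<exists>m. (l, m) \<in> r \<and> (l', m) \<in> r \<and> Cmp C A (T l) (Z m) (\<pi> l m) h = Cmp C A (T l') (Z m) (\<pi> l' m) h'"
    if "A \<in> fp_objects C" "l \<in> L" "l' \<in> L" "h \<in> Mor C A (T l)" "h' \<in> Mor C A (T l')"
      "Cmp C A (T l) X (c l) h = Cmp C A (T l') X (c l') h'" for A l l' h h'
    by (rule ***[THEN conjunct2, THEN conjunct1, rule_format, OF that])
  show "Cmp C Y (T l) X (c l) h = Cmp C Y (T l') X (c l') h'"
    if "Y \<in> Obj C" "l \<in> L" "l' \<in> L" "h \<in> Mor C Y (T l)" "h' \<in> Mor C Y (T l')"
      "\<And>m. (l, m) \<in> r \<and> (l', m) \<in> r \<Longrightarrow> Cmp C Y (T l) (Z m) (\<pi> l m) h = Cmp C Y (T l') (Z m) (\<pi> l' m) h'"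
    for Y l l' h h'
    by (rule ***[THEN conjunct2, THEN conjunct2, THEN conjunct1, rule_format, OF that])
  show "\<exists>h\<in>Mor C Y (T l). \<forall>m. (l, m) \<in> r \<longrightarrow> Cmp C Y (T l) (Z m) (\<pi> l m) h = y m"
    if "Y \<in> Obj C" "l \<in> L" "\<And>m. (l, m) \<in> r \<Longrightarrow> y m \<in> Mor C Y (Z m)" for Y l y
    using ***[THEN conjunct2, THEN conjunct2, THEN conjunct2, rule_format, OF that(1,2), of y] that(3) by simp
qed

context finitely_accessible_products
begin

text \<open>A code \<open>\<phi>\<close> carries the directed set into \<open>'u\<close>, where
  direct limits are provided; \<open>\<psi>\<close> reads the diagram back.\<close>

lemma direct_limit_exists:
  fixes L :: "'l set"
  assumes L: "small TYPE('u) L" and sys: "directed_system C L r D d"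
  obtains X c where "fp_limit_cocone C L r D d X c"
proof -
  obtain \<phi> :: "'l \<Rightarrow> 'u" where \<phi>: "inj_on \<phi> L" using small_code[OF L] by blast
  define \<psi> where "\<psi> = inv_into L \<phi>"
  have \<psi>\<phi>: "\<psi> (\<phi> l) = l" if "l \<in> L" for l using \<phi> that by (simp add: \<psi>_def)
  note s = directed_systemD[OF sys] and dir = directed_posetD[OF directed_systemD(1)[OF sys]]
  define I where "I = \<phi> ` L"
  define r' where "r' = {(\<phi> l, \<phi> m) | l m. (l, m) \<in> r}"
  have r'_iff: "(\<phi> l, \<phi> m) \<in> r' \<longleftrightarrow> (l, m) \<in> r" if "l \<in> L" "m \<in> L" for l m
  proof
    assume "(\<phi> l, \<phi> m) \<in> r'"
    then obtain l' m' where e: "\<phi> l = \<phi> l'" "\<phi> m = \<phi> m'" and "(l', m') \<in> r" unfolding r'_def by blast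
    moreover from this have "l' \<in> L" "m' \<in> L" using dir(4) by blast+
    ultimately show "(l, m) \<in> r"
      using inj_onD[OF \<phi> e(1) that(1)] inj_onD[OF \<phi> e(2) that(2)] by simp
  qed (auto simp: r'_def)
  have r'E: "\<exists>l m. i = \<phi> l \<and> k = \<phi> m \<and> (l, m) \<in> r \<and> l \<in> L \<and> m \<in> L" if "(i, k) \<in> r'" for i k
    using that dir(4) unfolding r'_def by blast
  have po: "partial_order_on L r" using s(1) unfolding directed_poset_def by blast
  have "partial_order_on I r'"
    unfolding partial_order_on_def preorder_on_def
  proof (intro conjI)
    show "r' \<subseteq> I \<times> I" using dir(4) unfolding r'_def I_def by blast
    show "refl_on I r'" unfolding refl_on_def I_def r'_def using dir(2) by blast
    show "trans r'"
    proof (rule transI)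
      fix x y z assume "(x, y) \<in> r'" "(y, z) \<in> r'"
      then obtain l m m' n where "x = \<phi> l" "y = \<phi> m" "y = \<phi> m'" "z = \<phi> n" "(l, m) \<in> r" "(m', n) \<in> r"
        "m \<in> L" "m' \<in> L" using r'E by metis
      then show "(x, z) \<in> r'" using dir(3) \<phi> unfolding r'_def inj_on_def by blast
    qed
    show "antisym r'"
    proof (rule antisymI)
      fix x y assume "(x, y) \<in> r'" "(y, x) \<in> r'"
      then obtain l m where lm: "x = \<phi> l" "y = \<phi> m" "(l, m) \<in> r" "l \<in> L" "m \<in> L" using r'E by metis
      then have "(m, l) \<in> r" using \<open>(y, x) \<in> r'\<close> r'_iff by blast
      then show "x = y" using lm partial_order_onD(3)[OF po] unfolding antisym_def by blast
    qed
  qed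
  then have dp: "directed_poset I r'"
    unfolding directed_poset_def using dir(1,5) r'_iff by (fastforce simp: I_def)
  have sys': "directed_system C I r' (\<lambda>i. D (\<psi> i)) (\<lambda>i k. d (\<psi> i) (\<psi> k))"
    unfolding directed_system_def
  proof (intro conjI dp allI impI ballI)
    fix i k n assume "(i, k) \<in> r' \<and> (k, n) \<in> r'"
    then obtain l m m' o' where "i = \<phi> l" "k = \<phi> m" "k = \<phi> m'" "n = \<phi> o'" "(l, m) \<in> r" "(m', o') \<in> r"
        "l \<in> L" "m \<in> L" "m' \<in> L" "o' \<in> L" using r'E by metis
    moreover have "m = m'" using calculation \<phi> by (metis inj_onD)
    ultimately show "d (\<psi> i) (\<psi> n) = Cmp C (D (\<psi> i)) (D (\<psi> k)) (D (\<psi> n)) (d (\<psi> k) (\<psi> n)) (d (\<psi> i) (\<psi> k))"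
      using s(5)[of l m o'] \<psi>\<phi> by simp
  next
    fix p assume "p \<in> r'"
    then obtain l m where "p = (\<phi> l, \<phi> m)" "(l, m) \<in> r" "l \<in> L" "m \<in> L" using r'E by (cases p) metis
    then show "case p of (i, k) \<Rightarrow> d (\<psi> i) (\<psi> k) \<in> Mor C (D (\<psi> i)) (D (\<psi> k))" using s(3) \<psi>\<phi> by simp
  qed (use s \<psi>\<phi> in \<open>auto simp: I_def\<close>)
  have I: "small TYPE('u) I" unfolding I_def by (rule small_image[OF L])
  obtain X c where lim: "is_direct_limit C I r' (\<lambda>i. D (\<psi> i)) (\<lambda>i k. d (\<psi> i) (\<psi> k)) X c"
    using direct_limits[unfolded has_direct_limits_def] I sys' by blast
  show thesis
  proof (rule that[of X "\<lambda>l. c (\<phi> l)"], unfold fp_limit_cocone_def, intro conjI ballI impI)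
    show "is_cocone C L r D d X (\<lambda>l. c (\<phi> l))"
      unfolding is_cocone_def
    proof (intro conjI ballI)
      show "X \<in> Obj C" by (rule is_direct_limitD(2)[OF lim])
      show "c (\<phi> l) \<in> Mor C (D l) X" if "l \<in> L" for l
        using is_direct_limitD(3)[OF lim, of "\<phi> l"] that \<psi>\<phi> by (simp add: I_def)
      fix p assume "p \<in> r"
      then obtain l m where p: "p = (l, m)" "(l, m) \<in> r" by (cases p) auto
      then have "(\<phi> l, \<phi> m) \<in> r'" "l \<in> L" "m \<in> L" using dir(4) r'_iff by blast+
      then show "case p of (l, m) \<Rightarrow> Cmp C (D l) (D m) X (c (\<phi> m)) (d l m) = c (\<phi> l)"
        using is_direct_limitD(4)[OF lim] \<psi>\<phi> p by fastforce
    qed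
    show "\<exists>l\<in>L. \<exists>h'\<in>Mor C A (D l). h = Cmp C A (D l) X (c (\<phi> l)) h'"
      if A: "A \<in> fp_objects C" and h: "h \<in> Mor C A X" for A h
    proof -
      obtain i h' where i: "i \<in> I" "h' \<in> Mor C A (D (\<psi> i))" "h = Cmp C A (D (\<psi> i)) X (c i) h'"
        using fp_lift[OF A I lim h] by blast
      then obtain l where "i = \<phi> l" "l \<in> L" unfolding I_def by blast
      then show ?thesis using i \<psi>\<phi> by auto
    qed
    show "\<exists>m. (l, m) \<in> r \<and> Cmp C A (D l) (D m) (d l m) h = Cmp C A (D l) (D m) (d l m) h'"
      if A: "A \<in> fp_objects C" and l: "l \<in> L" and h: "h \<in> Mor C A (D l)" "h' \<in> Mor C A (D l)"
        and eq: "Cmp C A (D l) X (c (\<phi> l)) h = Cmp C A (D l) X (c (\<phi> l)) h'" for A l h h'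
    proof -
      have "\<phi> l \<in> I" using l by (simp add: I_def)
      then obtain k where k: "(\<phi> l, k) \<in> r'" "Cmp C A (D l) (D (\<psi> k)) (d l (\<psi> k)) h = Cmp C A (D l) (D (\<psi> k)) (d l (\<psi> k)) h'"
        using fp_eq[OF A I lim, of "\<phi> l" h h'] h eq \<psi>\<phi>[OF l] by auto
      obtain m where "k = \<phi> m" "m \<in> L" using r'E[OF k(1)] by blast
      then show ?thesis using k r'_iff[OF l] \<psi>\<phi> by auto
    qed
  qed
qed

lemma reduced_product:
  fixes L :: "'l set"
  assumes L: "small TYPE('u) L" and dp: "directed_poset L r" and Z: "\<And>l. l \<in> L \<Longrightarrow> Z l \<in> Obj C"
  obtains X T c \<pi> where "is_reduced_product C L r Z X T c \<pi>"
proof -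
  note dir = directed_posetD[OF dp]
  define up where "up l = {m. (l, m) \<in> r}" for l
  have up_L: "up l \<subseteq> L" for l unfolding up_def using dir(4) by blast
  have "\<exists>P. is_product C (up l) Z (fst P) (snd P)" for l
    using product_exists[OF products small_subset[OF L up_L[of l]], of Z] Z up_L[of l] by (metis fst_conv snd_conv subsetD)
  then obtain P where P: "\<And>l. is_product C (up l) Z (fst (P l)) (snd (P l))" by metis
  define T where "T l = fst (P l)" for l
  define \<pi> where "\<pi> l = snd (P l)" for l
  have P: "is_product C (up l) Z (T l) (\<pi> l)" for l using P by (simp add: T_def \<pi>_def)
  have T: "T l \<in> Obj C" for l using productD(1)[OF P] .
  have \<pi>: "\<pi> l m \<in> Mor C (T l) (Z m)" and Zm: "Z m \<in> Obj C" if "(l, m) \<in> r" for l m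
    using productD[OF P, of m] that by (auto simp: up_def)
  have tuple: "\<exists>h\<in>Mor C Y (T l). \<forall>m. (l, m) \<in> r \<longrightarrow> Cmp C Y (T l) (Z m) (\<pi> l m) h = y m"
    if Y: "Y \<in> Obj C" and yM: "\<And>m. (l, m) \<in> r \<Longrightarrow> y m \<in> Mor C Y (Z m)" for Y l y
  proof -
    have y: "y m \<in> Mor C Y (Z m)" if "m \<in> up l" for m using that yM by (simp add: up_def)
    obtain h where "h \<in> Mor C Y (T l)" "\<And>m. m \<in> up l \<Longrightarrow> Cmp C Y (T l) (Z m) (\<pi> l m) h = y m"
      using product_universal[OF P[of l] Y y] by blast
    then show ?thesis by (auto simp: up_def)
  qed
  have T_eqI: "h = h'" if "Y \<in> Obj C" "h \<in> Mor C Y (T l)" "h' \<in> Mor C Y (T l)"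
    "\<And>m. (l, m) \<in> r \<Longrightarrow> Cmp C Y (T l) (Z m) (\<pi> l m) h = Cmp C Y (T l) (Z m) (\<pi> l m) h'" for Y l h h'
    by (rule product_eqI[OF P that(1-3) _ preadditive_category_axioms]) (use that(4) in \<open>simp add: up_def\<close>)
  \<comment> \<open>Transition maps forget the coordinates that are not above
    \<open>m\<close>.\<close>
  have "\<exists>h\<in>Mor C (T l) (T m). \<forall>n. (m, n) \<in> r \<longrightarrow> Cmp C (T l) (T m) (Z n) (\<pi> m n) h = \<pi> l n" if "(l, m) \<in> r" for l m
    by (rule tuple[OF T]) (use \<pi> dir(3)[OF that] in blast)
  then obtain d where d: "\<And>l m. (l, m) \<in> r \<Longrightarrow> d l m \<in> Mor C (T l) (T m)"
    "\<And>l m n. (l, m) \<in> r \<Longrightarrow> (m, n) \<in> r \<Longrightarrow> Cmp C (T l) (T m) (Z n) (\<pi> m n) (d l m) = \<pi> l n" by metis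
  have sys: "directed_system C L r T d"
    unfolding directed_system_def
  proof (intro conjI dp allI impI ballI T)
    show "case p of (i, j) \<Rightarrow> d i j \<in> Mor C (T i) (T j)" if "p \<in> r" for p using d(1) that by (cases p) auto
    show "d l l = Idt C (T l)" if "l \<in> L" for l
    proof (rule T_eqI[OF T d(1)[OF dir(2)[OF that]] Idt_Mor[OF T]])
      show "Cmp C (T l) (T l) (Z m) (\<pi> l m) (d l l) = Cmp C (T l) (T l) (Z m) (\<pi> l m) (Idt C (T l))" if "(l, m) \<in> r" for m
        using d(2)[OF dir(2)[OF \<open>l \<in> L\<close>] that] \<pi>[OF that] Zm[OF that] T by (simp add: Cmp_Idt_right)
    qed
    fix l m n assume lmn: "(l, m) \<in> r \<and> (m, n) \<in> r"
    then have ln: "(l, n) \<in> r" using dir(3) by blast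
    show "d l n = Cmp C (T l) (T m) (T n) (d m n) (d l m)"
    proof (rule T_eqI[OF T d(1)[OF ln] Cmp_Mor[OF T T T]])
      fix k assume k: "(n, k) \<in> r"
      then have "(m, k) \<in> r" using dir(3) lmn by blast
      then show "Cmp C (T l) (T n) (Z k) (\<pi> n k) (d l n) = Cmp C (T l) (T n) (Z k) (\<pi> n k) (Cmp C (T l) (T m) (T n) (d m n) (d l m))"
        using d lmn ln k \<pi>[OF k] Zm[OF k] T by (simp add: Cmp_assoc)
    qed (use d lmn in blast)+
  qed
  obtain X c where lim: "fp_limit_cocone C L r T d X c"
    by (rule direct_limit_exists[OF L sys])
  note cc = fp_limit_coconeD(1)[OF lim] and lift = fp_limit_coconeD(2)[OF lim] and eq = fp_limit_coconeD(3)[OF lim]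
  have X: "X \<in> Obj C" and c: "\<And>l. l \<in> L \<Longrightarrow> c l \<in> Mor C (T l) X"
    and cd: "\<And>l m. (l, m) \<in> r \<Longrightarrow> Cmp C (T l) (T m) X (c m) (d l m) = c l"
    using cc unfolding is_cocone_def by auto
  have push: "Cmp C Y (T l) X (c l) h = Cmp C Y (T m) X (c m) (Cmp C Y (T l) (T m) (d l m) h)"
    and push_M: "Cmp C Y (T l) (T m) (d l m) h \<in> Mor C Y (T m)"
    and push_\<pi>: "(m, n) \<in> r \<Longrightarrow> Cmp C Y (T m) (Z n) (\<pi> m n) (Cmp C Y (T l) (T m) (d l m) h) = Cmp C Y (T l) (Z n) (\<pi> l n) h"
    if Y: "Y \<in> Obj C" and h: "h \<in> Mor C Y (T l)" and r: "(l, m) \<in> r" for Y h l m n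
  proof -
    have mL: "m \<in> L" using dir(4) r by blast
    show "Cmp C Y (T l) X (c l) h = Cmp C Y (T m) X (c m) (Cmp C Y (T l) (T m) (d l m) h)"
      unfolding cd[OF r, symmetric] using Cmp_assoc[OF Y T T X h d(1)[OF r] c[OF mL]] by simp
    show "Cmp C Y (T l) (T m) (d l m) h \<in> Mor C Y (T m)" using Cmp_Mor[OF Y T T h d(1)[OF r]] .
    show "Cmp C Y (T m) (Z n) (\<pi> m n) (Cmp C Y (T l) (T m) (d l m) h) = Cmp C Y (T l) (Z n) (\<pi> l n) h" if n: "(m, n) \<in> r"
      unfolding d(2)[OF r n, symmetric] using Cmp_assoc[OF Y T T Zm[OF n] h d(1)[OF r] \<pi>[OF n]] .
  qed
  show thesis
  proof (rule that[of X T c \<pi>], unfold is_reduced_product_def, intro conjI ballI allI impI)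
    fix A l l' h h' assume A: "A \<in> fp_objects C" and l: "l \<in> L" "l' \<in> L" and h: "h \<in> Mor C A (T l)" "h' \<in> Mor C A (T l')"
      and e: "Cmp C A (T l) X (c l) h = Cmp C A (T l') X (c l') h'"
    have oA: "A \<in> Obj C" using A by (rule fp_objects_Obj)
    obtain m where m: "m \<in> L" "(l, m) \<in> r" "(l', m) \<in> r" using dir(5)[OF l] by blast
    have "Cmp C A (T m) X (c m) (Cmp C A (T l) (T m) (d l m) h) = Cmp C A (T m) X (c m) (Cmp C A (T l') (T m) (d l' m) h')"
      using e push[OF oA h(1) m(2)] push[OF oA h(2) m(3)] by simp
    then obtain n where n: "(m, n) \<in> r"
      "Cmp C A (T m) (T n) (d m n) (Cmp C A (T l) (T m) (d l m) h) = Cmp C A (T m) (T n) (d m n) (Cmp C A (T l') (T m) (d l' m) h')"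
      using eq[OF A m(1) push_M[OF oA h(1) m(2)] push_M[OF oA h(2) m(3)]] by blast
    \<comment> \<open>\<open>n\<close> itself is one of the coordinates of \<open>T n\<close>, so
      equality at stage \<open>n\<close> is read off there.\<close>
    have nn: "(n, n) \<in> r" and ln: "(l, n) \<in> r" "(l', n) \<in> r" using n dir m by blast+
    have "Cmp C A (T l) (Z n) (\<pi> l n) h = Cmp C A (T l') (Z n) (\<pi> l' n) h'"
      using push_\<pi>[OF oA push_M[OF oA h(1) m(2)] n(1) nn] push_\<pi>[OF oA h(1) m(2) n(1)]
        push_\<pi>[OF oA push_M[OF oA h(2) m(3)] n(1) nn] push_\<pi>[OF oA h(2) m(3) n(1)] n(2) by simp
    then show "\<exists>m. (l, m) \<in> r \<and> (l', m) \<in> r \<and> Cmp C A (T l) (Z m) (\<pi> l m) h = Cmp C A (T l') (Z m) (\<pi> l' m) h'"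
      using ln by blast
  next
    fix Y l l' h h' assume Y: "Y \<in> Obj C" and l: "l \<in> L" "l' \<in> L" and h: "h \<in> Mor C Y (T l)" "h' \<in> Mor C Y (T l')"
      and e: "\<forall>m. (l, m) \<in> r \<and> (l', m) \<in> r \<longrightarrow> Cmp C Y (T l) (Z m) (\<pi> l m) h = Cmp C Y (T l') (Z m) (\<pi> l' m) h'"
    obtain m where m: "m \<in> L" "(l, m) \<in> r" "(l', m) \<in> r" using dir(5)[OF l] by blast
    \<comment> \<open>At a common stage \<open>m\<close> only coordinates above both
      \<open>l\<close> and \<open>l'\<close> remain, and there the hypothesis applies.\<close>
    have "Cmp C Y (T l) (T m) (d l m) h = Cmp C Y (T l') (T m) (d l' m) h'"
    proof (rule T_eqI[OF Y push_M[OF Y h(1) m(2)] push_M[OF Y h(2) m(3)]])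
      fix n assume n: "(m, n) \<in> r"
      then have "(l, n) \<in> r" "(l', n) \<in> r" using m dir(3) by blast+
      then show "Cmp C Y (T m) (Z n) (\<pi> m n) (Cmp C Y (T l) (T m) (d l m) h) = Cmp C Y (T m) (Z n) (\<pi> m n) (Cmp C Y (T l') (T m) (d l' m) h')"
        unfolding push_\<pi>[OF Y h(1) m(2) n] push_\<pi>[OF Y h(2) m(3) n] using e by blast
    qed
    then show "Cmp C Y (T l) X (c l) h = Cmp C Y (T l') X (c l') h'"
      using push[OF Y h(1) m(2)] push[OF Y h(2) m(3)] by simp
  qed (use X T c \<pi> lift tuple in simp_all)
qed

end

section \<open>Separating an object of the definable subcategory\<close>

context serre_setting
begin

text \<open>The invariant of the construction. For \<open>a' = f\<close> it says that
  \<open>a\<close> can factor through \<open>f\<close> only if \<open>f\<close> is annihilated; it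
  ranges over all finitely presented \<open>Z\<close> so that it applies to the lifts of
  \<open>a\<close> to the stages of a direct limit.\<close>

definition admissible :: "'o \<Rightarrow> 'o \<Rightarrow> 'u \<Rightarrow> bool" where
  "admissible A X a \<longleftrightarrow> X \<in> Obj C \<and> a \<in> Mor C A X \<and>
     (\<forall>Z \<in> fp_objects C. \<forall>a' \<in> Mor C A Z. \<forall>z \<in> Mor C Z X. Cmp C A Z X z a' = a \<longrightarrow> annihilated A Z a')"

text \<open>For an index \<open>l = (i, s)\<close> the morphism \<open>z l : D i \<rightarrow> Z l\<close> solves those of the finitely many problems in \<open>s\<close>
  that are defined at stage \<open>i\<close>; the object \<open>X'\<close> is the reduced product of the \<open>Z l\<close>.\<close>

lemma admissible_step:
  assumes A: "A \<in> fp_objects C" and a: "admissible A X a"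
  obtains X' j where "j \<in> Mor C X X'" "admissible A X' (Cmp C A X X' j a)"
    "\<And>B D g u. \<lbrakk>B \<in> generators; D \<in> generators; annihilated B D g; u \<in> Mor C B X\<rbrakk>
      \<Longrightarrow> factors C B D X' g (Cmp C B X X' j u)"
proof -
  have X: "X \<in> Obj C" and aM: "a \<in> Mor C A X"
    and inv: "\<And>Z a' z. \<lbrakk>Z \<in> fp_objects C; a' \<in> Mor C A Z; z \<in> Mor C Z X; Cmp C A Z X z a' = a\<rbrakk> \<Longrightarrow> annihilated A Z a'"
    using a unfolding admissible_def by blast+
  have oA: "A \<in> Obj C" using A by (rule fp_objects_Obj)
  obtain I :: "'u set" and r D d c where I: "small TYPE('u) I" "D ` I \<subseteq> fp_objects C" and lim: "is_direct_limit C I r D d X c"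
    by (rule direct_limit_of_fp[OF X])
  note sys = directed_systemD[OF is_direct_limitD(1)[OF lim]] and c = is_direct_limitD(3)[OF lim]
    and cd = is_direct_limitD(4)[OF lim]
  note dir = directed_posetD[OF sys(1)]
  have fpD: "D i \<in> fp_objects C" if "i \<in> I" for i using I that by blast
  obtain i1 a1 where i1: "i1 \<in> I" and a1: "a1 \<in> Mor C A (D i1)" "a = Cmp C A (D i1) X (c i1) a1"
    using fp_lift[OF A I(1) lim aM] by blast
  \<comment> \<open>\<open>a\<close> factors through each of its lifts to a stage, so the lifts are
    annihilated.\<close>
  have ann: "annihilated A (D i) (Cmp C A (D i1) (D i) (d i1 i) a1)" if r: "(i1, i) \<in> r" for i
  proof -
    have i: "i \<in> I" using dir(4) r by blast
    have "Cmp C A (D i) X (c i) (Cmp C A (D i1) (D i) (d i1 i) a1) = a"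
      unfolding a1(2) cd[OF r, symmetric]
      using Cmp_assoc[OF oA sys(2)[OF i1] sys(2)[OF i] X a1(1) sys(3)[OF r] c[OF i]] .
    then show ?thesis
      using inv[OF fpD[OF i] Cmp_Mor[OF oA sys(2)[OF i1] sys(2)[OF i] a1(1) sys(3)[OF r]] c[OF i]] by blast
  qed
  \<comment> \<open>A problem asks to extend \<open>u\<close> along \<open>g\<close>. It suffices to
    list those posed at a stage, since a morphism from a generator to \<open>X\<close> comes from
    some stage.\<close>
  define Lab where "Lab = {(B, E, g, k, u). B \<in> generators \<and> E \<in> generators \<and> annihilated B E g \<and> k \<in> I \<and> u \<in> Mor C B (D k)}"
  have gen: "Z \<in> Obj C" if "Z \<in> generators" for Z using that generators_fp fp_objects_Obj[of Z C] by blast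
  have Lab_small: "small TYPE('u) Lab"
  proof (rule small_subset)
    show "small TYPE('u) (SIGMA B:generators. SIGMA E:generators. Mor C B E \<times> (SIGMA k:I. Mor C B (D k)))"
      by (intro small_Sigma universe generators_small I(1) small_Mor gen sys(2))
    show "Lab \<subseteq> (SIGMA B:generators. SIGMA E:generators. Mor C B E \<times> (SIGMA k:I. Mor C B (D k)))"
      unfolding Lab_def using annihilatedD(3) by auto
  qed
  \<comment> \<open>Stages start at \<open>i1\<close>, where a lift of \<open>a\<close> is
    available.\<close>
  define \<Lambda> where "\<Lambda> = {(i, s). (i1, i) \<in> r \<and> finite s \<and> s \<subseteq> Lab}"
  define R where "R = {((i, s), (i', s')). (i, s) \<in> \<Lambda> \<and> (i', s') \<in> \<Lambda> \<and> (i, i') \<in> r \<and> s \<subseteq> s'}"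
  have \<Lambda>_small: "small TYPE('u) \<Lambda>"
  proof (rule small_subset)
    show "small TYPE('u) (I \<times> Pow Lab)" by (intro small_Sigma small_Pow universe I(1) Lab_small)
    show "\<Lambda> \<subseteq> I \<times> Pow Lab" unfolding \<Lambda>_def using dir(4) by blast
  qed
  have po: "partial_order_on I r" using sys(1) unfolding directed_poset_def by blast
  have "partial_order_on \<Lambda> R"
    unfolding partial_order_on_def preorder_on_def
  proof (intro conjI)
    show "R \<subseteq> \<Lambda> \<times> \<Lambda>" unfolding R_def by blast
    show "refl_on \<Lambda> R" unfolding refl_on_def R_def using dir(2,4) by (auto simp: \<Lambda>_def)
    show "trans R" unfolding trans_def R_def using dir(3) by blast
    show "antisym R" unfolding antisym_def R_def using partial_order_onD(3)[OF po] by (auto simp: antisym_def)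
  qed
  moreover have "(i1, {}) \<in> \<Lambda>" unfolding \<Lambda>_def using dir(2) i1 by simp
  moreover have "\<exists>n\<in>\<Lambda>. (l, n) \<in> R \<and> (m, n) \<in> R" if "l \<in> \<Lambda>" "m \<in> \<Lambda>" for l m
  proof -
    obtain i s i' s' where lm: "l = (i, s)" "m = (i', s')" by (cases l, cases m) auto
    have "i \<in> I" "i' \<in> I" using that lm dir(4) unfolding \<Lambda>_def by auto
    then obtain k where k: "k \<in> I" "(i, k) \<in> r" "(i', k) \<in> r" using dir(5) by blast
    then have "(k, s \<union> s') \<in> \<Lambda>" using that lm dir(3) unfolding \<Lambda>_def by auto
    then show ?thesis using that lm k unfolding R_def by blast
  qed
  ultimately have dp: "directed_poset \<Lambda> R" unfolding directed_poset_def by blast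
  have "\<exists>p. annihilated (D i) (fst p) (snd p) \<and> (\<forall>(B, E, g, k, u) \<in> s. (k, i) \<in> r \<longrightarrow>
      factors C B E (fst p) g (Cmp C B (D i) (fst p) (snd p) (Cmp C B (D k) (D i) (d k i) u)))"
    if l: "(i, s) \<in> \<Lambda>" for i s
  proof -
    have i: "i \<in> I" and s: "finite s" "s \<subseteq> Lab" using l dir(4) unfolding \<Lambda>_def by auto
    let ?t = "(\<lambda>(B, E, g, k, u). (B, E, g, Cmp C B (D k) (D i) (d k i) u)) ` {(B, E, g, k, u). (B, E, g, k, u) \<in> s \<and> (k, i) \<in> r}"
    have "finite {(B, E, g, k, u). (B, E, g, k, u) \<in> s \<and> (k, i) \<in> r}"
      by (rule finite_subset[OF _ s(1)]) auto
    then have "finite ?t" by (rule finite_imageI)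
    moreover have "annihilated B E g \<and> v \<in> Mor C B (D i)" if t: "(B, E, g, v) \<in> ?t" for B E g v
    proof -
      obtain k u where k: "(B, E, g, k, u) \<in> s" "(k, i) \<in> r" "v = Cmp C B (D k) (D i) (d k i) u" using t by auto
      then have "(B, E, g, k, u) \<in> Lab" using s by blast
      then show ?thesis unfolding k(3) Lab_def
        using Cmp_Mor[OF gen sys(2) sys(2)[OF i] _ sys(3)[OF k(2)]] by auto
    qed
    ultimately obtain Z z where "annihilated (D i) Z z" "\<forall>(B, E, g, v) \<in> ?t. factors C B E Z g (Cmp C B (D i) Z z v)"
      using annihilated_finite_pushout[OF _ fpD[OF i], of ?t] by blast
    then show ?thesis by (intro exI[of _ "(Z, z)"]) auto
  qed
  then obtain p where p: "\<And>i s. (i, s) \<in> \<Lambda> \<Longrightarrow> annihilated (D i) (fst (p i s)) (snd (p i s))"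
    "\<And>i s B E g k u. \<lbrakk>(i, s) \<in> \<Lambda>; (B, E, g, k, u) \<in> s; (k, i) \<in> r\<rbrakk> \<Longrightarrow>
      factors C B E (fst (p i s)) g (Cmp C B (D i) (fst (p i s)) (snd (p i s)) (Cmp C B (D k) (D i) (d k i) u))"
    by (metis (mono_tags, lifting) case_prodD)
  define Z where "Z l = fst (p (fst l) (snd l))" for l
  define z where "z l = snd (p (fst l) (snd l))" for l
  have zann: "annihilated (D (fst l)) (Z l) (z l)" if "l \<in> \<Lambda>" for l
    unfolding Z_def z_def using p(1)[of "fst l" "snd l"] that by simp
  have zfac: "factors C B E (Z l) g (Cmp C B (D (fst l)) (Z l) (z l) (Cmp C B (D k) (D (fst l)) (d k (fst l)) u))"
    if "l \<in> \<Lambda>" "(B, E, g, k, u) \<in> snd l" "(k, fst l) \<in> r" for l B E g k u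
    unfolding Z_def z_def using p(2)[of "fst l" "snd l"] that by simp
  have Zo: "Z l \<in> Obj C" if "l \<in> \<Lambda>" for l using annihilatedD(5)[OF zann[OF that]] .
  have zM: "z l \<in> Mor C (D (fst l)) (Z l)" if "l \<in> \<Lambda>" for l using annihilatedD(3)[OF zann[OF that]] .
  obtain X' T c' \<pi> where rp: "is_reduced_product C \<Lambda> R Z X' T c' \<pi>"
    by (rule reduced_product[OF \<Lambda>_small dp Zo])
  note X' = is_reduced_productD(1)[OF rp] and T = is_reduced_productD(2)[OF rp] and c' = is_reduced_productD(3)[OF rp]
    and \<pi> = is_reduced_productD(4)[OF rp] and lift = is_reduced_productD(5)[OF rp]
    and eqD = is_reduced_productD(6)[OF rp] and eqI = is_reduced_productD(7)[OF rp] and tuple = is_reduced_productD(8)[OF rp]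
  have "\<exists>l. l \<in> \<Lambda> \<and> (i, fst l) \<in> r" if i: "i \<in> I" for i
  proof -
    obtain k where "(i, k) \<in> r" "(i1, k) \<in> r" using dir(5)[OF i i1] by blast
    then show ?thesis unfolding \<Lambda>_def by (intro exI[of _ "(k, {})"]) auto
  qed
  then obtain l where l: "\<And>i. i \<in> I \<Longrightarrow> l i \<in> \<Lambda>" "\<And>i. i \<in> I \<Longrightarrow> (i, fst (l i)) \<in> r" by metis
  have RD: "m \<in> \<Lambda>" "(fst n, fst m) \<in> r" "snd n \<subseteq> snd m" if "(n, m) \<in> R" for n m using that unfolding R_def by auto
  have lr: "(i, fst m) \<in> r" if "i \<in> I" "(l i, m) \<in> R" for i m
    using l(2)[OF that(1)] RD(2)[OF that(2)] dir(3) by blast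
  have fI: "fst m \<in> I" if "m \<in> \<Lambda>" for m using that dir(4) unfolding \<Lambda>_def by auto
  \<comment> \<open>All coordinates \<open>m\<close> of \<open>T (l i)\<close> have a stage above
    \<open>i\<close>, so \<open>D i\<close> maps to \<open>Z m\<close> by going to that stage and
    applying \<open>z m\<close>.\<close>
  have "\<exists>h\<in>Mor C (D i) (T (l i)). \<forall>m. (l i, m) \<in> R \<longrightarrow>
      Cmp C (D i) (T (l i)) (Z m) (\<pi> (l i) m) h = Cmp C (D i) (D (fst m)) (Z m) (z m) (d i (fst m))" if i: "i \<in> I" for i
    by (rule tuple[OF sys(2)[OF i] l(1)[OF i]])
      (use RD(1) lr[OF i] fI Zo zM sys i in \<open>blast intro: Cmp_Mor\<close>)
  then obtain h where h: "\<And>i. i \<in> I \<Longrightarrow> h i \<in> Mor C (D i) (T (l i))"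
    "\<And>i m. i \<in> I \<Longrightarrow> (l i, m) \<in> R \<Longrightarrow> Cmp C (D i) (T (l i)) (Z m) (\<pi> (l i) m) (h i) = Cmp C (D i) (D (fst m)) (Z m) (z m) (d i (fst m))"
    by metis
  have hu: "Cmp C B (T (l i)) (Z m) (\<pi> (l i) m) (Cmp C B (D i) (T (l i)) (h i) u)
      = Cmp C B (D (fst m)) (Z m) (z m) (Cmp C B (D i) (D (fst m)) (d i (fst m)) u)"
    if i: "i \<in> I" and m: "(l i, m) \<in> R" and B: "B \<in> Obj C" and u: "u \<in> Mor C B (D i)" for i m B u
    using Cmp_assoc[OF B sys(2)[OF i] T[OF l(1)[OF i]] Zo[OF RD(1)[OF m]] u h(1)[OF i] \<pi>[OF m]]
      Cmp_assoc[OF B sys(2)[OF i] sys(2)[OF fI[OF RD(1)[OF m]]] Zo[OF RD(1)[OF m]] u sys(3)[OF lr[OF i m]] zM[OF RD(1)[OF m]]]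
      h(2)[OF i m] by simp
  define b where "b i = Cmp C (D i) (T (l i)) X' (c' (l i)) (h i)" for i
  have bM: "b i \<in> Mor C (D i) X'" if "i \<in> I" for i
    unfolding b_def using Cmp_Mor[OF sys(2)[OF that] T[OF l(1)[OF that]] X' h(1)[OF that] c'[OF l(1)[OF that]]] .
  have bu: "Cmp C B (D i) X' (b i) u = Cmp C B (T (l i)) X' (c' (l i)) (Cmp C B (D i) (T (l i)) (h i) u)"
    if i: "i \<in> I" and B: "B \<in> Obj C" and u: "u \<in> Mor C B (D i)" for i B u
    unfolding b_def using Cmp_assoc[OF B sys(2)[OF i] T[OF l(1)[OF i]] X' u h(1)[OF i] c'[OF l(1)[OF i]]] by simp
  have "is_cocone C I r D d X' b"
    unfolding is_cocone_def
  proof (intro conjI ballI X' bM)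
    fix ik assume "ik \<in> r"
    then obtain i k where ik: "ik = (i, k)" "(i, k) \<in> r" by (cases ik) auto
    then have iI: "i \<in> I" and kI: "k \<in> I" using dir(4) by blast+
    \<comment> \<open>At a common coordinate \<open>m\<close> both sides go from \<open>D i\<close>
      to the stage \<open>fst m\<close> and apply \<open>z m\<close>.\<close>
    have "Cmp C (D i) (D k) X' (b k) (d i k) = b i"
      unfolding bu[OF kI sys(2)[OF iI] sys(3)[OF ik(2)]] b_def[of i]
    proof (rule eqI[OF sys(2)[OF iI] l(1)[OF kI] l(1)[OF iI] Cmp_Mor[OF sys(2)[OF iI] sys(2)[OF kI] T[OF l(1)[OF kI]] sys(3)[OF ik(2)] h(1)[OF kI]] h(1)[OF iI]])
      fix m assume "(l k, m) \<in> R \<and> (l i, m) \<in> R"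
      then have m: "(l k, m) \<in> R" "(l i, m) \<in> R" by blast+
      show "Cmp C (D i) (T (l k)) (Z m) (\<pi> (l k) m) (Cmp C (D i) (D k) (T (l k)) (h k) (d i k)) = Cmp C (D i) (T (l i)) (Z m) (\<pi> (l i) m) (h i)"
        unfolding hu[OF kI m(1) sys(2)[OF iI] sys(3)[OF ik(2)]] h(2)[OF iI m(2)]
        using sys(5)[OF ik(2) lr[OF kI m(1)]] by simp
    qed
    then show "case ik of (i, k) \<Rightarrow> Cmp C (D i) (D k) X' (b k) (d i k) = b i" using ik by simp
  qed
  then obtain j where j: "j \<in> Mor C X X'" "\<And>i. i \<in> I \<Longrightarrow> Cmp C (D i) X X' j (c i) = b i"
    using direct_limit_universal[OF lim] by blast
  have jc: "Cmp C B X X' j (Cmp C B (D i) X (c i) u) = Cmp C B (D i) X' (b i) u"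
    if "i \<in> I" "B \<in> Obj C" "u \<in> Mor C B (D i)" for i B u
    unfolding j(2)[OF that(1), symmetric] using Cmp_assoc[OF that(2) sys(2)[OF that(1)] X X' that(3) c[OF that(1)] j(1)] .
  show thesis
  proof (rule that[OF j(1)])
    show "admissible A X' (Cmp C A X X' j a)"
      unfolding admissible_def
    proof (intro conjI ballI impI X')
      show "Cmp C A X X' j a \<in> Mor C A X'" using Cmp_Mor[OF oA X X' aM j(1)] .
      fix W a' w assume W: "W \<in> fp_objects C" and a': "a' \<in> Mor C A W" and w: "w \<in> Mor C W X'" and wa: "Cmp C A W X' w a' = Cmp C A X X' j a"
      have oW: "W \<in> Obj C" using W by (rule fp_objects_Obj)
      obtain k w' where k: "k \<in> \<Lambda>" and w': "w' \<in> Mor C W (T k)" "w = Cmp C W (T k) X' (c' k) w'" using lift[OF W w] by blast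
      note lk = l(1)[OF i1]
      have ha: "Cmp C A (D i1) (T (l i1)) (h i1) a1 \<in> Mor C A (T (l i1))" using Cmp_Mor[OF oA sys(2)[OF i1] T[OF lk] a1(1) h(1)[OF i1]] .
      have w'a: "Cmp C A W (T k) w' a' \<in> Mor C A (T k)" using Cmp_Mor[OF oA oW T[OF k] a' w'(1)] .
      have "Cmp C A (T k) X' (c' k) (Cmp C A W (T k) w' a') = Cmp C A W X' w a'"
        unfolding w'(2) using Cmp_assoc[OF oA oW T[OF k] X' a' w'(1) c'[OF k]] .
      also have "\<dots> = Cmp C A (T (l i1)) X' (c' (l i1)) (Cmp C A (D i1) (T (l i1)) (h i1) a1)"
        unfolding wa a1(2) jc[OF i1 oA a1(1)] bu[OF i1 oA a1(1)] ..
      \<comment> \<open>The two morphisms from \<open>A\<close> agree at one coordinate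
        \<open>m\<close>. There the right-hand one is a composite of two annihilated morphisms, and
        \<open>a'\<close> is a first factor of it.\<close>
      finally obtain m where m: "(k, m) \<in> R" "(l i1, m) \<in> R"
        "Cmp C A (T k) (Z m) (\<pi> k m) (Cmp C A W (T k) w' a') = Cmp C A (T (l i1)) (Z m) (\<pi> (l i1) m) (Cmp C A (D i1) (T (l i1)) (h i1) a1)"
        using eqD[OF A k lk w'a ha] by blast
      note mL = RD(1)[OF m(1)]
      have "annihilated A (Z m) (Cmp C A (D (fst m)) (Z m) (z m) (Cmp C A (D i1) (D (fst m)) (d i1 (fst m)) a1))"
        using annihilated_Cmp[OF ann[OF lr[OF i1 m(2)]] zann[OF mL]] .
      also have "Cmp C A (D (fst m)) (Z m) (z m) (Cmp C A (D i1) (D (fst m)) (d i1 (fst m)) a1)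
        = Cmp C A W (Z m) (Cmp C W (T k) (Z m) (\<pi> k m) w') a'"
        using m(3) hu[OF i1 m(2) oA a1(1)] Cmp_assoc[OF oA oW T[OF k] Zo[OF mL] a' w'(1) \<pi>[OF m(1)]] by simp
      finally show "annihilated A W a'"
        using annihilated_right[OF A W annihilatedD(2)[OF zann[OF mL]] a' Cmp_Mor[OF oW T[OF k] Zo[OF mL] w'(1) \<pi>[OF m(1)]]] by blast
    qed
    fix B E g u assume B: "B \<in> generators" and E: "E \<in> generators" and g: "annihilated B E g" and u: "u \<in> Mor C B X"
    note oB = annihilatedD(4)[OF g] and oE = annihilatedD(5)[OF g] and gM = annihilatedD(3)[OF g]
    obtain k u' where k: "k \<in> I" and u': "u' \<in> Mor C B (D k)" "u = Cmp C B (D k) X (c k) u'"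
      using fp_lift[OF annihilatedD(1)[OF g] I(1) lim u] by blast
    let ?lab = "(B, E, g, k, u')"
    obtain i where i: "i \<in> I" "(k, i) \<in> r" "(i1, i) \<in> r" using dir(5)[OF k i1] by blast
    \<comment> \<open>Above the index carrying just this problem every \<open>Z m\<close> solves it,
      so the solutions form one morphism into the product \<open>T ?n\<close>.\<close>
    let ?n = "(i, {?lab})"
    have n: "?n \<in> \<Lambda>" using i B E g k u' unfolding \<Lambda>_def Lab_def by simp
    have "\<exists>y. y \<in> Mor C E (Z m) \<and> Cmp C B (D (fst m)) (Z m) (z m) (Cmp C B (D k) (D (fst m)) (d k (fst m)) u') = Cmp C B E (Z m) y g"
      if m: "(?n, m) \<in> R" for m
    proof -
      have "?lab \<in> snd m" "(k, fst m) \<in> r" using RD[OF m] i dir(3) by auto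
      from zfac[OF RD(1)[OF m] this] show ?thesis unfolding factors_def by blast
    qed
    then obtain y where y: "\<And>m. (?n, m) \<in> R \<Longrightarrow> y m \<in> Mor C E (Z m)"
      "\<And>m. (?n, m) \<in> R \<Longrightarrow> Cmp C B (D (fst m)) (Z m) (z m) (Cmp C B (D k) (D (fst m)) (d k (fst m)) u') = Cmp C B E (Z m) (y m) g"
      by metis
    obtain v where v: "v \<in> Mor C E (T ?n)" "\<And>m. (?n, m) \<in> R \<Longrightarrow> Cmp C E (T ?n) (Z m) (\<pi> ?n m) v = y m"
      using tuple[OF oE n y(1)] by metis
    have "Cmp C B X X' j u = Cmp C B (T (l k)) X' (c' (l k)) (Cmp C B (D k) (T (l k)) (h k) u')"
      unfolding u'(2) jc[OF k oB u'(1)] bu[OF k oB u'(1)] ..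
    also have "\<dots> = Cmp C B (T ?n) X' (c' ?n) (Cmp C B E (T ?n) v g)"
    proof (rule eqI[OF oB l(1)[OF k] n Cmp_Mor[OF oB sys(2)[OF k] T[OF l(1)[OF k]] u'(1) h(1)[OF k]] Cmp_Mor[OF oB oE T[OF n] gM v(1)]])
      fix m assume "(l k, m) \<in> R \<and> (?n, m) \<in> R"
      then have m: "(l k, m) \<in> R" "(?n, m) \<in> R" by blast+
      show "Cmp C B (T (l k)) (Z m) (\<pi> (l k) m) (Cmp C B (D k) (T (l k)) (h k) u') = Cmp C B (T ?n) (Z m) (\<pi> ?n m) (Cmp C B E (T ?n) v g)"
        unfolding hu[OF k m(1) oB u'(1)] y(2)[OF m(2)] v(2)[OF m(2), symmetric]
        using Cmp_assoc[OF oB oE T[OF n] Zo[OF RD(1)[OF m(2)]] gM v(1) \<pi>[OF m(2)]] by simp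
    qed
    also have "\<dots> = Cmp C B E X' (Cmp C E (T ?n) X' (c' ?n) v) g"
      using Cmp_assoc[OF oB oE T[OF n] X' gM v(1) c'[OF n]] .
    finally show "factors C B E X' g (Cmp C B X X' j u)"
      unfolding factors_def using Cmp_Mor[OF oE T[OF n] X' v(1) c'[OF n]] by blast
  qed
qed

text \<open>A sequence of steps is enough because a morphism from a generator to the limit comes
  from a finite stage, and the problem it poses is solved at the next one. A factorization of the
  morphism from \<open>A\<close> through \<open>f\<close> would likewise show at a finite stage,
  against admissibility.\<close>

lemma separating_object:
  assumes A: "A \<in> fp_objects C" and B: "B \<in> fp_objects C" and f: "f \<in> Mor C A B" and nf: "\<not> annihilated A B f"
  obtains X x where "X \<in> definable_of C S" "x \<in> Mor C A X" "\<not> factors C A B X f x"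
proof -
  have oA: "A \<in> Obj C" and oB: "B \<in> Obj C" using A B by (simp_all add: fp_objects_Obj)
  define P where "P = (\<lambda>(n::nat) (X, a). admissible A X a)"
  define Q where "Q = (\<lambda>(n::nat) (X, a) (X', a'). \<exists>j \<in> Mor C X X'. a' = Cmp C A X X' j a \<and>
    (\<forall>B D g u. B \<in> generators \<longrightarrow> D \<in> generators \<longrightarrow> annihilated B D g \<longrightarrow> u \<in> Mor C B X \<longrightarrow>
      factors C B D X' g (Cmp C B X X' j u)))"
  have "admissible A A (Idt C A)"
    unfolding admissible_def
  proof (intro conjI oA Idt_Mor ballI impI)
    fix Z a' z assume "Z \<in> fp_objects C" "a' \<in> Mor C A Z" "z \<in> Mor C Z A" "Cmp C A Z A z a' = Idt C A"
    then show "annihilated A Z a'"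
      using annihilated_right[OF A _ A] annihilated_Idt[OF A] by simp
  qed
  then have "\<exists>s. P 0 s" unfolding P_def by auto
  moreover have "\<exists>s'. P (Suc n) s' \<and> Q n s s'" if Ps: "P n s" for n s
  proof -
    obtain X a where s: "s = (X, a)" by (cases s)
    have "admissible A X a" using Ps s unfolding P_def by simp
    then obtain X' j where "j \<in> Mor C X X'" "admissible A X' (Cmp C A X X' j a)"
      "\<And>B D g u. \<lbrakk>B \<in> generators; D \<in> generators; annihilated B D g; u \<in> Mor C B X\<rbrakk>
        \<Longrightarrow> factors C B D X' g (Cmp C B X X' j u)"
      using admissible_step[OF A] by metis
    then show ?thesis unfolding P_def Q_def s by (intro exI[of _ "(X', Cmp C A X X' j a)"]) auto
  qed
  ultimately obtain s where s: "\<And>n. P n (s n)" "\<And>n. Q n (s n) (s (Suc n))"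
    using dependent_nat_choice[of P Q] by metis
  define X where "X n = fst (s n)" for n
  define a where "a n = snd (s n)" for n
  have adm: "admissible A (X n) (a n)" for n using s(1)[of n] unfolding P_def X_def a_def by (simp add: case_prod_beta)
  have X: "X n \<in> Obj C" and a: "a n \<in> Mor C A (X n)" for n using adm[of n] unfolding admissible_def by blast+
  have "\<exists>j. j \<in> Mor C (X n) (X (Suc n)) \<and> a (Suc n) = Cmp C A (X n) (X (Suc n)) j (a n) \<and>
    (\<forall>B D g u. B \<in> generators \<longrightarrow> D \<in> generators \<longrightarrow> annihilated B D g \<longrightarrow> u \<in> Mor C B (X n) \<longrightarrow>
      factors C B D (X (Suc n)) g (Cmp C B (X n) (X (Suc n)) j u))" for n
    using s(2)[of n] unfolding Q_def X_def a_def by (auto simp: case_prod_beta)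
  then obtain j where j: "\<And>n. j n \<in> Mor C (X n) (X (Suc n))" "\<And>n. a (Suc n) = Cmp C A (X n) (X (Suc n)) (j n) (a n)"
    "\<And>n B D g u. \<lbrakk>B \<in> generators; D \<in> generators; annihilated B D g; u \<in> Mor C B (X n)\<rbrakk> \<Longrightarrow>
      factors C B D (X (Suc n)) g (Cmp C B (X n) (X (Suc n)) (j n) u)"
    by metis
  \<comment> \<open>\<open>d m k\<close> is the composite of \<open>k\<close> steps from stage
    \<open>m\<close>; the transition from \<open>m\<close> to \<open>n\<close> is
    \<open>d m (n - m)\<close>.\<close>
  define d where "d m = rec_nat (Idt C (X m)) (\<lambda>k. Cmp C (X m) (X (m + k)) (X (Suc (m + k))) (j (m + k)))" for m
  have d0: "d m 0 = Idt C (X m)" and dS: "d m (Suc k) = Cmp C (X m) (X (m + k)) (X (Suc (m + k))) (j (m + k)) (d m k)" for m k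
    by (simp_all add: d_def)
  have dM: "d m k \<in> Mor C (X m) (X (m + k))" for m k
    by (induction k) (simp_all add: d0 dS Idt_Mor X Cmp_Mor j)
  have dC: "d m (k + l) = Cmp C (X m) (X (m + k)) (X (m + k + l)) (d (m + k) l) (d m k)" for m k l
  proof (induction l)
    case 0 then show ?case using dM by (simp add: d0 Cmp_Idt_left X)
  next
    case (Suc l)
    then show ?case using dM[of "m + k" l] dM[of m k] j(1)[of "m + k + l"]
      by (simp add: dS add.assoc[symmetric] Cmp_assoc X)
  qed
  have da: "Cmp C A (X m) (X (m + k)) (d m k) (a m) = a (m + k)" for m k
  proof (induction k)
    case 0
    show ?case using a by (simp add: d0 Cmp_Idt_left X oA)
  next
    case (Suc k)
    then show ?case using j(2)[of "m + k"] Cmp_assoc[OF oA X X X a dM j(1), of m k] by (simp add: dS)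
  qed
  let ?r = "{(m, n). m \<le> n} :: nat rel"
  have sys: "directed_system C UNIV ?r X (\<lambda>m n. d m (n - m))"
    unfolding directed_system_def
  proof (intro conjI allI impI ballI X)
    have "partial_order_on UNIV ?r"
      unfolding partial_order_on_def preorder_on_def refl_on_def trans_def antisym_def by auto
    then show "directed_poset UNIV ?r" unfolding directed_poset_def by (auto intro: max.cobounded1 max.cobounded2)
    show "case p of (m, n) \<Rightarrow> d m (n - m) \<in> Mor C (X m) (X n)" if "p \<in> ?r" for p
      using that dM[of "fst p" "snd p - fst p"] by auto
    show "d m (m - m) = Idt C (X m)" for m by (simp add: d0)
    fix m n q assume "(m, n) \<in> ?r \<and> (n, q) \<in> ?r"
    then have "m \<le> n" "n \<le> q" by auto
    then show "d m (q - m) = Cmp C (X m) (X n) (X q) (d n (q - n)) (d m (n - m))"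
      using dC[of m "n - m" "q - n"] by simp
  qed
  obtain Y c where lim: "fp_limit_cocone C UNIV ?r X (\<lambda>m n. d m (n - m)) Y c"
    by (rule direct_limit_exists[OF small_nat[OF universe] sys])
  note cc = fp_limit_coconeD(1)[OF lim] and lift = fp_limit_coconeD(2)[OF lim] and eq = fp_limit_coconeD(3)[OF lim]
  have Y: "Y \<in> Obj C" and c: "\<And>n. c n \<in> Mor C (X n) Y"
    and cd: "\<And>m n. m \<le> n \<Longrightarrow> Cmp C (X m) (X n) Y (c n) (d m (n - m)) = c m"
    using cc unfolding is_cocone_def by auto
  have d1: "d n (Suc n - n) = j n" for n
    using j(1)[of n] by (simp add: dS d0 Cmp_Idt_right X)
  have cj: "Cmp C (X n) (X (Suc n)) Y (c (Suc n)) (j n) = c n" for n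
    using cd[of n "Suc n"] unfolding d1 by simp
  have YD: "Y \<in> definable_of C S"
    unfolding definable_of_iff
  proof (intro conjI Y allI impI)
    fix B D g assume "annihilated B D g"
    then obtain B0 D0 g0 where B0: "B0 \<in> generators" "D0 \<in> generators" "annihilated B0 D0 g0"
      and red: "\<And>X. \<lbrakk>X \<in> Obj C; \<And>x. x \<in> Mor C B0 X \<Longrightarrow> factors C B0 D0 X g0 x\<rbrakk>
        \<Longrightarrow> \<forall>x \<in> Mor C B X. factors C B D X g x"
      by (rule annihilated_generators) blast
    note o0 = annihilatedD(4,5)[OF B0(3)]
    show "\<forall>x\<in>Mor C B Y. factors C B D Y g x"
    proof (rule red[OF Y])
      fix x assume x: "x \<in> Mor C B0 Y"
      obtain n x' where x': "x' \<in> Mor C B0 (X n)" "x = Cmp C B0 (X n) Y (c n) x'"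
        using lift[OF annihilatedD(1)[OF B0(3)] x] by blast
      have "x = Cmp C B0 (X (Suc n)) Y (c (Suc n)) (Cmp C B0 (X n) (X (Suc n)) (j n) x')"
        unfolding x'(2) using Cmp_assoc[OF o0(1) X X Y x'(1) j(1) c] cj by simp
      then show "factors C B0 D0 Y g0 x"
        using factors_Cmp[OF o0 X Y annihilatedD(3)[OF B0(3)] c j(3)[OF B0 x'(1)]] by simp
    qed
  qed
  let ?x = "Cmp C A (X 0) Y (c 0) (a 0)"
  have x: "?x \<in> Mor C A Y" using Cmp_Mor[OF oA X Y a c] .
  have ca: "Cmp C A (X n) Y (c n) (a n) = ?x" for n
    using cd[of 0 n] da[of 0 n] Cmp_assoc[OF oA X X Y a dM c, of 0 n] by simp
  have "\<not> factors C A B Y f ?x"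
  proof
    assume "factors C A B Y f ?x"
    then obtain y where y: "y \<in> Mor C B Y" "?x = Cmp C A B Y y f" unfolding factors_def by blast
    obtain n y' where y': "y' \<in> Mor C B (X n)" "y = Cmp C B (X n) Y (c n) y'" using lift[OF B y(1)] by blast
    have y'f: "Cmp C A B (X n) y' f \<in> Mor C A (X n)" using Cmp_Mor[OF oA oB X f y'(1)] .
    have "Cmp C A (X n) Y (c n) (Cmp C A B (X n) y' f) = Cmp C A (X n) Y (c n) (a n)"
      unfolding ca[of n] y(2) y'(2) using Cmp_assoc[OF oA oB X Y f y'(1) c] .
    then obtain m where m: "n \<le> m" "Cmp C A (X n) (X m) (d n (m - n)) (Cmp C A B (X n) y' f) = Cmp C A (X n) (X m) (d n (m - n)) (a n)"
      using eq[OF A UNIV_I y'f a] by blast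
    have dnm: "d n (m - n) \<in> Mor C (X n) (X m)" using dM[of n "m - n"] m by simp
    have "Cmp C A B (X m) (Cmp C B (X n) (X m) (d n (m - n)) y') f = a m"
      using m da[of n "m - n"] Cmp_assoc[OF oA oB X X f y'(1) dnm] by simp
    then have "annihilated A B f"
      using adm[of m] B f Cmp_Mor[OF oB X X y'(1) dnm] unfolding admissible_def by blast
    then show False using nf by blast
  qed
  then show thesis using that YD x by blast
qed

end

text \<open>Factorizations are found coordinatewise in a product, at a stage of a direct limit since
  the source is finitely presented, and are pulled back along a pure monomorphism by the definition
  of purity.\<close>

lemma (in serre_setting) definable_subcategory_definable_of: "definable_subcategory C (definable_of C S)"
  unfolding definable_subcategory_def
proof (intro conjI allI ballI impI)
  show "definable_of C S \<subseteq> Obj C" using definable_of_iff by blast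
next
  fix I :: "'u set" and D X p
  assume *: "small TYPE('u) I \<and> D ` I \<subseteq> definable_of C S \<and> is_product C I D X p"
  then have P: "is_product C I D X p" and D: "\<And>i. i \<in> I \<Longrightarrow> D i \<in> definable_of C S" by blast+
  note X = productD(1)[OF P]
  show "X \<in> definable_of C S"
    unfolding definable_of_iff
  proof (intro conjI X allI impI ballI)
    fix A B f x assume f: "annihilated A B f" and x: "x \<in> Mor C A X"
    note m = annihilatedD[OF f]
    have "\<exists>y\<in>Mor C B (D i). Cmp C A X (D i) (p i) x = Cmp C A B (D i) y f" if i: "i \<in> I" for i
      using D[OF i] f Cmp_Mor[OF m(4) X productD(2)[OF P i] x productD(3)[OF P i]]
      unfolding definable_of_iff factors_def by blast
    then obtain y where y: "\<And>i. i \<in> I \<Longrightarrow> y i \<in> Mor C B (D i)"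
      "\<And>i. i \<in> I \<Longrightarrow> Cmp C A X (D i) (p i) x = Cmp C A B (D i) (y i) f" by metis
    obtain z where z: "z \<in> Mor C B X" "\<And>i. i \<in> I \<Longrightarrow> Cmp C B X (D i) (p i) z = y i"
      using product_universal[OF P m(5), of y] y(1) by blast
    have "x = Cmp C A B X z f"
    proof (rule product_eqI[OF P m(4) x Cmp_Mor[OF m(4,5) X m(3) z(1)] _ preadditive_category_axioms])
      fix i assume i: "i \<in> I"
      show "Cmp C A X (D i) (p i) x = Cmp C A X (D i) (p i) (Cmp C A B X z f)"
        unfolding y(2)[OF i] z(2)[OF i, symmetric]
        using Cmp_assoc[OF m(4,5) X productD(2)[OF P i] m(3) z(1) productD(3)[OF P i]] by simp
    qed
    then show "factors C A B X f x" unfolding factors_def using z(1) by blast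
  qed
next
  fix I :: "'u set" and r D d X c
  assume *: "small TYPE('u) I \<and> D ` I \<subseteq> definable_of C S \<and> is_direct_limit C I r D d X c"
  then have I: "small TYPE('u) I" and lim: "is_direct_limit C I r D d X c" and D: "\<And>i. i \<in> I \<Longrightarrow> D i \<in> definable_of C S" by blast+
  note X = is_direct_limitD(2)[OF lim] and c = is_direct_limitD(3)[OF lim]
  show "X \<in> definable_of C S"
    unfolding definable_of_iff
  proof (intro conjI X allI impI ballI)
    fix A B f x assume f: "annihilated A B f" and x: "x \<in> Mor C A X"
    note m = annihilatedD[OF f]
    obtain i x' where i: "i \<in> I" "x' \<in> Mor C A (D i)" "x = Cmp C A (D i) X (c i) x'"
      using fp_lift[OF m(1) I lim x] by blast
    have "factors C A B (D i) f x'" "D i \<in> Obj C" using D[OF i(1)] f i(2) unfolding definable_of_iff by blast+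
    then show "factors C A B X f x" unfolding i(3) by (intro factors_Cmp m X c i)
  qed
next
  fix X Y m assume X: "X \<in> Obj C" and Y: "Y \<in> definable_of C S" and pure: "pure_mono C X Y m"
  have oY: "Y \<in> Obj C" using Y definable_of_iff by blast
  have mM: "m \<in> Mor C X Y" using pure unfolding pure_mono_def mono_mor_def by blast
  show "X \<in> definable_of C S"
    unfolding definable_of_iff
  proof (intro conjI X allI impI ballI)
    fix A B f x assume f: "annihilated A B f" and x: "x \<in> Mor C A X"
    note n = annihilatedD[OF f]
    have "factors C A B Y f (Cmp C A X Y m x)"
      using Y f Cmp_Mor[OF n(4) X oY x mM] unfolding definable_of_iff by blast
    then obtain h' where h': "h' \<in> Mor C B Y" "Cmp C A B Y h' f = Cmp C A X Y m x" unfolding factors_def by metis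
    have "\<forall>A\<in>fp_objects C. \<forall>B\<in>fp_objects C. \<forall>f\<in>Mor C A B. \<forall>h\<in>Mor C A X. \<forall>h'\<in>Mor C B Y.
      Cmp C A B Y h' f = Cmp C A X Y m h \<longrightarrow> (\<exists>k\<in>Mor C B X. Cmp C A B X k f = h)"
      using pure unfolding pure_mono_def by blast
    from this[rule_format, OF n(1,2,3) x h'] show "factors C A B X f x" unfolding factors_def by metis
  qed
qed

section \<open>Day convolution of presented functors\<close>

locale small_symmetric_monoidal = symmetric_monoidal C M + small_preadditive_category C
  for C :: "('o, 'u) category" and M :: "('o, 'u) monoidal_structure" (structure)
begin

lemma TMor_hom_left:
  "\<lbrakk>X \<in> Obj C; X' \<in> Obj C; Y \<in> Obj C; Y' \<in> Obj C; g \<in> Mor C Y Y'\<rbrakk>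
    \<Longrightarrow> (\<lambda>f. TMor M X X' Y Y' f g) \<in> hom (Hom C X X') (Hom C (X \<boxtimes> Y) (X' \<boxtimes> Y'))"
  by (rule homI) (simp_all add: TMor_Mor TMor_add_left)

lemma TMor_hom_right:
  "\<lbrakk>X \<in> Obj C; X' \<in> Obj C; Y \<in> Obj C; Y' \<in> Obj C; f \<in> Mor C X X'\<rbrakk>
    \<Longrightarrow> TMor M X X' Y Y' f \<in> hom (Hom C Y Y') (Hom C (X \<boxtimes> Y) (X' \<boxtimes> Y'))"
  by (rule homI) (simp_all add: TMor_Mor TMor_add_right)

text \<open>By the Yoneda lemma a biadditive family \<open>b\<close> out of \<open>G\<close> and \<open>F\<close> is determined by
  its value at the pair of generators.\<close>

lemma presents_day_convolution:
  assumes pG: "presents C P Q g G eG" and pF: "presents C A B f F eF"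
    and pD: "presents C (P \<boxtimes> A) R h D eD"
    and h: "\<And>W x. \<lbrakk>W \<in> Obj C; x \<in> Mor C (P \<boxtimes> A) W\<rbrakk> \<Longrightarrow> factors C (P \<boxtimes> A) R W h x \<longleftrightarrow>
      (\<exists>y \<in> Mor C (P \<boxtimes> B) W. \<exists>y' \<in> Mor C (Q \<boxtimes> A) W.
        x = Cmp C (P \<boxtimes> A) (P \<boxtimes> B) W y (TMor M P P A B (Idt C P) f)
          \<otimes>\<^bsub>Hom C (P \<boxtimes> A) W\<^esub> Cmp C (P \<boxtimes> A) (Q \<boxtimes> A) W y' (TMor M P Q A A g (Idt C A)))"
  shows "is_day_convolution C M G F D"
proof -
  note G = presents_functor[OF pG] and F = presents_functor[OF pF] and D = presents_functor[OF pD]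
  note mG = presents_Mor[OF pG] and mF = presents_Mor[OF pF] and mD = presents_Mor[OF pD]
  note eG = presents_gen[OF pG] and eF = presents_gen[OF pF] and eD = presents_gen[OF pD]
  note o = mG(1,2) mF(1,2) TOb_Obj[OF mG(1) mF(1)] TOb_Obj[OF mG(1) mF(2)] TOb_Obj[OF mG(2) mF(1)]
  note IP = Idt_Mor[OF o(1)] and IA = Idt_Mor[OF o(3)]
  let ?f = "TMor M P P A B (Idt C P) f" and ?g = "TMor M P Q A A g (Idt C A)"
  have fM: "?f \<in> Mor C (P \<boxtimes> A) (P \<boxtimes> B)" using TMor_Mor[OF o(1,1,3,4) IP mF(3)] .
  have gM: "?g \<in> Mor C (P \<boxtimes> A) (Q \<boxtimes> A)" using TMor_Mor[OF o(1,2,3,3) mG(3) IA] .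
  have hf: "factors C (P \<boxtimes> A) R W h (Cmp C (P \<boxtimes> A) (P \<boxtimes> B) W y ?f)" if "W \<in> Obj C" "y \<in> Mor C (P \<boxtimes> B) W" for W y
  proof -
    have yM: "Cmp C (P \<boxtimes> A) (P \<boxtimes> B) W y ?f \<in> Mor C (P \<boxtimes> A) W" using Cmp_Mor[OF o(5,6) that(1) fM that(2)] .
    interpret W: comm_group "Hom C (P \<boxtimes> A) W" using Hom_comm_group o(5) that(1) by blast
    have "Cmp C (P \<boxtimes> A) (P \<boxtimes> B) W y ?f = Cmp C (P \<boxtimes> A) (P \<boxtimes> B) W y ?f
        \<otimes>\<^bsub>Hom C (P \<boxtimes> A) W\<^esub> Cmp C (P \<boxtimes> A) (Q \<boxtimes> A) W (zero_mor C (Q \<boxtimes> A) W) ?g"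
      using yM gM o that by simp
    then show ?thesis using h[OF that(1) yM] that zero_Mor[OF o(7) that(1)] by blast
  qed
  have hg: "factors C (P \<boxtimes> A) R W h (Cmp C (P \<boxtimes> A) (Q \<boxtimes> A) W y ?g)" if "W \<in> Obj C" "y \<in> Mor C (Q \<boxtimes> A) W" for W y
  proof -
    have yM: "Cmp C (P \<boxtimes> A) (Q \<boxtimes> A) W y ?g \<in> Mor C (P \<boxtimes> A) W" using Cmp_Mor[OF o(5,7) that(1) gM that(2)] .
    interpret W: comm_group "Hom C (P \<boxtimes> A) W" using Hom_comm_group o(5) that(1) by blast
    have "Cmp C (P \<boxtimes> A) (Q \<boxtimes> A) W y ?g = Cmp C (P \<boxtimes> A) (P \<boxtimes> B) W (zero_mor C (P \<boxtimes> B) W) ?f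
        \<otimes>\<^bsub>Hom C (P \<boxtimes> A) W\<^esub> Cmp C (P \<boxtimes> A) (Q \<boxtimes> A) W y ?g"
      using yM fM o that by simp
    then show ?thesis using h[OF that(1) yM] that zero_Mor[OF o(6) that(1)] by blast
  qed
  \<comment> \<open>Elements of \<open>G U\<close> and \<open>F V\<close> are named by chosen
    morphisms out of \<open>P\<close> and \<open>A\<close>.\<close>
  define \<xi> where "\<xi> U x = (SOME x'. x' \<in> Mor C P U \<and> x = FMor G P U x' eG)" for U x
  define \<upsilon> where "\<upsilon> V y = (SOME y'. y' \<in> Mor C A V \<and> y = FMor F A V y' eF)" for V y
  have \<xi>: "\<xi> U x \<in> Mor C P U" "FMor G P U (\<xi> U x) eG = x" if "U \<in> Obj C" "x \<in> carrier (FOb G U)" for U x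
  proof -
    have "\<exists>x'. x' \<in> Mor C P U \<and> x = FMor G P U x' eG" using presents_surj[OF pG that] by blast
    note * = someI_ex[OF this, folded \<xi>_def]
    show "\<xi> U x \<in> Mor C P U" by (rule conjunct1[OF *])
    show "FMor G P U (\<xi> U x) eG = x" by (rule conjunct2[OF *, symmetric])
  qed
  have \<upsilon>: "\<upsilon> V y \<in> Mor C A V" "FMor F A V (\<upsilon> V y) eF = y" if "V \<in> Obj C" "y \<in> carrier (FOb F V)" for V y
  proof -
    have "\<exists>y'. y' \<in> Mor C A V \<and> y = FMor F A V y' eF" using presents_surj[OF pF that] by blast
    note * = someI_ex[OF this, folded \<upsilon>_def]
    show "\<upsilon> V y \<in> Mor C A V" by (rule conjunct1[OF *])
    show "FMor F A V (\<upsilon> V y) eF = y" by (rule conjunct2[OF *, symmetric])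
  qed
  define u where "u U V x y = FMor D (P \<boxtimes> A) (U \<boxtimes> V) (TMor M P U A V (\<xi> U x) (\<upsilon> V y)) eD" for U V x y
  \<comment> \<open>\<open>E\<close> is \<open>u\<close> on morphisms instead of elements. It is
    biadditive, and it depends only on the elements named, because \<open>D\<close> kills the
    relations \<open>P \<boxtimes> f\<close> and \<open>g \<boxtimes> A\<close>.\<close>
  define E where "E U V x y = FMor D (P \<boxtimes> A) (U \<boxtimes> V) (TMor M P U A V x y) eD" for U V x y
  have E_hom_left: "(\<lambda>x. E U V x y) \<in> hom (Hom C P U) (FOb D (U \<boxtimes> V))"
    if "U \<in> Obj C" "V \<in> Obj C" "y \<in> Mor C A V" for U V y
    using hom_compose[OF TMor_hom_left[OF o(1) that(1) o(3) that(2,3)] functor_eval_hom[OF D o(5) TOb_Obj[OF that(1,2)] eD]]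
    unfolding E_def by (simp add: comp_def)
  have E_hom_right: "E U V x \<in> hom (Hom C A V) (FOb D (U \<boxtimes> V))"
    if "U \<in> Obj C" "V \<in> Obj C" "x \<in> Mor C P U" for U V x
    using hom_compose[OF TMor_hom_right[OF o(1) that(1) o(3) that(2,3)] functor_eval_hom[OF D o(5) TOb_Obj[OF that(1,2)] eD]]
    unfolding E_def by (simp add: comp_def)
  have E_left: "E U V x1 y = E U V x2 y"
    if U: "U \<in> Obj C" "V \<in> Obj C" and x: "x1 \<in> Mor C P U" "x2 \<in> Mor C P U" and y: "y \<in> Mor C A V"
      and eq: "FMor G P U x1 eG = FMor G P U x2 eG" for U V x1 x2 y
  proof -
    interpret eh: group_hom "Hom C P U" "FOb G U" "\<lambda>x. FMor G P U x eG"
      using functor_eval_hom[OF G o(1) U(1) eG] Hom_group[OF o(1) U(1)] functor_group[OF G U(1)]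
      by (intro group_hom.intro group_hom_axioms.intro)
    interpret El: group_hom "Hom C P U" "FOb D (U \<boxtimes> V)" "\<lambda>x. E U V x y"
      using E_hom_left[OF U y] Hom_group[OF o(1) U(1)] functor_group[OF D TOb_Obj[OF U]]
      by (intro group_hom.intro group_hom_axioms.intro)
    let ?d = "x1 \<otimes>\<^bsub>Hom C P U\<^esub> inv\<^bsub>Hom C P U\<^esub> x2"
    have d: "?d \<in> Mor C P U" using x by simp
    have "FMor G P U ?d eG = \<one>\<^bsub>FOb G U\<^esub>" using x eq eh.hom_closed[OF x(2)] by simp
    then obtain v where v: "v \<in> Mor C Q U" "?d = Cmp C P Q U v g"
      using presents_kernel[OF pG U(1) d] unfolding factors_def by blast
    have vy: "TMor M Q U A V v y \<in> Mor C (Q \<boxtimes> A) (U \<boxtimes> V)" using TMor_Mor[OF o(2) U(1) o(3) U(2) v(1) y] .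
    \<comment> \<open>The difference factors through \<open>g\<close>, so its tensor product with
      \<open>y\<close> factors through \<open>g \<boxtimes> A\<close>.\<close>
    have "TMor M P U A V ?d y = Cmp C (P \<boxtimes> A) (Q \<boxtimes> A) (U \<boxtimes> V) (TMor M Q U A V v y) ?g"
      using TMor_Cmp[OF o(1,2) U(1) o(3,3) U(2) mG(3) v(1) IA y] v(2) Cmp_Idt_right[OF o(3) U(2) y] by simp
    then have "E U V ?d y = \<one>\<^bsub>FOb D (U \<boxtimes> V)\<^esub>"
      unfolding E_def using presents_kernel[OF pD TOb_Obj[OF U] Cmp_Mor[OF o(5,7) TOb_Obj[OF U] gM vy]] hg[OF TOb_Obj[OF U] vy] by simp
    then show ?thesis using x El.H.mult_inv_eq_one_iff[of "E U V x1 y" "E U V x2 y"] by simp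
  qed
  have E_right: "E U V x y1 = E U V x y2"
    if U: "U \<in> Obj C" "V \<in> Obj C" and x: "x \<in> Mor C P U" and y: "y1 \<in> Mor C A V" "y2 \<in> Mor C A V"
      and eq: "FMor F A V y1 eF = FMor F A V y2 eF" for U V x y1 y2
  proof -
    interpret eh: group_hom "Hom C A V" "FOb F V" "\<lambda>x. FMor F A V x eF"
      using functor_eval_hom[OF F o(3) U(2) eF] Hom_group[OF o(3) U(2)] functor_group[OF F U(2)]
      by (intro group_hom.intro group_hom_axioms.intro)
    interpret El: group_hom "Hom C A V" "FOb D (U \<boxtimes> V)" "E U V x"
      using E_hom_right[OF U x] Hom_group[OF o(3) U(2)] functor_group[OF D TOb_Obj[OF U]]
      by (intro group_hom.intro group_hom_axioms.intro)
    let ?d = "y1 \<otimes>\<^bsub>Hom C A V\<^esub> inv\<^bsub>Hom C A V\<^esub> y2"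
    have d: "?d \<in> Mor C A V" using y by simp
    have "FMor F A V ?d eF = \<one>\<^bsub>FOb F V\<^esub>" using y eq eh.hom_closed[OF y(2)] by simp
    then obtain v where v: "v \<in> Mor C B V" "?d = Cmp C A B V v f"
      using presents_kernel[OF pF U(2) d] unfolding factors_def by blast
    have vy: "TMor M P U B V x v \<in> Mor C (P \<boxtimes> B) (U \<boxtimes> V)" using TMor_Mor[OF o(1) U(1) o(4) U(2) x v(1)] .
    have "TMor M P U A V x ?d = Cmp C (P \<boxtimes> A) (P \<boxtimes> B) (U \<boxtimes> V) (TMor M P U B V x v) ?f"
      using TMor_Cmp[OF o(1,1) U(1) o(3,4) U(2) IP x mF(3) v(1)] v(2) Cmp_Idt_right[OF o(1) U(1) x] by simp
    then have "E U V x ?d = \<one>\<^bsub>FOb D (U \<boxtimes> V)\<^esub>"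
      unfolding E_def using presents_kernel[OF pD TOb_Obj[OF U] Cmp_Mor[OF o(5,6) TOb_Obj[OF U] fM vy]] hf[OF TOb_Obj[OF U] vy] by simp
    then show ?thesis using y El.H.mult_inv_eq_one_iff[of "E U V x y1" "E U V x y2"] by simp
  qed
  have u_eq: "u U V (FMor G P U x eG) (FMor F A V y eF) = E U V x y"
    if U: "U \<in> Obj C" "V \<in> Obj C" and x: "x \<in> Mor C P U" and y: "y \<in> Mor C A V" for U V x y
  proof -
    note x' = \<xi>[OF U(1) functor_closed[OF G o(1) U(1) x eG]] and y' = \<upsilon>[OF U(2) functor_closed[OF F o(3) U(2) y eF]]
    have "u U V (FMor G P U x eG) (FMor F A V y eF) = E U V x (\<upsilon> V (FMor F A V y eF))"
      unfolding u_def E_def[symmetric] by (rule E_left[OF U x'(1) x y'(1) x'(2)])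
    also have "\<dots> = E U V x y" by (rule E_right[OF U x y'(1) y y'(2)])
    finally show ?thesis .
  qed
  have uE: "u U V x y = E U V (\<xi> U x) (\<upsilon> V y)" for U V x y unfolding u_def E_def ..
  have bi: "biadditive_family C M G F D u"
    unfolding biadditive_family_def
  proof (intro conjI ballI)
    fix U V x assume U: "U \<in> Obj C" "V \<in> Obj C" and x: "x \<in> carrier (FOb G U)"
    note x' = \<xi>[OF U(1) x]
    show "u U V x \<in> hom (FOb F V) (FOb D (U \<boxtimes> V))"
    proof (rule homI)
      fix y assume y: "y \<in> carrier (FOb F V)"
      show "u U V x y \<in> carrier (FOb D (U \<boxtimes> V))"
        unfolding uE using hom_in_carrier[OF E_hom_right[OF U x'(1)] \<upsilon>(1)[OF U(2) y]] .
      fix z assume z: "z \<in> carrier (FOb F V)"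
      note y' = \<upsilon>[OF U(2) y] and z' = \<upsilon>[OF U(2) z]
      have "y \<otimes>\<^bsub>FOb F V\<^esub> z = FMor F A V (\<upsilon> V y \<otimes>\<^bsub>Hom C A V\<^esub> \<upsilon> V z) eF"
        using functor_add[OF F o(3) U(2) y'(1) z'(1) eF] y'(2) z'(2) by simp
      then have "u U V x (y \<otimes>\<^bsub>FOb F V\<^esub> z) = E U V (\<xi> U x) (\<upsilon> V y \<otimes>\<^bsub>Hom C A V\<^esub> \<upsilon> V z)"
        using u_eq[OF U x'(1) mult_Mor[OF o(3) U(2) y'(1) z'(1)]] x'(2) by simp
      then show "u U V x (y \<otimes>\<^bsub>FOb F V\<^esub> z) = u U V x y \<otimes>\<^bsub>FOb D (U \<boxtimes> V)\<^esub> u U V x z"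
        using hom_mult[OF E_hom_right[OF U x'(1)] y'(1) z'(1)] by (simp add: uE)
    qed
  next
    fix U V y assume U: "U \<in> Obj C" "V \<in> Obj C" and y: "y \<in> carrier (FOb F V)"
    note y' = \<upsilon>[OF U(2) y]
    show "(\<lambda>x. u U V x y) \<in> hom (FOb G U) (FOb D (U \<boxtimes> V))"
    proof (rule homI)
      fix x assume x: "x \<in> carrier (FOb G U)"
      show "u U V x y \<in> carrier (FOb D (U \<boxtimes> V))"
        unfolding uE using hom_in_carrier[OF E_hom_left[OF U y'(1)] \<xi>(1)[OF U(1) x]] .
      fix z assume z: "z \<in> carrier (FOb G U)"
      note x' = \<xi>[OF U(1) x] and z' = \<xi>[OF U(1) z]
      have "x \<otimes>\<^bsub>FOb G U\<^esub> z = FMor G P U (\<xi> U x \<otimes>\<^bsub>Hom C P U\<^esub> \<xi> U z) eG"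
        using functor_add[OF G o(1) U(1) x'(1) z'(1) eG] x'(2) z'(2) by simp
      then have "u U V (x \<otimes>\<^bsub>FOb G U\<^esub> z) y = E U V (\<xi> U x \<otimes>\<^bsub>Hom C P U\<^esub> \<xi> U z) (\<upsilon> V y)"
        using u_eq[OF U mult_Mor[OF o(1) U(1) x'(1) z'(1)] y'(1)] y'(2) by simp
      then show "u U V (x \<otimes>\<^bsub>FOb G U\<^esub> z) y = u U V x y \<otimes>\<^bsub>FOb D (U \<boxtimes> V)\<^esub> u U V z y"
        using hom_mult[OF E_hom_left[OF U y'(1)] x'(1) z'(1)] by (simp add: uE)
    qed
  next
    fix U U' V V' a b x y
    assume U: "U \<in> Obj C" "U' \<in> Obj C" "V \<in> Obj C" "V' \<in> Obj C" and a: "a \<in> Mor C U U'" and b: "b \<in> Mor C V V'"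
      and x: "x \<in> carrier (FOb G U)" and y: "y \<in> carrier (FOb F V)"
    note x' = \<xi>[OF U(1) x] and y' = \<upsilon>[OF U(3) y]
    have Gx: "FMor G U U' a x = FMor G P U' (Cmp C P U U' a (\<xi> U x)) eG"
      using functor_Cmp[OF G o(1) U(1,2) x'(1) a eG] x'(2) by simp
    have Fy: "FMor F V V' b y = FMor F A V' (Cmp C A V V' b (\<upsilon> V y)) eF"
      using functor_Cmp[OF F o(3) U(3,4) y'(1) b eF] y'(2) by simp
    have "u U' V' (FMor G U U' a x) (FMor F V V' b y) = E U' V' (Cmp C P U U' a (\<xi> U x)) (Cmp C A V V' b (\<upsilon> V y))"
      unfolding Gx Fy using u_eq[OF U(2,4) Cmp_Mor[OF o(1) U(1,2) x'(1) a] Cmp_Mor[OF o(3) U(3,4) y'(1) b]] .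
    also have "\<dots> = FMor D (U \<boxtimes> V) (U' \<boxtimes> V') (TMor M U U' V V' a b) (u U V x y)"
      unfolding uE E_def TMor_Cmp[OF o(1) U(1,2) o(3) U(3,4) x'(1) a y'(1) b]
      using functor_Cmp[OF D o(5) TOb_Obj[OF U(1,3)] TOb_Obj[OF U(2,4)] TMor_Mor[OF o(1) U(1) o(3) U(3) x'(1) y'(1)] TMor_Mor[OF U a b] eD] .
    finally show "FMor D (U \<boxtimes> V) (U' \<boxtimes> V') (TMor M U U' V V' a b) (u U V x y)
      = u U' V' (FMor G U U' a x) (FMor F V V' b y)" by simp
  qed
  \<comment> \<open>The family reaches the generator of \<open>D\<close>, so a transformation out of
    \<open>D\<close> is determined by its effect on the family.\<close>
  have u_gen: "u P A eG eF = eD"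
    using u_eq[OF o(1,3) IP IA] functor_Idt[OF G o(1) eG] functor_Idt[OF F o(3) eF] functor_Idt[OF D o(5) eD] TMor_Idt[OF o(1,3)]
    by (simp add: E_def)
  show ?thesis
    unfolding is_day_convolution_def
  proof (intro conjI D exI[of _ u] bi allI impI, elim conjE)
    fix H b assume H: "additive_functor C Ab H" and b: "biadditive_family C M G F H b"
    let ?e = "b P A eG eF"
    have b_hom: "b U V x \<in> hom (FOb F V) (FOb H (U \<boxtimes> V))" if "U \<in> Obj C" "V \<in> Obj C" "x \<in> carrier (FOb G U)" for U V x
      using b that unfolding biadditive_family_def by blast
    have b_hom': "(\<lambda>x. b U V x y) \<in> hom (FOb G U) (FOb H (U \<boxtimes> V))" if "U \<in> Obj C" "V \<in> Obj C" "y \<in> carrier (FOb F V)" for U V y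
      using b that unfolding biadditive_family_def by blast
    have b_nat: "FMor H (P \<boxtimes> A) (U \<boxtimes> V) (TMor M P U A V x y) ?e = b U V (FMor G P U x eG) (FMor F A V y eF)"
      if "U \<in> Obj C" "V \<in> Obj C" "x \<in> Mor C P U" "y \<in> Mor C A V" for U V x y
      using b that o eG eF unfolding biadditive_family_def by blast
    have e: "?e \<in> carrier (FOb H (P \<boxtimes> A))" using hom_in_carrier[OF b_hom[OF o(1,3) eG] eF] .
    \<comment> \<open>\<open>h\<close> factors through itself, so it is a sum of multiples of the
      two relations, each of which kills the value of \<open>b\<close> at the generators.\<close>
    have "factors C (P \<boxtimes> A) R R h h"
      unfolding factors_def using Cmp_Idt_left[OF mD] Idt_Mor[OF mD(2)] by metis
    then obtain y y' where y: "y \<in> Mor C (P \<boxtimes> B) R" "y' \<in> Mor C (Q \<boxtimes> A) R"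
      "h = Cmp C (P \<boxtimes> A) (P \<boxtimes> B) R y ?f \<otimes>\<^bsub>Hom C (P \<boxtimes> A) R\<^esub> Cmp C (P \<boxtimes> A) (Q \<boxtimes> A) R y' ?g"
      using h[OF mD(2,3)] by blast
    have "FMor H (P \<boxtimes> A) (P \<boxtimes> B) ?f ?e = b P B eG (FMor F A B f eF)"
      using b_nat[OF o(1,4) IP mF(3)] functor_Idt[OF G o(1) eG] by simp
    also have "FMor F A B f eF = \<one>\<^bsub>FOb F B\<^esub>"
      using presents_kernel[OF pF o(4) mF(3)] Cmp_Idt_left[OF mF] Idt_Mor[OF o(4)] unfolding factors_def by metis
    also have "b P B eG \<one>\<^bsub>FOb F B\<^esub> = \<one>\<^bsub>FOb H (P \<boxtimes> B)\<^esub>"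
      by (rule hom_one[OF b_hom[OF o(1,4) eG] functor_group[OF F o(4)] functor_group[OF H o(6)]])
    finally have Hf: "FMor H (P \<boxtimes> A) (P \<boxtimes> B) ?f ?e = \<one>\<^bsub>FOb H (P \<boxtimes> B)\<^esub>" .
    have "FMor H (P \<boxtimes> A) (Q \<boxtimes> A) ?g ?e = b Q A (FMor G P Q g eG) eF"
      using b_nat[OF o(2,3) mG(3) IA] functor_Idt[OF F o(3) eF] by simp
    also have "FMor G P Q g eG = \<one>\<^bsub>FOb G Q\<^esub>"
      using presents_kernel[OF pG o(2) mG(3)] Cmp_Idt_left[OF mG] Idt_Mor[OF o(2)] unfolding factors_def by metis
    also have "b Q A \<one>\<^bsub>FOb G Q\<^esub> eF = \<one>\<^bsub>FOb H (Q \<boxtimes> A)\<^esub>"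
      by (rule hom_one[OF b_hom'[OF o(2,3) eF] functor_group[OF G o(2)] functor_group[OF H o(7)]])
    finally have Hg: "FMor H (P \<boxtimes> A) (Q \<boxtimes> A) ?g ?e = \<one>\<^bsub>FOb H (Q \<boxtimes> A)\<^esub>" .
    have "FMor H (P \<boxtimes> A) R h ?e = \<one>\<^bsub>FOb H R\<^esub>"
    proof -
      interpret HR: group "FOb H R" using functor_group[OF H mD(2)] .
      have M: "Cmp C (P \<boxtimes> A) (P \<boxtimes> B) R y ?f \<in> Mor C (P \<boxtimes> A) R" "Cmp C (P \<boxtimes> A) (Q \<boxtimes> A) R y' ?g \<in> Mor C (P \<boxtimes> A) R"
        using Cmp_Mor[OF o(5,6) mD(2) fM y(1)] Cmp_Mor[OF o(5,7) mD(2) gM y(2)] by blast+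
      show ?thesis
        unfolding y(3) functor_add[OF H o(5) mD(2) M e] functor_Cmp[OF H o(5,6) mD(2) fM y(1) e]
          functor_Cmp[OF H o(5,7) mD(2) gM y(2) e] Hf Hg
          functor_one[OF H o(6) mD(2) y(1)] functor_one[OF H o(7) mD(2) y(2)] by simp
    qed
    then obtain t where t: "t \<in> nat_trans C Ab D H" "t (P \<boxtimes> A) eD = ?e"
      using presents_universal[OF pD H e] by blast
    have tu: "t (U \<boxtimes> V) (u U V x y) = b U V x y"
      if U: "U \<in> Obj C" "V \<in> Obj C" and x: "x \<in> carrier (FOb G U)" and y: "y \<in> carrier (FOb F V)" for U V x y
      unfolding u_def
      using presents_nat_trans_apply[OF pD t(1) TOb_Obj[OF U] TMor_Mor[OF o(1) U(1) o(3) U(2) \<xi>(1)[OF U(1) x] \<upsilon>(1)[OF U(2) y]]]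
        b_nat[OF U \<xi>(1)[OF U(1) x] \<upsilon>(1)[OF U(2) y]] \<xi>(2)[OF U(1) x] \<upsilon>(2)[OF U(2) y] t(2) by simp
    show "\<exists>!t. t \<in> nat_trans C Ab D H \<and> (\<forall>U \<in> Obj C. \<forall>V \<in> Obj C. \<forall>x \<in> carrier (FOb G U). \<forall>y \<in> carrier (FOb F V).
      t (U \<boxtimes> V) (u U V x y) = b U V x y)"
    proof (rule ex1I[of _ t])
      show "t \<in> nat_trans C Ab D H \<and> (\<forall>U \<in> Obj C. \<forall>V \<in> Obj C. \<forall>x \<in> carrier (FOb G U). \<forall>y \<in> carrier (FOb F V).
        t (U \<boxtimes> V) (u U V x y) = b U V x y)" using t(1) tu by blast
      fix t' assume t': "t' \<in> nat_trans C Ab D H \<and> (\<forall>U \<in> Obj C. \<forall>V \<in> Obj C. \<forall>x \<in> carrier (FOb G U). \<forall>y \<in> carrier (FOb F V).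
        t' (U \<boxtimes> V) (u U V x y) = b U V x y)"
      then have "t' (P \<boxtimes> A) (u P A eG eF) = ?e" using o eG eF by blast
      then show "t' = t"
        using presents_nat_trans_eqI[OF pD conjunct1[OF t'] t(1)] t(2) u_gen by simp
    qed
  qed
qed

text \<open>A Day convolution is initial among the functors receiving a biadditive family.\<close>

lemma day_convolution_unique:
  assumes D1: "is_day_convolution C M G F D1" and D2: "is_day_convolution C M G F D2"
  shows "isomorphic (functor_category C Ab) D1 D2"
proof -
  have ex: "\<exists>u. biadditive_family C M G F D u \<and> (\<forall>H b. additive_functor C Ab H \<and> biadditive_family C M G F H b \<longrightarrow>
       (\<exists>!t. t \<in> nat_trans C Ab D H \<and> (\<forall>A \<in> Obj C. \<forall>B \<in> Obj C. \<forall>x \<in> carrier (FOb G A). \<forall>y \<in> carrier (FOb F B).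
           t (A \<boxtimes> B) (u A B x y) = b A B x y)))"
    and adf: "additive_functor C Ab D" if "is_day_convolution C M G F D" for D
    using that unfolding is_day_convolution_def by blast+
  note f1 = adf[OF D1] and f2 = adf[OF D2]
  obtain u1 where a1: "biadditive_family C M G F D1 u1 \<and> (\<forall>H b. additive_functor C Ab H \<and> biadditive_family C M G F H b \<longrightarrow>
       (\<exists>!t. t \<in> nat_trans C Ab D1 H \<and> (\<forall>A \<in> Obj C. \<forall>B \<in> Obj C. \<forall>x \<in> carrier (FOb G A). \<forall>y \<in> carrier (FOb F B).
           t (A \<boxtimes> B) (u1 A B x y) = b A B x y)))"
    by (rule exE[OF ex[OF D1]])
  note u1 = a1[THEN conjunct1] and un1 = a1[THEN conjunct2, rule_format, OF conjI]
  obtain u2 where a2: "biadditive_family C M G F D2 u2 \<and> (\<forall>H b. additive_functor C Ab H \<and> biadditive_family C M G F H b \<longrightarrow>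
       (\<exists>!t. t \<in> nat_trans C Ab D2 H \<and> (\<forall>A \<in> Obj C. \<forall>B \<in> Obj C. \<forall>x \<in> carrier (FOb G A). \<forall>y \<in> carrier (FOb F B).
           t (A \<boxtimes> B) (u2 A B x y) = b A B x y)))"
    by (rule exE[OF ex[OF D2]])
  note u2 = a2[THEN conjunct1] and un2 = a2[THEN conjunct2, rule_format, OF conjI]
  have c: "u A B x y \<in> carrier (FOb D (A \<boxtimes> B))"
    if "biadditive_family C M G F D u" "A \<in> Obj C" "B \<in> Obj C" "x \<in> carrier (FOb G A)" "y \<in> carrier (FOb F B)" for D u A B x y
  proof -
    have "u A B x \<in> hom (FOb F B) (FOb D (A \<boxtimes> B))" using that unfolding biadditive_family_def by blast
    then show ?thesis using that(5) by (rule hom_in_carrier)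
  qed
  obtain t where t: "t \<in> nat_trans C Ab D1 D2" and tu: "\<forall>A \<in> Obj C. \<forall>B \<in> Obj C. \<forall>x \<in> carrier (FOb G A). \<forall>y \<in> carrier (FOb F B).
           t (A \<boxtimes> B) (u1 A B x y) = u2 A B x y" using ex1_implies_ex[OF un1[OF f2 u2]] by blast
  obtain s where s: "s \<in> nat_trans C Ab D2 D1" and su: "\<forall>A \<in> Obj C. \<forall>B \<in> Obj C. \<forall>x \<in> carrier (FOb G A). \<forall>y \<in> carrier (FOb F B).
           s (A \<boxtimes> B) (u2 A B x y) = u1 A B x y" using ex1_implies_ex[OF un2[OF f1 u1]] by blast
  let ?K = "functor_category C Ab"
  have "Cmp ?K D1 D2 D1 s t = Idt ?K D1"
  proof (rule ex1E[OF un1[OF f1 u1]])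
    fix r assume r: "\<forall>y. y \<in> nat_trans C Ab D1 D1 \<and> (\<forall>A \<in> Obj C. \<forall>B \<in> Obj C. \<forall>x \<in> carrier (FOb G A). \<forall>z \<in> carrier (FOb F B).
           y (A \<boxtimes> B) (u1 A B x z) = u1 A B x z) \<longrightarrow> y = r"
    have "Cmp ?K D1 D2 D1 s t = r"
      by (rule r[rule_format]) (simp add: Cmp_nat_trans[OF f1 f2 f1 t s] TOb_Obj c[OF u1] tu su)
    moreover have "Idt ?K D1 = r"
      by (rule r[rule_format]) (simp add: Idt_nat_trans[OF f1] TOb_Obj c[OF u1])
    ultimately show ?thesis by simp
  qed
  moreover have "Cmp ?K D2 D1 D2 t s = Idt ?K D2"
  proof (rule ex1E[OF un2[OF f2 u2]])
    fix r assume r: "\<forall>y. y \<in> nat_trans C Ab D2 D2 \<and> (\<forall>A \<in> Obj C. \<forall>B \<in> Obj C. \<forall>x \<in> carrier (FOb G A). \<forall>z \<in> carrier (FOb F B).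
           y (A \<boxtimes> B) (u2 A B x z) = u2 A B x z) \<longrightarrow> y = r"
    have "Cmp ?K D2 D1 D2 t s = r"
      by (rule r[rule_format]) (simp add: Cmp_nat_trans[OF f2 f1 f2 s t] TOb_Obj c[OF u2] tu su)
    moreover have "Idt ?K D2 = r"
      by (rule r[rule_format]) (simp add: Idt_nat_trans[OF f2] TOb_Obj c[OF u2])
    ultimately show ?thesis by simp
  qed
  ultimately show ?thesis
    unfolding isomorphic_def iso_mor_def inverse_mors_def using s t by auto
qed

text \<open>Right exactness in both variables: \<open>(P \<boxtimes> A,-)\<close> modulo the
  relations of \<open>F\<close> tensored with \<open>P\<close> and those of \<open>G\<close>
  tensored with \<open>A\<close>. The explicit cokernel also shows that the choice in
  \<open>day_tensor\<close> has a candidate.\<close>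

lemma day_tensor_presents:
  assumes pG: "presents C P Q g G eG" and pF: "presents C A B f F eF"
    and R: "R \<in> Obj C" and hM: "h \<in> Mor C (P \<boxtimes> A) R"
    and h: "\<And>W x. \<lbrakk>W \<in> Obj C; x \<in> Mor C (P \<boxtimes> A) W\<rbrakk> \<Longrightarrow> factors C (P \<boxtimes> A) R W h x \<longleftrightarrow>
      (\<exists>y \<in> Mor C (P \<boxtimes> B) W. \<exists>y' \<in> Mor C (Q \<boxtimes> A) W.
        x = Cmp C (P \<boxtimes> A) (P \<boxtimes> B) W y (TMor M P P A B (Idt C P) f)
          \<otimes>\<^bsub>Hom C (P \<boxtimes> A) W\<^esub> Cmp C (P \<boxtimes> A) (Q \<boxtimes> A) W y' (TMor M P Q A A g (Idt C A)))"
  obtains e where "presents C (P \<boxtimes> A) R h (day_tensor C M G F) e"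
proof -
  have o: "P \<boxtimes> A \<in> Obj C" using presents_Mor[OF pG] presents_Mor[OF pF] TOb_Obj by blast
  obtain e where p: "presents C (P \<boxtimes> A) R h (Cok C (P \<boxtimes> A) R h) e"
    using Cok_presents[OF o R hM] by blast
  have d: "is_day_convolution C M G F (Cok C (P \<boxtimes> A) R h)"
    by (rule presents_day_convolution[OF pG pF p h])
  then have d': "is_day_convolution C M G F (day_tensor C M G F)"
    unfolding day_tensor_def by (rule someI)
  then have "additive_functor C Ab (day_tensor C M G F)" unfolding is_day_convolution_def by blast
  then show thesis
    using presents_isomorphic[OF p day_convolution_unique[OF d d']] that by blast
qed

end

section \<open>Tensor products and direct limits\<close>

context closed_symmetric_monoidal
begin

lemma TMor_Cmp_Idt:
  "\<lbrakk>X \<in> Obj C; X' \<in> Obj C; X'' \<in> Obj C; Y \<in> Obj C; f \<in> Mor C X X'; f' \<in> Mor C X' X''\<rbrakk>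
    \<Longrightarrow> Cmp C (X \<boxtimes> Y) (X' \<boxtimes> Y) (X'' \<boxtimes> Y) (TMor M X' X'' Y Y f' (Idt C Y)) (TMor M X X' Y Y f (Idt C Y))
      = TMor M X X'' Y Y (Cmp C X X' X'' f' f) (Idt C Y)"
  using TMor_Cmp[of X X' X'' Y Y Y f f' "Idt C Y" "Idt C Y"] by (simp add: Idt_Mor Cmp_Idt_left)

text \<open>\<open>- \<boxtimes> Y\<close> is a left adjoint: evaluation turns cocones with vertex
  \<open>H\<close> on the \<open>D i\<close> bijectively into cocones with vertex \<open>Z\<close>
  on the \<open>D i \<boxtimes> Y\<close>.\<close>

lemma tensor_direct_limit:
  assumes lim: "is_direct_limit C I r D d X c" and Y: "Y \<in> Obj C"
  shows "is_direct_limit C I r (\<lambda>i. D i \<boxtimes> Y) (\<lambda>i j. TMor M (D i) (D j) Y Y (d i j) (Idt C Y))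
    (X \<boxtimes> Y) (\<lambda>i. TMor M (D i) X Y Y (c i) (Idt C Y))"
proof -
  note sys = directed_systemD[OF is_direct_limitD(1)[OF lim]] and c = is_direct_limitD(3)[OF lim]
    and X = is_direct_limitD(2)[OF lim]
  note dir = directed_posetD[OF sys(1)]
  have T: "TMor M U V Y Y f (Idt C Y) \<in> Mor C (U \<boxtimes> Y) (V \<boxtimes> Y)" if "U \<in> Obj C" "V \<in> Obj C" "f \<in> Mor C U V" for U V f
    using TMor_Mor[OF that(1,2) Y Y that(3) Idt_Mor[OF Y]] .
  have dsys: "directed_system C I r (\<lambda>i. D i \<boxtimes> Y) (\<lambda>i j. TMor M (D i) (D j) Y Y (d i j) (Idt C Y))"
    unfolding directed_system_def
  proof (intro conjI ballI allI impI sys(1))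
    show "D i \<boxtimes> Y \<in> Obj C" if "i \<in> I" for i using TOb_Obj[OF sys(2)[OF that] Y] .
    show "TMor M (D i) (D i) Y Y (d i i) (Idt C Y) = Idt C (D i \<boxtimes> Y)" if "i \<in> I" for i
      using TMor_Idt[OF sys(2)[OF that] Y] sys(4)[OF that] by simp
    show "case p of (i, j) \<Rightarrow> TMor M (D i) (D j) Y Y (d i j) (Idt C Y) \<in> Mor C (D i \<boxtimes> Y) (D j \<boxtimes> Y)" if p: "p \<in> r" for p
    proof -
      obtain i j where ij: "p = (i, j)" by (cases p)
      then have "i \<in> I" "j \<in> I" "d i j \<in> Mor C (D i) (D j)" using p dir(4) sys(3) by blast+
      then show ?thesis using ij T sys(2) by simp
    qed
    fix i j k assume ijk: "(i, j) \<in> r \<and> (j, k) \<in> r"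
    then have "i \<in> I" "j \<in> I" "k \<in> I" "d i j \<in> Mor C (D i) (D j)" "d j k \<in> Mor C (D j) (D k)" using dir(4) sys(3) by blast+
    then show "TMor M (D i) (D k) Y Y (d i k) (Idt C Y)
      = Cmp C (D i \<boxtimes> Y) (D j \<boxtimes> Y) (D k \<boxtimes> Y) (TMor M (D j) (D k) Y Y (d j k) (Idt C Y)) (TMor M (D i) (D j) Y Y (d i j) (Idt C Y))"
      using TMor_Cmp_Idt[of "D i" "D j" "D k" Y "d i j" "d j k"] sys(2) sys(5)[of i j k] ijk Y by simp
  qed
  have cone: "is_cocone C I r (\<lambda>i. D i \<boxtimes> Y) (\<lambda>i j. TMor M (D i) (D j) Y Y (d i j) (Idt C Y)) (X \<boxtimes> Y) (\<lambda>i. TMor M (D i) X Y Y (c i) (Idt C Y))"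
    unfolding is_cocone_def
  proof (intro conjI ballI)
    show "X \<boxtimes> Y \<in> Obj C" using TOb_Obj[OF X Y] .
    show "TMor M (D i) X Y Y (c i) (Idt C Y) \<in> Mor C (D i \<boxtimes> Y) (X \<boxtimes> Y)" if "i \<in> I" for i
      using T[OF sys(2)[OF that] X c[OF that]] .
    fix p assume p: "p \<in> r"
    obtain i j where ij: "p = (i, j)" by (cases p)
    then have I: "i \<in> I" "j \<in> I" "d i j \<in> Mor C (D i) (D j)" "(i, j) \<in> r" using p dir(4) sys(3) by blast+
    show "case p of (i, j) \<Rightarrow> Cmp C (D i \<boxtimes> Y) (D j \<boxtimes> Y) (X \<boxtimes> Y) (TMor M (D j) X Y Y (c j) (Idt C Y)) (TMor M (D i) (D j) Y Y (d i j) (Idt C Y))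
      = TMor M (D i) X Y Y (c i) (Idt C Y)"
      using TMor_Cmp_Idt[OF sys(2)[OF I(1)] sys(2)[OF I(2)] X Y I(3) c[OF I(2)]] is_direct_limitD(4)[OF lim I(4)] ij by simp
  qed
  show ?thesis
    unfolding is_direct_limit_def
  proof (intro conjI dsys cone allI impI)
    fix Z b assume b: "is_cocone C I r (\<lambda>i. D i \<boxtimes> Y) (\<lambda>i j. TMor M (D i) (D j) Y Y (d i j) (Idt C Y)) Z b"
    then have Z: "Z \<in> Obj C" and bM: "\<And>i. i \<in> I \<Longrightarrow> b i \<in> Mor C (D i \<boxtimes> Y) Z"
      and bd: "\<And>i j. (i, j) \<in> r \<Longrightarrow> Cmp C (D i \<boxtimes> Y) (D j \<boxtimes> Y) Z (b j) (TMor M (D i) (D j) Y Y (d i j) (Idt C Y)) = b i"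
      unfolding is_cocone_def by auto
    obtain H e where H: "H \<in> Obj C" and e: "e \<in> Mor C (H \<boxtimes> Y) Z"
      and adj: "\<And>X f. \<lbrakk>X \<in> Obj C; f \<in> Mor C (X \<boxtimes> Y) Z\<rbrakk> \<Longrightarrow>
          \<exists>!g. g \<in> Mor C X H \<and> Cmp C (X \<boxtimes> Y) (H \<boxtimes> Y) Z e (TMor M X H Y Y g (Idt C Y)) = f"
      using closed[OF Y Z] by blast
    let ?ev = "\<lambda>X g. Cmp C (X \<boxtimes> Y) (H \<boxtimes> Y) Z e (TMor M X H Y Y g (Idt C Y))"
    \<comment> \<open>Naturality of the adjunction in the first argument; it carries the cocone
      equations in both directions.\<close>
    have ev_Cmp: "Cmp C (U \<boxtimes> Y) (V \<boxtimes> Y) Z (?ev V g) (TMor M U V Y Y k (Idt C Y)) = ?ev U (Cmp C U V H g k)"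
      if "U \<in> Obj C" "V \<in> Obj C" "k \<in> Mor C U V" "g \<in> Mor C V H" for U V k g
      using Cmp_assoc[OF TOb_Obj[OF that(1) Y] TOb_Obj[OF that(2) Y] TOb_Obj[OF H Y] Z T[OF that(1-3)] T[OF that(2) H that(4)] e]
        TMor_Cmp_Idt[OF that(1,2) H Y that(3,4)] by simp
    have ev_inj: "g = g'" if "U \<in> Obj C" "g \<in> Mor C U H" "g' \<in> Mor C U H" "?ev U g = ?ev U g'" for U g g'
      using adj[OF that(1) Cmp_Mor[OF TOb_Obj[OF that(1) Y] TOb_Obj[OF H Y] Z T[OF that(1) H that(3)] e]] that by blast
    have "\<exists>g. g \<in> Mor C (D i) H \<and> ?ev (D i) g = b i" if "i \<in> I" for i
      using adj[OF sys(2)[OF that] bM[OF that]] by blast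
    then obtain g where g: "\<And>i. i \<in> I \<Longrightarrow> g i \<in> Mor C (D i) H" "\<And>i. i \<in> I \<Longrightarrow> ?ev (D i) (g i) = b i" by metis
    have gc: "is_cocone C I r D d H g"
      unfolding is_cocone_def
    proof (intro conjI ballI H g(1))
      fix p assume p: "p \<in> r"
      obtain i j where ij: "p = (i, j)" by (cases p)
      then have I: "i \<in> I" "j \<in> I" "d i j \<in> Mor C (D i) (D j)" "(i, j) \<in> r" using p dir(4) sys(3) by blast+
      have "Cmp C (D i) (D j) H (g j) (d i j) = g i"
      proof (rule ev_inj[OF sys(2)[OF I(1)] Cmp_Mor[OF sys(2)[OF I(1)] sys(2)[OF I(2)] H I(3) g(1)[OF I(2)]] g(1)[OF I(1)]])
        show "?ev (D i) (Cmp C (D i) (D j) H (g j) (d i j)) = ?ev (D i) (g i)"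
          using ev_Cmp[OF sys(2)[OF I(1)] sys(2)[OF I(2)] I(3) g(1)[OF I(2)]] g(2)[OF I(1)] g(2)[OF I(2)] bd[OF I(4)] by simp
      qed
      then show "case p of (i, j) \<Rightarrow> Cmp C (D i) (D j) H (g j) (d i j) = g i" using ij by simp
    qed
    obtain k where k: "k \<in> Mor C X H" "\<And>i. i \<in> I \<Longrightarrow> Cmp C (D i) X H k (c i) = g i"
      using direct_limit_universal[OF lim gc] by blast
    show "\<exists>!f. f \<in> Mor C (X \<boxtimes> Y) Z \<and> (\<forall>i\<in>I. Cmp C (D i \<boxtimes> Y) (X \<boxtimes> Y) Z f (TMor M (D i) X Y Y (c i) (Idt C Y)) = b i)"
    proof (rule ex1I[of _ "?ev X k"])
      have "?ev X k \<in> Mor C (X \<boxtimes> Y) Z"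
        using Cmp_Mor[OF TOb_Obj[OF X Y] TOb_Obj[OF H Y] Z T[OF X H k(1)] e] .
      then show "?ev X k \<in> Mor C (X \<boxtimes> Y) Z \<and> (\<forall>i\<in>I. Cmp C (D i \<boxtimes> Y) (X \<boxtimes> Y) Z (?ev X k) (TMor M (D i) X Y Y (c i) (Idt C Y)) = b i)"
        using ev_Cmp[OF sys(2) X c k(1)] k(2) g(2) by simp
      fix f assume f: "f \<in> Mor C (X \<boxtimes> Y) Z \<and> (\<forall>i\<in>I. Cmp C (D i \<boxtimes> Y) (X \<boxtimes> Y) Z f (TMor M (D i) X Y Y (c i) (Idt C Y)) = b i)"
      obtain l where l: "l \<in> Mor C X H" "?ev X l = f" using adj[OF X conjunct1[OF f]] by blast
      have "l = k"
      proof (rule direct_limit_unique[OF lim gc l(1) _ k])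
        fix i assume i: "i \<in> I"
        show "Cmp C (D i) X H l (c i) = g i"
        proof (rule ev_inj[OF sys(2)[OF i] Cmp_Mor[OF sys(2)[OF i] X H c[OF i] l(1)] g(1)[OF i]])
          show "?ev (D i) (Cmp C (D i) X H l (c i)) = ?ev (D i) (g i)"
            using ev_Cmp[OF sys(2)[OF i] X c[OF i] l(1)] l(2) f i g(2)[OF i] by simp
        qed
      qed
      then show "f = ?ev X k" using l(2) by simp
    qed
  qed
qed

end

section \<open>Duality\<close>

text \<open>Morphisms bundled with their source and target, so that calculations need not repeat the objects.\<close>

context symmetric_monoidal
begin

definition arr :: "'o \<times> 'm \<times> 'o \<Rightarrow> bool" where
  "arr p \<longleftrightarrow> fst p \<in> Obj C \<and> snd (snd p) \<in> Obj C \<and> fst (snd p) \<in> Mor C (fst p) (snd (snd p))"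

definition src :: "'o \<times> 'm \<times> 'o \<Rightarrow> 'o" where "src p = fst p"

definition tgt :: "'o \<times> 'm \<times> 'o \<Rightarrow> 'o" where "tgt p = snd (snd p)"

definition acmp :: "'o \<times> 'm \<times> 'o \<Rightarrow> 'o \<times> 'm \<times> 'o \<Rightarrow> 'o \<times> 'm \<times> 'o" (infixr \<open>\<bullet>\<close> 60) where
  "q \<bullet> p = (fst p, Cmp C (fst p) (snd (snd p)) (snd (snd q)) (fst (snd q)) (fst (snd p)), snd (snd q))"

definition aten :: "'o \<times> 'm \<times> 'o \<Rightarrow> 'o \<times> 'm \<times> 'o \<Rightarrow> 'o \<times> 'm \<times> 'o" (infixr \<open>\<otimes>\<otimes>\<close> 70) where
  "p \<otimes>\<otimes> q = (fst p \<boxtimes> fst q, TMor M (fst p) (snd (snd p)) (fst q) (snd (snd q)) (fst (snd p)) (fst (snd q)),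
     snd (snd p) \<boxtimes> snd (snd q))"

definition idn :: "'o \<Rightarrow> 'o \<times> 'm \<times> 'o" where "idn X = (X, Idt C X, X)"

definition asc :: "'o \<Rightarrow> 'o \<Rightarrow> 'o \<Rightarrow> 'o \<times> 'm \<times> 'o" where
  "asc X Y Z = ((X \<boxtimes> Y) \<boxtimes> Z, Asc M X Y Z, X \<boxtimes> (Y \<boxtimes> Z))"

definition lun :: "'o \<Rightarrow> 'o \<times> 'm \<times> 'o" where "lun X = (\<II> \<boxtimes> X, Lun M X, X)"

definition run :: "'o \<Rightarrow> 'o \<times> 'm \<times> 'o" where "run X = (X \<boxtimes> \<II>, Run M X, X)"

definition ainv :: "'o \<times> 'm \<times> 'o \<Rightarrow> 'o \<times> 'm \<times> 'o" where
  "ainv p = (snd (snd p), inv_mor C (fst p) (snd (snd p)) (fst (snd p)), fst p)"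

definition aiso :: "'o \<times> 'm \<times> 'o \<Rightarrow> bool" where
  "aiso p \<longleftrightarrow> arr p \<and> iso_mor C (fst p) (snd (snd p)) (fst (snd p))"

lemmas arrow_defs = arr_def src_def tgt_def acmp_def aten_def idn_def asc_def lun_def run_def

lemma src_tgt [simp]:
  "src (q \<bullet> p) = src p" "tgt (q \<bullet> p) = tgt q"
  "src (p \<otimes>\<otimes> q) = src p \<boxtimes> src q" "tgt (p \<otimes>\<otimes> q) = tgt p \<boxtimes> tgt q"
  "src (idn X) = X" "tgt (idn X) = X"
  "src (asc X Y Z) = (X \<boxtimes> Y) \<boxtimes> Z" "tgt (asc X Y Z) = X \<boxtimes> (Y \<boxtimes> Z)"
  "src (lun X) = \<II> \<boxtimes> X" "tgt (lun X) = X" "src (run X) = X \<boxtimes> \<II>" "tgt (run X) = X"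
  "src (ainv p) = tgt p" "tgt (ainv p) = src p"
  by (simp_all add: arrow_defs ainv_def)

lemma arr_Obj: "arr p \<Longrightarrow> src p \<in> Obj C" "arr p \<Longrightarrow> tgt p \<in> Obj C"
  by (simp_all add: arrow_defs)

lemma arr_simps [simp]:
  "\<lbrakk>arr q; arr p; src q = tgt p\<rbrakk> \<Longrightarrow> arr (q \<bullet> p)"
  "\<lbrakk>arr p; arr q\<rbrakk> \<Longrightarrow> arr (p \<otimes>\<otimes> q)"
  "X \<in> Obj C \<Longrightarrow> arr (idn X)"
  by (simp_all add: arrow_defs Cmp_Mor TOb_Obj TMor_Mor Idt_Mor)

lemma aiso_arr: "aiso p \<Longrightarrow> arr p"
  by (simp add: aiso_def)

lemma aiso_coherence [simp]:
  "\<lbrakk>X \<in> Obj C; Y \<in> Obj C; Z \<in> Obj C\<rbrakk> \<Longrightarrow> aiso (asc X Y Z)"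
  "X \<in> Obj C \<Longrightarrow> aiso (lun X)" "X \<in> Obj C \<Longrightarrow> aiso (run X)"
  using Asc_iso[of X Y Z] Lun_iso[of X] Run_iso[of X]
  by (auto simp: aiso_def arrow_defs iso_mor_def inverse_mors_def TOb_Obj Unt_Obj)

lemma arr_coherence [simp]:
  "\<lbrakk>X \<in> Obj C; Y \<in> Obj C; Z \<in> Obj C\<rbrakk> \<Longrightarrow> arr (asc X Y Z)"
  "X \<in> Obj C \<Longrightarrow> arr (lun X)" "X \<in> Obj C \<Longrightarrow> arr (run X)"
  by (simp_all add: aiso_arr)

lemma acmp_assoc: "\<lbrakk>arr p; arr q; arr r; src q = tgt p; src r = tgt q\<rbrakk> \<Longrightarrow> (r \<bullet> q) \<bullet> p = r \<bullet> (q \<bullet> p)"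
  by (auto simp: arrow_defs Cmp_assoc)

lemma acmp_idn [simp]:
  "\<lbrakk>arr p; X = tgt p\<rbrakk> \<Longrightarrow> idn X \<bullet> p = p" "\<lbrakk>arr p; X = src p\<rbrakk> \<Longrightarrow> p \<bullet> idn X = p"
  by (auto simp: arrow_defs Cmp_Idt_left Cmp_Idt_right)

lemma aten_idn: "\<lbrakk>X \<in> Obj C; Y \<in> Obj C\<rbrakk> \<Longrightarrow> idn X \<otimes>\<otimes> idn Y = idn (X \<boxtimes> Y)"
  by (simp add: arrow_defs TMor_Idt)

lemma interchange:
  "\<lbrakk>arr p; arr p'; arr q; arr q'; src p' = tgt p; src q' = tgt q\<rbrakk>
    \<Longrightarrow> (p' \<otimes>\<otimes> q') \<bullet> (p \<otimes>\<otimes> q) = (p' \<bullet> p) \<otimes>\<otimes> (q' \<bullet> q)"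
  by (auto simp: arrow_defs TMor_Cmp)

lemma inverse_mors_unique:
  assumes "X \<in> Obj C" "Y \<in> Obj C" "inverse_mors C X Y f g" "inverse_mors C X Y f g'"
  shows "g = g'"
  using assms unfolding inverse_mors_def by (metis Cmp_Idt_left Cmp_Idt_right Cmp_assoc)

text \<open>\<open>inv_mor\<close> is a definite description and gets its meaning from the
  uniqueness of inverses.\<close>

lemma ainv_simps [simp]:
  assumes "aiso p"
  shows "arr (ainv p)" "ainv p \<bullet> p = idn (src p)" "p \<bullet> ainv p = idn (tgt p)"
proof -
  obtain X f Y where p: "p = (X, f, Y)" by (cases p) auto
  have o: "X \<in> Obj C" "Y \<in> Obj C" using assms p by (simp_all add: aiso_def arr_def)
  obtain g where g: "inverse_mors C X Y f g" using assms p by (auto simp: aiso_def iso_mor_def)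
  then have "inv_mor C X Y f = g"
    unfolding inv_mor_def using inverse_mors_unique[OF o] by blast
  then show "arr (ainv p)" "ainv p \<bullet> p = idn (src p)" "p \<bullet> ainv p = idn (tgt p)"
    using g o by (simp_all add: p ainv_def arrow_defs inverse_mors_def)
qed

lemma ainv_cancel [simp]:
  "\<lbrakk>aiso p; arr q; tgt q = src p\<rbrakk> \<Longrightarrow> ainv p \<bullet> (p \<bullet> q) = q"
  "\<lbrakk>aiso p; arr q; tgt q = tgt p\<rbrakk> \<Longrightarrow> p \<bullet> (ainv p \<bullet> q) = q"
  by (simp_all add: acmp_assoc[symmetric] aiso_arr)

lemma aiso_cancel_right:
  assumes "aiso p" "arr q" "arr r" "src q = tgt p" "src r = tgt p" "q \<bullet> p = r \<bullet> p"
  shows "q = r"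
proof -
  have "q = (q \<bullet> p) \<bullet> ainv p" using assms(1-5) by (simp add: acmp_assoc aiso_arr)
  also have "\<dots> = r" unfolding assms(6) using assms(1-5) by (simp add: acmp_assoc aiso_arr)
  finally show ?thesis .
qed

lemma aiso_cancel_left:
  assumes "aiso p" "arr q" "arr r" "tgt q = src p" "tgt r = src p" "p \<bullet> q = p \<bullet> r"
  shows "q = r"
  using assms ainv_cancel(1) by metis

lemma aisoI:
  assumes "arr p" "arr q" "src q = tgt p" "tgt q = src p" "q \<bullet> p = idn (src p)" "p \<bullet> q = idn (tgt p)"
  shows "aiso p"
proof -
  obtain X f Y where p: "p = (X, f, Y)" by (cases p) auto
  obtain X' g Y' where q: "q = (X', g, Y')" by (cases q) auto
  have "X' = Y" "Y' = X" using assms p q by (simp_all add: arrow_defs)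
  then have "inverse_mors C X Y f g" using assms by (auto simp: p q inverse_mors_def arrow_defs)
  then show ?thesis using assms(1) by (auto simp: aiso_def iso_mor_def p)
qed

lemma aiso_acmp [simp]: "\<lbrakk>aiso p; aiso q; src q = tgt p\<rbrakk> \<Longrightarrow> aiso (q \<bullet> p)"
  by (rule aisoI[where q = "ainv p \<bullet> ainv q"]) (simp_all add: aiso_arr acmp_assoc)

lemma aiso_idn [simp]: "X \<in> Obj C \<Longrightarrow> aiso (idn X)"
  by (rule aisoI[where q = "idn X"]) simp_all

lemma aiso_aten [simp]: "\<lbrakk>aiso p; aiso q\<rbrakk> \<Longrightarrow> aiso (p \<otimes>\<otimes> q)"
  by (rule aisoI[where q = "ainv p \<otimes>\<otimes> ainv q"])
    (simp_all add: aiso_arr interchange aten_idn arr_Obj)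

lemma aiso_ainv [simp]: "aiso p \<Longrightarrow> aiso (ainv p)"
  by (rule aisoI[where q = p]) (simp_all add: aiso_arr)

lemma asc_natural:
  "\<lbrakk>arr p; arr q; arr r\<rbrakk> \<Longrightarrow> asc (tgt p) (tgt q) (tgt r) \<bullet> ((p \<otimes>\<otimes> q) \<otimes>\<otimes> r)
    = (p \<otimes>\<otimes> (q \<otimes>\<otimes> r)) \<bullet> asc (src p) (src q) (src r)"
  by (simp add: arrow_defs Asc_natural)

lemma ainv_asc_natural:
  assumes "arr p" "arr q" "arr r"
  shows "((p \<otimes>\<otimes> q) \<otimes>\<otimes> r) \<bullet> ainv (asc (src p) (src q) (src r))
    = ainv (asc (tgt p) (tgt q) (tgt r)) \<bullet> (p \<otimes>\<otimes> (q \<otimes>\<otimes> r))"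
proof (rule aiso_cancel_left[where p = "asc (tgt p) (tgt q) (tgt r)"])
  show "asc (tgt p) (tgt q) (tgt r) \<bullet> ((p \<otimes>\<otimes> q) \<otimes>\<otimes> r) \<bullet> ainv (asc (src p) (src q) (src r))
    = asc (tgt p) (tgt q) (tgt r) \<bullet> ainv (asc (tgt p) (tgt q) (tgt r)) \<bullet> (p \<otimes>\<otimes> (q \<otimes>\<otimes> r))"
    using assms by (simp add: acmp_assoc[symmetric] asc_natural arr_Obj TOb_Obj)
      (simp add: acmp_assoc arr_Obj TOb_Obj)
qed (use assms in \<open>simp_all add: arr_Obj TOb_Obj\<close>)

lemma lun_natural: "arr p \<Longrightarrow> lun (tgt p) \<bullet> (idn \<II> \<otimes>\<otimes> p) = p \<bullet> lun (src p)"
  by (simp add: arrow_defs Lun_natural)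

lemma run_natural: "arr p \<Longrightarrow> run (tgt p) \<bullet> (p \<otimes>\<otimes> idn \<II>) = p \<bullet> run (src p)"
  by (simp add: arrow_defs Run_natural)

lemma triangle_arr:
  "\<lbrakk>X \<in> Obj C; Y \<in> Obj C\<rbrakk> \<Longrightarrow> (idn X \<otimes>\<otimes> lun Y) \<bullet> asc X \<II> Y = run X \<otimes>\<otimes> idn Y"
  by (simp add: arrow_defs triangle)

lemma pentagon_arr:
  "\<lbrakk>W \<in> Obj C; X \<in> Obj C; Y \<in> Obj C; Z \<in> Obj C\<rbrakk> \<Longrightarrow>
    asc W X (Y \<boxtimes> Z) \<bullet> asc (W \<boxtimes> X) Y Z
    = (idn W \<otimes>\<otimes> asc X Y Z) \<bullet> (asc W (X \<boxtimes> Y) Z \<bullet> (asc W X Y \<otimes>\<otimes> idn Z))"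
  by (simp add: arrow_defs pentagon)

lemma aten_eq_right:
  "\<lbrakk>arr p; arr q; X \<in> Obj C; src p = tgt q\<rbrakk> \<Longrightarrow> idn X \<otimes>\<otimes> (p \<bullet> q) = (idn X \<otimes>\<otimes> p) \<bullet> (idn X \<otimes>\<otimes> q)"
  by (simp add: interchange)

lemma aten_eq_left:
  "\<lbrakk>arr p; arr q; X \<in> Obj C; src p = tgt q\<rbrakk> \<Longrightarrow> (p \<bullet> q) \<otimes>\<otimes> idn X = (p \<otimes>\<otimes> idn X) \<bullet> (q \<otimes>\<otimes> idn X)"
  by (simp add: interchange)

section \<open>Factorization and duality for bundled morphisms\<close>

definition afactors :: "'o \<times> 'm \<times> 'o \<Rightarrow> 'o \<times> 'm \<times> 'o \<Rightarrow> bool" where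
  "afactors f x \<longleftrightarrow> (\<exists>y. arr y \<and> src y = tgt f \<and> x = y \<bullet> f)"

lemma afactors_iff:
  "\<lbrakk>B \<in> Obj C; W \<in> Obj C\<rbrakk> \<Longrightarrow> afactors (A, f, B) (A, x, W) \<longleftrightarrow> factors C A B W f x"
  by (fastforce simp: afactors_def factors_def arrow_defs)

lemma arr_triple: "\<lbrakk>X \<in> Obj C; Y \<in> Obj C\<rbrakk> \<Longrightarrow> arr (X, f, Y) \<longleftrightarrow> f \<in> Mor C X Y"
  by (simp add: arrow_defs)

text \<open>\<open>\<kappa>\<close> is \<open>P \<boxtimes> \<eta>\<close> followed by the inverse
  associator. The equation for it uses the associator itself, the form in which the pentagon will be
  applied.\<close>

lemma dual_triangle:
  assumes P: "P \<in> Obj C" and dual: "is_dual C M P P' \<eta> \<epsilon>"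
  obtains \<kappa> \<epsilon>' \<eta>' where "P' \<in> Obj C" "arr \<epsilon>'" "src \<epsilon>' = P \<boxtimes> P'" "tgt \<epsilon>' = \<II>"
    "arr \<eta>'" "src \<eta>' = \<II>" "tgt \<eta>' = P' \<boxtimes> P" "arr \<kappa>" "src \<kappa> = P \<boxtimes> \<II>" "tgt \<kappa> = (P \<boxtimes> P') \<boxtimes> P"
    "asc P P' P \<bullet> \<kappa> = idn P \<otimes>\<otimes> \<eta>'" "lun P \<bullet> ((\<epsilon>' \<otimes>\<otimes> idn P) \<bullet> \<kappa>) = run P"
proof -
  have P': "P' \<in> Obj C" and \<eta>: "\<eta> \<in> Mor C \<II> (P' \<boxtimes> P)" and \<epsilon>: "\<epsilon> \<in> Mor C (P \<boxtimes> P') \<II>"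
    using dual unfolding is_dual_def by blast+
  note [simp] = P P' TOb_Obj Unt_Obj
  let ?\<eta> = "(\<II>, \<eta>, P' \<boxtimes> P)" and ?\<epsilon> = "(P \<boxtimes> P', \<epsilon>, \<II>)"
  have a: "arr ?\<eta>" "arr ?\<epsilon>" using \<eta> \<epsilon> by (simp_all add: arr_triple)
  have st: "src ?\<eta> = \<II>" "tgt ?\<eta> = P' \<boxtimes> P" "src ?\<epsilon> = P \<boxtimes> P'" "tgt ?\<epsilon> = \<II>" by (simp_all add: arrow_defs)
  let ?\<kappa> = "ainv (asc P P' P) \<bullet> (idn P \<otimes>\<otimes> ?\<eta>)"
  have "lun P \<bullet> ((?\<epsilon> \<otimes>\<otimes> idn P) \<bullet> ?\<kappa>) = run P"
    using dual unfolding is_dual_def by (simp add: arrow_defs ainv_def)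
  then show thesis
    using that[of ?\<epsilon> ?\<eta> ?\<kappa>] a st by simp
qed

text \<open>Correcting \<open>w\<close> by the automorphism \<open>\<sigma> \<rho>\<^sup>-\<^sup>1\<close> of \<open>P \<boxtimes> A\<close> spares the proof that it is the identity,
  that is, the compatibility of the left unit with the associator.\<close>

lemma dual_factors_left:
  assumes P: "P \<in> Obj C" and dual: "is_dual C M P P' \<eta> \<epsilon>"
    and f: "arr f" and X: "X \<in> Obj C"
    and fac: "\<And>v. \<lbrakk>arr v; src v = src f; tgt v = P' \<boxtimes> X\<rbrakk> \<Longrightarrow> afactors f v"
    and w: "arr w" "src w = P \<boxtimes> src f" "tgt w = X"
  shows "afactors (idn P \<otimes>\<otimes> f) w"
proof -
  obtain \<kappa> e n where P': "P' \<in> Obj C" and e: "arr e" "src e = P \<boxtimes> P'" "tgt e = \<II>"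
    and n: "arr n" "src n = \<II>" "tgt n = P' \<boxtimes> P" and \<kappa>: "arr \<kappa>" "src \<kappa> = P \<boxtimes> \<II>" "tgt \<kappa> = (P \<boxtimes> P') \<boxtimes> P"
    and \<kappa>n: "asc P P' P \<bullet> \<kappa> = idn P \<otimes>\<otimes> n" and tri: "lun P \<bullet> ((e \<otimes>\<otimes> idn P) \<bullet> \<kappa>) = run P"
    using dual_triangle[OF P dual] by metis
  define A B where "A = src f" and "B = tgt f"
  have o: "A \<in> Obj C" "B \<in> Obj C" using f arr_Obj by (simp_all add: A_def B_def)
  have sf: "src f = A" "tgt f = B" by (simp_all add: A_def B_def)
  have sw: "src w = P \<boxtimes> A" using w A_def by simp
  note [simp] = P P' X o TOb_Obj Unt_Obj e n \<kappa> f sf w(1,3) sw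
  let ?\<zeta> = "(e \<otimes>\<otimes> idn P) \<bullet> \<kappa>"
  \<comment> \<open>The duality identity exhibits this composite as a composite of unitors.\<close>
  have \<zeta>: "aiso ?\<zeta>"
  proof -
    have "?\<zeta> = ainv (lun P) \<bullet> run P" unfolding tri[symmetric] by simp
    then show ?thesis by simp
  qed
  define \<rho> where "\<rho> = lun (P \<boxtimes> A) \<bullet> asc \<II> P A \<bullet> (?\<zeta> \<otimes>\<otimes> idn A)"
  have \<rho>: "aiso \<rho>" "src \<rho> = (P \<boxtimes> \<II>) \<boxtimes> A" "tgt \<rho> = P \<boxtimes> A"
    using \<zeta> by (simp_all add: \<rho>_def)
  define \<sigma> where "\<sigma> = (idn P \<otimes>\<otimes> lun A) \<bullet> asc P \<II> A"
  have \<sigma>: "aiso \<sigma>" "src \<sigma> = (P \<boxtimes> \<II>) \<boxtimes> A" "tgt \<sigma> = P \<boxtimes> A" by (simp_all add: \<sigma>_def)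
  note [simp] = \<rho> \<sigma> aiso_arr[OF \<rho>(1)] aiso_arr[OF \<sigma>(1)]
  define w1 where "w1 = w \<bullet> \<sigma> \<bullet> ainv \<rho>"
  have w1 [simp]: "arr w1" "src w1 = P \<boxtimes> A" "tgt w1 = X" by (simp_all add: w1_def)
  \<comment> \<open>Up to the left unitor, the transpose of \<open>w1\<close> under the adjunction
    given by the duality; \<open>fac\<close> applies to it.\<close>
  define N where "N = (idn P' \<otimes>\<otimes> w1) \<bullet> asc P' P A \<bullet> (n \<otimes>\<otimes> idn A)"
  have N [simp]: "arr N" "src N = \<II> \<boxtimes> A" "tgt N = P' \<boxtimes> X" by (simp_all add: N_def)
  have "afactors f (N \<bullet> ainv (lun A))" by (rule fac) simp_all
  then obtain y where y: "arr y" "src y = B" "N \<bullet> ainv (lun A) = y \<bullet> f" unfolding afactors_def by auto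
  have ty: "tgt y = P' \<boxtimes> X" using arg_cong[OF y(3), of tgt] by simp
  note [simp] = y(1,2) ty
  have Ny: "N = y \<bullet> f \<bullet> lun A"
  proof -
    have "N = (N \<bullet> ainv (lun A)) \<bullet> lun A" by (simp add: acmp_assoc)
    then show ?thesis unfolding y(3) by (simp add: acmp_assoc)
  qed
  \<comment> \<open>The counit from \<open>P \<boxtimes> (P' \<boxtimes> X)\<close> to
    \<open>X\<close>, which transposes back.\<close>
  define cou where "cou = lun X \<bullet> (e \<otimes>\<otimes> idn X) \<bullet> ainv (asc P P' X)"
  have cou [simp]: "arr cou" "src cou = P \<boxtimes> (P' \<boxtimes> X)" "tgt cou = X" by (simp_all add: cou_def)
  have cou_w1: "cou \<bullet> (idn P \<otimes>\<otimes> (idn P' \<otimes>\<otimes> w1)) = w1 \<bullet> lun (P \<boxtimes> A) \<bullet> (e \<otimes>\<otimes> idn (P \<boxtimes> A)) \<bullet> ainv (asc P P' (P \<boxtimes> A))"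
  proof -
    have 1: "ainv (asc P P' X) \<bullet> (idn P \<otimes>\<otimes> (idn P' \<otimes>\<otimes> w1)) = (idn (P \<boxtimes> P') \<otimes>\<otimes> w1) \<bullet> ainv (asc P P' (P \<boxtimes> A))"
      using ainv_asc_natural[of "idn P" "idn P'" w1] by (simp add: aten_idn)
    have 2: "(e \<otimes>\<otimes> idn X) \<bullet> (idn (P \<boxtimes> P') \<otimes>\<otimes> w1) = (idn \<II> \<otimes>\<otimes> w1) \<bullet> (e \<otimes>\<otimes> idn (P \<boxtimes> A))"
      by (simp add: interchange)
    have 3: "lun X \<bullet> (idn \<II> \<otimes>\<otimes> w1) = w1 \<bullet> lun (P \<boxtimes> A)" using lun_natural[of w1] by simp
    have "cou \<bullet> (idn P \<otimes>\<otimes> (idn P' \<otimes>\<otimes> w1)) = lun X \<bullet> (e \<otimes>\<otimes> idn X) \<bullet> (ainv (asc P P' X) \<bullet> (idn P \<otimes>\<otimes> (idn P' \<otimes>\<otimes> w1)))"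
      unfolding cou_def by (simp add: acmp_assoc)
    also have "\<dots> = lun X \<bullet> ((e \<otimes>\<otimes> idn X) \<bullet> (idn (P \<boxtimes> P') \<otimes>\<otimes> w1)) \<bullet> ainv (asc P P' (P \<boxtimes> A))"
      unfolding 1 by (simp add: acmp_assoc)
    also have "\<dots> = (lun X \<bullet> (idn \<II> \<otimes>\<otimes> w1)) \<bullet> (e \<otimes>\<otimes> idn (P \<boxtimes> A)) \<bullet> ainv (asc P P' (P \<boxtimes> A))"
      unfolding 2 by (simp add: acmp_assoc)
    finally show ?thesis unfolding 3 by (simp add: acmp_assoc)
  qed
  \<comment> \<open>The pentagon moves the unit past the associators, where it becomes
    \<open>\<kappa>\<close> tensored with \<open>A\<close>.\<close>
  have key: "(idn P \<otimes>\<otimes> asc P' P A) \<bullet> (idn P \<otimes>\<otimes> (n \<otimes>\<otimes> idn A)) \<bullet> asc P \<II> A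
      = asc P P' (P \<boxtimes> A) \<bullet> asc (P \<boxtimes> P') P A \<bullet> (\<kappa> \<otimes>\<otimes> idn A)"
  proof -
    have "(idn P \<otimes>\<otimes> (n \<otimes>\<otimes> idn A)) \<bullet> asc P \<II> A = asc P (P' \<boxtimes> P) A \<bullet> ((idn P \<otimes>\<otimes> n) \<otimes>\<otimes> idn A)"
      using asc_natural[of "idn P" n "idn A"] by simp
    also have "(idn P \<otimes>\<otimes> n) \<otimes>\<otimes> idn A = (asc P P' P \<otimes>\<otimes> idn A) \<bullet> (\<kappa> \<otimes>\<otimes> idn A)"
      unfolding \<kappa>n[symmetric] by (simp add: aten_eq_left)
    finally have "(idn P \<otimes>\<otimes> asc P' P A) \<bullet> (idn P \<otimes>\<otimes> (n \<otimes>\<otimes> idn A)) \<bullet> asc P \<II> A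
      = ((idn P \<otimes>\<otimes> asc P' P A) \<bullet> asc P (P' \<boxtimes> P) A \<bullet> (asc P P' P \<otimes>\<otimes> idn A)) \<bullet> (\<kappa> \<otimes>\<otimes> idn A)"
      by (simp add: acmp_assoc)
    also have "\<dots> = (asc P P' (P \<boxtimes> A) \<bullet> asc (P \<boxtimes> P') P A) \<bullet> (\<kappa> \<otimes>\<otimes> idn A)"
      by (simp add: pentagon_arr)
    finally show ?thesis by (simp add: acmp_assoc)
  qed
  have e_nat: "(e \<otimes>\<otimes> idn (P \<boxtimes> A)) \<bullet> asc (P \<boxtimes> P') P A = asc \<II> P A \<bullet> ((e \<otimes>\<otimes> idn P) \<otimes>\<otimes> idn A)"
    using asc_natural[of e "idn P" "idn A"] by (simp add: aten_idn)
  \<comment> \<open>Transposing \<open>w1\<close> and back gives \<open>w1\<close> after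
    \<open>\<rho>\<close>, which is \<open>w\<close> after \<open>\<sigma>\<close> by the choice of
    \<open>w1\<close>.\<close>
  have "cou \<bullet> (idn P \<otimes>\<otimes> N) \<bullet> asc P \<II> A
    = (cou \<bullet> (idn P \<otimes>\<otimes> (idn P' \<otimes>\<otimes> w1))) \<bullet> ((idn P \<otimes>\<otimes> asc P' P A) \<bullet> (idn P \<otimes>\<otimes> (n \<otimes>\<otimes> idn A)) \<bullet> asc P \<II> A)"
    unfolding N_def by (simp add: acmp_assoc aten_eq_right)
  also have "\<dots> = w1 \<bullet> lun (P \<boxtimes> A) \<bullet> ((e \<otimes>\<otimes> idn (P \<boxtimes> A)) \<bullet> asc (P \<boxtimes> P') P A) \<bullet> (\<kappa> \<otimes>\<otimes> idn A)"
    unfolding cou_w1 key by (simp add: acmp_assoc)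
  also have "\<dots> = w1 \<bullet> \<rho>"
    unfolding e_nat \<rho>_def by (simp add: acmp_assoc aten_eq_left)
  also have "\<dots> = w \<bullet> \<sigma>" unfolding w1_def by (simp add: acmp_assoc)
  finally have "cou \<bullet> (idn P \<otimes>\<otimes> N) \<bullet> asc P \<II> A = w \<bullet> \<sigma>" .
  moreover have "cou \<bullet> (idn P \<otimes>\<otimes> N) \<bullet> asc P \<II> A = (cou \<bullet> (idn P \<otimes>\<otimes> y) \<bullet> (idn P \<otimes>\<otimes> f)) \<bullet> \<sigma>"
    unfolding Ny \<sigma>_def by (simp add: acmp_assoc aten_eq_right)
  ultimately have "w \<bullet> \<sigma> = (cou \<bullet> (idn P \<otimes>\<otimes> y) \<bullet> (idn P \<otimes>\<otimes> f)) \<bullet> \<sigma>" by simp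
  then have "w = cou \<bullet> (idn P \<otimes>\<otimes> y) \<bullet> (idn P \<otimes>\<otimes> f)"
    by (rule aiso_cancel_right[OF \<sigma>(1), rotated -1]) simp_all
  then show ?thesis
    unfolding afactors_def by (intro exI[of _ "cou \<bullet> (idn P \<otimes>\<otimes> y)"]) (simp add: acmp_assoc)
qed

text \<open>Tensoring with \<open>P'\<close> is left adjoint to tensoring with \<open>P\<close>, so
  \<open>h\<close> corresponds to a morphism from \<open>src f \<boxtimes> P'\<close> to
  \<open>Y\<close>. Transposing back produces the isomorphism \<open>\<Theta>\<close> in the place
  of the right unitor of \<open>Y \<boxtimes> P\<close>; being invertible, it is undone at the
  end.\<close>

lemma dual_factors_right:
  assumes P: "P \<in> Obj C" and dual: "is_dual C M P P' \<eta> \<epsilon>"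
    and f: "arr f" and Y: "Y \<in> Obj C"
    and fac: "\<And>v. \<lbrakk>arr v; src v = src f \<boxtimes> P'; tgt v = Y\<rbrakk> \<Longrightarrow> afactors (f \<otimes>\<otimes> idn P') v"
    and h: "arr h" "src h = src f" "tgt h = Y \<boxtimes> P"
  shows "afactors f h"
proof -
  obtain \<kappa> e n where P': "P' \<in> Obj C" and e: "arr e" "src e = P \<boxtimes> P'" "tgt e = \<II>"
    and n: "arr n" "src n = \<II>" "tgt n = P' \<boxtimes> P" and \<kappa>: "arr \<kappa>" "src \<kappa> = P \<boxtimes> \<II>" "tgt \<kappa> = (P \<boxtimes> P') \<boxtimes> P"
    and \<kappa>n: "asc P P' P \<bullet> \<kappa> = idn P \<otimes>\<otimes> n" and tri: "lun P \<bullet> ((e \<otimes>\<otimes> idn P) \<bullet> \<kappa>) = run P"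
    using dual_triangle[OF P dual] by metis
  define A B where "A = src f" and "B = tgt f"
  have o: "A \<in> Obj C" "B \<in> Obj C" using f arr_Obj by (simp_all add: A_def B_def)
  have sf: "src f = A" "tgt f = B" by (simp_all add: A_def B_def)
  have sh: "src h = A" using h A_def by simp
  note [simp] = P P' Y o TOb_Obj Unt_Obj e n \<kappa> f sf h(1,3) sh
  \<comment> \<open>The transpose of \<open>h\<close>, to which \<open>fac\<close> applies.\<close>
  have "afactors (f \<otimes>\<otimes> idn P') (run Y \<bullet> (idn Y \<otimes>\<otimes> e) \<bullet> asc Y P P' \<bullet> (h \<otimes>\<otimes> idn P'))"
    by (rule fac) simp_all
  then obtain y where y: "arr y" "src y = B \<boxtimes> P'" "run Y \<bullet> (idn Y \<otimes>\<otimes> e) \<bullet> asc Y P P' \<bullet> (h \<otimes>\<otimes> idn P') = y \<bullet> (f \<otimes>\<otimes> idn P')"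
    unfolding afactors_def by auto
  have ty: "tgt y = Y" using arg_cong[OF y(3), of tgt] by simp
  note [simp] = y(1,2) ty
  let ?c = "run Y \<bullet> (idn Y \<otimes>\<otimes> e) \<bullet> asc Y P P'"
  \<comment> \<open>The transpose of \<open>y\<close> back to a morphism from \<open>B\<close>; it
    gives the factor of \<open>h\<close> up to \<open>\<Theta>\<close> and a unitor.\<close>
  define z where "z = (y \<otimes>\<otimes> idn P) \<bullet> ainv (asc B P' P) \<bullet> (idn B \<otimes>\<otimes> n) \<bullet> ainv (run B)"
  have z [simp]: "arr z" "src z = B" "tgt z = Y \<boxtimes> P" by (simp_all add: z_def)
  define \<Theta> where "\<Theta> = (idn Y \<otimes>\<otimes> run P) \<bullet> asc Y P \<II>"
  have \<Theta> [simp]: "aiso \<Theta>" "src \<Theta> = (Y \<boxtimes> P) \<boxtimes> \<II>" "tgt \<Theta> = Y \<boxtimes> P" by (simp_all add: \<Theta>_def)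
  note [simp] = aiso_arr[OF \<Theta>(1)]
  \<comment> \<open>The unit and then the counit, reduced by the pentagon, the triangle and the
    duality identity.\<close>
  have \<Theta>_eq: "(?c \<otimes>\<otimes> idn P) \<bullet> ainv (asc (Y \<boxtimes> P) P' P) \<bullet> (idn (Y \<boxtimes> P) \<otimes>\<otimes> n) = \<Theta>"
  proof -
    have 1: "asc Y (P \<boxtimes> P') P \<bullet> (asc Y P P' \<otimes>\<otimes> idn P) \<bullet> ainv (asc (Y \<boxtimes> P) P' P) \<bullet> (idn (Y \<boxtimes> P) \<otimes>\<otimes> n)
      = (idn Y \<otimes>\<otimes> \<kappa>) \<bullet> asc Y P \<II>"
    proof (rule aiso_cancel_left[where p = "idn Y \<otimes>\<otimes> asc P P' P"])
      have "(idn Y \<otimes>\<otimes> asc P P' P) \<bullet> asc Y (P \<boxtimes> P') P \<bullet> (asc Y P P' \<otimes>\<otimes> idn P) \<bullet> ainv (asc (Y \<boxtimes> P) P' P) \<bullet> (idn (Y \<boxtimes> P) \<otimes>\<otimes> n)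
        = ((idn Y \<otimes>\<otimes> asc P P' P) \<bullet> asc Y (P \<boxtimes> P') P \<bullet> (asc Y P P' \<otimes>\<otimes> idn P)) \<bullet> ainv (asc (Y \<boxtimes> P) P' P) \<bullet> (idn (Y \<boxtimes> P) \<otimes>\<otimes> n)"
        by (simp add: acmp_assoc)
      also have "\<dots> = (asc Y P (P' \<boxtimes> P) \<bullet> asc (Y \<boxtimes> P) P' P) \<bullet> ainv (asc (Y \<boxtimes> P) P' P) \<bullet> (idn (Y \<boxtimes> P) \<otimes>\<otimes> n)"
        by (simp add: pentagon_arr)
      also have "\<dots> = asc Y P (P' \<boxtimes> P) \<bullet> ((idn Y \<otimes>\<otimes> idn P) \<otimes>\<otimes> n)"
        by (simp add: acmp_assoc aten_idn)
      also have "\<dots> = (idn Y \<otimes>\<otimes> (idn P \<otimes>\<otimes> n)) \<bullet> asc Y P \<II>"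
        using asc_natural[of "idn Y" "idn P" n] by simp
      also have "\<dots> = (idn Y \<otimes>\<otimes> asc P P' P) \<bullet> (idn Y \<otimes>\<otimes> \<kappa>) \<bullet> asc Y P \<II>"
        unfolding \<kappa>n[symmetric] by (simp add: aten_eq_right acmp_assoc)
      finally show "(idn Y \<otimes>\<otimes> asc P P' P) \<bullet> asc Y (P \<boxtimes> P') P \<bullet> (asc Y P P' \<otimes>\<otimes> idn P) \<bullet> ainv (asc (Y \<boxtimes> P) P' P) \<bullet> (idn (Y \<boxtimes> P) \<otimes>\<otimes> n)
        = (idn Y \<otimes>\<otimes> asc P P' P) \<bullet> (idn Y \<otimes>\<otimes> \<kappa>) \<bullet> asc Y P \<II>" .
    qed simp_all
    have 2: "(run Y \<otimes>\<otimes> idn P) \<bullet> ((idn Y \<otimes>\<otimes> e) \<otimes>\<otimes> idn P) = (idn Y \<otimes>\<otimes> (lun P \<bullet> (e \<otimes>\<otimes> idn P))) \<bullet> asc Y (P \<boxtimes> P') P"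
    proof -
      have "(run Y \<otimes>\<otimes> idn P) \<bullet> ((idn Y \<otimes>\<otimes> e) \<otimes>\<otimes> idn P) = (idn Y \<otimes>\<otimes> lun P) \<bullet> (asc Y \<II> P \<bullet> ((idn Y \<otimes>\<otimes> e) \<otimes>\<otimes> idn P))"
        unfolding triangle_arr[OF Y P, symmetric] by (simp add: acmp_assoc)
      also have "asc Y \<II> P \<bullet> ((idn Y \<otimes>\<otimes> e) \<otimes>\<otimes> idn P) = (idn Y \<otimes>\<otimes> (e \<otimes>\<otimes> idn P)) \<bullet> asc Y (P \<boxtimes> P') P"
        using asc_natural[of "idn Y" e "idn P"] by simp
      finally show ?thesis by (simp add: aten_eq_right acmp_assoc)
    qed
    have "(?c \<otimes>\<otimes> idn P) \<bullet> ainv (asc (Y \<boxtimes> P) P' P) \<bullet> (idn (Y \<boxtimes> P) \<otimes>\<otimes> n)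
      = ((run Y \<otimes>\<otimes> idn P) \<bullet> ((idn Y \<otimes>\<otimes> e) \<otimes>\<otimes> idn P)) \<bullet> (asc Y P P' \<otimes>\<otimes> idn P) \<bullet> ainv (asc (Y \<boxtimes> P) P' P) \<bullet> (idn (Y \<boxtimes> P) \<otimes>\<otimes> n)"
      by (simp add: aten_eq_left acmp_assoc)
    also have "\<dots> = (idn Y \<otimes>\<otimes> (lun P \<bullet> (e \<otimes>\<otimes> idn P))) \<bullet> (asc Y (P \<boxtimes> P') P \<bullet> (asc Y P P' \<otimes>\<otimes> idn P) \<bullet> ainv (asc (Y \<boxtimes> P) P' P) \<bullet> (idn (Y \<boxtimes> P) \<otimes>\<otimes> n))"
      unfolding 2 by (simp add: acmp_assoc)
    also have "\<dots> = (idn Y \<otimes>\<otimes> (lun P \<bullet> ((e \<otimes>\<otimes> idn P) \<bullet> \<kappa>))) \<bullet> asc Y P \<II>"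
      unfolding 1 by (simp add: aten_eq_right acmp_assoc)
    also have "\<dots> = \<Theta>" unfolding tri \<Theta>_def ..
    finally show ?thesis .
  qed
  have hh: "((h \<otimes>\<otimes> idn P') \<otimes>\<otimes> idn P) \<bullet> ainv (asc A P' P) = ainv (asc (Y \<boxtimes> P) P' P) \<bullet> (h \<otimes>\<otimes> idn (P' \<boxtimes> P))"
    using ainv_asc_natural[of h "idn P'" "idn P"] by (simp add: aten_idn)
  have ff: "((f \<otimes>\<otimes> idn P') \<otimes>\<otimes> idn P) \<bullet> ainv (asc A P' P) = ainv (asc B P' P) \<bullet> (f \<otimes>\<otimes> idn (P' \<boxtimes> P))"
    using ainv_asc_natural[of f "idn P'" "idn P"] by (simp add: aten_idn)
  have runf: "run B \<bullet> (f \<otimes>\<otimes> idn \<II>) = f \<bullet> run A" using run_natural[of f] by simp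
  have "((?c \<bullet> (h \<otimes>\<otimes> idn P')) \<otimes>\<otimes> idn P) \<bullet> ainv (asc A P' P) \<bullet> (idn A \<otimes>\<otimes> n)
    = (?c \<otimes>\<otimes> idn P) \<bullet> (((h \<otimes>\<otimes> idn P') \<otimes>\<otimes> idn P) \<bullet> ainv (asc A P' P)) \<bullet> (idn A \<otimes>\<otimes> n)"
    by (simp add: aten_eq_left acmp_assoc)
  also have "\<dots> = (?c \<otimes>\<otimes> idn P) \<bullet> ainv (asc (Y \<boxtimes> P) P' P) \<bullet> ((h \<otimes>\<otimes> idn (P' \<boxtimes> P)) \<bullet> (idn A \<otimes>\<otimes> n))"
    unfolding hh by (simp add: acmp_assoc)
  also have "(h \<otimes>\<otimes> idn (P' \<boxtimes> P)) \<bullet> (idn A \<otimes>\<otimes> n) = (idn (Y \<boxtimes> P) \<otimes>\<otimes> n) \<bullet> (h \<otimes>\<otimes> idn \<II>)"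
    by (simp add: interchange)
  also have "(?c \<otimes>\<otimes> idn P) \<bullet> ainv (asc (Y \<boxtimes> P) P' P) \<bullet> \<dots>
    = ((?c \<otimes>\<otimes> idn P) \<bullet> ainv (asc (Y \<boxtimes> P) P' P) \<bullet> (idn (Y \<boxtimes> P) \<otimes>\<otimes> n)) \<bullet> (h \<otimes>\<otimes> idn \<II>)"
    by (simp add: acmp_assoc)
  finally have L: "((?c \<bullet> (h \<otimes>\<otimes> idn P')) \<otimes>\<otimes> idn P) \<bullet> ainv (asc A P' P) \<bullet> (idn A \<otimes>\<otimes> n) = \<Theta> \<bullet> (h \<otimes>\<otimes> idn \<II>)"
    unfolding \<Theta>_eq .
  have "((y \<bullet> (f \<otimes>\<otimes> idn P')) \<otimes>\<otimes> idn P) \<bullet> ainv (asc A P' P) \<bullet> (idn A \<otimes>\<otimes> n)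
    = (y \<otimes>\<otimes> idn P) \<bullet> (((f \<otimes>\<otimes> idn P') \<otimes>\<otimes> idn P) \<bullet> ainv (asc A P' P)) \<bullet> (idn A \<otimes>\<otimes> n)"
    by (simp add: aten_eq_left acmp_assoc)
  also have "\<dots> = (y \<otimes>\<otimes> idn P) \<bullet> ainv (asc B P' P) \<bullet> ((f \<otimes>\<otimes> idn (P' \<boxtimes> P)) \<bullet> (idn A \<otimes>\<otimes> n))"
    unfolding ff by (simp add: acmp_assoc)
  also have "(f \<otimes>\<otimes> idn (P' \<boxtimes> P)) \<bullet> (idn A \<otimes>\<otimes> n) = (idn B \<otimes>\<otimes> n) \<bullet> (f \<otimes>\<otimes> idn \<II>)"
    by (simp add: interchange)
  also have "f \<otimes>\<otimes> idn \<II> = ainv (run B) \<bullet> (f \<bullet> run A)"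
    by (simp flip: runf)
  finally have "((y \<bullet> (f \<otimes>\<otimes> idn P')) \<otimes>\<otimes> idn P) \<bullet> ainv (asc A P' P) \<bullet> (idn A \<otimes>\<otimes> n) = (z \<bullet> f) \<bullet> run A"
    unfolding z_def by (simp add: acmp_assoc)
  moreover have "?c \<bullet> (h \<otimes>\<otimes> idn P') = y \<bullet> (f \<otimes>\<otimes> idn P')" unfolding y(3)[symmetric] by (simp add: acmp_assoc)
  ultimately have \<Theta>h: "\<Theta> \<bullet> (h \<otimes>\<otimes> idn \<II>) = (z \<bullet> f) \<bullet> run A" using L by simp
  have "h \<bullet> run A = run (Y \<boxtimes> P) \<bullet> (h \<otimes>\<otimes> idn \<II>)" using run_natural[of h] by simp
  also have "h \<otimes>\<otimes> idn \<II> = ainv \<Theta> \<bullet> (\<Theta> \<bullet> (h \<otimes>\<otimes> idn \<II>))" by simp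
  also have "run (Y \<boxtimes> P) \<bullet> \<dots> = (run (Y \<boxtimes> P) \<bullet> ainv \<Theta> \<bullet> z \<bullet> f) \<bullet> run A"
    unfolding \<Theta>h by (simp add: acmp_assoc)
  finally have "h = run (Y \<boxtimes> P) \<bullet> ainv \<Theta> \<bullet> z \<bullet> f"
    by (rule aiso_cancel_right[where p = "run A", rotated -1]) simp_all
  then show ?thesis
    unfolding afactors_def by (intro exI[of _ "run (Y \<boxtimes> P) \<bullet> ainv \<Theta> \<bullet> z"]) (simp add: acmp_assoc)
qed

end

section \<open>The duality statements for morphisms without bundled objects\<close>

lemma (in symmetric_monoidal) dual_factors_left_Mor:
  assumes P: "P \<in> Obj C" and dual: "is_dual C M P P' \<eta> \<epsilon>"
    and o: "A \<in> Obj C" "B \<in> Obj C" "X \<in> Obj C" and f: "f \<in> Mor C A B"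
    and fac: "\<And>v. v \<in> Mor C A (P' \<boxtimes> X) \<Longrightarrow> factors C A B (P' \<boxtimes> X) f v"
    and w: "w \<in> Mor C (P \<boxtimes> A) X"
  shows "factors C (P \<boxtimes> A) (P \<boxtimes> B) X (TMor M P P A B (Idt C P) f) w"
proof -
  have P': "P' \<in> Obj C" using dual unfolding is_dual_def by blast
  note [simp] = P P' o TOb_Obj
  have "afactors (idn P \<otimes>\<otimes> (A, f, B)) (P \<boxtimes> A, w, X)"
  proof (rule dual_factors_left[OF P dual _ o(3)])
    fix v assume v: "arr v" "src v = src (A, f, B)" "tgt v = P' \<boxtimes> X"
    then obtain v' where v': "v = (A, v', P' \<boxtimes> X)" by (cases v) (auto simp: src_def tgt_def)
    then show "afactors (A, f, B) v" using fac v(1) by (simp add: afactors_iff arr_triple)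
  qed (use f w in \<open>simp_all add: arr_triple src_def tgt_def\<close>)
  then show ?thesis by (simp add: aten_def idn_def afactors_iff)
qed

lemma (in symmetric_monoidal) dual_factors_right_Mor:
  assumes P: "P \<in> Obj C" and dual: "is_dual C M P P' \<eta> \<epsilon>"
    and o: "A \<in> Obj C" "B \<in> Obj C" "Y \<in> Obj C" and f: "f \<in> Mor C A B"
    and fac: "\<And>v. v \<in> Mor C (A \<boxtimes> P') Y \<Longrightarrow>
      factors C (A \<boxtimes> P') (B \<boxtimes> P') Y (TMor M A B P' P' f (Idt C P')) v"
    and h: "h \<in> Mor C A (Y \<boxtimes> P)"
  shows "factors C A B (Y \<boxtimes> P) f h"
proof -
  have P': "P' \<in> Obj C" using dual unfolding is_dual_def by blast
  note [simp] = P P' o TOb_Obj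
  have ten: "(A, f, B) \<otimes>\<otimes> idn P' = (A \<boxtimes> P', TMor M A B P' P' f (Idt C P'), B \<boxtimes> P')"
    by (simp add: aten_def idn_def)
  have "afactors (A, f, B) (A, h, Y \<boxtimes> P)"
  proof (rule dual_factors_right[OF P dual _ o(3)])
    fix v assume v: "arr v" "src v = src (A, f, B) \<boxtimes> P'" "tgt v = Y"
    then obtain v' where v': "v = (A \<boxtimes> P', v', Y)" by (cases v) (auto simp: src_def tgt_def)
    then show "afactors ((A, f, B) \<otimes>\<otimes> idn P') v"
      using fac v(1) unfolding ten by (simp add: afactors_iff arr_triple)
  qed (use f h in \<open>simp_all add: arr_triple src_def tgt_def\<close>)
  then show ?thesis by (simp add: afactors_iff)
qed

section \<open>Tensor-ideals\<close>

locale tensor_setting = serre_setting C S + closed_symmetric_monoidal C M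
    + fp: small_symmetric_monoidal "fp_category C" M
  for C :: "('o, 'u) category" and S :: "('o, 'u) abfunctor set"
    and M :: "('o, 'u) monoidal_structure" (structure) +
  assumes fp_rigid: "A \<in> fp_objects C \<Longrightarrow> \<exists>A' \<eta> \<epsilon>. is_dual (fp_category C) M A A' \<eta> \<epsilon>"
begin

lemma fp_tensor: "\<lbrakk>A \<in> fp_objects C; B \<in> fp_objects C\<rbrakk> \<Longrightarrow> A \<boxtimes> B \<in> fp_objects C"
  using fp.TOb_Obj[of A B] by simp

text \<open>Homs, composition and inverses are the same in the full subcategory, so a dual there is
  a dual in \<open>C\<close>.\<close>

lemma fp_dual:
  assumes "A \<in> fp_objects C"
  obtains A' \<eta> \<epsilon> where "A' \<in> fp_objects C" "is_dual C M A A' \<eta> \<epsilon>"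
proof -
  obtain A' \<eta> \<epsilon> where d: "is_dual (fp_category C) M A A' \<eta> \<epsilon>" using fp_rigid[OF assms] by blast
  have i: "inv_mor (fp_category C) = inv_mor C"
    by (simp add: inv_mor_def inverse_mors_def fun_eq_iff)
  have "A' \<in> fp_objects C" using d unfolding is_dual_def by simp
  moreover have "is_dual C M A A' \<eta> \<epsilon>"
    using d fp_objects_Obj[of A' C] unfolding is_dual_def i by simp
  ultimately show thesis by (rule that)
qed

lemma annihilated_day_tensor:
  assumes pG: "presents (fp_category C) P Q g G eG" and pF: "presents (fp_category C) A B f F eF"
    and R: "R \<in> fp_objects C" and hM: "h \<in> Mor C (P \<boxtimes> A) R"
    and h: "\<And>W x. \<lbrakk>W \<in> fp_objects C; x \<in> Mor C (P \<boxtimes> A) W\<rbrakk> \<Longrightarrow> factors C (P \<boxtimes> A) R W h x \<longleftrightarrow>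
      (\<exists>y \<in> Mor C (P \<boxtimes> B) W. \<exists>y' \<in> Mor C (Q \<boxtimes> A) W.
        x = Cmp C (P \<boxtimes> A) (P \<boxtimes> B) W y (TMor M P P A B (Idt C P) f)
          \<otimes>\<^bsub>Hom C (P \<boxtimes> A) W\<^esub> Cmp C (P \<boxtimes> A) (Q \<boxtimes> A) W y' (TMor M P Q A A g (Idt C A)))"
  shows "day_tensor (fp_category C) M G F \<in> S \<longleftrightarrow> annihilated (P \<boxtimes> A) R h"
proof -
  obtain e where "presents (fp_category C) (P \<boxtimes> A) R h (day_tensor (fp_category C) M G F) e"
    using fp.day_tensor_presents[OF pG pF, of R h] R hM h by auto
  then show ?thesis by (rule presents_annihilated)
qed

lemma fp_tensor_Mor:
  assumes "P \<in> fp_objects C" "f \<in> Mor C A B" "A \<in> fp_objects C" "B \<in> fp_objects C"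
  shows "TMor M P P A B (Idt C P) f \<in> Mor C (P \<boxtimes> A) (P \<boxtimes> B)"
  using assms by (intro TMor_Mor Idt_Mor) (simp_all add: fp_objects_Obj)

text \<open>A representable functor is the cokernel of a zero morphism, so tensoring with it is a
  case of the general formula.\<close>

lemma presents_representable:
  assumes P: "P \<in> fp_objects C"
  shows "presents (fp_category C) P P (zero_mor C P P) (representable C P) (Idt C P)"
proof -
  have o: "P \<in> Obj C" using P by (rule fp_objects_Obj)
  show ?thesis
    unfolding presents_def
    using fp.representable_functor[of P] P o fp_objects_Obj[of _ C]
    by (auto simp: Idt_Mor Cmp_Idt_right factors_def intro: zero_Mor)
qed

lemma serre_tensor_ideal_annihilated:
  assumes ideal: "serre_tensor_ideal C M S" and f: "annihilated A B f" and P: "P \<in> fp_objects C"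
  shows "annihilated (P \<boxtimes> A) (P \<boxtimes> B) (TMor M P P A B (Idt C P) f)"
proof -
  note m = annihilatedD[OF f]
  have oP: "P \<in> Obj C" using P by (rule fp_objects_Obj)
  obtain e where pF: "presents (fp_category C) A B f (Cok C A B f) e"
    using fp_Cok_presents[OF m(1-3)] by blast
  note pG = presents_representable[OF P]
  have "Cok C A B f \<in> S" using f unfolding annihilated_def by blast
  moreover have "representable C P \<in> Obj (fp_mod C)" using Obj_fp_mod pG by blast
  ultimately have "day_tensor (fp_category C) M (representable C P) (Cok C A B f) \<in> S"
    using ideal unfolding serre_tensor_ideal_def by blast
  moreover have "day_tensor (fp_category C) M (representable C P) (Cok C A B f) \<in> S
    \<longleftrightarrow> annihilated (P \<boxtimes> A) (P \<boxtimes> B) (TMor M P P A B (Idt C P) f)"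
  proof (rule annihilated_day_tensor[OF pG pF fp_tensor[OF P m(2)] fp_tensor_Mor[OF P m(3,1,2)]])
    fix W x assume W: "W \<in> fp_objects C" and x: "x \<in> Mor C (P \<boxtimes> A) W"
    have o: "W \<in> Obj C" "P \<boxtimes> A \<in> Obj C" "P \<boxtimes> B \<in> Obj C"
      using W TOb_Obj oP m by (simp_all add: fp_objects_Obj)
    interpret G: comm_group "Hom C (P \<boxtimes> A) W" using Hom_comm_group o by blast
    have fM: "TMor M P P A B (Idt C P) f \<in> Mor C (P \<boxtimes> A) (P \<boxtimes> B)" using fp_tensor_Mor[OF P m(3,1,2)] .
    \<comment> \<open>The relations of \<open>(P,-)\<close> are zero and add nothing to those coming
      from \<open>f\<close>.\<close>
    have zero: "TMor M P P A A (zero_mor C P P) (Idt C A) = zero_mor C (P \<boxtimes> A) (P \<boxtimes> A)"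
    proof -
      have "(\<lambda>g. TMor M P P A A g (Idt C A)) \<in> hom (Hom C P P) (Hom C (P \<boxtimes> A) (P \<boxtimes> A))"
        using oP m(4) by (intro homI) (simp_all add: TMor_Mor TMor_add_left Idt_Mor)
      then show ?thesis using hom_one Hom_group oP o(2) by metis
    qed
    have "Cmp C (P \<boxtimes> A) (P \<boxtimes> B) W y (TMor M P P A B (Idt C P) f) \<otimes>\<^bsub>Hom C (P \<boxtimes> A) W\<^esub>
        Cmp C (P \<boxtimes> A) (P \<boxtimes> A) W y' (TMor M P P A A (zero_mor C P P) (Idt C A))
      = Cmp C (P \<boxtimes> A) (P \<boxtimes> B) W y (TMor M P P A B (Idt C P) f)"
      if "y \<in> Mor C (P \<boxtimes> B) W" "y' \<in> Mor C (P \<boxtimes> A) W" for y y'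
      unfolding zero using that o fM Cmp_Mor[OF o(2,3,1) fM that(1)] by simp
    then show "factors C (P \<boxtimes> A) (P \<boxtimes> B) W (TMor M P P A B (Idt C P) f) x \<longleftrightarrow>
      (\<exists>y \<in> Mor C (P \<boxtimes> B) W. \<exists>y' \<in> Mor C (P \<boxtimes> A) W.
        x = Cmp C (P \<boxtimes> A) (P \<boxtimes> B) W y (TMor M P P A B (Idt C P) f)
          \<otimes>\<^bsub>Hom C (P \<boxtimes> A) W\<^esub> Cmp C (P \<boxtimes> A) (P \<boxtimes> A) W y' (TMor M P P A A (zero_mor C P P) (Idt C A)))"
      unfolding factors_def using zero_Mor[OF o(2,1)] by (metis (no_types, lifting))
  qed
  ultimately show ?thesis by blast
qed

text \<open>A morphism from \<open>A\<close> to \<open>Y \<boxtimes> P\<close> corresponds to one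
  from \<open>A \<boxtimes> P'\<close> to \<open>Y\<close>, and \<open>P' \<boxtimes> f\<close> is
  annihilated by the ideal property. The braiding is used twice, to pass between
  \<open>P' \<boxtimes> f\<close> and \<open>f \<boxtimes> P'\<close> and between
  \<open>P \<boxtimes> Y\<close> and \<open>Y \<boxtimes> P\<close>.\<close>

lemma fp_tensor_definable:
  assumes ideal: "serre_tensor_ideal C M S" and P: "P \<in> fp_objects C" and Y: "Y \<in> definable_of C S"
  shows "P \<boxtimes> Y \<in> definable_of C S"
proof -
  have o: "P \<in> Obj C" "Y \<in> Obj C" using P Y definable_of_iff by (auto simp: fp_objects_Obj)
  obtain P' \<eta> \<epsilon> where P': "P' \<in> fp_objects C" and dual: "is_dual C M P P' \<eta> \<epsilon>" using fp_dual[OF P] by blast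
  have oP': "P' \<in> Obj C" using P' by (rule fp_objects_Obj)
  have brd: "Brd M X Z \<in> Mor C (X \<boxtimes> Z) (Z \<boxtimes> X)" if "X \<in> Obj C" "Z \<in> Obj C" for X Z
    using Brd_iso[OF that] unfolding iso_mor_def inverse_mors_def by blast
  show ?thesis
    unfolding definable_of_iff
  proof (intro conjI TOb_Obj o allI impI ballI)
    fix A B f h assume f: "annihilated A B f" and h: "h \<in> Mor C A (P \<boxtimes> Y)"
    note m = annihilatedD[OF f]
    let ?Pf = "TMor M P' P' A B (Idt C P') f" and ?fP = "TMor M A B P' P' f (Idt C P')"
    have Pf: "?Pf \<in> Mor C (P' \<boxtimes> A) (P' \<boxtimes> B)" using fp_tensor_Mor[OF P' m(3,1,2)] .
    have fP: "?fP \<in> Mor C (A \<boxtimes> P') (B \<boxtimes> P')" using TMor_Mor[OF m(4,5) oP' oP' m(3) Idt_Mor[OF oP']] .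
    note t = TOb_Obj[OF oP' m(4)] TOb_Obj[OF oP' m(5)] TOb_Obj[OF m(4) oP'] TOb_Obj[OF m(5) oP']
    note bA = brd[OF oP' m(4)] and bA' = brd[OF m(4) oP'] and bB' = brd[OF m(5) oP']
    have "factors C (A \<boxtimes> P') (B \<boxtimes> P') Y ?fP v" if v: "v \<in> Mor C (A \<boxtimes> P') Y" for v
    proof -
      have "factors C (P' \<boxtimes> A) (P' \<boxtimes> B) Y ?Pf (Cmp C (P' \<boxtimes> A) (A \<boxtimes> P') Y v (Brd M P' A))"
        using Y serre_tensor_ideal_annihilated[OF ideal f P'] Cmp_Mor[OF t(1,3) o(2) bA v]
        unfolding definable_of_iff by blast
      then obtain y where y: "y \<in> Mor C (P' \<boxtimes> B) Y"
        "Cmp C (P' \<boxtimes> A) (A \<boxtimes> P') Y v (Brd M P' A) = Cmp C (P' \<boxtimes> A) (P' \<boxtimes> B) Y y ?Pf"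
        unfolding factors_def by blast
      have "v = Cmp C (A \<boxtimes> P') (A \<boxtimes> P') Y v (Cmp C (A \<boxtimes> P') (P' \<boxtimes> A) (A \<boxtimes> P') (Brd M P' A) (Brd M A P'))"
        using symmetry[OF m(4) oP'] Cmp_Idt_right[OF t(3) o(2) v] by simp
      also have "\<dots> = Cmp C (A \<boxtimes> P') (P' \<boxtimes> A) Y (Cmp C (P' \<boxtimes> A) (A \<boxtimes> P') Y v (Brd M P' A)) (Brd M A P')"
        using Cmp_assoc[OF t(3,1,3) o(2) bA' bA v] .
      also have "\<dots> = Cmp C (A \<boxtimes> P') (P' \<boxtimes> B) Y y (Cmp C (A \<boxtimes> P') (P' \<boxtimes> A) (P' \<boxtimes> B) ?Pf (Brd M A P'))"
        unfolding y(2) using Cmp_assoc[OF t(3,1,2) o(2) bA' Pf y(1)] by simp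
      also have "Cmp C (A \<boxtimes> P') (P' \<boxtimes> A) (P' \<boxtimes> B) ?Pf (Brd M A P') = Cmp C (A \<boxtimes> P') (B \<boxtimes> P') (P' \<boxtimes> B) (Brd M B P') ?fP"
        using Brd_natural[OF m(4,5) oP' oP' m(3) Idt_Mor[OF oP']] by simp
      also have "Cmp C (A \<boxtimes> P') (P' \<boxtimes> B) Y y \<dots> = Cmp C (A \<boxtimes> P') (B \<boxtimes> P') Y (Cmp C (B \<boxtimes> P') (P' \<boxtimes> B) Y y (Brd M B P')) ?fP"
        using Cmp_assoc[OF t(3,4,2) o(2) fP bB' y(1)] .
      finally show ?thesis unfolding factors_def using Cmp_Mor[OF t(4,2) o(2) bB' y(1)] by blast
    qed
    then have "factors C A B (Y \<boxtimes> P) f (Cmp C A (P \<boxtimes> Y) (Y \<boxtimes> P) (Brd M P Y) h)"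
      using dual_factors_right_Mor[OF o(1) dual m(4,5) o(2) m(3)]
        Cmp_Mor[OF m(4) TOb_Obj[OF o] TOb_Obj[OF o(2,1)] h brd[OF o]] by blast
    then have "factors C A B (P \<boxtimes> Y) f (Cmp C A (Y \<boxtimes> P) (P \<boxtimes> Y) (Brd M Y P) (Cmp C A (P \<boxtimes> Y) (Y \<boxtimes> P) (Brd M P Y) h))"
      by (rule factors_Cmp[OF m(4,5) TOb_Obj[OF o(2,1)] TOb_Obj[OF o] m(3) brd[OF o(2,1)]])
    then show "factors C A B (P \<boxtimes> Y) f h"
      using Cmp_assoc[OF m(4) TOb_Obj[OF o] TOb_Obj[OF o(2,1)] TOb_Obj[OF o] h brd[OF o] brd[OF o(2,1)]]
        symmetry[OF o] Cmp_Idt_left[OF m(4) TOb_Obj[OF o] h] by simp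
  qed
qed

lemma serre_imp_definable_tensor_ideal:
  assumes ideal: "serre_tensor_ideal C M S"
  shows "definable_tensor_ideal C M (definable_of C S)"
  unfolding definable_tensor_ideal_def
proof (intro conjI ballI definable_subcategory_definable_of)
  fix X Y assume X: "X \<in> Obj C" and Y: "Y \<in> definable_of C S"
  have oY: "Y \<in> Obj C" using Y definable_of_iff by blast
  obtain I :: "'u set" and r D d c where I: "small TYPE('u) I" "D ` I \<subseteq> fp_objects C" and lim: "is_direct_limit C I r D d X c"
    by (rule direct_limit_of_fp[OF X])
  have "(\<lambda>i. D i \<boxtimes> Y) ` I \<subseteq> definable_of C S" using I fp_tensor_definable[OF ideal _ Y] by blast
  then show "X \<boxtimes> Y \<in> definable_of C S"
    using definable_subcategory_definable_of tensor_direct_limit[OF lim oY] I(1)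
    unfolding definable_subcategory_def by blast
qed

lemma definable_imp_serre_tensor_ideal:
  assumes ideal: "definable_tensor_ideal C M (definable_of C S)"
  shows "serre_tensor_ideal C M S"
  unfolding serre_tensor_ideal_def
proof (intro conjI ballI serre)
  fix F G assume F: "F \<in> S" and G: "G \<in> Obj (fp_mod C)"
  obtain P Q g eG where pG: "presents (fp_category C) P Q g G eG" using G Obj_fp_mod by blast
  have "F \<in> Obj (fp_mod C)" using F serre unfolding serre_subcategory_def by blast
  then obtain A B f eF where pF: "presents (fp_category C) A B f F eF" using Obj_fp_mod by blast
  have f: "annihilated A B f" using presents_annihilated[OF pF] F by blast
  note m = annihilatedD[OF f] and n = presents_Mor[OF pG, simplified]
  have o: "P \<in> Obj C" "Q \<in> Obj C" using n by (simp_all add: fp_objects_Obj)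
  let ?Pf = "TMor M P P A B (Idt C P) f" and ?gA = "TMor M P Q A A g (Idt C A)"
  note t = fp_tensor[OF n(1) m(1)] fp_tensor[OF n(1) m(2)] fp_tensor[OF n(2) m(1)]
  note ot = TOb_Obj[OF o(1) m(4)] TOb_Obj[OF o(1) m(5)] TOb_Obj[OF o(2) m(4)]
  have Pf: "?Pf \<in> Mor C (P \<boxtimes> A) (P \<boxtimes> B)" using fp_tensor_Mor[OF n(1) m(3,1,2)] .
  have gA: "?gA \<in> Mor C (P \<boxtimes> A) (Q \<boxtimes> A)" using TMor_Mor[OF o m(4,4) n(3) Idt_Mor[OF m(4)]] .
  \<comment> \<open>If \<open>P \<boxtimes> f\<close> were not annihilated, an object
    \<open>X\<close> of the definable subcategory would witness it; but
    \<open>P' \<boxtimes> X\<close> lies in that subcategory too, so all morphisms from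
    \<open>A\<close> to it factor through \<open>f\<close>.\<close>
  have aPf: "annihilated (P \<boxtimes> A) (P \<boxtimes> B) ?Pf"
  proof (rule ccontr)
    assume "\<not> annihilated (P \<boxtimes> A) (P \<boxtimes> B) ?Pf"
    then obtain X w where X: "X \<in> definable_of C S" and w: "w \<in> Mor C (P \<boxtimes> A) X"
      and nf: "\<not> factors C (P \<boxtimes> A) (P \<boxtimes> B) X ?Pf w"
      using separating_object[OF t(1,2) Pf] by blast
    have oX: "X \<in> Obj C" using X definable_of_iff by blast
    obtain P' \<eta> \<epsilon> where P': "P' \<in> fp_objects C" and dual: "is_dual C M P P' \<eta> \<epsilon>" using fp_dual[OF n(1)] by blast
    have "P' \<boxtimes> X \<in> definable_of C S"
      using ideal X fp_objects_Obj[OF P'] unfolding definable_tensor_ideal_def by blast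
    then have "factors C A B (P' \<boxtimes> X) f v" if "v \<in> Mor C A (P' \<boxtimes> X)" for v
      using f that unfolding definable_of_iff by blast
    then show False using dual_factors_left_Mor[OF o(1) dual m(4,5) oX m(3) _ w] nf by blast
  qed
  obtain R i j p q where R: "R \<in> fp_objects C" and bp: "biproduct C (P \<boxtimes> B) (Q \<boxtimes> A) R i j p q"
    using fp_biproduct'[OF t(2,3)] by blast
  define h where "h = Cmp C (P \<boxtimes> A) (P \<boxtimes> B) R i ?Pf \<otimes>\<^bsub>Hom C (P \<boxtimes> A) R\<^esub> Cmp C (P \<boxtimes> A) (Q \<boxtimes> A) R j ?gA"
  note hp = biproduct_pair[OF bp ot Pf gA, folded h_def]
  \<comment> \<open>A general \<open>G\<close> only adds the relation
    \<open>g \<boxtimes> A\<close>, so its tensor product with \<open>F\<close> is a quotient of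
    that of \<open>(P,-)\<close> with \<open>F\<close>.\<close>
  have "factors C (P \<boxtimes> A) R (P \<boxtimes> B) h ?Pf"
  proof -
    interpret G: comm_group "Hom C (P \<boxtimes> A) (P \<boxtimes> B)" using Hom_comm_group ot by blast
    have "?Pf = Cmp C (P \<boxtimes> A) (P \<boxtimes> B) (P \<boxtimes> B) (Idt C (P \<boxtimes> B)) ?Pf
        \<otimes>\<^bsub>Hom C (P \<boxtimes> A) (P \<boxtimes> B)\<^esub> Cmp C (P \<boxtimes> A) (Q \<boxtimes> A) (P \<boxtimes> B) (zero_mor C (Q \<boxtimes> A) (P \<boxtimes> B)) ?gA"
      using Pf gA ot by (simp add: Cmp_Idt_left)
    then show ?thesis unfolding hp(3)[OF ot(2)] using Idt_Mor[OF ot(2)] zero_Mor[OF ot(3,2)] by blast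
  qed
  then have "annihilated (P \<boxtimes> A) R h" using annihilated_factors[OF aPf R hp(1)] by blast
  moreover have "day_tensor (fp_category C) M G F \<in> S \<longleftrightarrow> annihilated (P \<boxtimes> A) R h"
    by (rule annihilated_day_tensor[OF pG pF R hp(1)]) (rule hp(3)[OF fp_objects_Obj])
  ultimately show "day_tensor (fp_category C) M G F \<in> S" by blast
qed

end

theorem corollary4p3:
  fixes C :: "('o, 'u) category"
    and M :: "('o, 'u) monoidal_structure"
    and S :: "('o, 'u) abfunctor set"
    and \<D> :: "'o set"
  assumes "universe TYPE('u)"
    and "finitely_accessible C"
    and "has_products C"
    and "closed_symmetric_monoidal C M"
    and "rigid_symmetric_monoidal (fp_category C) M"
    and "serre_subcategory (fp_mod C) S"
    and "\<D> = definable_of C S"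
  shows "serre_tensor_ideal C M S \<longleftrightarrow> definable_tensor_ideal C M \<D>"
proof -
  interpret U: finitely_accessible_universe C
    using assms(1,2) by (intro finitely_accessible_universe.intro finitely_accessible_universe_axioms.intro)
  interpret R: rigid_symmetric_monoidal "fp_category C" M by fact
  interpret closed_symmetric_monoidal C M by fact
  interpret serre_setting C S
    using assms(3,6) R.ex_biproduct by unfold_locales simp_all
  interpret tensor_setting C S M
    using R.rigid by unfold_locales simp_all
  show ?thesis
    using serre_imp_definable_tensor_ideal definable_imp_serre_tensor_ideal unfolding assms(7) by blast
qed

end
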